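(* Let $k\in\mathbb Z_{>0}$ and $1+\frac{k+2}{(k+1)n}<p<1+\frac{k+1}{kn}$. Let $u_0\in L^1_1(\mathbb R^n)\cap L^\infty(\mathbb R^n)$ and let $u$ be the global solution with initial datum $u_0$. Then $\psi_{0,k}\in L^1(\mathbb R^n)$ and for every $q\in[1,\infty]$, $$\lim_{t\to\infty}t^{\frac n2(1-\frac1q)+\frac12}\|u(t)-\mathcal A_{1,k}(t)\|_q=0,$$ where $\mathcal A_{1,k}(t)=\mathcal A_{0,k}(t)+\frac12t^{-1/2}\sum_{j=1}^n\mathcal M_{e_j}(u_0)\delta_t(x_jG_1)+\sum_{j=1}^na_j\Lambda_{e_j,0}(t;\psi_{0,k})$ and $\psi_{0,k}=\int_0^1\big(f(u(s))-f(\mathcal A_0(s))\big)ds+\int_1^\infty\big(f(u(s))-f(\mathcal A_{0,k-1}(s))\big)ds.$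
   Context: Let $n\ge1$, $a=(a_1,\dots,a_n)\in\mathbb R^n\setminus\{0\}$, $p\in(1,\infty)$, and let $f\in C^1(\mathbb R)$, $f\not\equiv0$, $f(0)=0$, satisfy $|f(\xi)-f(\eta)|\le C(|\xi|^{p-1}+|\eta|^{p-1})|\xi-\eta|$. $\|\cdot\|_q$ is the $L^q(\mathbb R^n)$ norm; $L^1_1=\{\varphi\in L^1: x_j\varphi\in L^1\ \forall j\}$. $G_t(x)=(4\pi t)^{-n/2}e^{-|x|^2/(4t)}$, $e^{t\Delta}\varphi=G_t*\varphi$. The global solution for $u_0\in L^1\cap L^\infty$ is the unique $u\in (C\cap L^\infty)([0,\infty);L^1)\cap(C\cap L^\infty)((0,\infty);L^\infty)$ with $u(t)=e^{t\Delta}u_0+\int_0^ta\cdot\nabla e^{(t-s)\Delta}f(u(s))ds$ for all $t>0$ (it solves $\partial_tu-\Delta u=a\cdot\nabla f(u)$, $u(0)=u_0$). $(\delta_t\varphi)(x)=t^{-n/2}\varphi(t^{-1/2}x)$; $\mathcal M_0(\varphi)=\int\varphi$; $\mathcal M_{e_j}(\varphi)=\int x_j\varphi(x)dx$; $\mathcal A_0(t)=\mathcal M_0(u_0)G_t$; $\sigma=\frac n2(p-1)-\frac12$. $\mathcal A_{0,0}=\mathcal A_0$, and for $k\ge1$, $\mathcal A_{0,k}(t)=\mathcal A_0(t)+\int_0^1a\cdot\nabla e^{(t-s)\Delta}f(\mathcal A_0(s))ds+\int_1^ta\cdot\nabla e^{(t-s)\Delta}f(\mathcal A_{0,k-1}(s))ds$.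 $\Lambda_{e_j,0}(t;\varphi)=-\frac12t^{-1/2}\mathcal M_0(\varphi)\delta_t(x_jG_1)$. *)

theory Defs
  imports "HOL-Probability.Probability"
begin

text \<open>Heat kernel G_t on R^n (n = DIM('a)); set to 0 for t \<le> 0 (never used there).\<close>
definition heatG :: "real \<Rightarrow> 'a::euclidean_space \<Rightarrow> real" where
  "heatG t x = (if t > 0 then (4 * pi * t) powr (- real DIM('a) / 2) * exp (- (norm x)\<^sup>2 / (4 * t)) else 0)"

definition heat :: "real \<Rightarrow> ('a::euclidean_space \<Rightarrow> real) \<Rightarrow> 'a \<Rightarrow> real" where
  "heat t \<phi> x = (\<integral>y. heatG t (x - y) * \<phi> y \<partial>lborel)"

text \<open>(a . nabla e^{t Delta}) phi = (a . nabla G_t) * phi, where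
  (a . nabla G_t)(z) = - (a . z) / (2 t) * G_t(z).\<close>
definition grad_heat :: "'a::euclidean_space \<Rightarrow> real \<Rightarrow> ('a \<Rightarrow> real) \<Rightarrow> 'a \<Rightarrow> real" where
  "grad_heat a t \<phi> x = (\<integral>y. (- (a \<bullet> (x - y)) / (2 * t)) * heatG t (x - y) * \<phi> y \<partial>lborel)"

definition Lq_norm :: "ereal \<Rightarrow> ('a::euclidean_space \<Rightarrow> real) \<Rightarrow> real" where
  "Lq_norm q \<phi> = (if q = \<infinity> then real_of_ereal (esssup lborel (\<lambda>x. ereal \<bar>\<phi> x\<bar>))
      else (\<integral>x. \<bar>\<phi> x\<bar> powr real_of_ereal q \<partial>lborel) powr (1 / real_of_ereal q))"

definition memLq :: "ereal \<Rightarrow> ('a::euclidean_space \<Rightarrow> real) \<Rightarrow> bool" where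
  "memLq q \<phi> \<longleftrightarrow> \<phi> \<in> borel_measurable lborel \<and>
     (if q = \<infinity> then esssup lborel (\<lambda>x. ereal \<bar>\<phi> x\<bar>) < \<infinity>
      else integrable lborel (\<lambda>x. \<bar>\<phi> x\<bar> powr real_of_ereal q))"

definition M0 :: "('a::euclidean_space \<Rightarrow> real) \<Rightarrow> real" where
  "M0 \<phi> = (\<integral>x. \<phi> x \<partial>lborel)"

definition Me :: "'a::euclidean_space \<Rightarrow> ('a \<Rightarrow> real) \<Rightarrow> real" where
  "Me b \<phi> = (\<integral>x. (x \<bullet> b) * \<phi> x \<partial>lborel)"

definition dil :: "real \<Rightarrow> ('a::euclidean_space \<Rightarrow> real) \<Rightarrow> 'a \<Rightarrow> real" where
  "dil t \<phi> x = t powr (- real DIM('a) / 2) * \<phi> (t powr (-1/2) *\<^sub>R x)"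

definition xG1 :: "'a::euclidean_space \<Rightarrow> 'a \<Rightarrow> real" where
  "xG1 b x = (x \<bullet> b) * heatG 1 x"

definition L11 :: "('a::euclidean_space \<Rightarrow> real) \<Rightarrow> bool" where
  "L11 \<phi> \<longleftrightarrow> integrable lborel \<phi> \<and> (\<forall>b\<in>Basis. integrable lborel (\<lambda>x. (x \<bullet> b) * \<phi> x))"

definition duhamel :: "'a::euclidean_space \<Rightarrow> (real \<Rightarrow> 'a \<Rightarrow> real) \<Rightarrow> real \<Rightarrow> real \<Rightarrow> real \<Rightarrow> 'a \<Rightarrow> real" where
  "duhamel a F t0 t1 t x = (\<integral>s\<in>{t0..t1}. grad_heat a (t - s) (F s) x \<partial>lborel)"

definition global_solution ::
  "'a::euclidean_space \<Rightarrow> (real \<Rightarrow> real) \<Rightarrow> ('a \<Rightarrow> real) \<Rightarrow> (real \<Rightarrow> 'a \<Rightarrow> real) \<Rightarrow> bool" where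
  "global_solution a f u0 u \<longleftrightarrow>
     (\<lambda>(t, x). u t x) \<in> borel_measurable (lborel \<Otimes>\<^sub>M lborel) \<and>
     (\<forall>t\<ge>0. integrable lborel (u t)) \<and>
     (\<forall>t\<ge>0. ((\<lambda>s. Lq_norm 1 (\<lambda>x. u s x - u t x)) \<longlongrightarrow> 0) (at t within {0..})) \<and>
     (\<exists>M. \<forall>t\<ge>0. Lq_norm 1 (u t) \<le> M) \<and>
     (\<forall>t>0. memLq \<infinity> (u t)) \<and>
     (\<forall>t>0. ((\<lambda>s. Lq_norm \<infinity> (\<lambda>x. u s x - u t x)) \<longlongrightarrow> 0) (at t within {0<..})) \<and>
     (\<exists>M. \<forall>t>0. Lq_norm \<infinity> (u t) \<le> M) \<and>
     (\<forall>t>0. AE x in lborel.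
        u t x = heat t u0 x + duhamel a (\<lambda>s y. f (u s y)) 0 t t x)"

definition A0 :: "('a::euclidean_space \<Rightarrow> real) \<Rightarrow> real \<Rightarrow> 'a \<Rightarrow> real" where
  "A0 u0 t x = M0 u0 * heatG t x"

fun A0k :: "'a::euclidean_space \<Rightarrow> (real \<Rightarrow> real) \<Rightarrow> ('a \<Rightarrow> real) \<Rightarrow> nat \<Rightarrow> real \<Rightarrow> 'a \<Rightarrow> real" where
  "A0k a f u0 0 t x = A0 u0 t x"
| "A0k a f u0 (Suc k) t x = A0 u0 t x
     + duhamel a (\<lambda>s y. f (A0 u0 s y)) 0 1 t x
     + duhamel a (\<lambda>s y. f (A0k a f u0 k s y)) 1 t t x"

definition Lambda :: "'a::euclidean_space \<Rightarrow> real \<Rightarrow> ('a \<Rightarrow> real) \<Rightarrow> 'a \<Rightarrow> real" where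
  "Lambda b t \<phi> x = - (1/2) * t powr (-1/2) * M0 \<phi> * dil t (xG1 b) x"

definition psi0k :: "'a::euclidean_space \<Rightarrow> (real \<Rightarrow> real) \<Rightarrow> ('a \<Rightarrow> real) \<Rightarrow> (real \<Rightarrow> 'a \<Rightarrow> real) \<Rightarrow> nat \<Rightarrow> 'a \<Rightarrow> real" where
  "psi0k a f u0 u k x =
     (\<integral>s\<in>{0..1}. f (u s x) - f (A0 u0 s x) \<partial>lborel)
   + (\<integral>s\<in>{1..}. f (u s x) - f (A0k a f u0 (k - 1) s x) \<partial>lborel)"

definition A1k :: "'a::euclidean_space \<Rightarrow> (real \<Rightarrow> real) \<Rightarrow> ('a \<Rightarrow> real) \<Rightarrow> (real \<Rightarrow> 'a \<Rightarrow> real) \<Rightarrow> nat \<Rightarrow> real \<Rightarrow> 'a \<Rightarrow> real" where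
  "A1k a f u0 u k t x = A0k a f u0 k t x
     + (1/2) * t powr (-1/2) * (\<Sum>b\<in>Basis. Me b u0 * dil t (xG1 b) x)
     + (\<Sum>b\<in>Basis. (a \<bullet> b) * Lambda b t (psi0k a f u0 u k) x)"

end

theory Submission
  imports Defs
begin

text \<open>
  Write \<open>S t\<close> for the heat semigroup, \<open>n\<close> for the dimension and \<open>\<sigma> = n (p - 1) / 2 - 1 / 2\<close>; the
  hypotheses on \<open>p\<close> say \<open>k \<sigma> < 1 / 2 < (k + 1) \<sigma>\<close>. Every estimate is made in \<open>L\<^sup>1\<close> and
  \<open>L\<^sup>\<infinity>\<close> only, starting from pointwise Gaussian bounds on the kernels.

  The point that is not perturbative is the decay \<open>t powr (- n / 2)\<close> of the sup norm for large
  data. Duhamel's formula gives Hoelder continuity of \<open>u (t)\<close> under translations, and since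
  \<open>\<integral> f (w) (a \<cdot> \<nabla>w) = 0\<close>, this yields \<open>\<integral> u (t + h)\<^sup>2 \<le> \<integral> (S h (u t))\<^sup>2 + O (h powr (5 / 4))\<close>
  without differentiating \<open>u\<close>. Convexity of \<open>\<tau> \<mapsto> \<integral> (S \<tau> v)\<^sup>2\<close> then forces the energy, hence the sup
  norm, to become small at some time; from there on the supercritical nonlinearity is a small
  perturbation and a barrier argument gives the decay rate.

  With the decay at hand, each iteration \<open>A0k j\<close> improves \<open>u - A0k j\<close> to
  \<open>O (t powr (- (j + 1) \<sigma>))\<close> as long as \<open>(j + 1) \<sigma> < 1 / 2\<close>. At \<open>j = k\<close> the Duhamel source
  is integrable in space-time, so the Duhamel term is asymptotic to its mass times \<open>a \<cdot> \<nabla>G\<close>, and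
  dominated convergence gives the claim.
\<close>

text \<open>Scaling alone gives no decay. With n (p - 1) / 2 = 1/2 + \<sigma>, a function of
  Gaussian height has |u|^(p - 1) of size \<open>t powr (- (1 / 2) - \<sigma>)\<close>; the 1/2 pays
  for the singularity of the kernel a \<cdot> \<nabla>G, and the surplus
  \<open>t powr (- \<sigma>)\<close> is small only at a large age. A solution bounded by an
  \<open>M\<close> of arbitrary size has to reach that regime on its own, and the L1 bound does not
  by itself force it to: this is why an energy argument precedes the expansion, and why its error
  per step of length h must be o(h), although a Duhamel term with bounded source is a priori only
  O(\<open>h powr (1 / 2)\<close>). The same surplus \<sigma> is the gain of one iteration, and 1/2
  is the ceiling of the gains because the linear flow leaves \<open>A0\<close> at the rate
  \<open>t powr (- (1 / 2))\<close>, a rate that the first moment of \<open>u0\<close> makes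
  available. Sources are cut at time 1 because near 0 the comparison with \<open>A0\<close> is
  already integrable, by \<sigma> < 1/2, whereas the iterates are controlled from time 1 on.
  Everything rests on the mild formula, an identity almost everywhere; hence norms enter as bounds
  that survive null sets.\<close>

definition L1_le :: "real \<Rightarrow> ('a::euclidean_space \<Rightarrow> real) \<Rightarrow> bool" where
  "L1_le m \<phi> \<longleftrightarrow> integrable lborel \<phi> \<and> (\<integral>x. \<bar>\<phi> x\<bar> \<partial>lborel) \<le> m"

text \<open>An essential bound without \<open>esssup\<close>: the inequality holds off a null set,
  so changing \<open>\<phi>\<close> by an almost everywhere identity costs nothing.
  \<open>L1_le\<close> carries integrability explicitly, because the Bochner integral of a
  non-integrable function is 0 and would satisfy any nonnegative bound.\<close>

definition Linf_le :: "real \<Rightarrow> ('a::euclidean_space \<Rightarrow> real) \<Rightarrow> bool" where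
  "Linf_le l \<phi> \<longleftrightarrow> \<phi> \<in> borel_measurable borel \<and> (AE x in lborel. \<bar>\<phi> x\<bar> \<le> l)"

section \<open>Reflections and translations of Lebesgue measure\<close>

lemma distr_lborel_reflect:
  fixes c :: "'a::euclidean_space"
  shows "distr lborel borel (\<lambda>x. c - x) = lborel"
  using lborel_affine[of "-1" c] by (simp add: density_1)

lemma lborel_reflect:
  fixes \<phi> :: "'a::euclidean_space \<Rightarrow> real"
  assumes [measurable]: "\<phi> \<in> borel_measurable borel"
  shows integral_reflect: "(\<integral>x. \<phi> (c - x) \<partial>lborel) = (\<integral>x. \<phi> x \<partial>lborel)"
    and integrable_reflect_iff: "integrable lborel (\<lambda>x. \<phi> (c - x)) \<longleftrightarrow> integrable lborel \<phi>"
    and AE_reflect: "(AE x in lborel. P (\<phi> x)) \<Longrightarrow> {y. P y} \<in> sets borel \<Longrightarrow> AE x in lborel. P (\<phi> (c - x))"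
proof -
  have m: "(\<lambda>x. c - x) \<in> measurable lborel borel" by simp
  show "(\<integral>x. \<phi> (c - x) \<partial>lborel) = (\<integral>x. \<phi> x \<partial>lborel)"
    by (subst (2) distr_lborel_reflect[of c, symmetric]) (simp add: integral_distr)
  show "integrable lborel (\<lambda>x. \<phi> (c - x)) \<longleftrightarrow> integrable lborel \<phi>"
    by (subst (2) distr_lborel_reflect[of c, symmetric]) (simp add: integrable_distr_eq)
  assume A: "AE x in lborel. P (\<phi> x)" and [measurable]: "{y. P y} \<in> sets borel"
  have S: "{x \<in> space borel. P (\<phi> x)} \<in> sets borel"
    using measurable_sets[OF assms \<open>{y. P y} \<in> sets borel\<close>] by (simp add: vimage_def)
  have "AE x in distr lborel borel (\<lambda>x. c - x). P (\<phi> x)"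
    unfolding distr_lborel_reflect by (rule A)
  then show "AE x in lborel. P (\<phi> (c - x))"
    by (subst (asm) AE_distr_iff[OF m]) (use S in auto)
qed

text \<open>A translation is the composition of the two reflections x \<mapsto> -x and x \<mapsto> c
  - x.\<close>

lemma lborel_shift:
  fixes \<phi> :: "'a::euclidean_space \<Rightarrow> real"
  assumes [measurable]: "\<phi> \<in> borel_measurable borel"
  shows integral_shift: "(\<integral>x. \<phi> (x - c) \<partial>lborel) = (\<integral>x. \<phi> x \<partial>lborel)"
    and integrable_shift_iff: "integrable lborel (\<lambda>x. \<phi> (x - c)) \<longleftrightarrow> integrable lborel \<phi>"
    and AE_shift: "(AE x in lborel. P (\<phi> x)) \<Longrightarrow> {y. P y} \<in> sets borel \<Longrightarrow> AE x in lborel. P (\<phi> (x - c))"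
proof -
  show "(\<integral>x. \<phi> (x - c) \<partial>lborel) = (\<integral>x. \<phi> x \<partial>lborel)"
    using integral_reflect[of "\<lambda>x. \<phi> (- x)" c] integral_reflect[of \<phi> 0] by simp
  show "integrable lborel (\<lambda>x. \<phi> (x - c)) \<longleftrightarrow> integrable lborel \<phi>"
    using integrable_reflect_iff[of "\<lambda>x. \<phi> (- x)" c] integrable_reflect_iff[of \<phi> 0] by simp
  show "(AE x in lborel. P (\<phi> x)) \<Longrightarrow> {y. P y} \<in> sets borel \<Longrightarrow> AE x in lborel. P (\<phi> (x - c))"
    using AE_reflect[of "\<lambda>x. \<phi> (- x)" P c] AE_reflect[of \<phi> P 0] by simp
qed

section \<open>Calculus of L1 and sup bounds\<close>

lemma L1_leD: "L1_le m \<phi> \<Longrightarrow> integrable lborel \<phi>" "L1_le m \<phi> \<Longrightarrow> (\<integral>x. \<bar>\<phi> x\<bar> \<partial>lborel) \<le> m"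
  by (auto simp: L1_le_def)

lemma L1_le_nonneg: "L1_le m \<phi> \<Longrightarrow> 0 \<le> m"
  by (rule order_trans[OF _ L1_leD(2)]) auto

lemma L1_le_measurable: "L1_le m \<phi> \<Longrightarrow> \<phi> \<in> borel_measurable borel"
  by (auto simp: L1_le_def)

lemma Linf_leD: "Linf_le l \<phi> \<Longrightarrow> \<phi> \<in> borel_measurable borel" "Linf_le l \<phi> \<Longrightarrow> AE x in lborel. \<bar>\<phi> x\<bar> \<le> l"
  by (auto simp: Linf_le_def)

text \<open>The whole space is not a null set, so a statement that does not mention the point cannot
  hold almost everywhere without holding. The sign of an essential bound is extracted in this
  way.\<close>

lemma AE_lborel_nonempty: "AE x in lborel :: 'a::euclidean_space measure. P \<Longrightarrow> P"
proof (rule ccontr)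
  assume "AE x in lborel :: 'a measure. P" "\<not> P"
  then have "AE x in lborel :: 'a measure. False" by simp
  then show False
    by (auto simp: eventually_ae_filter null_sets_def top_unique)
qed

lemma Linf_le_nonneg:
  fixes \<phi> :: "'a::euclidean_space \<Rightarrow> real"
  shows "Linf_le l \<phi> \<Longrightarrow> 0 \<le> l"
proof (rule AE_lborel_nonempty)
  assume "Linf_le l \<phi>"
  then have "AE x in lborel. \<bar>\<phi> x\<bar> \<le> l" by (simp add: Linf_le_def)
  then show "AE x in lborel :: 'a measure. 0 \<le> l" by eventually_elim linarith
qed

lemma L1_le_mono: "L1_le m \<phi> \<Longrightarrow> m \<le> m' \<Longrightarrow> L1_le m' \<phi>"
  by (auto simp: L1_le_def)

lemma Linf_le_mono: "Linf_le l \<phi> \<Longrightarrow> l \<le> l' \<Longrightarrow> Linf_le l' \<phi>"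
  by (auto simp: Linf_le_def elim!: eventually_mono)

lemma L1_le_add: "L1_le m \<phi> \<Longrightarrow> L1_le m' \<psi> \<Longrightarrow> L1_le (m + m') (\<lambda>x. \<phi> x + \<psi> x)"
  unfolding L1_le_def
  apply (intro conjI)
   apply (rule Bochner_Integration.integrable_add; simp)
  apply (rule order_trans[of _ "\<integral>x. \<bar>\<phi> x\<bar> + \<bar>\<psi> x\<bar> \<partial>lborel"])
   apply (rule integral_mono)
     apply (auto intro!: integrable_abs Bochner_Integration.integrable_add)
  done

lemma Linf_le_add: "Linf_le m \<phi> \<Longrightarrow> Linf_le m' \<psi> \<Longrightarrow> Linf_le (m + m') (\<lambda>x. \<phi> x + \<psi> x)"
  unfolding Linf_le_def
  apply (intro conjI)
   apply (rule borel_measurable_add; simp)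
  apply (elim conjE)
  subgoal premises p using p(2,4) by eventually_elim linarith
  done

lemma L1_le_cmult: "L1_le m \<phi> \<Longrightarrow> L1_le (\<bar>c\<bar> * m) (\<lambda>x. c * \<phi> x)"
  by (auto simp: L1_le_def abs_mult intro!: mult_left_mono)

lemma Linf_le_cmult: "Linf_le m \<phi> \<Longrightarrow> Linf_le (\<bar>c\<bar> * m) (\<lambda>x. c * \<phi> x)"
  by (auto simp: Linf_le_def abs_mult elim!: eventually_mono intro!: mult_left_mono)

lemma L1_le_diff: "L1_le m \<phi> \<Longrightarrow> L1_le m' \<psi> \<Longrightarrow> L1_le (m + m') (\<lambda>x. \<phi> x - \<psi> x)"
  using L1_le_add[of m \<phi> m' "\<lambda>x. - 1 * \<psi> x"] L1_le_cmult[of m' \<psi> "-1"] by simp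

lemma Linf_le_diff: "Linf_le m \<phi> \<Longrightarrow> Linf_le m' \<psi> \<Longrightarrow> Linf_le (m + m') (\<lambda>x. \<phi> x - \<psi> x)"
  using Linf_le_add[of m \<phi> m' "\<lambda>x. - 1 * \<psi> x"] Linf_le_cmult[of m' \<psi> "-1"] by simp

lemma L1_le_dominated:
  assumes "L1_le m \<psi>" "\<phi> \<in> borel_measurable borel" "AE x in lborel. \<bar>\<phi> x\<bar> \<le> \<bar>\<psi> x\<bar>"
  shows "L1_le m \<phi>"
  unfolding L1_le_def
proof
  have i: "integrable lborel \<psi>" using assms(1) by (rule L1_leD)
  then show j: "integrable lborel \<phi>"
    by (rule Bochner_Integration.integrable_bound) (use assms in auto)
  have "(\<integral>x. \<bar>\<phi> x\<bar> \<partial>lborel) \<le> (\<integral>x. \<bar>\<psi> x\<bar> \<partial>lborel)"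
    by (rule integral_mono_AE) (use i j assms in auto)
  then show "(\<integral>x. \<bar>\<phi> x\<bar> \<partial>lborel) \<le> m" using L1_leD(2)[OF assms(1)] by linarith
qed

lemma Linf_le_dominated:
  assumes "Linf_le m \<psi>" "\<phi> \<in> borel_measurable borel" "AE x in lborel. \<bar>\<phi> x\<bar> \<le> \<bar>\<psi> x\<bar>"
  shows "Linf_le m \<phi>"
  using assms unfolding Linf_le_def
  by (auto elim!: eventually_elim2)

lemma L1_le_cong_AE:
  assumes "L1_le m \<psi>" "\<phi> \<in> borel_measurable borel" "AE x in lborel. \<phi> x = \<psi> x"
  shows "L1_le m \<phi>"
  by (rule L1_le_dominated[OF assms(1,2)]) (use assms(3) in eventually_elim, auto)

lemma Linf_le_cong_AE:
  assumes "Linf_le m \<psi>" "\<phi> \<in> borel_measurable borel" "AE x in lborel. \<phi> x = \<psi> x"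
  shows "Linf_le m \<phi>"
  by (rule Linf_le_dominated[OF assms(1,2)]) (use assms(3) in eventually_elim, auto)

lemma L1_le_shift: "L1_le m \<phi> \<Longrightarrow> L1_le m (\<lambda>x. \<phi> (x - c))"
  using integral_shift[of "\<lambda>x. \<bar>\<phi> x\<bar>" c] integrable_shift_iff[of \<phi> c]
  by (auto simp: L1_le_def)

lemma Linf_le_shift: "Linf_le m \<phi> \<Longrightarrow> Linf_le m (\<lambda>x. \<phi> (x - c))"
  unfolding Linf_le_def
  by (intro conjI AE_shift[of \<phi> "\<lambda>y. \<bar>y\<bar> \<le> m"]) (auto)

section \<open>Minkowski's integral inequality in L1 and in the sup norm\<close>

text \<open>Tonelli applied to \<open>\<bar>H w x\<bar>\<close>. Besides the bound it hands out
  integrability on the product, which licenses later exchanges of integrals, and integrability of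
  almost every section, which the time integrals in \<open>psi0k\<close> rely on.\<close>

lemma Minkowski_L1:
  fixes H :: "'w \<Rightarrow> 'a::euclidean_space \<Rightarrow> real"
  assumes "sigma_finite_measure N"
    and [measurable]: "(\<lambda>(w, x). H w x) \<in> borel_measurable (N \<Otimes>\<^sub>M lborel)"
    and H: "AE w in N. L1_le (m w) (H w)" and m: "integrable N m"
  shows Minkowski_L1_le: "L1_le (\<integral>w. m w \<partial>N) (\<lambda>x. \<integral>w. H w x \<partial>N)"
    and Minkowski_L1_integrable: "integrable (N \<Otimes>\<^sub>M lborel) (\<lambda>(w, x). H w x)"
    and Minkowski_L1_AE: "AE x in lborel. integrable N (\<lambda>w. H w x)"
proof -
  interpret N: sigma_finite_measure N by fact
  interpret P: pair_sigma_finite N "lborel :: 'a measure" by standard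
  have i1: "integrable N (\<lambda>w. \<integral>x. \<bar>H w x\<bar> \<partial>lborel)"
  proof (rule Bochner_Integration.integrable_bound[OF m])
    show "AE w in N. norm (\<integral>x. \<bar>H w x\<bar> \<partial>lborel) \<le> norm (m w)"
      using H by eventually_elim (auto simp: L1_le_def)
  qed measurable
  show i: "integrable (N \<Otimes>\<^sub>M lborel) (\<lambda>(w, x). H w x)"
    by (rule P.Fubini_integrable) (use i1 H in \<open>auto simp: L1_le_def elim!: eventually_mono\<close>)
  show a: "AE x in lborel. integrable N (\<lambda>w. H w x)"
    by (rule P.AE_integrable_snd[OF i])
  have ia: "integrable (N \<Otimes>\<^sub>M lborel) (\<lambda>(w, x). \<bar>H w x\<bar>)"
    using integrable_abs[OF i] by (simp add: case_prod_beta')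
  have I: "integrable lborel (\<lambda>x. \<integral>w. H w x \<partial>N)"
    by (rule P.integrable_snd[OF i])
  have "(\<integral>x. \<bar>\<integral>w. H w x \<partial>N\<bar> \<partial>lborel) \<le> (\<integral>x. (\<integral>w. \<bar>H w x\<bar> \<partial>N) \<partial>lborel)"
    by (rule integral_mono_AE) (use I P.integrable_snd[OF ia] in auto)
  also have "\<dots> = (\<integral>w. (\<integral>x. \<bar>H w x\<bar> \<partial>lborel) \<partial>N)"
    using P.Fubini_integral[OF ia] by simp
  also have "\<dots> \<le> (\<integral>w. m w \<partial>N)"
    by (rule integral_mono_AE[OF i1 m]) (use H in \<open>auto simp: L1_le_def elim!: eventually_mono\<close>)
  finally show "L1_le (\<integral>w. m w \<partial>N) (\<lambda>x. \<integral>w. H w x \<partial>N)"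
    using I by (simp add: L1_le_def)
qed

text \<open>The hypothesis gives a null set of points for almost every parameter;
  \<open>AE_commute\<close> turns this into a null set of parameters for almost every point, and
  there the integral over the parameter can be bounded.\<close>

lemma Minkowski_Linf:
  fixes H :: "'w \<Rightarrow> 'a::euclidean_space \<Rightarrow> real"
  assumes "sigma_finite_measure N"
    and [measurable]: "(\<lambda>(w, x). H w x) \<in> borel_measurable (N \<Otimes>\<^sub>M lborel)"
    and H: "AE w in N. Linf_le (l w) (H w)" and l: "integrable N l"
  shows Minkowski_Linf_le: "Linf_le (\<integral>w. l w \<partial>N) (\<lambda>x. \<integral>w. H w x \<partial>N)"
    and Minkowski_Linf_AE: "AE x in lborel. integrable N (\<lambda>w. H w x)"
proof -
  interpret N: sigma_finite_measure N by fact
  interpret P: pair_sigma_finite N "lborel :: 'a measure" by standard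
  note [measurable] = borel_measurable_integrable[OF l]
  have "AE w in N. AE x in lborel. \<bar>H w x\<bar> \<le> l w"
    using H by eventually_elim (auto simp: Linf_le_def)
  then have b: "AE x in lborel. AE w in N. \<bar>H w x\<bar> \<le> l w"
    by (subst (asm) P.AE_commute) measurable
  have a: "AE x in lborel. integrable N (\<lambda>w. H w x) \<and> \<bar>\<integral>w. H w x \<partial>N\<bar> \<le> (\<integral>w. l w \<partial>N)"
    using b AE_space
  proof eventually_elim
    case (elim x)
    have i: "integrable N (\<lambda>w. H w x)"
      by (rule Bochner_Integration.integrable_bound[OF l]) (use elim in \<open>auto elim!: eventually_mono\<close>)
    moreover have "\<bar>\<integral>w. H w x \<partial>N\<bar> \<le> (\<integral>w. \<bar>H w x\<bar> \<partial>N)" by simp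
    moreover have "\<dots> \<le> (\<integral>w. l w \<partial>N)"
      by (rule integral_mono_AE) (use i l elim in auto)
    ultimately show ?case by linarith
  qed
  show "AE x in lborel. integrable N (\<lambda>w. H w x)" using a by eventually_elim simp
  have "(\<lambda>x. \<integral>w. H w x \<partial>N) \<in> borel_measurable borel" by measurable
  then show "Linf_le (\<integral>w. l w \<partial>N) (\<lambda>x. \<integral>w. H w x \<partial>N)"
    unfolding Linf_le_def using a by (auto elim!: eventually_mono)
qed

subsection \<open>Gaussian kernels\<close>

text \<open>The kernel of a \<cdot> \<nabla>S(t). The direction is an argument because the same
  kernel, with a displacement \<open>y\<close> or a basis vector in place of \<open>a\<close>, is
  the first-order Taylor term of the Gaussian.\<close>

definition gradG :: "'a::euclidean_space \<Rightarrow> real \<Rightarrow> 'a \<Rightarrow> real" where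
  "gradG a t z = (- (a \<bullet> z) / (2 * t)) * heatG t z"

lemma heatG_nonneg[simp]: "0 \<le> heatG t x"
  by (simp add: heatG_def)

lemma heatG_measurable2[measurable]:
  "(\<lambda>(t, x). heatG t (x::'a::euclidean_space)) \<in> borel_measurable (borel \<Otimes>\<^sub>M borel)"
  unfolding heatG_def by measurable

lemma heatG_measurable_comp[measurable (raw)]:
  assumes "g \<in> borel_measurable M" "h \<in> borel_measurable M"
  shows "(\<lambda>w. heatG (g w) (h w :: 'a::euclidean_space)) \<in> borel_measurable M"
  using measurable_compose[OF measurable_Pair[OF assms] heatG_measurable2] by simp

lemma gradG_measurable_comp[measurable (raw)]:
  assumes [measurable]: "a \<in> borel_measurable M" "g \<in> borel_measurable M" "h \<in> borel_measurable M"
  shows "(\<lambda>w. gradG (a w) (g w) (h w :: 'a::euclidean_space)) \<in> borel_measurable M"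
  unfolding gradG_def by measurable

lemma heatG_uminus[simp]: "heatG t (- x) = heatG t x"
  by (simp add: heatG_def)

lemma gradG_uminus[simp]: "gradG a t (- x) = - gradG a t x"
  by (simp add: gradG_def)

text \<open>The kernel is a product of one-dimensional normal densities of variance 2t, so its mass
  is the product of their masses.\<close>

lemma heatG_has_integral:
  assumes t: "t > 0"
  shows heatG_integrable: "integrable lborel (heatG t :: 'a::euclidean_space \<Rightarrow> real)"
    and heatG_integral: "(\<integral>x. heatG t (x::'a) \<partial>lborel) = 1"
proof -
  have eq: "heatG t x = (\<Prod>b\<in>Basis. normal_density 0 (sqrt (2 * t)) (x \<bullet> b))" for x :: 'a
  proof -
    have "(\<Prod>b\<in>Basis. normal_density 0 (sqrt (2 * t)) (x \<bullet> b))
        = (\<Prod>b\<in>(Basis::'a set). 1 / sqrt (4 * pi * t)) * (\<Prod>b\<in>Basis. exp (- (x \<bullet> b)\<^sup>2 / (4 * t)))"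
      unfolding normal_density_def prod.distrib[symmetric] using t by (simp add: mult_ac)
    also have "(\<Prod>b\<in>Basis. exp (- (x \<bullet> b)\<^sup>2 / (4 * t))) = exp (\<Sum>b\<in>Basis. - (x \<bullet> b)\<^sup>2 / (4 * t))"
      by (simp add: exp_sum)
    also have "(\<Sum>b\<in>Basis. - (x \<bullet> b)\<^sup>2 / (4 * t)) = - (norm x)\<^sup>2 / (4 * t)"
      unfolding power2_norm_eq_inner euclidean_inner[of x x]
      by (simp add: sum_divide_distrib sum_negf power2_eq_square)
    also have "(\<Prod>b\<in>(Basis::'a set). 1 / sqrt (4 * pi * t)) = (4 * pi * t) powr (- real DIM('a) / 2)"
    proof -
      have "(1 / sqrt (4 * pi * t)) = (4 * pi * t) powr (- 1 / 2)"
        using t by (simp add: powr_half_sqrt powr_minus_divide)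
      then show ?thesis using t by (simp add: powr_powr flip: powr_realpow)
    qed
    finally show ?thesis using t by (simp add: heatG_def)
  qed
  have "(\<integral>\<^sup>+x. heatG t (x::'a) \<partial>lborel) = (\<integral>\<^sup>+x. (\<Prod>b\<in>Basis. ennreal (normal_density 0 (sqrt (2 * t)) ((x::'a) \<bullet> b))) \<partial>lborel)"
    unfolding eq by (simp add: prod_ennreal)
  also have "\<dots> = (\<Prod>b\<in>(Basis::'a set). (\<integral>\<^sup>+x. ennreal (normal_density 0 (sqrt (2 * t)) x) \<partial>lborel))"
    by (rule nn_integral_lborel_prod) auto
  also have "\<dots> = 1"
    using t by (simp add: nn_integral_eq_integral)
  finally have n: "(\<integral>\<^sup>+x. heatG t (x::'a) \<partial>lborel) = 1" .
  show i: "integrable lborel (heatG t :: 'a \<Rightarrow> real)"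
    by (rule integrableI_bounded) (use n in auto)
  show "(\<integral>x. heatG t (x::'a) \<partial>lborel) = 1"
    using n by (simp add: integral_eq_nn_integral)
qed

lemma heatG_L1: "t > 0 \<Longrightarrow> L1_le 1 (heatG t)"
  by (simp add: L1_le_def heatG_integrable heatG_integral)

lemma heatG_le:
  assumes "t > 0"
  shows "heatG t (x::'a::euclidean_space) \<le> t powr (- real DIM('a) / 2)"
proof -
  have "heatG t x \<le> (4 * pi * t) powr (- real DIM('a) / 2)"
    using assms by (auto simp: heatG_def intro!: mult_left_le)
  also have "\<dots> \<le> t powr (- real DIM('a) / 2)"
    using assms pi_gt3 by (intro powr_mono2') auto
  finally show ?thesis .
qed

text \<open>Completing the square in \<open>y\<close>: up to a factor depending on \<open>x\<close>,
  the product of two Gaussians is a Gaussian of time s t / (s + t) centred at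
  \<open>(t / (s + t)) *\<^sub>R x\<close>. Both semigroup laws then reduce to integrals of one
  centred kernel.\<close>

lemma heatG_semigroup_factor:
  assumes s: "s > 0" and t: "t > 0"
  shows "heatG s (x - y) * heatG t y
    = heatG (s + t) x * heatG (s * t / (s + t)) (y - (t / (s + t)) *\<^sub>R (x::'a::euclidean_space))"
proof -
  have st: "s + t > 0" using assms by simp
  have e: "(norm (x - y))\<^sup>2 / (4 * s) + (norm y)\<^sup>2 / (4 * t)
      = (norm x)\<^sup>2 / (4 * (s + t)) + (norm (y - (t / (s + t)) *\<^sub>R x))\<^sup>2 / (4 * (s * t / (s + t)))"
  proof -
    define X Y Z where "X = x \<bullet> x" "Y = y \<bullet> y" "Z = x \<bullet> y"
    have 1: "(norm (x - y))\<^sup>2 = X - 2 * Z + Y"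
      by (simp add: X_Y_Z_def power2_norm_eq_inner inner_diff inner_commute)
    have 2: "(norm (y - (t / (s + t)) *\<^sub>R x))\<^sup>2 = Y - 2 * (t / (s + t)) * Z + (t / (s + t))\<^sup>2 * X"
      unfolding power2_norm_eq_inner inner_diff inner_scaleR_left inner_scaleR_right X_Y_Z_def
      by (simp add: inner_commute power2_eq_square algebra_simps)
    have 3: "(norm x)\<^sup>2 = X" "(norm y)\<^sup>2 = Y" by (simp_all add: X_Y_Z_def power2_norm_eq_inner)
    define r where "r = s + t"
    have r: "r \<noteq> 0" "s = r - t" "t \<noteq> 0" "r - t \<noteq> 0" using s t by (auto simp: r_def)
    show ?thesis unfolding 1 2 3 unfolding r_def[symmetric] unfolding r(2) using r(1,3,4)
      by (simp add: divide_simps power2_eq_square) (simp add: algebra_simps)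
  qed
  have p: "(4 * pi * s) * (4 * pi * t) = (4 * pi * (s + t)) * (4 * pi * (s * t / (s + t)))"
    using st by (simp add: field_simps)
  have pp: "(4 * pi * s) powr c * (4 * pi * t) powr c = (4 * pi * (s + t)) powr c * (4 * pi * (s * t / (s + t))) powr c" for c
  proof -
    have "(4 * pi * s) powr c * (4 * pi * t) powr c = ((4 * pi * s) * (4 * pi * t)) powr c"
      using s t by (intro powr_mult[symmetric])
    also have "\<dots> = (4 * pi * (s + t)) powr c * (4 * pi * (s * t / (s + t))) powr c"
      unfolding p using s t by (intro powr_mult)
    finally show ?thesis .
  qed
  have ee: "exp (- (norm (x - y))\<^sup>2 / (4 * s)) * exp (- (norm y)\<^sup>2 / (4 * t))
     = exp (- (norm x)\<^sup>2 / (4 * (s + t))) * exp (- (norm (y - (t / (s + t)) *\<^sub>R x))\<^sup>2 / (4 * (s * t / (s + t))))"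
    unfolding exp_add[symmetric] minus_divide_left[symmetric] minus_add_distrib[symmetric] e ..
  have pos: "s * t / (s + t) > 0" using s t by simp
  define A B A' B' where "A = (4 * pi * s) powr (- real DIM('a) / 2)"
     "B = (4 * pi * t) powr (- real DIM('a) / 2)"
     "A' = (4 * pi * (s + t)) powr (- real DIM('a) / 2)"
     "B' = (4 * pi * (s * t / (s + t))) powr (- real DIM('a) / 2)"
  have AB: "A * B = A' * B'" unfolding A_B_A'_B'_def by (rule pp)
  have "heatG s (x - y) * heatG t y
      = (A * B) * (exp (- (norm (x - y))\<^sup>2 / (4 * s)) * exp (- (norm y)\<^sup>2 / (4 * t)))"
    unfolding heatG_def A_B_A'_B'_def using s t by simp
  also have "\<dots> = heatG (s + t) x * heatG (s * t / (s + t)) (y - (t / (s + t)) *\<^sub>R x)"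
    unfolding AB ee unfolding heatG_def A_B_A'_B'_def using st pos by (simp only: if_True mult_ac)
  finally show ?thesis .
qed

subsection \<open>Pointwise kernel bounds\<close>

text \<open>One crude constant, depending only on the dimension, dominates every Gaussian bound.\<close>

definition kC :: "'a::euclidean_space itself \<Rightarrow> real" where
  "kC _ = (real DIM('a) + 2) * 4 ^ (DIM('a) + 2) * 16 ^ 4"

text \<open>Parabolic scaling. With c = sqrt t it reduces a kernel estimate at time \<open>t\<close>
  to the same estimate at time 1.\<close>

lemma heatG_scale:
  assumes "c > 0" "t > 0"
  shows "heatG (c\<^sup>2 * t) (c *\<^sub>R (z::'a::euclidean_space)) = c powr (- real DIM('a)) * heatG t z"
proof -
  have "(4 * pi * (c\<^sup>2 * t)) powr (- real DIM('a) / 2) = (c\<^sup>2) powr (- real DIM('a) / 2) * (4 * pi * t) powr (- real DIM('a) / 2)"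
    using assms by (subst powr_mult[symmetric]) (auto simp: mult_ac)
  also have "(c\<^sup>2) powr (- real DIM('a) / 2) = c powr (- real DIM('a))"
    using assms by (simp add: powr_powr flip: powr_numeral)
  finally show ?thesis
    using assms by (simp add: heatG_def power_mult_distrib)
qed

lemma gradG_scale:
  assumes "c > 0" "t > 0"
  shows "gradG a (c\<^sup>2 * t) (c *\<^sub>R (z::'a::euclidean_space)) = c powr (- real DIM('a) - 1) * gradG a t z"
  unfolding gradG_def heatG_scale[OF assms] using assms
  by (simp add: powr_diff field_simps power2_eq_square)

text \<open>The fourth root of the claim is \<open>(1 + r) / 16 \<le> exp (r\<^sup>2 / 32)\<close>,
  which is 1 + x \<le> exp x combined with 2r \<le> 1 + r^2. Degree four covers the polynomials
  produced by differentiating the kernels in space and time.\<close>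

lemma poly4_le_exp:
  fixes r :: real assumes "0 \<le> r"
  shows "(1 + r) ^ 4 \<le> 16 ^ 4 * exp (r\<^sup>2 / 8)"
proof -
  have "0 \<le> (r - 1)\<^sup>2" by simp
  then have "(1 + r) / 16 \<le> 1 + r\<^sup>2 / 32" by (simp add: power2_eq_square field_simps)
  also have "\<dots> \<le> exp (r\<^sup>2 / 32)" by simp
  finally have "((1 + r) / 16) ^ 4 \<le> exp (r\<^sup>2 / 32) ^ 4"
    using assms by (intro power_mono) auto
  also have "\<dots> = exp (r\<^sup>2 / 8)" by (simp flip: exp_of_nat_mult)
  finally show ?thesis by (simp add: power_divide field_simps)
qed

lemma exp_shift_le:
  fixes z y :: "'a::euclidean_space"
  assumes "norm y \<le> 1"
  shows "exp (- (norm (z - y))\<^sup>2 / 8) \<le> 2 * exp (- (norm z)\<^sup>2 / 16)"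
proof -
  have "norm z \<le> norm (z - y) + norm y" by (metis diff_add_cancel norm_triangle_ineq)
  then have "(norm z)\<^sup>2 \<le> (norm (z - y) + 1)\<^sup>2" using assms by (intro power_mono) auto
  also have "\<dots> \<le> 2 * (norm (z - y))\<^sup>2 + 2"
    using sum_squares_bound[of "norm (z - y)" 1] by (simp add: power2_eq_square algebra_simps)
  finally have "- (norm (z - y))\<^sup>2 / 8 \<le> 1/8 - (norm z)\<^sup>2 / 16" by simp
  then have "exp (- (norm (z - y))\<^sup>2 / 8) \<le> exp (1/8 - (norm z)\<^sup>2 / 16)" by simp
  also have "\<dots> = exp (1/8) * exp (- (norm z)\<^sup>2 / 16)" by (simp flip: exp_add)
  also have "exp (1/8::real) \<le> 2" using exp_bound[of "1/8::real"] by (simp add: power2_eq_square)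
  finally show ?thesis by simp
qed

text \<open>Why time 4: half of the exponent -|z - y|^2 / 4 absorbs the polynomial, the other half
  is recentred at \<open>z\<close> at the price of halving the rate once more, and exp (-|z|^2 / 16)
  is the profile of the Gaussian at time 4.\<close>

lemma heatG_4: "heatG 4 (z::'a::euclidean_space)
    = 2 powr (- real DIM('a)) * (4 * pi) powr (- real DIM('a) / 2) * exp (- (norm z)\<^sup>2 / 16)"
proof -
  have "(4 * pi * 4) powr (- real DIM('a) / 2) = 4 powr (- real DIM('a) / 2) * (4 * pi) powr (- real DIM('a) / 2)"
    by (subst powr_mult[symmetric]) (auto simp: mult_ac)
  also have "(4::real) powr (- real DIM('a) / 2) = (2 powr 2) powr (- real DIM('a) / 2)" by simp
  also have "\<dots> = 2 powr (- real DIM('a))" unfolding powr_powr by simp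
  finally show ?thesis unfolding heatG_def by (simp add: mult_ac)
qed

text \<open>Polynomial factors along a displaced point are absorbed by widening the Gaussian.\<close>

lemma poly_gauss_le:
  fixes z y :: "'a::euclidean_space"
  assumes y: "norm y \<le> 1"
  shows "(1 + norm (z - y)) ^ 4 * ((4 * pi) powr (- real DIM('a) / 2) * exp (- (norm (z - y))\<^sup>2 / 4))
    \<le> 2 * 16 ^ 4 * 2 ^ DIM('a) * heatG 4 z"
proof -
  define P where "P = (4 * pi) powr (- real DIM('a) / 2)"
  have "(1 + norm (z - y)) ^ 4 * exp (- (norm (z - y))\<^sup>2 / 4)
     \<le> (16 ^ 4 * exp ((norm (z - y))\<^sup>2 / 8)) * exp (- (norm (z - y))\<^sup>2 / 4)"
    by (intro mult_right_mono poly4_le_exp) auto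
  also have "\<dots> = 16 ^ 4 * exp (- (norm (z - y))\<^sup>2 / 8)" by (simp flip: exp_add)
  also have "\<dots> \<le> 16 ^ 4 * (2 * exp (- (norm z)\<^sup>2 / 16))"
    by (intro mult_left_mono exp_shift_le y) auto
  finally have "P * ((1 + norm (z - y)) ^ 4 * exp (- (norm (z - y))\<^sup>2 / 4)) \<le> P * (16 ^ 4 * (2 * exp (- (norm z)\<^sup>2 / 16)))"
    by (intro mult_left_mono) (auto simp: P_def)
  also have "\<dots> = 2 * 16 ^ 4 * 2 ^ DIM('a) * heatG 4 z"
    unfolding heatG_4 P_def by (simp add: powr_minus powr_realpow field_simps)
  finally show ?thesis unfolding P_def by (simp add: mult_ac)
qed

lemma kC_ge: "2 * 16 ^ 4 * 2 ^ DIM('a) * (2 * 2 ^ DIM('a) * (real DIM('a) + 2)) \<le> kC TYPE('a::euclidean_space)"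
proof -
  have "(2::real) ^ DIM('a) * 2 ^ DIM('a) = 4 ^ DIM('a)" by (simp flip: power_mult_distrib)
  then show ?thesis unfolding kC_def by (simp add: power_add) 
qed

lemma kC_ge1: "1 \<le> kC TYPE('a::euclidean_space)"
proof -
  have "1 * 1 * 1 \<le> (real DIM('a) + 2) * 4 ^ (DIM('a) + 2) * 16 ^ 4"
    by (intro mult_mono one_le_power) auto
  then show ?thesis by (simp add: kC_def)
qed

lemma kC_ge': "2 * 16 ^ 4 * 2 ^ DIM('a) \<le> kC TYPE('a::euclidean_space)"
proof -
  have "2 * 16 ^ 4 * 2 ^ DIM('a) * 1 \<le> 2 * 16 ^ 4 * 2 ^ DIM('a) * (2 * 2 ^ DIM('a) * (real DIM('a) + 2))"
  proof (intro mult_left_mono)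
    have "1 * 1 * 1 \<le> 2 * (2::real) ^ DIM('a) * (real DIM('a) + 2)" by (intro mult_mono) auto
    then show "1 \<le> 2 * (2::real) ^ DIM('a) * (real DIM('a) + 2)" by simp
  qed auto
  then show ?thesis using kC_ge[where 'a='a] by linarith
qed

lemma gradG_bound1: "\<bar>gradG a 1 (z::'a::euclidean_space)\<bar> \<le> kC TYPE('a) * norm a * heatG 4 z"
proof -
  define P where "P = (4 * pi) powr (- real DIM('a) / 2)"
  have "\<bar>a \<bullet> z\<bar> \<le> norm a * norm z" by (rule Cauchy_Schwarz_ineq2)
  also have "\<dots> \<le> norm a * (1 + norm z) ^ 4"
  proof (intro mult_left_mono)
    have "(1 + norm z) ^ 1 \<le> (1 + norm z) ^ 4" by (intro power_increasing) auto
    then show "norm z \<le> (1 + norm z) ^ 4" by simp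
  qed auto
  finally have 1: "\<bar>a \<bullet> z\<bar> / 2 \<le> norm a * (1 + norm z) ^ 4" by simp
  have "\<bar>gradG a 1 z\<bar> = (\<bar>a \<bullet> z\<bar> / 2) * (P * exp (- (norm z)\<^sup>2 / 4))"
    unfolding gradG_def heatG_def P_def by (simp add: abs_mult)
  also have "\<dots> \<le> (norm a * (1 + norm z) ^ 4) * (P * exp (- (norm z)\<^sup>2 / 4))"
    using 1 by (intro mult_right_mono) (auto simp: P_def)
  also have "\<dots> = norm a * ((1 + norm (z - 0)) ^ 4 * (P * exp (- (norm (z - 0))\<^sup>2 / 4)))" by simp
  also have "\<dots> \<le> norm a * (2 * 16 ^ 4 * 2 ^ DIM('a) * heatG 4 z)"
    unfolding P_def by (intro mult_left_mono poly_gauss_le) auto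
  also have "\<dots> \<le> norm a * (kC TYPE('a) * heatG 4 z)"
    by (intro mult_left_mono mult_right_mono kC_ge') auto
  finally show ?thesis by (simp add: mult_ac)
qed

lemma quarter_square_le: "0 \<le> x \<Longrightarrow> x\<^sup>2 / 4 + 1 / 2 \<le> (1 + x)\<^sup>2" for x :: real
  proof -
  assume "0 \<le> x"
  have "(1 + x)\<^sup>2 = 1 + 2 * x + x\<^sup>2" by (simp add: power2_eq_square algebra_simps)
  moreover have "0 \<le> x\<^sup>2" by simp
  ultimately show ?thesis using \<open>0 \<le> x\<close> by linarith
qed

text \<open>Second-order Maclaurin expansion of \<theta> \<mapsto> heatG 1 (z - \<theta> y) on
  [0, 1]. The first derivative at 0 is \<open>- gradG y 1 z\<close>, so the quantity on the left is
  exactly the remainder; \<open>norm y \<le> 1\<close> keeps the intermediate point within reach of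
  the widened Gaussian.\<close>

lemma heatG_taylor1:
  fixes z y :: "'a::euclidean_space"
  assumes y: "norm y \<le> 1"
  shows "\<bar>heatG 1 (z - y) - heatG 1 z + gradG y 1 z\<bar> \<le> kC TYPE('a) * (norm y)\<^sup>2 * heatG 4 z"
proof -
  define P where "P = (4 * pi) powr (- real DIM('a) / 2)"
  have P0: "P \<ge> 0" by (simp add: P_def)
  define e where "e \<theta> = P * exp (- (norm (z - \<theta> *\<^sub>R y))\<^sup>2 / 4)" for \<theta> :: real
  define d1 where "d1 \<theta> = e \<theta> * ((z - \<theta> *\<^sub>R y) \<bullet> y / 2)" for \<theta>
  define d2 where "d2 \<theta> = e \<theta> * (((z - \<theta> *\<^sub>R y) \<bullet> y / 2)\<^sup>2 - (y \<bullet> y) / 2)" for \<theta>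
  have Dn: "((\<lambda>\<theta>. (norm (z - \<theta> *\<^sub>R y))\<^sup>2) has_real_derivative (- 2 * ((z - \<theta> *\<^sub>R y) \<bullet> y))) (at \<theta>)" for \<theta>
    unfolding power2_norm_eq_inner inner_diff inner_scaleR_left inner_scaleR_right
    by (auto intro!: derivative_eq_intros simp: inner_commute algebra_simps)
  have D1: "(e has_real_derivative d1 \<theta>) (at \<theta>)" for \<theta>
    unfolding e_def d1_def
    by (rule derivative_eq_intros Dn refl | simp)+
  have D2: "(d1 has_real_derivative d2 \<theta>) (at \<theta>)" for \<theta>
  proof -
    have "((\<lambda>\<theta>. (z - \<theta> *\<^sub>R y) \<bullet> y / 2) has_real_derivative (- (y \<bullet> y) / 2)) (at \<theta>)"
      unfolding inner_diff inner_scaleR_left by (auto intro!: derivative_eq_intros)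
    note d = DERIV_mult[OF D1 this]
    have "E * (L\<^sup>2 - Y / 2) = (E * L) * L + (- Y / 2) * E" for E L Y :: real
      by (simp add: power2_eq_square algebra_simps)
    then have "d2 \<theta> = d1 \<theta> * ((z - \<theta> *\<^sub>R y) \<bullet> y / 2) + (- (y \<bullet> y) / 2) * e \<theta>"
      unfolding d1_def d2_def by blast
    moreover have "d1 = (\<lambda>\<theta>. e \<theta> * ((z - \<theta> *\<^sub>R y) \<bullet> y / 2))"
      by (rule ext) (rule d1_def)
    ultimately show ?thesis using d by simp
  qed
  define diff where "diff m = (if m = 0 then e else if m = 1 then d1 else d2)" for m :: nat
  have "\<exists>\<theta>>0. \<theta> < 1 \<and> e 1 = (\<Sum>m<2. diff m 0 / fact m * 1 ^ m) + diff 2 \<theta> / fact 2 * 1 ^ 2"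
    by (rule Maclaurin) (auto simp: diff_def less_2_cases_iff D1 D2)
  then obtain \<theta> where \<theta>: "0 < \<theta>" "\<theta> < 1" "e 1 = e 0 + d1 0 + d2 \<theta> / 2"
    by (auto simp: diff_def numeral_2_eq_2)
  have "heatG 1 (z - y) = e 1" "heatG 1 z = e 0" by (simp_all add: heatG_def e_def P_def)
  moreover have "gradG y 1 z = - d1 0"
    unfolding gradG_def d1_def by (simp add: heatG_def e_def P_def inner_commute)
  ultimately have "\<bar>heatG 1 (z - y) - heatG 1 z + gradG y 1 z\<bar> \<le> \<bar>d2 \<theta>\<bar>"
    using \<theta>(3) by simp
  also have "\<dots> = e \<theta> * \<bar>((z - \<theta> *\<^sub>R y) \<bullet> y / 2)\<^sup>2 - (y \<bullet> y) / 2\<bar>"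
    unfolding d2_def abs_mult using P0 by (simp add: e_def)
  also have "\<dots> \<le> e \<theta> * ((norm y)\<^sup>2 * (1 + norm (z - \<theta> *\<^sub>R y)) ^ 4)"
  proof (rule mult_left_mono)
    let ?r = "norm (z - \<theta> *\<^sub>R y)"
    have "((z - \<theta> *\<^sub>R y) \<bullet> y)\<^sup>2 \<le> (?r * norm y)\<^sup>2"
      using Cauchy_Schwarz_ineq2[of "z - \<theta> *\<^sub>R y" y] by (metis abs_ge_zero power2_abs power_mono)
    then have "\<bar>((z - \<theta> *\<^sub>R y) \<bullet> y / 2)\<^sup>2 - (y \<bullet> y) / 2\<bar> \<le> (?r * norm y)\<^sup>2 / 4 + (norm y)\<^sup>2 / 2"
      unfolding power2_norm_eq_inner[symmetric] power_divide by (simp add: abs_le_iff) (smt (verit) zero_le_power2)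
    also have "\<dots> = (norm y)\<^sup>2 * (?r\<^sup>2 / 4 + 1 / 2)" by (simp add: power_mult_distrib algebra_simps)
    also have "\<dots> \<le> (norm y)\<^sup>2 * (1 + ?r) ^ 4"
    proof (rule mult_left_mono)
      have "(1 + ?r) ^ 2 \<le> (1 + ?r) ^ 4" by (intro power_increasing) auto
      moreover have "?r\<^sup>2 / 4 + 1 / 2 \<le> (1 + ?r) ^ 2" by (rule quarter_square_le) (rule norm_ge_zero)
      ultimately show "?r\<^sup>2 / 4 + 1 / 2 \<le> (1 + ?r) ^ 4" by linarith
    qed auto
    finally show "\<bar>((z - \<theta> *\<^sub>R y) \<bullet> y / 2)\<^sup>2 - (y \<bullet> y) / 2\<bar> \<le> (norm y)\<^sup>2 * (1 + ?r) ^ 4" .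
  qed (use P0 in \<open>simp add: e_def\<close>)
  also have "\<dots> = (norm y)\<^sup>2 * ((1 + norm (z - \<theta> *\<^sub>R y)) ^ 4 * e \<theta>)" by (simp add: mult_ac)
  also have "\<dots> \<le> (norm y)\<^sup>2 * (2 * 16 ^ 4 * 2 ^ DIM('a) * heatG 4 z)"
    unfolding e_def P_def using y \<theta> by (intro mult_left_mono poly_gauss_le) (auto intro: mult_le_one)
  also have "\<dots> \<le> (norm y)\<^sup>2 * (kC TYPE('a) * heatG 4 z)"
    by (intro mult_left_mono mult_right_mono kC_ge') auto
  finally show ?thesis by (simp add: mult_ac)
qed

lemma DERIV_exp_neg_quotient:
  fixes n v :: "real \<Rightarrow> real"
  assumes "(n has_real_derivative (- 2 * d)) (at x)" "(v has_real_derivative - s) (at x)" "v x > 0"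
  shows "((\<lambda>x. exp (- (n x / (4 * v x)))) has_real_derivative
    (exp (- (n x / (4 * v x))) * (d / (2 * v x) - n x * s / (4 * (v x)\<^sup>2)))) (at x)"
proof -
  have "((\<lambda>x. n x / (4 * v x)) has_real_derivative
      ((- 2 * d) * (4 * v x) - n x * (4 * (- s))) / ((4 * v x) * (4 * v x))) (at x)"
    by (intro DERIV_divide DERIV_cmult assms) (use assms in auto)
  from DERIV_exp[THEN DERIV_chain2, OF DERIV_minus[OF this]]
  show ?thesis
    by (rule DERIV_cong) (use assms(3) in \<open>simp add: field_simps power2_eq_square\<close>)
qed

text \<open>Mean value theorem along the straight path in space-time from (1, z) to (1 - s, z - y),
  which treats both displacements at once; s \<le> 1/2 keeps the path away from the singular time
  0.\<close>

lemma gradG_diff1: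
  fixes z y a :: "'a::euclidean_space"
  assumes y: "norm y \<le> 1" and s: "0 \<le> s" "s \<le> 1/2"
  shows "\<bar>gradG a (1 - s) (z - y) - gradG a 1 z\<bar> \<le> kC TYPE('a) * norm a * (norm y + s) * heatG 4 z"
proof -
  define N where "N = real DIM('a)"
  have N: "N \<ge> 1" unfolding N_def using DIM_positive[where 'a='a] by linarith
  define P where "P = (4 * pi) powr (- N / 2)"
  have P0: "P \<ge> 0" by (simp add: P_def)
  define q where "q \<theta> = P * (1 - \<theta> * s) powr (- N / 2 - 1)" for \<theta> :: real
  define E where "E \<theta> = exp (- ((norm (z - \<theta> *\<^sub>R y))\<^sup>2 / (4 * (1 - \<theta> * s))))" for \<theta> :: real
  define h where "h \<theta> = - (a \<bullet> (z - \<theta> *\<^sub>R y)) / 2" for \<theta> :: real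
  \<comment> \<open>\<open>J\<close> is the logarithmic derivative of \<open>q * E\<close>: the
    first term comes from the power of the time, the other two from the exponent.\<close>
  define J where "J \<theta> = (N / 2 + 1) * s / (1 - \<theta> * s) + (z - \<theta> *\<^sub>R y) \<bullet> y / (2 * (1 - \<theta> * s))
       - (norm (z - \<theta> *\<^sub>R y))\<^sup>2 * s / (4 * (1 - \<theta> * s)\<^sup>2)" for \<theta> :: real
  have tau: "1/2 \<le> 1 - \<theta> * s" "1 - \<theta> * s \<le> 1" if "0 \<le> \<theta>" "\<theta> \<le> 1" for \<theta>
    using s that mult_mono[of \<theta> 1 s "1/2"] by auto
  define g where "g \<theta> = h \<theta> * (q \<theta> * E \<theta>)" for \<theta>
  define g' where "g' \<theta> = q \<theta> * E \<theta> * (a \<bullet> y / 2 + h \<theta> * J \<theta>)" for \<theta>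
  have gg: "gradG a (1 - \<theta> * s) (z - \<theta> *\<^sub>R y) = g \<theta>" if "0 \<le> \<theta>" "\<theta> \<le> 1" for \<theta>
  proof -
    have t: "1 - \<theta> * s > 0" using tau[OF that] by linarith
    have "(4 * pi * (1 - \<theta> * s)) powr (- N / 2) = P * (1 - \<theta> * s) powr (- N / 2)"
      unfolding P_def using t by (intro powr_mult)
    then show ?thesis
      unfolding gradG_def heatG_def g_def h_def q_def E_def N_def[symmetric] powr_diff using t
      by (simp add: field_simps)
  qed
  have D: "(g has_real_derivative g' \<theta>) (at \<theta>)" if th: "0 \<le> \<theta>" "\<theta> \<le> 1" for \<theta>
  proof -
    have t: "1 - \<theta> * s > 0" using tau[OF that] by linarith
    have Dh: "(h has_real_derivative (a \<bullet> y / 2)) (at \<theta>)"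
      unfolding h_def inner_diff inner_scaleR_right
      by (auto intro!: derivative_eq_intros)
    have Dq: "(q has_real_derivative (q \<theta> * ((N / 2 + 1) * s / (1 - \<theta> * s)))) (at \<theta>)"
    proof -
      have "((\<lambda>\<theta>. (1 - \<theta> * s) powr (- N / 2 - 1)) has_real_derivative
          ((- N / 2 - 1) * (1 - \<theta> * s) powr (- N / 2 - 1 - of_nat 1) * (- s))) (at \<theta>)"
        using t by (intro DERIV_fun_powr) (auto intro!: derivative_eq_intros)
      moreover have "(1 - \<theta> * s) powr (- N / 2 - 1 - of_nat 1) = (1 - \<theta> * s) powr (- N / 2 - 1) / (1 - \<theta> * s)"
        using powr_diff[of "1 - \<theta> * s" "- N / 2 - 1" 1] t by simp
      ultimately have d: "((\<lambda>\<theta>. (1 - \<theta> * s) powr (- N / 2 - 1)) has_real_derivative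
          ((- N / 2 - 1) * ((1 - \<theta> * s) powr (- N / 2 - 1) / (1 - \<theta> * s)) * (- s))) (at \<theta>)"
        by (simp only:)
      have A: "- N / 2 - 1 = - (N / 2 + 1)" by simp
      have "P * (- A * (w / v) * (- s)) = P * w * (A * s / v)" for A w v
        by simp
      then have "P * ((- N / 2 - 1) * ((1 - \<theta> * s) powr (- N / 2 - 1) / (1 - \<theta> * s)) * (- s))
          = q \<theta> * ((N / 2 + 1) * s / (1 - \<theta> * s))"
        unfolding q_def A by blast
      with DERIV_cmult[OF d, of P] show ?thesis unfolding q_def[abs_def] by (simp only:)
    qed
    have Dn: "((\<lambda>\<theta>. (norm (z - \<theta> *\<^sub>R y))\<^sup>2) has_real_derivative (- 2 * ((z - \<theta> *\<^sub>R y) \<bullet> y))) (at \<theta>)"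
      unfolding power2_norm_eq_inner inner_diff inner_scaleR_left inner_scaleR_right
      by (auto intro!: derivative_eq_intros simp: inner_commute algebra_simps)
    have DE: "(E has_real_derivative (E \<theta> * ((z - \<theta> *\<^sub>R y) \<bullet> y / (2 * (1 - \<theta> * s))
       - (norm (z - \<theta> *\<^sub>R y))\<^sup>2 * s / (4 * (1 - \<theta> * s)\<^sup>2)))) (at \<theta>)"
    proof -
      have "((\<lambda>\<theta>. 1 - \<theta> * s) has_real_derivative - s) (at \<theta>)"
        by (auto intro!: derivative_eq_intros)
      from DERIV_exp_neg_quotient[OF Dn this] t show ?thesis
        unfolding E_def[abs_def] by simp
    qed
    have alg: "c * (Q * F) + ((Q * A) * F + (F * (B - C)) * Q) * H = Q * F * (c + H * (A + B - C))"
      for c Q F A B C H :: real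
      by (simp add: algebra_simps)
    have "(g has_real_derivative (a \<bullet> y / 2 * (q \<theta> * E \<theta>) +
        ((q \<theta> * ((N / 2 + 1) * s / (1 - \<theta> * s))) * E \<theta> +
         (E \<theta> * ((z - \<theta> *\<^sub>R y) \<bullet> y / (2 * (1 - \<theta> * s))
            - (norm (z - \<theta> *\<^sub>R y))\<^sup>2 * s / (4 * (1 - \<theta> * s)\<^sup>2))) * q \<theta>) * h \<theta>)) (at \<theta>)"
      unfolding g_def[abs_def] by (rule DERIV_mult[OF Dh DERIV_mult[OF Dq DE]])
    then show ?thesis unfolding g'_def J_def alg .
  qed
  have "\<exists>\<theta>>0. \<theta> < 1 \<and> g 1 - g 0 = (1 - 0) * g' \<theta>"
    by (rule MVT2) (use D in auto)
  then obtain \<theta> where \<theta>: "0 < \<theta>" "\<theta> < 1" "g 1 - g 0 = g' \<theta>" by auto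
  define \<tau> where "\<tau> = 1 - \<theta> * s"
  have \<tau>: "1/2 \<le> \<tau>" "\<tau> \<le> 1" using tau[of \<theta>] \<theta> by (auto simp: \<tau>_def)
  define r where "r = norm (z - \<theta> *\<^sub>R y)"
  have r0: "r \<ge> 0" by (simp add: r_def)
  have q_le: "q \<theta> \<le> P * (2 * 2 ^ DIM('a))"
  proof -
    have "\<tau> powr (- N / 2 - 1) \<le> (1/2) powr (- N / 2 - 1)"
      using \<tau> N by (intro powr_mono2') auto
    also have "\<dots> = inverse (2 powr (- (N / 2 + 1)))" by (simp add: powr_divide inverse_eq_divide)
    also have "\<dots> = 2 powr (N / 2 + 1)" unfolding powr_minus by simp
    also have "\<dots> \<le> 2 powr (N + 1)" using N by (intro powr_mono) auto
    also have "\<dots> = 2 * 2 ^ DIM('a)" by (simp add: powr_add powr_realpow N_def)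
    finally show ?thesis unfolding q_def \<tau>_def[symmetric] using P0 by (intro mult_left_mono)
  qed
  have E_le: "E \<theta> \<le> exp (- r\<^sup>2 / 4)"
  proof -
    have "r\<^sup>2 * \<tau> \<le> r\<^sup>2" using \<tau> by (intro mult_left_le) auto
    then show ?thesis unfolding E_def \<tau>_def[symmetric] r_def[symmetric] using \<tau> by (simp add: field_simps)
  qed
  have b1: "\<bar>a \<bullet> y\<bar> \<le> norm a * norm y" by (rule Cauchy_Schwarz_ineq2)
  have b2: "\<bar>h \<theta>\<bar> \<le> norm a * r" using Cauchy_Schwarz_ineq2[of a "z - \<theta> *\<^sub>R y"] 
    by (simp add: h_def r_def)
  have b3: "\<bar>J \<theta>\<bar> \<le> (N + 2) * s + r * norm y + r\<^sup>2 * s"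
  proof -
    have "(N / 2 + 1) * s / \<tau> \<le> (N / 2 + 1) * s / (1/2)"
      using \<tau> N s by (intro divide_left_mono) auto
    then have i: "\<bar>(N / 2 + 1) * s / \<tau>\<bar> \<le> (N + 2) * s" using \<tau> N s by (simp add: algebra_simps)
    have "\<bar>(z - \<theta> *\<^sub>R y) \<bullet> y\<bar> / (2 * \<tau>) \<le> (r * norm y) / (2 * \<tau>)"
      using Cauchy_Schwarz_ineq2[of "z - \<theta> *\<^sub>R y" y] \<tau> by (intro divide_right_mono) (auto simp: r_def)
    also have "\<dots> \<le> (r * norm y) / 1" using \<tau> r0 by (intro divide_left_mono) auto
    finally have ii: "\<bar>(z - \<theta> *\<^sub>R y) \<bullet> y / (2 * \<tau>)\<bar> \<le> r * norm y" using \<tau> by (simp add: abs_divide)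
    have "(1/2)\<^sup>2 \<le> \<tau>\<^sup>2" using \<tau> by (intro power_mono) auto
    then have "1 \<le> 4 * \<tau>\<^sup>2" by (simp add: power2_eq_square)
    then have "r\<^sup>2 * s / (4 * \<tau>\<^sup>2) \<le> r\<^sup>2 * s / 1" using s by (intro divide_left_mono) auto
    then have iii: "\<bar>r\<^sup>2 * s / (4 * \<tau>\<^sup>2)\<bar> \<le> r\<^sup>2 * s" using s by simp
    show ?thesis using i ii iii unfolding J_def \<tau>_def[symmetric] r_def[symmetric] by linarith
  qed
  have b4: "\<bar>a \<bullet> y / 2 + h \<theta> * J \<theta>\<bar> \<le> norm a * (N + 2) * (norm y + s) * (1 + r) ^ 4"
  proof -
    have "\<bar>a \<bullet> y / 2 + h \<theta> * J \<theta>\<bar> \<le> \<bar>a \<bullet> y\<bar> + \<bar>h \<theta>\<bar> * \<bar>J \<theta>\<bar>"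
      unfolding abs_mult[symmetric] by linarith
    also have "\<dots> \<le> norm a * norm y + (norm a * r) * ((N + 2) * s + r * norm y + r\<^sup>2 * s)"
      using b1 b2 b3 r0 by (intro add_mono mult_mono) auto
    also have "\<dots> = norm a * (norm y * (1 + r\<^sup>2) + s * ((N + 2) * r + r ^ 3))"
      by (simp add: algebra_simps power2_eq_square power3_eq_cube)
    also have "\<dots> \<le> norm a * (norm y * ((N + 2) * (1 + r) ^ 4) + s * ((N + 2) * (1 + r) ^ 4))"
    proof -
      have p: "(1 + r) ^ 4 = 1 + 4 * r + 6 * r\<^sup>2 + 4 * r ^ 3 + r ^ 4"
        by (simp add: power4_eq_xxxx power2_eq_square power3_eq_cube algebra_simps)
      have "1 + r\<^sup>2 \<le> (1 + r) ^ 4" unfolding p using r0 by simp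
      also have "\<dots> \<le> (N + 2) * (1 + r) ^ 4" using N r0 mult_right_mono[of 1 "N + 2" "(1 + r) ^ 4"] by simp
      finally have x: "1 + r\<^sup>2 \<le> (N + 2) * (1 + r) ^ 4" .
      have "(N + 2) * r + r ^ 3 \<le> (N + 2) * r + (N + 2) * r ^ 3"
        using N r0 mult_right_mono[of 1 "N + 2" "r ^ 3"] by simp
      also have "\<dots> = (N + 2) * (r + r ^ 3)" by (simp add: algebra_simps)
      also have "\<dots> \<le> (N + 2) * (1 + r) ^ 4"
        unfolding p using N r0 by (intro mult_left_mono) auto
      finally show ?thesis using x s by (intro mult_left_mono add_mono) auto
    qed
    also have "\<dots> = norm a * (N + 2) * (norm y + s) * (1 + r) ^ 4" by (simp add: algebra_simps)
    finally show ?thesis .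
  qed
  have th: "norm (\<theta> *\<^sub>R y) \<le> 1" using y \<theta> by (auto intro: mult_le_one)
  have "\<bar>gradG a (1 - s) (z - y) - gradG a 1 z\<bar> = \<bar>g' \<theta>\<bar>"
    using gg[of 0] gg[of 1] \<theta>(3) by simp
  also have "\<dots> = (q \<theta> * E \<theta>) * \<bar>a \<bullet> y / 2 + h \<theta> * J \<theta>\<bar>"
    unfolding g'_def abs_mult using P0 by (simp add: q_def E_def)
  also have "\<dots> \<le> ((P * (2 * 2 ^ DIM('a))) * exp (- r\<^sup>2 / 4)) * (norm a * (N + 2) * (norm y + s) * (1 + r) ^ 4)"
    using q_le E_le b4 P0 N s r0 by (intro mult_mono) (auto simp: E_def)
  also have "\<dots> = (norm a * (norm y + s) * (2 * 2 ^ DIM('a) * (N + 2))) * ((1 + r) ^ 4 * (P * exp (- r\<^sup>2 / 4)))"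
    by (simp add: mult_ac)
  also have "\<dots> \<le> (norm a * (norm y + s) * (2 * 2 ^ DIM('a) * (N + 2))) * (2 * 16 ^ 4 * 2 ^ DIM('a) * heatG 4 z)"
    unfolding r_def P_def N_def using s by (intro mult_left_mono poly_gauss_le th) auto
  also have "\<dots> = (norm a * (norm y + s)) * ((2 * 16 ^ 4 * 2 ^ DIM('a) * (2 * 2 ^ DIM('a) * (N + 2))) * heatG 4 z)"
    by (simp add: mult_ac)
  also have "\<dots> \<le> (norm a * (norm y + s)) * (kC TYPE('a) * heatG 4 z)"
    unfolding N_def using s by (intro mult_left_mono mult_right_mono kC_ge) auto
  finally show ?thesis by (simp add: mult_ac)
qed

lemma sqrt_powr_minus1: "t > 0 \<Longrightarrow> sqrt t powr - 1 = t powr (- 1 / 2)"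
proof -
  assume "t > 0"
  then have "sqrt t powr - 1 = (t powr (1 / 2)) powr - 1" by (simp only: powr_half_sqrt)
  also have "\<dots> = t powr (1 / 2 * - 1)" by (rule powr_powr)
  finally show ?thesis by simp
qed

lemma sqrt_powr_diff1:
  assumes "t > 0"
  shows "sqrt t powr (d - 1) = sqrt t powr d * t powr (- 1 / 2)"
  using powr_add[of "sqrt t" d "- 1"] unfolding sqrt_powr_minus1[OF assms] by (simp only: diff_conv_add_uminus)

lemma gradG_bound:
  fixes z :: "'a::euclidean_space"
  assumes "t > 0"
  shows "\<bar>gradG a t z\<bar> \<le> kC TYPE('a) * norm a * t powr (- 1 / 2) * heatG (4 * t) z"
proof -
  define c w where "c = sqrt t" and "w = (1 / c) *\<^sub>R z"
  have c: "c > 0" "c\<^sup>2 = t" "z = c *\<^sub>R w" using assms by (auto simp: c_def w_def)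
  have h: "heatG (4 * t) z = c powr (- real DIM('a)) * heatG 4 w"
    using heatG_scale[of c 4 w] c by (simp add: mult_ac)
  have g: "gradG a t z = c powr (- real DIM('a) - 1) * gradG a 1 w"
    using gradG_scale[of c 1 a w] c by simp
  have "\<bar>gradG a t z\<bar> = c powr (- real DIM('a) - 1) * \<bar>gradG a 1 w\<bar>"
    unfolding g by (simp add: abs_mult)
  also have "\<dots> \<le> c powr (- real DIM('a) - 1) * (kC TYPE('a) * norm a * heatG 4 w)"
    by (intro mult_left_mono gradG_bound1) auto
  also have "c powr (- real DIM('a) - 1) = c powr (- real DIM('a)) * t powr (- 1 / 2)"
    unfolding c_def by (rule sqrt_powr_diff1[OF assms])
  finally show ?thesis unfolding h by (simp only: mult_ac)
qed

lemma gradG_diff: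
  fixes z y :: "'a::euclidean_space"
  assumes "t > 0" "norm y \<le> sqrt t" "0 \<le> s" "s \<le> t / 2"
  shows "\<bar>gradG a (t - s) (z - y) - gradG a t z\<bar>
    \<le> kC TYPE('a) * norm a * t powr (- 1 / 2) * (norm y / sqrt t + s / t) * heatG (4 * t) z"
proof -
  define c w v where "c = sqrt t" and "w = (1 / c) *\<^sub>R z" and "v = (1 / c) *\<^sub>R y"
  have c: "c > 0" "c\<^sup>2 = t" "z = c *\<^sub>R w" "y = c *\<^sub>R v" using assms by (auto simp: c_def w_def v_def)
  have v: "norm v \<le> 1" "norm v = norm y / sqrt t" using assms c(1) by (auto simp: v_def c_def)
  have h: "heatG (4 * t) z = c powr (- real DIM('a)) * heatG 4 w"
    using heatG_scale[of c 4 w] c by (simp add: mult_ac)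
  have g: "gradG a t z = c powr (- real DIM('a) - 1) * gradG a 1 w"
    using gradG_scale[of c 1 a w] c by simp
  have st: "0 \<le> s / t" "s / t \<le> 1 / 2" using assms by (auto simp: field_simps)
  have ts: "c\<^sup>2 * (1 - s / t) = t - s" "c *\<^sub>R (w - v) = z - y"
    unfolding c(2) scaleR_diff_right c(3,4)[symmetric] using assms(1) by (auto simp: right_diff_distrib)
  have g': "gradG a (t - s) (z - y) = c powr (- real DIM('a) - 1) * gradG a (1 - s / t) (w - v)"
    using gradG_scale[of c "1 - s / t" a "w - v"] c(1) st unfolding ts by simp
  have "\<bar>gradG a (t - s) (z - y) - gradG a t z\<bar>
     = c powr (- real DIM('a) - 1) * \<bar>gradG a (1 - s / t) (w - v) - gradG a 1 w\<bar>"
    unfolding g g' by (simp add: abs_mult flip: right_diff_distrib)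
  also have "\<dots> \<le> c powr (- real DIM('a) - 1) * (kC TYPE('a) * norm a * (norm v + s / t) * heatG 4 w)"
    by (intro mult_left_mono gradG_diff1 v st) auto
  also have "c powr (- real DIM('a) - 1) = c powr (- real DIM('a)) * t powr (- 1 / 2)"
    unfolding c_def by (rule sqrt_powr_diff1[OF assms(1)])
  finally show ?thesis unfolding h v(2) by (simp only: mult_ac)
qed

lemma heatG_taylor:
  fixes z y :: "'a::euclidean_space"
  assumes "t > 0" "norm y \<le> sqrt t"
  shows "\<bar>heatG t (z - y) - heatG t z + gradG y t z\<bar> \<le> kC TYPE('a) * (norm y / sqrt t)\<^sup>2 * heatG (4 * t) z"
proof -
  define c w v where "c = sqrt t" and "w = (1 / c) *\<^sub>R z" and "v = (1 / c) *\<^sub>R y"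
  have c: "c > 0" "c\<^sup>2 = t" "z = c *\<^sub>R w" "y = c *\<^sub>R v" using assms by (auto simp: c_def w_def v_def)
  have v: "norm v \<le> 1" "norm v = norm y / sqrt t" using assms c(1) by (auto simp: v_def c_def)
  have h: "heatG (4 * t) z = c powr (- real DIM('a)) * heatG 4 w"
    using heatG_scale[of c 4 w] c by (simp add: mult_ac)
  have h1: "heatG t z = c powr (- real DIM('a)) * heatG 1 w"
    using heatG_scale[of c 1 w] c by simp
  have h2: "heatG t (z - y) = c powr (- real DIM('a)) * heatG 1 (w - v)"
    using heatG_scale[of c 1 "w - v"] c by (simp add: scaleR_diff_right)
  have "gradG y t z = c * gradG v t z"
    unfolding gradG_def by (subst c(4)) simp
  also have "\<dots> = c * (c powr (- real DIM('a) - 1) * gradG v 1 w)"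
    using gradG_scale[of c 1 v w] c by simp
  finally have g: "gradG y t z = c powr (- real DIM('a)) * gradG v 1 w"
    using c(1) by (simp add: powr_diff)
  have "\<bar>heatG t (z - y) - heatG t z + gradG y t z\<bar>
     = c powr (- real DIM('a)) * \<bar>heatG 1 (w - v) - heatG 1 w + gradG v 1 w\<bar>"
    unfolding h1 h2 g by (simp add: abs_mult flip: right_diff_distrib distrib_left)
  also have "\<dots> \<le> c powr (- real DIM('a)) * (kC TYPE('a) * (norm v)\<^sup>2 * heatG 4 w)"
    by (intro mult_left_mono heatG_taylor1 v) auto
  finally show ?thesis unfolding h v(2) by (simp only: mult_ac)
qed

text \<open>One pointwise Gaussian majorant yields both norms: its mass bounds the L1 norm and its
  height the sup norm. The ratio \<open>t powr (- real DIM('a) / 2)\<close> of the two is the weight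
  built into the bounds of the asymptotic expansion.\<close>

lemma gaussian_dominated:
  fixes k :: "'a::euclidean_space \<Rightarrow> real"
  assumes "t > 0" "k \<in> borel_measurable borel" "0 \<le> c" "\<And>z. \<bar>k z\<bar> \<le> c * heatG (4 * t) z"
  shows "L1_le c k" "\<bar>k z\<bar> \<le> c * t powr (- real DIM('a) / 2)"
proof -
  have "L1_le (\<bar>c\<bar> * 1) (\<lambda>z::'a. c * heatG (4 * t) z)"
    using assms by (intro L1_le_cmult heatG_L1) auto
  then show "L1_le c k"
    by (rule L1_le_dominated[OF L1_le_mono]) (use assms in \<open>auto simp: abs_mult\<close>)
  have "\<bar>k z\<bar> \<le> c * heatG (4 * t) z" by fact
  also have "\<dots> \<le> c * (4 * t) powr (- real DIM('a) / 2)"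
    using assms by (intro mult_left_mono heatG_le) auto
  also have "\<dots> \<le> c * t powr (- real DIM('a) / 2)"
    using assms by (intro mult_left_mono powr_mono2') auto
  finally show "\<bar>k z\<bar> \<le> c * t powr (- real DIM('a) / 2)" .
qed

lemma kC_pos: "0 < kC TYPE('a::euclidean_space)"
  using kC_ge1[where 'a='a] by linarith

lemma kC_nonneg[simp]: "0 \<le> kC TYPE('a::euclidean_space)"
  using kC_pos[where 'a='a] by linarith

lemma gradG_L1: "t > 0 \<Longrightarrow> L1_le (kC TYPE('a) * norm a * t powr (- 1 / 2)) (gradG (a::'a::euclidean_space) t)"
  by (rule gaussian_dominated(1)[OF _ _ _ gradG_bound]) simp_all

lemma gradG_le: "t > 0 \<Longrightarrow> \<bar>gradG (a::'a::euclidean_space) t z\<bar>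
    \<le> kC TYPE('a) * norm a * t powr (- 1 / 2) * t powr (- real DIM('a) / 2)"
  by (rule gaussian_dominated(2)[OF _ _ _ gradG_bound]) simp_all

lemma gradG_integral_0: "t > 0 \<Longrightarrow> (\<integral>z. gradG a t z \<partial>lborel) = 0"
  using integral_reflect[of "gradG a t" 0] by simp

text \<open>Enlarges \<open>kC\<close> to cover the regime where two kernels are bounded separately
  and negative powers of t - s \<ge> t/2 are traded for powers of t.\<close>

definition kD :: "'a::euclidean_space itself \<Rightarrow> real" where
  "kD T = 2 ^ (DIM('a) + 2) * kC T"

lemma kD_nonneg[simp]: "0 \<le> kD TYPE('a::euclidean_space)"
  by (simp add: kD_def)

lemma half_powr_le:
  fixes t s :: real
  assumes "t > 0" "s \<le> t / 2" "0 \<le> e" "e \<le> real n"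
  shows "(t - s) powr (- e) \<le> 2 ^ n * t powr (- e)"
proof -
  have "(t - s) powr (- e) \<le> (t / 2) powr (- e)" using assms by (intro powr_mono2') auto
  also have "\<dots> = 2 powr e * t powr (- e)"
    using assms by (simp add: powr_divide powr_minus field_simps)
  also have "\<dots> \<le> 2 powr (real n) * t powr (- e)"
    using assms by (intro mult_right_mono powr_mono) auto
  finally show ?thesis by (simp add: powr_realpow)
qed

text \<open>The mean value bound serves small displacements, the triangle inequality large ones. The
  truncation by \<open>min 1\<close> is what dominated convergence will want: a bound uniform in the
  displacement that tends to 0, for fixed s and y, as t grows.\<close>

lemma gradG_diff_est:
  fixes a y :: "'a::euclidean_space"
  assumes t: "t > 0" and s: "0 \<le> s" "s \<le> t / 2"
  shows "L1_le (kD TYPE('a) * norm a * t powr (- 1 / 2) * min 1 (norm y / sqrt t + s / t))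
      (\<lambda>z. gradG a (t - s) (z - y) - gradG a t z)" (is ?L)
    and "\<bar>gradG a (t - s) (z - y) - gradG a t z\<bar>
      \<le> kD TYPE('a) * norm a * t powr (- 1 / 2) * min 1 (norm y / sqrt t + s / t) * t powr (- real DIM('a) / 2)" (is ?I)
proof -
  let ?r = "norm y / sqrt t + s / t"
  let ?d = "real DIM('a)"
  have r0: "?r \<ge> 0" "norm y / sqrt t \<ge> 0" "s / t \<ge> 0" using t s by auto
  have "?L \<and> ?I"
  proof (cases "?r \<le> 1")
    case True
    then have y: "norm y \<le> sqrt t" 
    proof -
      have "norm y / sqrt t \<le> 1" using True r0 by linarith
      then show ?thesis using t by (simp add: pos_divide_le_eq)
    qed
    have le: "kC TYPE('a) * norm a * t powr (- 1 / 2) * ?r \<le> kD TYPE('a) * norm a * t powr (- 1 / 2) * ?r"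
    proof (intro mult_right_mono r0(1))
      have "1 * kC TYPE('a) \<le> 2 ^ (DIM('a) + 2) * kC TYPE('a)"
        by (intro mult_right_mono one_le_power) auto
      then show "kC TYPE('a) \<le> kD TYPE('a)" by (simp add: kD_def)
    qed auto
    have c0: "0 \<le> kC TYPE('a) * norm a * t powr (- 1 / 2) * ?r" using r0(1) by simp
    note g = gaussian_dominated[OF t _ c0 gradG_diff[OF t y s]]
    have 1: ?L using L1_le_mono[OF g(1) le] True by (simp add: min_def)
    have "\<bar>gradG a (t - s) (z - y) - gradG a t z\<bar> \<le> kC TYPE('a) * norm a * t powr (- 1 / 2) * ?r * t powr (- ?d / 2)"
      by (rule g(2)) measurable
    also have "\<dots> \<le> kD TYPE('a) * norm a * t powr (- 1 / 2) * ?r * t powr (- ?d / 2)"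
      by (intro mult_right_mono le) auto
    finally show ?thesis using 1 True by (simp add: min_def)
  next
    case False
    have ts: "t - s > 0" using t s by auto
    let ?c = "kC TYPE('a) * norm a"
    have c0: "0 \<le> ?c" by simp
    have "(t - s) powr (- (1 / 2)) \<le> 2 ^ 1 * t powr (- (1 / 2))"
      by (rule half_powr_le) (use t s in auto)
    then have b1: "(t - s) powr (- 1 / 2) \<le> 2 * t powr (- 1 / 2)" by simp
    have "(t - s) powr (- (?d / 2)) \<le> 2 ^ DIM('a) * t powr (- (?d / 2))"
      by (rule half_powr_le) (use t s in auto)
    then have b2: "(t - s) powr (- ?d / 2) \<le> 2 ^ DIM('a) * t powr (- ?d / 2)" by simp
    have k: "3 * kC TYPE('a) \<le> kD TYPE('a)" "(2 * 2 ^ DIM('a) + 1) * kC TYPE('a) \<le> kD TYPE('a)"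
      unfolding kD_def
    proof -
      have "(1::real) \<le> 2 ^ DIM('a)" by simp
      then have *: "3 \<le> (2::real) ^ (DIM('a) + 2)" "(2 * 2 ^ DIM('a) + 1) \<le> (2::real) ^ (DIM('a) + 2)"
        by (auto simp: power_add simp del: one_le_power)
      show "3 * kC TYPE('a) \<le> 2 ^ (DIM('a) + 2) * kC TYPE('a)"
        "(2 * 2 ^ DIM('a) + 1) * kC TYPE('a) \<le> 2 ^ (DIM('a) + 2) * kC TYPE('a)"
        using * by (auto intro!: mult_right_mono simp del: power_add)
    qed
    have "L1_le (?c * (t - s) powr (- 1 / 2) + ?c * t powr (- 1 / 2)) (\<lambda>z. gradG a (t - s) (z - y) - gradG a t z)"
      by (intro L1_le_diff L1_le_shift[of _ "gradG a (t - s)"] gradG_L1 ts t)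
    moreover have "?c * (t - s) powr (- 1 / 2) + ?c * t powr (- 1 / 2) \<le> kD TYPE('a) * norm a * t powr (- 1 / 2)"
    proof -
      have "?c * (t - s) powr (- 1 / 2) + ?c * t powr (- 1 / 2) \<le> ?c * (2 * t powr (- 1 / 2)) + ?c * t powr (- 1 / 2)"
        by (intro add_mono mult_left_mono b1 c0) auto
      also have "\<dots> = (3 * kC TYPE('a)) * (norm a * t powr (- 1 / 2))" by simp
      also have "\<dots> \<le> kD TYPE('a) * (norm a * t powr (- 1 / 2))"
        by (intro mult_right_mono k) auto
      finally show ?thesis by simp
    qed
    ultimately have 1: ?L using False by (simp add: min_def L1_le_mono)
    have "\<bar>gradG a (t - s) (z - y) - gradG a t z\<bar> \<le> \<bar>gradG a (t - s) (z - y)\<bar> + \<bar>gradG a t z\<bar>" by simp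
    also have "\<dots> \<le> ?c * (t - s) powr (- 1 / 2) * (t - s) powr (- ?d / 2) + ?c * t powr (- 1 / 2) * t powr (- ?d / 2)"
      by (intro add_mono gradG_le ts t)
    also have "\<dots> \<le> ?c * (2 * t powr (- 1 / 2)) * (2 ^ DIM('a) * t powr (- ?d / 2)) + ?c * t powr (- 1 / 2) * t powr (- ?d / 2)"
      by (intro add_mono mult_mono b1 b2) auto
    also have "\<dots> = ((2 * 2 ^ DIM('a) + 1) * kC TYPE('a)) * (norm a * t powr (- 1 / 2) * t powr (- ?d / 2))"
      by (simp add: distrib_right distrib_left)
    also have "\<dots> \<le> kD TYPE('a) * (norm a * t powr (- 1 / 2) * t powr (- ?d / 2))"
      by (intro mult_right_mono k) auto
    finally show ?thesis using 1 False by (simp add: min_def mult_ac)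
  qed
  then show ?L ?I by auto
qed

lemma triple_square_le: "0 \<le> K \<Longrightarrow> K * r\<^sup>2 \<le> 3 * K * r * r" for K r :: real
proof -
  assume "0 \<le> K"
  then have "0 \<le> K * r\<^sup>2" by simp
  moreover have "3 * K * r * r = 3 * (K * r\<^sup>2)" by (simp add: power2_eq_square)
  ultimately show ?thesis by linarith
qed

text \<open>With r = |y| / sqrt t the error is quadratic for r \<le> 1; beyond, the three terms are
  bounded separately and the error is linear. The form r min(1, r) fits data with a finite first
  moment: one factor r is paid by the moment and yields \<open>t powr (- 1 / 2)\<close>, the other
  tends to 0.\<close>

lemma heatG_taylor_est:
  fixes y :: "'a::euclidean_space"
  assumes t: "t > 0"
  shows "L1_le (3 * kC TYPE('a) * (norm y / sqrt t) * min 1 (norm y / sqrt t))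
      (\<lambda>z. heatG t (z - y) - heatG t z + gradG y t z)" (is ?L)
    and "\<bar>heatG t (z - y) - heatG t z + gradG y t z\<bar>
      \<le> 3 * kC TYPE('a) * (norm y / sqrt t) * min 1 (norm y / sqrt t) * t powr (- real DIM('a) / 2)" (is ?I)
proof -
  let ?r = "norm y / sqrt t"
  let ?d = "real DIM('a)"
  have r0: "?r \<ge> 0" using t by auto
  have tr: "norm y * t powr (- 1 / 2) = ?r"
    using t by (simp add: powr_minus_divide powr_half_sqrt)
  have "?L \<and> ?I"
  proof (cases "?r \<le> 1")
    case True
    then have mn: "min 1 ?r = ?r" by (rule min_absorb2)
    from True have y: "norm y \<le> sqrt t" using t by (simp add: field_simps)
    have le: "kC TYPE('a) * ?r\<^sup>2 \<le> 3 * kC TYPE('a) * ?r * ?r"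
      by (rule triple_square_le) simp
    have c0: "0 \<le> kC TYPE('a) * ?r\<^sup>2" by simp
    note g = gaussian_dominated[OF t _ c0 heatG_taylor[OF t y]]
    have 1: ?L unfolding mn by (rule L1_le_mono[OF g(1) le]) measurable
    have "\<bar>heatG t (z - y) - heatG t z + gradG y t z\<bar> \<le> kC TYPE('a) * ?r\<^sup>2 * t powr (- ?d / 2)"
      by (rule g(2)) measurable
    also have "\<dots> \<le> 3 * kC TYPE('a) * ?r * ?r * t powr (- ?d / 2)"
      by (intro mult_right_mono le) auto
    finally show ?thesis using 1 unfolding mn by blast
  next
    case False
    then have mn: "min 1 ?r = 1" by (simp only: min_def) simp
    from False have r1: "1 \<le> ?r" by simp
    have "1 * 1 \<le> kC TYPE('a) * ?r" by (intro mult_mono kC_ge1 r1) auto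
    then have le: "1 + 1 + kC TYPE('a) * ?r \<le> 3 * kC TYPE('a) * ?r" by simp
    have g: "L1_le (kC TYPE('a) * ?r) (gradG y t)"
      using gradG_L1[OF t, of y] tr by (simp add: mult.assoc)
    have g': "\<bar>gradG y t z\<bar> \<le> kC TYPE('a) * ?r * t powr (- ?d / 2)"
      using gradG_le[OF t, of y z] unfolding mult.assoc[of "kC TYPE('a)" "norm y" "t powr (- 1 / 2)"] tr .
    have "L1_le (1 + 1 + kC TYPE('a) * ?r) (\<lambda>z. heatG t (z - y) - heatG t z + gradG y t z)"
      by (intro L1_le_add L1_le_diff L1_le_shift[of _ "heatG t"] heatG_L1 g t)
    then have 1: ?L unfolding mn mult_1_right by (rule L1_le_mono[OF _ le])
    have "\<bar>heatG t (z - y) - heatG t z + gradG y t z\<bar> \<le> heatG t (z - y) + heatG t z + \<bar>gradG y t z\<bar>"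
      using heatG_nonneg[of t z] heatG_nonneg[of t "z - y"] by linarith
    also have "\<dots> \<le> t powr (- ?d / 2) + t powr (- ?d / 2) + kC TYPE('a) * ?r * t powr (- ?d / 2)"
      by (intro add_mono heatG_le t g')
    also have "\<dots> = (1 + 1 + kC TYPE('a) * ?r) * t powr (- ?d / 2)"
      by (simp add: distrib_right)
    also have "\<dots> \<le> 3 * kC TYPE('a) * ?r * t powr (- ?d / 2)"
      by (intro mult_right_mono le) auto
    finally show ?thesis using 1 unfolding mn by (simp only: mult_1_right)
  qed
  then show ?L ?I by auto
qed

lemma heatG_diff_L1:
  fixes y :: "'a::euclidean_space"
  assumes t: "t > 0"
  shows "L1_le (4 * kC TYPE('a) * min 1 (norm y / sqrt t)) (\<lambda>z. heatG t (z - y) - heatG t z)"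
proof -
  let ?r = "norm y / sqrt t"
  have r0: "?r \<ge> 0" using t by auto
  have tr: "norm y * t powr (- 1 / 2) = ?r"
    using t by (simp add: powr_minus_divide powr_half_sqrt)
  show ?thesis
  proof (cases "?r \<le> 1")
    case True
    have g: "L1_le (kC TYPE('a) * ?r) (gradG y t)"
      using gradG_L1[OF t, of y] tr by (simp add: mult.assoc)
    have "L1_le (3 * kC TYPE('a) * ?r * min 1 ?r + kC TYPE('a) * ?r)
        (\<lambda>z. (heatG t (z - y) - heatG t z + gradG y t z) - gradG y t z)"
      by (intro L1_le_diff g heatG_taylor_est t)
    moreover have "3 * kC TYPE('a) * ?r * min 1 ?r + kC TYPE('a) * ?r \<le> 4 * kC TYPE('a) * ?r"
    proof -
      have "3 * kC TYPE('a) * ?r * min 1 ?r \<le> 3 * kC TYPE('a) * ?r * 1"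
        by (intro mult_left_mono mult_nonneg_nonneg r0 kC_nonneg) simp_all
      then show ?thesis by simp
    qed
    ultimately show ?thesis using True by (simp add: min_def L1_le_mono)
  next
    case False
    have "L1_le (1 + 1) (\<lambda>z. heatG t (z - y) - heatG t z)"
      by (intro L1_le_diff L1_le_shift[of _ "heatG t"] heatG_L1 t)
    then show ?thesis using False kC_ge1[where 'a='a] by (simp add: min_def L1_le_mono)
  qed
qed

subsection \<open>Convolution\<close>

definition conv :: "('a::euclidean_space \<Rightarrow> real) \<Rightarrow> ('a \<Rightarrow> real) \<Rightarrow> 'a \<Rightarrow> real" where
  "conv k \<phi> x = (\<integral>y. k (x - y) * \<phi> y \<partial>lborel)"

lemma heat_conv: "heat t \<phi> = conv (heatG t) \<phi>"
  by (simp add: heat_def conv_def fun_eq_iff)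

lemma grad_heat_conv: "grad_heat a t \<phi> = conv (gradG a t) \<phi>"
  by (simp add: grad_heat_def conv_def fun_eq_iff gradG_def)

lemma conv_measurable[measurable (raw)]:
  assumes [measurable]: "k \<in> borel_measurable borel" "\<phi> \<in> borel_measurable borel"
  shows "conv k \<phi> \<in> borel_measurable borel"
  unfolding conv_def[abs_def] by measurable

lemma conv_commute:
  assumes [measurable]: "k \<in> borel_measurable borel" "\<phi> \<in> borel_measurable borel"
  shows "conv k \<phi> x = conv \<phi> k x"
  using integral_reflect[of "\<lambda>y. k y * \<phi> (x - y)" x]
  by (simp add: conv_def mult.commute)

lemma conv_cong_AE:
  assumes [measurable]: "k \<in> borel_measurable borel" "\<phi> \<in> borel_measurable borel" "\<psi> \<in> borel_measurable borel"
    and ae: "AE y in lborel. \<phi> y = \<psi> y"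
  shows "conv k \<phi> x = conv k \<psi> x"
  unfolding conv_def by (rule integral_cong_AE) (use ae in \<open>auto elim!: eventually_mono\<close>)

lemma conv_bounded_kernel:
  fixes k :: "'a::euclidean_space \<Rightarrow> real"
  assumes [measurable]: "k \<in> borel_measurable borel" and k: "\<And>z. \<bar>k z\<bar> \<le> l" and \<phi>: "L1_le m \<phi>"
  shows conv_bounded_kernel_integrable: "integrable lborel (\<lambda>y. k (x - y) * \<phi> y)"
    and conv_bounded_kernel_le: "\<bar>conv k \<phi> x\<bar> \<le> l * m"
proof -
  note [measurable] = L1_le_measurable[OF \<phi>]
  have l: "0 \<le> l" using k[of 0] by linarith
  have i: "integrable lborel (\<lambda>y. l * \<bar>\<phi> y\<bar>)" using L1_leD(1)[OF \<phi>] by simp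
  have b: "\<bar>k (x - y) * \<phi> y\<bar> \<le> l * \<bar>\<phi> y\<bar>" for y
    unfolding abs_mult by (intro mult_right_mono k) auto
  show j: "integrable lborel (\<lambda>y. k (x - y) * \<phi> y)"
    by (rule Bochner_Integration.integrable_bound[OF i]) (use b l in \<open>auto simp: abs_mult\<close>)
  have "\<bar>conv k \<phi> x\<bar> \<le> (\<integral>y. \<bar>k (x - y) * \<phi> y\<bar> \<partial>lborel)" unfolding conv_def by simp
  also have "\<dots> \<le> (\<integral>y. l * \<bar>\<phi> y\<bar> \<partial>lborel)"
    by (rule integral_mono) (use i j b in auto)
  also have "\<dots> \<le> l * m" using L1_leD(2)[OF \<phi>] l by (simp add: mult_left_mono)
  finally show "\<bar>conv k \<phi> x\<bar> \<le> l * m" .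
qed

text \<open>The bound holds at every \<open>x\<close>, not merely almost everywhere, since the
  integral defining the convolution does not see null sets. Convergence at every point of Duhamel
  integrals with bounded sources rests on this.\<close>

lemma conv_bounded:
  assumes k: "L1_le m k" and \<phi>: "Linf_le l \<phi>"
  shows conv_bounded_integrable: "integrable lborel (\<lambda>y. k (x - y) * \<phi> y)"
    and conv_bounded_le: "\<bar>conv k \<phi> x\<bar> \<le> m * l"
proof -
  note [measurable] = L1_le_measurable[OF k] Linf_leD(1)[OF \<phi>]
  have l: "0 \<le> l" using \<phi> by (rule Linf_le_nonneg)
  have k': "integrable lborel (\<lambda>y. k (x - y))" "(\<integral>y. \<bar>k (x - y)\<bar> \<partial>lborel) \<le> m"
    using L1_leD[OF k] integrable_reflect_iff[of k x] integral_reflect[of "\<lambda>y. \<bar>k y\<bar>" x] by auto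
  have i: "integrable lborel (\<lambda>y. \<bar>k (x - y)\<bar> * l)" using k' by simp
  have b: "AE y in lborel. \<bar>k (x - y) * \<phi> y\<bar> \<le> \<bar>k (x - y)\<bar> * l"
    using Linf_leD(2)[OF \<phi>] by eventually_elim (auto simp: abs_mult intro!: mult_left_mono)
  show j: "integrable lborel (\<lambda>y. k (x - y) * \<phi> y)"
    by (rule Bochner_Integration.integrable_bound[OF i]) (use b l in auto)
  have "\<bar>conv k \<phi> x\<bar> \<le> (\<integral>y. \<bar>k (x - y) * \<phi> y\<bar> \<partial>lborel)" unfolding conv_def by simp
  also have "\<dots> \<le> (\<integral>y. \<bar>k (x - y)\<bar> * l \<partial>lborel)"
    by (rule integral_mono_AE) (use i j b in auto)
  also have "\<dots> \<le> m * l" using k'(2) l by (simp add: mult_right_mono)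
  finally show "\<bar>conv k \<phi> x\<bar> \<le> m * l" .
qed

text \<open>Young's inequality, with the convolution read as a superposition of translates of
  \<open>k\<close> with weights \<open>\<phi> y\<close>.\<close>

lemma conv_L1:
  fixes k :: "'a::euclidean_space \<Rightarrow> real"
  assumes k: "L1_le m k" and \<phi>: "L1_le m' \<phi>"
  shows "L1_le (m * m') (conv k \<phi>)"
proof -
  note [measurable] = L1_le_measurable[OF k] L1_le_measurable[OF \<phi>]
  have "L1_le (\<integral>y. m * \<bar>\<phi> y\<bar> \<partial>lborel) (\<lambda>x. \<integral>y. k (x - y) * \<phi> y \<partial>lborel)"
  proof (rule Minkowski_L1_le)
    have "L1_le (m * \<bar>\<phi> y\<bar>) (\<lambda>x. k (x - y) * \<phi> y)" for y
      using L1_le_cmult[OF L1_le_shift[OF k], of "\<phi> y"] by (simp add: mult.commute)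
    then show "AE y in lborel. L1_le (m * \<bar>\<phi> y\<bar>) (\<lambda>x. k (x - y) * \<phi> y)" by simp
  qed (use L1_leD[OF \<phi>] in \<open>auto intro: sigma_finite_lborel\<close>)
  moreover have "(\<integral>y. m * \<bar>\<phi> y\<bar> \<partial>lborel) \<le> m * m'"
    using L1_leD(2)[OF \<phi>] L1_le_nonneg[OF k] by (simp add: mult_left_mono)
  ultimately show ?thesis unfolding conv_def[abs_def] by (rule L1_le_mono)
qed

lemma conv_Linf:
  assumes k: "L1_le m k" and \<phi>: "Linf_le l \<phi>"
  shows "Linf_le (m * l) (conv k \<phi>)"
  unfolding Linf_le_def using conv_bounded_le[OF assms] L1_le_measurable[OF k] Linf_leD(1)[OF \<phi>]
  by auto

lemma conv_L1_Linf:
  fixes k :: "'a::euclidean_space \<Rightarrow> real"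
  assumes k: "k \<in> borel_measurable borel" "\<And>z. \<bar>k z\<bar> \<le> l" and \<phi>: "L1_le m \<phi>"
  shows "Linf_le (l * m) (conv k \<phi>)"
  unfolding Linf_le_def using conv_bounded_kernel_le[OF assms] L1_le_measurable[OF \<phi>] k(1)
  by auto

text \<open>Associativity by Fubini: k2(y - z) \<phi>(z) is integrable on the product, and
  multiplying by the bounded outer kernel keeps it so.\<close>

lemma conv_conv:
  fixes k1 :: "'a::euclidean_space \<Rightarrow> real"
  assumes m1[measurable]: "k1 \<in> borel_measurable borel" and k1: "\<And>z. \<bar>k1 z\<bar> \<le> l"
    and k2: "L1_le m k2" and \<phi>: "L1_le m' \<phi>"
  shows "conv k1 (conv k2 \<phi>) x = conv (conv k1 k2) \<phi> x"
proof -
  note [measurable] = L1_le_measurable[OF k2] L1_le_measurable[OF \<phi>]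
  have l: "0 \<le> l" using k1[of 0] by linarith
  have i: "integrable (lborel \<Otimes>\<^sub>M lborel) (\<lambda>(z, y). k1 (x - y) * (k2 (y - z) * \<phi> z))"
  proof (rule Minkowski_L1_integrable)
    have "L1_le (l * (m * \<bar>\<phi> z\<bar>)) (\<lambda>y. k1 (x - y) * (k2 (y - z) * \<phi> z))" for z
    proof -
      have "L1_le (\<bar>l\<bar> * (\<bar>\<phi> z\<bar> * m)) (\<lambda>y. l * (\<phi> z * k2 (y - z)))"
        by (intro L1_le_cmult L1_le_shift k2)
      then show ?thesis
      proof (rule L1_le_dominated[OF L1_le_mono])
        have "\<bar>k1 (x - y) * (k2 (y - z) * \<phi> z)\<bar> \<le> \<bar>l * (\<phi> z * k2 (y - z))\<bar>" for y
        proof -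
          have "\<bar>k1 (x - y)\<bar> * \<bar>\<phi> z * k2 (y - z)\<bar> \<le> l * \<bar>\<phi> z * k2 (y - z)\<bar>"
            by (intro mult_right_mono k1) auto
          then show ?thesis using l by (simp add: abs_mult mult_ac)
        qed
        then show "AE y in lborel. \<bar>k1 (x - y) * (k2 (y - z) * \<phi> z)\<bar> \<le> \<bar>l * (\<phi> z * k2 (y - z))\<bar>" by simp
      qed (use l in \<open>auto simp: mult_ac\<close>)
    qed
    then show "AE z in lborel. L1_le (l * (m * \<bar>\<phi> z\<bar>)) (\<lambda>y. k1 (x - y) * (k2 (y - z) * \<phi> z))" by simp
  qed (use L1_leD[OF \<phi>] in \<open>auto intro: sigma_finite_lborel\<close>)
  have "conv k1 (conv k2 \<phi>) x = (\<integral>y. (\<integral>z. k1 (x - y) * (k2 (y - z) * \<phi> z) \<partial>lborel) \<partial>lborel)"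
    by (simp add: conv_def)
  also have "\<dots> = (\<integral>z. (\<integral>y. k1 (x - y) * (k2 (y - z) * \<phi> z) \<partial>lborel) \<partial>lborel)"
    by (rule lborel_pair.Fubini_integral[OF i])
  also have "\<dots> = (\<integral>z. (\<integral>y. k1 (x - z - y) * k2 y \<partial>lborel) * \<phi> z \<partial>lborel)"
  proof (rule Bochner_Integration.integral_cong[OF refl])
    fix z
    have "(\<integral>y. k1 (x - y) * (k2 (y - z) * \<phi> z) \<partial>lborel) = (\<integral>y. (k1 (x - y) * k2 (y - z)) * \<phi> z \<partial>lborel)"
      by (simp add: mult.assoc)
    also have "\<dots> = (\<integral>y. k1 (x - y) * k2 (y - z) \<partial>lborel) * \<phi> z" by simp
    also have "(\<integral>y. k1 (x - y) * k2 (y - z) \<partial>lborel) = (\<integral>y. k1 (x - z - y) * k2 y \<partial>lborel)"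
      using integral_shift[of "\<lambda>y. k1 (x - z - y) * k2 y" z] by simp
    finally show "(\<integral>y. k1 (x - y) * (k2 (y - z) * \<phi> z) \<partial>lborel) = (\<integral>y. k1 (x - z - y) * k2 y \<partial>lborel) * \<phi> z" .
  qed
  finally show ?thesis by (simp add: conv_def)
qed

text \<open>Fubini; transposition reflects the kernel. For the even heat kernel this is
  self-adjointness, for the odd gradient kernel it is integration by parts with the derivative kept
  on the kernel.\<close>

lemma conv_adjoint:
  fixes k :: "'a::euclidean_space \<Rightarrow> real"
  assumes k: "L1_le m k" and \<phi>: "L1_le m' \<phi>" and \<psi>: "Linf_le l \<psi>"
  shows "(\<integral>x. conv k \<phi> x * \<psi> x \<partial>lborel) = (\<integral>x. \<phi> x * conv (\<lambda>z. k (- z)) \<psi> x \<partial>lborel)"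
proof -
  note [measurable] = L1_le_measurable[OF k] L1_le_measurable[OF \<phi>] Linf_leD(1)[OF \<psi>]
  have l: "0 \<le> l" using Linf_le_nonneg[OF \<psi>] .
  have i: "integrable (lborel \<Otimes>\<^sub>M lborel) (\<lambda>(y, x). k (x - y) * \<phi> y * \<psi> x)"
  proof (rule Minkowski_L1_integrable)
    have "L1_le (l * (m * \<bar>\<phi> y\<bar>)) (\<lambda>x. k (x - y) * \<phi> y * \<psi> x)" for y
    proof -
      have "L1_le (\<bar>l\<bar> * (\<bar>\<phi> y\<bar> * m)) (\<lambda>x. l * (\<phi> y * k (x - y)))"
        by (intro L1_le_cmult L1_le_shift k)
      then show ?thesis
      proof (rule L1_le_dominated[OF L1_le_mono])
        show "AE x in lborel. \<bar>k (x - y) * \<phi> y * \<psi> x\<bar> \<le> \<bar>l * (\<phi> y * k (x - y))\<bar>"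
          using Linf_leD(2)[OF \<psi>]
        proof eventually_elim
          case (elim x)
          then have "\<bar>\<psi> x\<bar> * \<bar>k (x - y) * \<phi> y\<bar> \<le> l * \<bar>k (x - y) * \<phi> y\<bar>" by (intro mult_right_mono) auto
          then show ?case using l by (simp add: abs_mult mult_ac)
        qed
      qed (use l in \<open>auto simp: mult_ac\<close>)
    qed
    then show "AE y in lborel. L1_le (l * (m * \<bar>\<phi> y\<bar>)) (\<lambda>x. k (x - y) * \<phi> y * \<psi> x)" by simp
  qed (use L1_leD[OF \<phi>] in \<open>auto intro: sigma_finite_lborel\<close>)
  have "(\<integral>x. conv k \<phi> x * \<psi> x \<partial>lborel) = (\<integral>x. (\<integral>y. k (x - y) * \<phi> y * \<psi> x \<partial>lborel) \<partial>lborel)"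
    by (simp add: conv_def)
  also have "\<dots> = (\<integral>y. (\<integral>x. k (x - y) * \<phi> y * \<psi> x \<partial>lborel) \<partial>lborel)"
    by (rule lborel_pair.Fubini_integral[OF i])
  also have "\<dots> = (\<integral>y. \<phi> y * conv (\<lambda>z. k (- z)) \<psi> y \<partial>lborel)"
    unfolding conv_def by (simp add: mult_ac flip: integral_mult_right_zero)
  finally show ?thesis .
qed

subsection \<open>The heat semigroup\<close>

lemma heatG_Linf: "t > 0 \<Longrightarrow> \<bar>heatG t (z::'a::euclidean_space)\<bar> \<le> t powr (- real DIM('a) / 2)"
  using heatG_le[of t z] by simp

lemma conv_heatG_heatG:
  assumes s: "s > 0" and t: "t > 0"
  shows "conv (heatG s) (heatG t) x = heatG (s + t) (x::'a::euclidean_space)"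
proof -
  have pos: "s * t / (s + t) > 0" using s t by simp
  have "conv (heatG s) (heatG t) x = (\<integral>y. heatG (s + t) x * heatG (s * t / (s + t)) (y - (t / (s + t)) *\<^sub>R x) \<partial>lborel)"
    unfolding conv_def heatG_semigroup_factor[OF s t] ..
  also have "\<dots> = heatG (s + t) x"
    using integral_shift[of "heatG (s * t / (s + t)) :: 'a \<Rightarrow> real" "(t / (s + t)) *\<^sub>R x"] heatG_integral[OF pos, where 'a='a]
    by simp
  finally show ?thesis .
qed

text \<open>With c the centre found by completing the square, a \<cdot> (x - y) = s/(s + t) a
  \<cdot> x - a \<cdot> (y - c). The second part is odd about c and integrates to 0; the first
  reproduces the gradient kernel at time s + t.\<close>

lemma conv_gradG_heatG:
  assumes s: "s > 0" and t: "t > 0"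
  shows "conv (gradG a s) (heatG t) x = gradG a (s + t) (x::'a::euclidean_space)"
proof -
  define r c where "r = s * t / (s + t)" and "c = (t / (s + t)) *\<^sub>R x"
  have pos: "r > 0" using s t by (simp add: r_def)
  have "a \<bullet> (x - y) = s / (s + t) * (a \<bullet> x) - a \<bullet> (y - c)" for y
  proof -
    have f: "s / (s + t) = 1 - t / (s + t)" using s t by (simp add: field_simps)
    show ?thesis unfolding c_def inner_diff inner_scaleR_right f by (simp add: algebra_simps)
  qed
  moreover have "- (s / (s + t) * X - Y) / (2 * s) * (H * R) = H * (- X / (2 * (s + t)) * R - r / s * (- Y / (2 * r) * R))"
    for X Y H R
  proof -
    have "- (s / (s + t) * X - Y) / (2 * s) = - X / (2 * (s + t)) + Y / (2 * s)"
      using s t by (simp add: divide_simps) (simp add: algebra_simps)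
    moreover have "r / s * (- Y / (2 * r) * R) = - (Y / (2 * s)) * R" using pos by simp
    ultimately show ?thesis by (simp only:) (simp only: algebra_simps)
  qed
  ultimately have e: "gradG a s (x - y) * heatG t y
      = heatG (s + t) x * (- (a \<bullet> x) / (2 * (s + t)) * heatG r (y - c) - (r / s) * gradG a r (y - c))" for y
    using heatG_semigroup_factor[OF s t, of x y] s t pos unfolding r_def[symmetric] c_def[symmetric] gradG_def
    by (simp only: mult.assoc)
  have sh: "(\<integral>y. heatG r (y - c) \<partial>lborel) = 1" "(\<integral>y. gradG a r (y - c) \<partial>lborel) = 0"
    "integrable lborel (\<lambda>y. heatG r (y - c))" "integrable lborel (\<lambda>y. gradG a r (y - c))"
    using integral_shift[of "heatG r :: 'a \<Rightarrow> real" c] integral_shift[of "gradG a r" c] heatG_integral[OF pos, where 'a='a]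
      gradG_integral_0[OF pos, of a] integrable_shift_iff[of "heatG r :: 'a \<Rightarrow> real" c] heatG_integrable[OF pos, where 'a='a]
      integrable_shift_iff[of "gradG a r" c] L1_leD(1)[OF gradG_L1[OF pos, of a]]
    by auto
  have "conv (gradG a s) (heatG t) x
     = (\<integral>y. heatG (s + t) x * (- (a \<bullet> x) / (2 * (s + t)) * heatG r (y - c) - (r / s) * gradG a r (y - c)) \<partial>lborel)"
    unfolding conv_def e ..
  also have "\<dots> = heatG (s + t) x * ((\<integral>y. - (a \<bullet> x) / (2 * (s + t)) * heatG r (y - c) \<partial>lborel) - (\<integral>y. (r / s) * gradG a r (y - c) \<partial>lborel))"
    unfolding integral_mult_right_zero
    by (subst Bochner_Integration.integral_diff) (use sh in auto)
  also have "\<dots> = gradG a (s + t) x"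
    unfolding integral_mult_right_zero sh by (simp add: gradG_def)
  finally show ?thesis .
qed

lemma conv_heatG_gradG:
  assumes s: "s > 0" and t: "t > 0"
  shows "conv (heatG s) (gradG a t) x = gradG a (s + t) (x::'a::euclidean_space)"
  using conv_gradG_heatG[OF t s, of a x] by (simp add: conv_commute[of "heatG s"] add.commute)

lemma heat_heat:
  fixes \<phi> :: "'a::euclidean_space \<Rightarrow> real"
  assumes "s > 0" "t > 0" "L1_le m \<phi>"
  shows "heat s (heat t \<phi>) = heat (s + t) \<phi>"
proof
  fix x
  have "conv (heatG s) (heatG t) = (heatG (s + t) :: 'a \<Rightarrow> real)" by (rule ext) (rule conv_heatG_heatG[OF assms(1,2)])
  then show "heat s (heat t \<phi>) x = heat (s + t) \<phi> x"
    unfolding heat_conv using conv_conv[where ?k1.0="heatG s" and x=x, OF _ heatG_Linf[OF assms(1)] heatG_L1[OF assms(2)] assms(3)] by simp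
qed

lemma grad_heat_heat:
  fixes \<phi> :: "'a::euclidean_space \<Rightarrow> real"
  assumes "s > 0" "t > 0" "L1_le m \<phi>"
  shows "grad_heat a s (heat t \<phi>) = grad_heat a (s + t) \<phi>"
proof
  fix x
  have "conv (gradG a s) (heatG t) = gradG a (s + t)" by (rule ext) (rule conv_gradG_heatG[OF assms(1,2)])
  then show "grad_heat a s (heat t \<phi>) x = grad_heat a (s + t) \<phi> x"
    unfolding heat_conv grad_heat_conv using conv_conv[where ?k1.0="gradG a s" and x=x, OF _ gradG_le[OF assms(1)] heatG_L1[OF assms(2)] assms(3)] by simp
qed

lemma heat_grad_heat:
  fixes \<phi> :: "'a::euclidean_space \<Rightarrow> real"
  assumes "s > 0" "t > 0" "L1_le m \<phi>"
  shows "heat s (grad_heat a t \<phi>) = grad_heat a (s + t) \<phi>"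
proof
  fix x
  have "conv (heatG s) (gradG a t) = gradG a (s + t)" by (rule ext) (rule conv_heatG_gradG[OF assms(1,2)])
  then show "heat s (grad_heat a t \<phi>) x = grad_heat a (s + t) \<phi> x"
    unfolding heat_conv grad_heat_conv using conv_conv[where ?k1.0="heatG s" and x=x, OF _ heatG_Linf[OF assms(1)] gradG_L1[OF assms(2)] assms(3)] by simp
qed

lemma heat_measurable: "\<phi> \<in> borel_measurable borel \<Longrightarrow> heat t \<phi> \<in> borel_measurable borel"
  unfolding heat_conv by measurable

lemma grad_heat_measurable: "\<phi> \<in> borel_measurable borel \<Longrightarrow> grad_heat a t \<phi> \<in> borel_measurable borel"
  unfolding grad_heat_conv by measurable

lemma heat_L1: "t > 0 \<Longrightarrow> L1_le m \<phi> \<Longrightarrow> L1_le m (heat t \<phi>)"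
  unfolding heat_conv using conv_L1[OF heatG_L1] by fastforce

lemma heat_Linf: "t > 0 \<Longrightarrow> Linf_le l \<phi> \<Longrightarrow> Linf_le l (heat t \<phi>)"
  unfolding heat_conv using conv_Linf[OF heatG_L1] by fastforce

lemma heat_L1_Linf: "t > 0 \<Longrightarrow> L1_le m \<phi> \<Longrightarrow> Linf_le (t powr (- real DIM('a) / 2) * m) (heat t (\<phi>::'a::euclidean_space \<Rightarrow> real))"
  unfolding heat_conv by (rule conv_L1_Linf[OF _ heatG_Linf]) simp_all

lemma grad_heat_L1: "t > 0 \<Longrightarrow> L1_le m \<phi> \<Longrightarrow>
    L1_le (kC TYPE('a) * norm a * t powr (- 1 / 2) * m) (grad_heat (a::'a::euclidean_space) t \<phi>)"
  unfolding grad_heat_conv by (intro conv_L1 gradG_L1)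

lemma grad_heat_Linf: "t > 0 \<Longrightarrow> Linf_le m \<phi> \<Longrightarrow>
    Linf_le (kC TYPE('a) * norm a * t powr (- 1 / 2) * m) (grad_heat (a::'a::euclidean_space) t \<phi>)"
  unfolding grad_heat_conv by (intro conv_Linf gradG_L1)

lemma grad_heat_L1_Linf: "t > 0 \<Longrightarrow> L1_le m \<phi> \<Longrightarrow>
    Linf_le (kC TYPE('a) * norm a * t powr (- 1 / 2) * t powr (- real DIM('a) / 2) * m) (grad_heat (a::'a::euclidean_space) t \<phi>)"
  unfolding grad_heat_conv by (rule conv_L1_Linf[OF _ gradG_le]) simp_all

subsection \<open>Time integrals\<close>

lemma set_integrable_powr_0:
  fixes e t :: real
  assumes "e > - 1" "t \<ge> 0"
  shows "set_integrable lborel {0..t} (\<lambda>s. s powr e)"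
    and "(LINT s:{0..t}|lborel. s powr e) = t powr (e + 1) / (e + 1)"
proof -
  have hi: "((\<lambda>x. x powr e) has_integral t powr (e + 1) / (e + 1)) {0..t}"
    by (rule has_integral_powr_from_0[OF assms])
  then have "(\<lambda>x. x powr e) absolutely_integrable_on {0..t}"
    by (intro nonnegative_absolutely_integrable_1) (auto simp: integrable_on_def)
  then show i: "set_integrable lborel {0..t} (\<lambda>s. s powr e)"
    unfolding set_integrable_def by (subst (asm) integrable_completion) auto
  show "(LINT s:{0..t}|lborel. s powr e) = t powr (e + 1) / (e + 1)"
    using set_borel_integral_eq_integral(2)[OF i] hi by (simp add: integral_unique)
qed

lemma set_integrable_powr_reflect:
  fixes e t :: real
  assumes "e > - 1" "t \<ge> 0"
  shows "set_integrable lborel {0..t} (\<lambda>s. (t - s) powr e)"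
    and "(LINT s:{0..t}|lborel. (t - s) powr e) = t powr (e + 1) / (e + 1)"
proof -
  have eq: "(\<lambda>s. indicator {0..t} s *\<^sub>R (t - s) powr e) = (\<lambda>s. (\<lambda>s. indicator {0..t} s *\<^sub>R s powr e) (t - s))"
    by (auto simp: fun_eq_iff indicator_def)
  have m: "(\<lambda>s. indicator {0..t} s *\<^sub>R s powr e) \<in> borel_measurable borel" by measurable
  show "set_integrable lborel {0..t} (\<lambda>s. (t - s) powr e)"
    unfolding set_integrable_def eq using set_integrable_powr_0(1)[OF assms] integrable_reflect_iff[OF m, of t]
    unfolding set_integrable_def by blast
  show "(LINT s:{0..t}|lborel. (t - s) powr e) = t powr (e + 1) / (e + 1)"
    using set_integrable_powr_0(2)[OF assms] integral_reflect[OF m, of t]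
    unfolding set_lebesgue_integral_def eq by (simp only:)
qed

lemma set_integrable_powr_inf:
  fixes e c :: real
  assumes "e < - 1" "c > 0"
  shows "set_integrable lborel {c..} (\<lambda>s. s powr e)"
proof -
  have hi: "((\<lambda>x. x powr e) has_integral - (c powr (e + 1)) / (e + 1)) {c..}"
    by (rule has_integral_powr_to_inf[OF assms])
  then have "(\<lambda>x. x powr e) absolutely_integrable_on {c..}"
    by (intro nonnegative_absolutely_integrable_1) (auto simp: integrable_on_def)
  then show ?thesis
    unfolding set_integrable_def by (subst (asm) integrable_completion) auto
qed

lemma AE_lborel_neq: "AE s in lborel. s \<noteq> (c::'b::euclidean_space)"
  by (rule AE_lborel_singleton)

subsection \<open>Superposition in time\<close>

lemma joint_measurable_comp:
  fixes F :: "real \<Rightarrow> 'a::euclidean_space \<Rightarrow> real"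
  assumes "case_prod F \<in> borel_measurable (borel \<Otimes>\<^sub>M borel)"
    and "g \<in> borel_measurable M" "h \<in> borel_measurable M"
  shows "(\<lambda>w. F (g w) (h w)) \<in> borel_measurable M"
  using measurable_compose[OF measurable_Pair[OF assms(2,3)] assms(1)] by simp

lemma joint_measurable_section:
  fixes F :: "real \<Rightarrow> 'a::euclidean_space \<Rightarrow> real"
  assumes "case_prod F \<in> borel_measurable (borel \<Otimes>\<^sub>M borel)"
  shows "F s \<in> borel_measurable borel"
  using joint_measurable_comp[OF assms, of "\<lambda>_. s" borel "\<lambda>x. x"] by simp

lemma grad_heat_joint_measurable:
  fixes F :: "real \<Rightarrow> 'a::euclidean_space \<Rightarrow> real"
  assumes F: "case_prod F \<in> borel_measurable (borel \<Otimes>\<^sub>M borel)"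
  shows "(\<lambda>w. grad_heat a (t - fst w) (F (fst w)) (snd w)) \<in> borel_measurable (borel \<Otimes>\<^sub>M borel)"
proof -
  have [measurable]: "(\<lambda>z. F (fst (fst z)) (snd z)) \<in> borel_measurable ((borel \<Otimes>\<^sub>M borel) \<Otimes>\<^sub>M lborel)"
    by (rule joint_measurable_comp[OF F]) auto
  have "(\<lambda>w. \<integral>y. gradG a (t - fst w) (snd w - y) * F (fst w) y \<partial>lborel) \<in> borel_measurable (borel \<Otimes>\<^sub>M borel)"
    by (rule lborel.borel_measurable_lebesgue_integral) (simp add: case_prod_beta', measurable)
  then show ?thesis unfolding grad_heat_conv conv_def .
qed

lemma duhamel_eq: "duhamel a F t0 t1 t x = (\<integral>s. indicator {t0..t1} s * grad_heat a (t - s) (F s) x \<partial>lborel)"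
  by (simp add: duhamel_def set_lebesgue_integral_def)

lemma duhamel_integrand_measurable:
  fixes F :: "real \<Rightarrow> 'a::euclidean_space \<Rightarrow> real"
  assumes F: "case_prod F \<in> borel_measurable (borel \<Otimes>\<^sub>M borel)"
  shows "(\<lambda>(s, x). indicator {t0..t1} s * grad_heat a (t - s) (F s) x) \<in> borel_measurable (lborel \<Otimes>\<^sub>M lborel)"
proof -
  note [measurable] = grad_heat_joint_measurable[OF F, of a t]
  have "(\<lambda>w. indicator {t0..t1} (fst w) * grad_heat a (t - fst w) (F (fst w)) (snd w)) \<in> borel_measurable (borel \<Otimes>\<^sub>M borel)"
    by measurable
  then show ?thesis by (simp add: case_prod_beta')
qed

lemma duhamel_measurable:
  fixes F :: "real \<Rightarrow> 'a::euclidean_space \<Rightarrow> real"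
  assumes F: "case_prod F \<in> borel_measurable (borel \<Otimes>\<^sub>M borel)"
  shows "duhamel a F t0 t1 t \<in> borel_measurable borel"
proof -
  have "(\<lambda>(x, s). indicator {t0..t1} s * grad_heat a (t - s) (F s) x) \<in> borel_measurable (lborel \<Otimes>\<^sub>M lborel)"
    using measurable_pair_swap[OF duhamel_integrand_measurable[OF F]] by (simp add: case_prod_beta')
  then have "(\<lambda>x. \<integral>s. indicator {t0..t1} s * grad_heat a (t - s) (F s) x \<partial>lborel) \<in> borel_measurable lborel"
    by (rule lborel.borel_measurable_lebesgue_integral)
  then show ?thesis unfolding duhamel_eq[abs_def] by simp
qed

lemma duhamel_slice_measurable:
  fixes F :: "real \<Rightarrow> 'a::euclidean_space \<Rightarrow> real"
  assumes F: "case_prod F \<in> borel_measurable (borel \<Otimes>\<^sub>M borel)"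
  shows "(\<lambda>s. grad_heat a (t - s) (F s) x) \<in> borel_measurable borel"
  using measurable_compose[OF measurable_Pair[OF measurable_ident measurable_const[of x borel borel]] grad_heat_joint_measurable[OF F, of a t]]
  by simp

text \<open>The weight lives on a superset \<open>S\<close> of the time window, so that a partial
  window can use the closed form of the integral over all of {0..t}. The slice bound is asked for
  almost every \<open>s\<close>, which leaves out endpoints where the kernel or the source is
  singular.\<close>

lemma duhamel_L1:
  fixes F :: "real \<Rightarrow> 'a::euclidean_space \<Rightarrow> real"
  assumes F: "case_prod F \<in> borel_measurable (borel \<Otimes>\<^sub>M borel)"
    and S: "{t0..t1} \<subseteq> S" "set_integrable lborel S m" "\<And>s. s \<in> S \<Longrightarrow> 0 \<le> m s"
    and b: "AE s in lborel. s \<in> {t0..t1} \<longrightarrow> L1_le (m s) (grad_heat a (t - s) (F s))"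
  shows "L1_le (LINT s:S|lborel. m s) (duhamel a F t0 t1 t)"
  unfolding duhamel_eq[abs_def] set_lebesgue_integral_def
proof (rule Minkowski_L1_le[OF sigma_finite_lborel duhamel_integrand_measurable[OF F]])
  show "integrable lborel (\<lambda>s. indicator S s *\<^sub>R m s)" using S(2) by (simp add: set_integrable_def)
  show "AE s in lborel. L1_le (indicator S s *\<^sub>R m s) (\<lambda>x. indicator {t0..t1} s * grad_heat a (t - s) (F s) x)"
    using b
  proof eventually_elim
    case (elim s)
    have z: "L1_le 0 (\<lambda>_::'a. 0)" by (simp add: L1_le_def)
    show ?case
    proof (cases "s \<in> {t0..t1}")
      case True
      then have "s \<in> S" using S(1) by blast
      then show ?thesis using elim True by simp
    next
      case False
      have "0 \<le> indicator S s *\<^sub>R m s" using S(3)[of s] by (auto simp: indicator_def)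
      then show ?thesis using L1_le_mono[OF z] False by simp
    qed
  qed
qed

lemma duhamel_Linf:
  fixes F :: "real \<Rightarrow> 'a::euclidean_space \<Rightarrow> real"
  assumes F: "case_prod F \<in> borel_measurable (borel \<Otimes>\<^sub>M borel)"
    and S: "{t0..t1} \<subseteq> S" "set_integrable lborel S m" "\<And>s. s \<in> S \<Longrightarrow> 0 \<le> m s"
    and b: "AE s in lborel. s \<in> {t0..t1} \<longrightarrow> Linf_le (m s) (grad_heat a (t - s) (F s))"
  shows "Linf_le (LINT s:S|lborel. m s) (duhamel a F t0 t1 t)"
    and "AE x in lborel. set_integrable lborel {t0..t1} (\<lambda>s. grad_heat a (t - s) (F s) x)"
proof -
  have i: "integrable lborel (\<lambda>s. indicator S s *\<^sub>R m s)" using S(2) by (simp add: set_integrable_def)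
  have ae: "AE s in lborel. Linf_le (indicator S s *\<^sub>R m s) (\<lambda>x. indicator {t0..t1} s * grad_heat a (t - s) (F s) x)"
    using b
  proof eventually_elim
    case (elim s)
    have z: "Linf_le 0 (\<lambda>_::'a. 0)" by (simp add: Linf_le_def)
    show ?case
    proof (cases "s \<in> {t0..t1}")
      case True
      then have "s \<in> S" using S(1) by blast
      then show ?thesis using elim True by simp
    next
      case False
      have "0 \<le> indicator S s *\<^sub>R m s" using S(3)[of s] by (auto simp: indicator_def)
      then show ?thesis using Linf_le_mono[OF z] False by simp
    qed
  qed
  note M = Minkowski_Linf[OF sigma_finite_lborel duhamel_integrand_measurable[OF F] ae i]
  show "Linf_le (LINT s:S|lborel. m s) (duhamel a F t0 t1 t)"
    using M(1) unfolding duhamel_eq[abs_def] set_lebesgue_integral_def .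
  show "AE x in lborel. set_integrable lborel {t0..t1} (\<lambda>s. grad_heat a (t - s) (F s) x)"
    using M(2) by (simp add: set_integrable_def)
qed

lemma powr_half_rescale:
  fixes t e :: real
  assumes "t > 0" "0 \<le> e" "e \<le> real n"
  shows "(t / 2) powr (- e) \<le> 2 ^ n * t powr (- e)"
  using half_powr_le[of t "t / 2" e n] assms by simp

text \<open>The weight splits at \<open>s = t / 2\<close>: early times carry the smoothing of the kernel, late
  times the decay of the source.\<close>

lemma time_weight_bound:
  fixes t s e \<kappa> :: real
  assumes t: "0 < s" "s < t" and e: "0 \<le> e" and k: "0 \<le> \<kappa>"
  defines "W \<equiv> (t / 2) powr (- (e + 1 / 2)) * s powr (- (1 / 2) - \<kappa>)
      + (t - s) powr (- (1 / 2)) * (t / 2) powr (- (e + 1 / 2 + \<kappa>))"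
  shows "s \<le> t / 2 \<Longrightarrow> (t - s) powr (- (1 / 2)) * (t - s) powr (- e) * s powr (- (1 / 2) - \<kappa>) \<le> W"
    and "t / 2 \<le> s \<Longrightarrow> (t - s) powr (- (1 / 2)) * (s powr (- (1 / 2) - \<kappa>) * s powr (- e)) \<le> W"
proof -
  have nn: "0 \<le> (t / 2) powr (- (e + 1 / 2)) * s powr (- (1 / 2) - \<kappa>)"
    "0 \<le> (t - s) powr (- (1 / 2)) * (t / 2) powr (- (e + 1 / 2 + \<kappa>))" by auto
  show "(t - s) powr (- (1 / 2)) * (t - s) powr (- e) * s powr (- (1 / 2) - \<kappa>) \<le> W" if "s \<le> t / 2"
  proof -
    have "(t - s) powr (- (1 / 2)) * (t - s) powr (- e) = (t - s) powr (- (e + 1 / 2))"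
      unfolding powr_add[symmetric] by (simp add: add.commute)
    also have "\<dots> \<le> (t / 2) powr (- (e + 1 / 2))"
      using that t e by (intro powr_mono2') auto
    finally have "(t - s) powr (- (1 / 2)) * (t - s) powr (- e) * s powr (- (1 / 2) - \<kappa>)
        \<le> (t / 2) powr (- (e + 1 / 2)) * s powr (- (1 / 2) - \<kappa>)"
      by (intro mult_right_mono) auto
    then show ?thesis unfolding W_def using nn by linarith
  qed
  show "(t - s) powr (- (1 / 2)) * (s powr (- (1 / 2) - \<kappa>) * s powr (- e)) \<le> W" if "t / 2 \<le> s"
  proof -
    have "s powr (- (1 / 2) - \<kappa>) * s powr (- e) = s powr (- (e + 1 / 2 + \<kappa>))"
      unfolding powr_add[symmetric] by (rule arg_cong[where f="(powr) s"]) simp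
    also have "\<dots> \<le> (t / 2) powr (- (e + 1 / 2 + \<kappa>))"
      using that t e k by (intro powr_mono2') auto
    finally have "(t - s) powr (- (1 / 2)) * (s powr (- (1 / 2) - \<kappa>) * s powr (- e))
        \<le> (t - s) powr (- (1 / 2)) * (t / 2) powr (- (e + 1 / 2 + \<kappa>))"
      by (intro mult_left_mono) auto
    then show ?thesis unfolding W_def using nn by linarith
  qed
qed

text \<open>Both summands integrate to multiples of
  \<open>t powr (- \<kappa>) * t powr (- e)\<close>. The condition \<kappa> < 1/2 is integrability
  of the source weight at s = 0 and produces 1 / (1/2 - \<kappa>); the 2 comes from the kernel
  singularity at s = t.\<close>

lemma time_weight_integral:
  fixes t e \<kappa> :: real
  assumes t: "0 < t" and e: "0 \<le> e" "e + 1 \<le> real n" and k: "0 \<le> \<kappa>" "\<kappa> < 1 / 2"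
  defines "W \<equiv> \<lambda>s. (t / 2) powr (- (e + 1 / 2)) * s powr (- (1 / 2) - \<kappa>)
      + (t - s) powr (- (1 / 2)) * (t / 2) powr (- (e + 1 / 2 + \<kappa>))"
  shows "set_integrable lborel {0..t} W"
    and "(LINT s:{0..t}|lborel. W s) \<le> 2 ^ n * (1 / (1 / 2 - \<kappa>) + 2) * (t powr (- \<kappa>) * t powr (- e))"
proof -
  have i1: "set_integrable lborel {0..t} (\<lambda>s. (t / 2) powr (- (e + 1 / 2)) * s powr (- (1 / 2) - \<kappa>))"
    using set_integrable_powr_0(1)[of "- (1 / 2) - \<kappa>" t] k t by (intro set_integrable_mult_right) auto
  have i2: "set_integrable lborel {0..t} (\<lambda>s. (t - s) powr (- (1 / 2)) * (t / 2) powr (- (e + 1 / 2 + \<kappa>)))"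
    using set_integrable_powr_reflect(1)[of "- (1 / 2)" t] t by (intro set_integrable_mult_left) auto
  show "set_integrable lborel {0..t} W" unfolding W_def by (intro set_integral_add(1) i1 i2)
  have "(LINT s:{0..t}|lborel. W s)
      = (t / 2) powr (- (e + 1 / 2)) * (t powr (1 / 2 - \<kappa>) / (1 / 2 - \<kappa>)) + (t powr (1 / 2) / (1 / 2)) * (t / 2) powr (- (e + 1 / 2 + \<kappa>))"
    unfolding W_def set_integral_add(2)[OF i1 i2] set_integral_mult_right set_integral_mult_left
    using set_integrable_powr_0(2)[of "- (1 / 2) - \<kappa>" t] set_integrable_powr_reflect(2)[of "- (1 / 2)" t] k t
    by simp
  also have "\<dots> \<le> (2 ^ n * t powr (- (e + 1 / 2))) * (t powr (1 / 2 - \<kappa>) / (1 / 2 - \<kappa>)) + (t powr (1 / 2) / (1 / 2)) * (2 ^ n * t powr (- (e + 1 / 2 + \<kappa>)))"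
    using t e k by (intro add_mono mult_mono powr_half_rescale) auto
  also have "\<dots> = 2 ^ n * (1 / (1 / 2 - \<kappa>) * (t powr (- (e + 1 / 2)) * t powr (1 / 2 - \<kappa>)) + 2 * (t powr (1 / 2) * t powr (- (e + 1 / 2 + \<kappa>))))"
    by (simp add: algebra_simps)
  also have "t powr (- (e + 1 / 2)) * t powr (1 / 2 - \<kappa>) = t powr (- \<kappa>) * t powr (- e)"
    unfolding powr_add[symmetric] by (simp add: algebra_simps)
  also have "t powr (1 / 2) * t powr (- (e + 1 / 2 + \<kappa>)) = t powr (- \<kappa>) * t powr (- e)"
    unfolding powr_add[symmetric] by (simp add: algebra_simps)
  finally show "(LINT s:{0..t}|lborel. W s) \<le> 2 ^ n * (1 / (1 / 2 - \<kappa>) + 2) * (t powr (- \<kappa>) * t powr (- e))"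
    by (simp add: distrib_right mult.assoc)
qed

text \<open>The kernel constant times the bound of \<open>time_weight_integral\<close>, taken with n
  = DIM + 1 so that it serves both e = 0 for L1 and e = DIM / 2 for the sup norm.\<close>

definition kE :: "'a::euclidean_space \<Rightarrow> real \<Rightarrow> real" where
  "kE a \<kappa> = kC TYPE('a) * norm a * (2 ^ (DIM('a) + 1) * (1 / (1 / 2 - \<kappa>) + 2))"

lemma kE_nonneg: "\<kappa> < 1 / 2 \<Longrightarrow> 0 \<le> kE a \<kappa>"
  unfolding kE_def by (intro mult_nonneg_nonneg) auto

text \<open>A source of size \<open>s powr (- (1 / 2) - \<kappa>)\<close> yields a term of size
  \<open>t powr (- \<kappa>)\<close>: the kernel singularity consumes half a power of time and the
  integration returns a whole one. For the sup norm, sources with s \<le> t/2 are smoothed from L1,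
  later ones are estimated from their own sup norm.\<close>

lemma duhamel_decay:
  fixes F :: "real \<Rightarrow> 'a::euclidean_space \<Rightarrow> real"
  assumes F: "case_prod F \<in> borel_measurable (borel \<Otimes>\<^sub>M borel)"
    and t: "0 < t" "0 \<le> t0" "t1 \<le> t" and k: "0 \<le> \<kappa>" "\<kappa> < 1 / 2" and A: "0 \<le> A"
    and b1: "\<And>s. 0 < s \<Longrightarrow> s < t \<Longrightarrow> t0 \<le> s \<Longrightarrow> s \<le> t1 \<Longrightarrow> L1_le (A * s powr (- (1 / 2) - \<kappa>)) (F s)"
    and b2: "\<And>s. 0 < s \<Longrightarrow> s < t \<Longrightarrow> t0 \<le> s \<Longrightarrow> s \<le> t1 \<Longrightarrow>
        Linf_le (A * (s powr (- (1 / 2) - \<kappa>) * s powr (- (real DIM('a) / 2)))) (F s)"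
  shows "L1_le (kE a \<kappa> * A * t powr (- \<kappa>)) (duhamel a F t0 t1 t)"
    and "Linf_le (kE a \<kappa> * A * (t powr (- \<kappa>) * t powr (- (real DIM('a) / 2)))) (duhamel a F t0 t1 t)"
    and "AE x in lborel. set_integrable lborel {t0..t1} (\<lambda>s. grad_heat a (t - s) (F s) x)"
proof -
  define W where "W e s = (t / 2) powr (- (e + 1 / 2)) * s powr (- (1 / 2) - \<kappa>)
      + (t - s) powr (- (1 / 2)) * (t / 2) powr (- (e + 1 / 2 + \<kappa>))" for e s
  let ?c = "kC TYPE('a) * norm a * A"
  let ?d = "real DIM('a) / 2"
  have c0: "0 \<le> ?c" using A by simp
  have W0: "0 \<le> W e s" for e s by (simp add: W_def)
  have sub: "{t0..t1} \<subseteq> {0..t}" using t by auto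
  have ae: "AE s in lborel. s \<noteq> 0 \<and> s \<noteq> t" using AE_lborel_neq[of "0::real"] AE_lborel_neq[of t] by eventually_elim simp
  have in1: "set_integrable lborel {0..t} (\<lambda>s. ?c * W e s)" if "0 \<le> e" "e + 1 \<le> real (DIM('a) + 1)" for e
    unfolding W_def using time_weight_integral(1)[OF t(1) that k] by (rule set_integrable_mult_right)
  have in2: "(LINT s:{0..t}|lborel. ?c * W e s) \<le> kE a \<kappa> * A * (t powr (- \<kappa>) * t powr (- e))"
    if "0 \<le> e" "e + 1 \<le> real (DIM('a) + 1)" for e
  proof -
    have "(LINT s:{0..t}|lborel. ?c * W e s) = ?c * (LINT s:{0..t}|lborel. W e s)" by simp
    also have "\<dots> \<le> ?c * (2 ^ (DIM('a) + 1) * (1 / (1 / 2 - \<kappa>) + 2) * (t powr (- \<kappa>) * t powr (- e)))"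
      unfolding W_def by (intro mult_left_mono time_weight_integral(2) t(1) k that c0)
    also have "\<dots> = kE a \<kappa> * A * (t powr (- \<kappa>) * t powr (- e))" unfolding kE_def by (simp only: mult_ac)
    finally show ?thesis .
  qed
  have "AE s in lborel. s \<in> {t0..t1} \<longrightarrow> L1_le (?c * W 0 s) (grad_heat a (t - s) (F s))"
    using ae
  proof (eventually_elim, intro impI)
    fix s assume s: "s \<noteq> 0 \<and> s \<noteq> t" "s \<in> {t0..t1}"
    then have s': "0 < s" "s < t" "t0 \<le> s" "s \<le> t1" using t by auto
    have "L1_le (kC TYPE('a) * norm a * (t - s) powr (- 1 / 2) * (A * s powr (- (1 / 2) - \<kappa>))) (grad_heat a (t - s) (F s))"
      using s' by (intro grad_heat_L1 b1) auto
    moreover have "(t - s) powr (- (1 / 2)) * s powr (- (1 / 2) - \<kappa>) \<le> W 0 s"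
      using time_weight_bound[OF s'(1,2), of 0 \<kappa>] k s' by (cases "s \<le> t / 2") (auto simp: W_def)
    then have "?c * ((t - s) powr (- (1 / 2)) * s powr (- (1 / 2) - \<kappa>)) \<le> ?c * W 0 s"
      using c0 by (rule mult_left_mono)
    then have "kC TYPE('a) * norm a * (t - s) powr (- 1 / 2) * (A * s powr (- (1 / 2) - \<kappa>)) \<le> ?c * W 0 s"
      by (simp add: mult_ac)
    ultimately show "L1_le (?c * W 0 s) (grad_heat a (t - s) (F s))" by (rule L1_le_mono)
  qed
  then have "L1_le (LINT s:{0..t}|lborel. ?c * W 0 s) (duhamel a F t0 t1 t)"
    by (intro duhamel_L1[OF F sub in1]) (use c0 W0 in auto)
  from L1_le_mono[OF this in2] show "L1_le (kE a \<kappa> * A * t powr (- \<kappa>)) (duhamel a F t0 t1 t)"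
    using t by simp
  have ae2: "AE s in lborel. s \<in> {t0..t1} \<longrightarrow> Linf_le (?c * W ?d s) (grad_heat a (t - s) (F s))"
    using ae
  proof (eventually_elim, intro impI)
    fix s assume s: "s \<noteq> 0 \<and> s \<noteq> t" "s \<in> {t0..t1}"
    then have s': "0 < s" "s < t" "t0 \<le> s" "s \<le> t1" using t by auto
    show "Linf_le (?c * W ?d s) (grad_heat a (t - s) (F s))"
    proof (cases "s \<le> t / 2")
      case True
      have "Linf_le (kC TYPE('a) * norm a * (t - s) powr (- 1 / 2) * (t - s) powr (- real DIM('a) / 2) * (A * s powr (- (1 / 2) - \<kappa>))) (grad_heat a (t - s) (F s))"
        using s' by (intro grad_heat_L1_Linf b1) auto
      moreover have "?c * ((t - s) powr (- (1 / 2)) * (t - s) powr (- ?d) * s powr (- (1 / 2) - \<kappa>)) \<le> ?c * W ?d s"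
        unfolding W_def using time_weight_bound(1)[OF s'(1,2) _ k(1) True, of ?d] c0 by (intro mult_left_mono) auto
      then have "kC TYPE('a) * norm a * (t - s) powr (- 1 / 2) * (t - s) powr (- real DIM('a) / 2) * (A * s powr (- (1 / 2) - \<kappa>)) \<le> ?c * W ?d s"
        by (simp add: mult_ac)
      ultimately show ?thesis by (rule Linf_le_mono)
    next
      case False
      then have F': "t / 2 \<le> s" by simp
      have "Linf_le (kC TYPE('a) * norm a * (t - s) powr (- 1 / 2) * (A * (s powr (- (1 / 2) - \<kappa>) * s powr (- ?d)))) (grad_heat a (t - s) (F s))"
        using s' by (intro grad_heat_Linf b2) auto
      moreover have "?c * ((t - s) powr (- (1 / 2)) * (s powr (- (1 / 2) - \<kappa>) * s powr (- ?d))) \<le> ?c * W ?d s"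
        unfolding W_def using time_weight_bound(2)[OF s'(1,2) _ k(1) F', of ?d] c0 by (intro mult_left_mono) auto
      then have "kC TYPE('a) * norm a * (t - s) powr (- 1 / 2) * (A * (s powr (- (1 / 2) - \<kappa>) * s powr (- ?d))) \<le> ?c * W ?d s"
        by (simp add: mult_ac)
      ultimately show ?thesis by (rule Linf_le_mono)
    qed
  qed
  have d: "0 \<le> ?d" "?d + 1 \<le> real (DIM('a) + 1)" by auto
  have nn: "0 \<le> ?c * W ?d s" for s by (intro mult_nonneg_nonneg c0 W0)
  note M = duhamel_Linf[OF F sub in1[OF d] nn ae2]
  show "Linf_le (kE a \<kappa> * A * (t powr (- \<kappa>) * t powr (- ?d))) (duhamel a F t0 t1 t)"
    by (rule Linf_le_mono[OF M(1) in2[OF d]])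
  show "AE x in lborel. set_integrable lborel {t0..t1} (\<lambda>s. grad_heat a (t - s) (F s) x)" by (rule M(2))
qed

text \<open>The kernel alone costs an integrable \<open>(t - s) powr (- 1 / 2)\<close>, so the term
  is small over short times. The second claim holds for every \<open>x\<close>, which lets the time
  interval be split without an exceptional set.\<close>

lemma duhamel_bounded:
  fixes F :: "real \<Rightarrow> 'a::euclidean_space \<Rightarrow> real"
  assumes F: "case_prod F \<in> borel_measurable (borel \<Otimes>\<^sub>M borel)"
    and t: "0 < t" "0 \<le> t0" "t1 \<le> t" and A: "0 \<le> A"
    and b: "\<And>s. 0 < s \<Longrightarrow> s < t \<Longrightarrow> t0 \<le> s \<Longrightarrow> s \<le> t1 \<Longrightarrow> Linf_le A (F s)"
  shows "Linf_le (kC TYPE('a) * norm a * A * (2 * t powr (1 / 2))) (duhamel a F t0 t1 t)"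
    and "set_integrable lborel {t0..t1} (\<lambda>s. grad_heat a (t - s) (F s) x)"
proof -
  let ?c = "kC TYPE('a) * norm a * A"
  have c0: "0 \<le> ?c" using A by simp
  have sub: "{t0..t1} \<subseteq> {0..t}" using t by auto
  have ae: "AE s in lborel. s \<noteq> 0 \<and> s \<noteq> t" using AE_lborel_neq[of "0::real"] AE_lborel_neq[of t] by eventually_elim simp
  have i: "set_integrable lborel {0..t} (\<lambda>s. ?c * (t - s) powr (- (1 / 2)))"
    using set_integrable_powr_reflect(1)[of "- (1 / 2)" t] t by (intro set_integrable_mult_right) auto
  have bd: "Linf_le (?c * (t - s) powr (- (1 / 2))) (grad_heat a (t - s) (F s))
     \<and> \<bar>grad_heat a (t - s) (F s) x\<bar> \<le> ?c * (t - s) powr (- (1 / 2))"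
    if "s \<noteq> 0 \<and> s \<noteq> t" "s \<in> {t0..t1}" for s
  proof -
    have s': "0 < s" "s < t" "t0 \<le> s" "s \<le> t1" using t that by auto
    have "Linf_le (kC TYPE('a) * norm a * (t - s) powr (- 1 / 2) * A) (grad_heat a (t - s) (F s))"
      using s' by (intro grad_heat_Linf b) auto
    moreover have "\<bar>grad_heat a (t - s) (F s) x\<bar> \<le> kC TYPE('a) * norm a * (t - s) powr (- 1 / 2) * A"
      unfolding grad_heat_conv using s' by (intro conv_bounded_le gradG_L1 b) auto
    ultimately show ?thesis by (simp add: mult_ac)
  qed
  have "Linf_le (LINT s:{0..t}|lborel. ?c * (t - s) powr (- (1 / 2))) (duhamel a F t0 t1 t)"
  proof (rule duhamel_Linf(1)[OF F sub i])
    show "AE s in lborel. s \<in> {t0..t1} \<longrightarrow> Linf_le (?c * (t - s) powr (- (1 / 2))) (grad_heat a (t - s) (F s))"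
      using ae by eventually_elim (use bd in blast)
  qed (use c0 in auto)
  then show "Linf_le (kC TYPE('a) * norm a * A * (2 * t powr (1 / 2))) (duhamel a F t0 t1 t)"
    using set_integrable_powr_reflect(2)[of "- (1 / 2)" t] t by (simp add: mult_ac)
  have i': "set_integrable lborel {t0..t1} (\<lambda>s. ?c * (t - s) powr (- (1 / 2)))"
    by (rule set_integrable_subset[OF i _ sub]) simp
  show "set_integrable lborel {t0..t1} (\<lambda>s. grad_heat a (t - s) (F s) x)"
    unfolding set_integrable_def
  proof (rule Bochner_Integration.integrable_bound[OF i'[unfolded set_integrable_def]])
    show "(\<lambda>s. indicator {t0..t1} s *\<^sub>R grad_heat a (t - s) (F s) x) \<in> borel_measurable lborel"
      using duhamel_slice_measurable[OF F, of a t x] by simp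
    show "AE s in lborel. norm (indicator {t0..t1} s *\<^sub>R grad_heat a (t - s) (F s) x)
        \<le> norm (indicator {t0..t1} s *\<^sub>R (?c * (t - s) powr (- (1 / 2))))"
      using ae
    proof eventually_elim
      case (elim s)
      show ?case using bd[OF elim] by (cases "s \<in> {t0..t1}") auto
    qed
  qed
qed

subsection \<open>Hoelder continuity under translations\<close>

text \<open>Any exponent strictly between \<open>1 / 2\<close> and \<open>1\<close> would serve: above \<open>1 / 2\<close> the error of an
  energy step of length \<open>h\<close> is \<open>o(h)\<close>, below \<open>1\<close> the bound follows from one Duhamel integral.\<close>

definition holder_L1 :: "real \<Rightarrow> ('a::euclidean_space \<Rightarrow> real) \<Rightarrow> bool" where
  "holder_L1 D \<phi> \<longleftrightarrow> (\<forall>y. L1_le (D * norm y powr (3 / 4)) (\<lambda>x. \<phi> (x - y) - \<phi> x))"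

definition holder_Linf :: "real \<Rightarrow> ('a::euclidean_space \<Rightarrow> real) \<Rightarrow> bool" where
  "holder_Linf D \<phi> \<longleftrightarrow> (\<forall>y. Linf_le (D * norm y powr (3 / 4)) (\<lambda>x. \<phi> (x - y) - \<phi> x))"

text \<open>The direction z / |z| makes |z| heatG t z / (2t) the modulus of a gradient kernel, so
  \<open>gradG_bound\<close> already contains this moment.\<close>

lemma heatG_first_moment:
  fixes z :: "'a::euclidean_space"
  assumes t: "t > 0"
  shows "norm z * heatG t z \<le> 2 * kC TYPE('a) * sqrt t * heatG (4 * t) z"
proof (cases "z = 0")
  case False
  define b where "b = (1 / norm z) *\<^sub>R z"
  have b: "norm b = 1" "b \<bullet> z = norm z" using False by (auto simp: b_def power2_norm_eq_inner[symmetric] power2_eq_square)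
  have "norm z / (2 * t) * heatG t z = \<bar>gradG b t z\<bar>"
    unfolding gradG_def b using t by (simp add: abs_mult)
  also have "\<dots> \<le> kC TYPE('a) * t powr (- 1 / 2) * heatG (4 * t) z"
    using gradG_bound[OF t, of b z] b by simp
  finally have "2 * t * (norm z / (2 * t) * heatG t z) \<le> 2 * t * (kC TYPE('a) * t powr (- 1 / 2) * heatG (4 * t) z)"
    using t by (intro mult_left_mono) auto
  moreover have "t * t powr (- 1 / 2) = sqrt t"
    using t by (simp add: powr_minus_divide powr_half_sqrt real_div_sqrt)
  then have "2 * t * (kC TYPE('a) * t powr (- 1 / 2) * heatG (4 * t) z) = 2 * kC TYPE('a) * sqrt t * heatG (4 * t) z"
    by (simp only: mult_ac) (metis mult.commute mult.left_commute)
  moreover have "2 * t * (norm z / (2 * t) * heatG t z) = norm z * heatG t z" using t by simp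
  ultimately show ?thesis by linarith
qed (use t in simp)

lemma powr_34_le: "0 \<le> r \<Longrightarrow> r powr (3 / 4) \<le> 1 + (r::real)"
proof (cases "r \<le> 1")
  case True
  assume "0 \<le> r"
  then have "r powr (3 / 4) \<le> 1 powr (3 / 4)" using True by (intro powr_mono2) auto
  then show ?thesis using \<open>0 \<le> r\<close> by simp
next
  case False
  then have "r powr (3 / 4) \<le> r powr 1" by (intro powr_mono) auto
  then show ?thesis using False by simp
qed

lemma min_powr_34: "0 \<le> r \<Longrightarrow> min 1 r \<le> (r::real) powr (3 / 4)"
proof (cases "r \<le> 1")
  case True
  assume r: "0 \<le> r"
  show ?thesis
  proof (cases "r = 0")
    case False
    then have "r powr 1 \<le> r powr (3 / 4)" using True r by (intro powr_mono') auto
    then show ?thesis using r True by simp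
  qed simp
next
  case False
  then have "1 powr (3 / 4) \<le> r powr (3 / 4)" by (intro powr_mono2) auto
  then show ?thesis using False by simp
qed

text \<open>In the scaled variable r = |z| / sqrt t one has
  \<open>r powr (3 / 4) \<le> 1 + r\<close>, which reduces the fractional moment to the mass and the
  first moment.\<close>

lemma heatG_moment_34:
  fixes t :: real
  assumes t: "t > 0"
  shows "L1_le (3 * kC TYPE('a) * t powr (3 / 8)) (\<lambda>z::'a::euclidean_space. norm z powr (3 / 4) * heatG t z)"
proof -
  have "L1_le (\<bar>t powr (3 / 8)\<bar> * (1 + \<bar>2 * kC TYPE('a)\<bar> * 1)) (\<lambda>z::'a. t powr (3 / 8) * (heatG t z + 2 * kC TYPE('a) * heatG (4 * t) z))"
    using t by (intro L1_le_cmult L1_le_add heatG_L1) auto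
  then show ?thesis
  proof (rule L1_le_dominated[OF L1_le_mono])
    have "t powr (3 / 8) * (1 + 2 * kC TYPE('a)) \<le> t powr (3 / 8) * (3 * kC TYPE('a))"
      using kC_ge1[where 'a='a] by (intro mult_left_mono) auto
    then show "\<bar>t powr (3 / 8)\<bar> * (1 + \<bar>2 * kC TYPE('a)\<bar> * 1) \<le> 3 * kC TYPE('a) * t powr (3 / 8)"
      by (simp add: mult_ac)
    have "norm z powr (3 / 4) * heatG t z \<le> t powr (3 / 8) * (heatG t z + 2 * kC TYPE('a) * heatG (4 * t) z)" for z :: 'a
    proof -
      have "norm z = sqrt t * (norm z / sqrt t)" using t by simp
      then have "norm z powr (3 / 4) = sqrt t powr (3 / 4) * (norm z / sqrt t) powr (3 / 4)"
        using t powr_mult[of "sqrt t" "norm z / sqrt t" "3 / 4"] by simp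
      also have "sqrt t powr (3 / 4) = t powr (3 / 8)"
        using t by (simp add: powr_powr flip: powr_half_sqrt)
      also have "t powr (3 / 8) * (norm z / sqrt t) powr (3 / 4) \<le> t powr (3 / 8) * (1 + norm z / sqrt t)"
        using t by (intro mult_left_mono powr_34_le) auto
      finally have "norm z powr (3 / 4) * heatG t z \<le> t powr (3 / 8) * (1 + norm z / sqrt t) * heatG t z"
        by (intro mult_right_mono) auto
      also have "\<dots> = t powr (3 / 8) * (heatG t z + (norm z * heatG t z) / sqrt t)"
        by (simp add: distrib_left distrib_right)
      also have "\<dots> \<le> t powr (3 / 8) * (heatG t z + (2 * kC TYPE('a) * sqrt t * heatG (4 * t) z) / sqrt t)"
        using t by (intro mult_left_mono add_mono divide_right_mono heatG_first_moment) auto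
      also have "\<dots> = t powr (3 / 8) * (heatG t z + 2 * kC TYPE('a) * heatG (4 * t) z)" using t by simp
      finally show ?thesis .
    qed
    then show "AE z in lborel. \<bar>norm (z::'a) powr (3 / 4) * heatG t z\<bar> \<le> \<bar>t powr (3 / 8) * (heatG t z + 2 * kC TYPE('a) * heatG (4 * t) z)\<bar>"
      by (simp add: abs_mult)
  qed measurable
qed

lemma gradG_moment_34:
  fixes a :: "'a::euclidean_space"
  assumes t: "t > 0"
  shows "L1_le (6 * kC TYPE('a) * kC TYPE('a) * norm a * t powr (- (1 / 8))) (\<lambda>z. norm z powr (3 / 4) * gradG a t z)"
proof -
  have t4: "4 * t > 0" using t by simp
  let ?c = "kC TYPE('a) * norm a * t powr (- 1 / 2)"
  have "L1_le (\<bar>?c\<bar> * (3 * kC TYPE('a) * (4 * t) powr (3 / 8))) (\<lambda>z::'a. ?c * (norm z powr (3 / 4) * heatG (4 * t) z))"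
    by (intro L1_le_cmult heatG_moment_34 t4)
  then show ?thesis
  proof (rule L1_le_dominated[OF L1_le_mono])
    have "(4::real) powr (3 / 8) \<le> 4 powr (1 / 2)" by (intro powr_mono) auto
    then have "(4::real) powr (3 / 8) \<le> 2" by (simp add: powr_half_sqrt)
    then have "(4 * t) powr (3 / 8) \<le> 2 * t powr (3 / 8)"
      unfolding powr_mult by (intro mult_right_mono) auto
    then have "?c * (3 * kC TYPE('a) * (4 * t) powr (3 / 8)) \<le> ?c * (3 * kC TYPE('a) * (2 * t powr (3 / 8)))"
      by (intro mult_left_mono) auto
    also have "\<dots> = 6 * kC TYPE('a) * kC TYPE('a) * norm a * (t powr (- 1 / 2) * t powr (3 / 8))" by (simp add: mult_ac)
    also have "t powr (- 1 / 2) * t powr (3 / 8) = t powr (- (1 / 8))" unfolding powr_add[symmetric] by simp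
    finally show "\<bar>?c\<bar> * (3 * kC TYPE('a) * (4 * t) powr (3 / 8)) \<le> 6 * kC TYPE('a) * kC TYPE('a) * norm a * t powr (- (1 / 8))"
      by simp
    have "\<bar>norm z powr (3 / 4) * gradG a t z\<bar> \<le> \<bar>?c * (norm z powr (3 / 4) * heatG (4 * t) z)\<bar>" for z
    proof -
      have "norm z powr (3 / 4) * \<bar>gradG a t z\<bar> \<le> norm z powr (3 / 4) * (?c * heatG (4 * t) z)"
        by (intro mult_left_mono gradG_bound t) auto
      then show ?thesis by (simp add: abs_mult mult_ac)
    qed
    then show "AE z in lborel. \<bar>norm z powr (3 / 4) * gradG a t z\<bar> \<le> \<bar>?c * (norm z powr (3 / 4) * heatG (4 * t) z)\<bar>" by simp
  qed measurable
qed

text \<open>After subtracting the mean of \<open>k\<close>, what is left is the integral of k(y)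
  (\<phi>(x - y) - \<phi>(x)), and the Hoelder increment supplies the weight |y|^(3/4). For the
  gradient kernel the mean is 0, so its cost drops from \<open>t powr (- 1 / 2)\<close> to
  \<open>t powr (- (1 / 8))\<close>.\<close>

lemma conv_holder:
  fixes k :: "'a::euclidean_space \<Rightarrow> real"
  assumes k: "L1_le m0 k" and I: "L1_le I (\<lambda>z. norm z powr (3 / 4) * k z)" and \<phi>: "Linf_le l \<phi>" and D: "0 \<le> D"
  shows "holder_L1 D \<phi> \<Longrightarrow> L1_le (D * I) (\<lambda>x. conv k \<phi> x - (\<integral>z. k z \<partial>lborel) * \<phi> x)"
    and "holder_Linf D \<phi> \<Longrightarrow> Linf_le (D * I) (\<lambda>x. conv k \<phi> x - (\<integral>z. k z \<partial>lborel) * \<phi> x)"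
proof -
  note [measurable] = L1_le_measurable[OF k] Linf_leD(1)[OF \<phi>]
  have eq: "conv k \<phi> x - (\<integral>z. k z \<partial>lborel) * \<phi> x = (\<integral>y. k y * (\<phi> (x - y) - \<phi> x) \<partial>lborel)" for x
  proof -
    have "conv k \<phi> x = conv \<phi> k x" by (rule conv_commute) measurable
    then have c: "conv k \<phi> x = (\<integral>y. k y * \<phi> (x - y) \<partial>lborel)" by (simp add: conv_def mult.commute)
    have "integrable lborel (\<lambda>y. k (x - (x - y)) * \<phi> (x - y))"
      using conv_bounded_integrable[OF k \<phi>, of x] integrable_reflect_iff[of "\<lambda>y. k (x - y) * \<phi> y" x] by simp
    then have "integrable lborel (\<lambda>y. k y * \<phi> (x - y))" by simp
    then show ?thesis unfolding c right_diff_distrib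
      by (subst Bochner_Integration.integral_diff) (use L1_leD(1)[OF k] in auto)
  qed
  have m: "(\<lambda>(y, x). k y * (\<phi> (x - y) - \<phi> x)) \<in> borel_measurable (lborel \<Otimes>\<^sub>M lborel)" by measurable
  have i: "integrable lborel (\<lambda>y. D * \<bar>norm y powr (3 / 4) * k y\<bar>)" using L1_leD(1)[OF I] by simp
  have le: "(\<integral>y. D * \<bar>norm y powr (3 / 4) * k y\<bar> \<partial>lborel) \<le> D * I"
    using L1_leD(2)[OF I] D by (simp add: mult_left_mono)
  show "L1_le (D * I) (\<lambda>x. conv k \<phi> x - (\<integral>z. k z \<partial>lborel) * \<phi> x)" if h: "holder_L1 D \<phi>"
  proof -
    have "L1_le (D * \<bar>norm y powr (3 / 4) * k y\<bar>) (\<lambda>x. k y * (\<phi> (x - y) - \<phi> x))" for y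
      using L1_le_cmult[OF h[unfolded holder_L1_def, rule_format, of y], of "k y"] by (simp add: abs_mult mult_ac)
    then have "L1_le (\<integral>y. D * \<bar>norm y powr (3 / 4) * k y\<bar> \<partial>lborel) (\<lambda>x. \<integral>y. k y * (\<phi> (x - y) - \<phi> x) \<partial>lborel)"
      by (intro Minkowski_L1_le[OF sigma_finite_lborel m _ i]) simp
    from L1_le_mono[OF this le] show ?thesis unfolding eq .
  qed
  show "Linf_le (D * I) (\<lambda>x. conv k \<phi> x - (\<integral>z. k z \<partial>lborel) * \<phi> x)" if h: "holder_Linf D \<phi>"
  proof -
    have "Linf_le (D * \<bar>norm y powr (3 / 4) * k y\<bar>) (\<lambda>x. k y * (\<phi> (x - y) - \<phi> x))" for y
      using Linf_le_cmult[OF h[unfolded holder_Linf_def, rule_format, of y], of "k y"] by (simp add: abs_mult mult_ac)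
    then have "Linf_le (\<integral>y. D * \<bar>norm y powr (3 / 4) * k y\<bar> \<partial>lborel) (\<lambda>x. \<integral>y. k y * (\<phi> (x - y) - \<phi> x) \<partial>lborel)"
      by (intro Minkowski_Linf_le[OF sigma_finite_lborel m _ i]) simp
    from Linf_le_mono[OF this le] show ?thesis unfolding eq .
  qed
qed

lemma heat_holder_L1:
  fixes \<phi> :: "'a::euclidean_space \<Rightarrow> real"
  assumes "t > 0" "Linf_le l \<phi>" "0 \<le> D" "holder_L1 D \<phi>"
  shows "L1_le (D * (3 * kC TYPE('a) * t powr (3 / 8))) (\<lambda>x. heat t \<phi> x - \<phi> x)"
  using conv_holder(1)[OF heatG_L1[OF assms(1)] heatG_moment_34[OF assms(1)] assms(2,3,4)] heatG_integral[OF assms(1), where 'a='a]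
  by (simp add: heat_conv)

lemma grad_heat_holder_L1:
  fixes \<phi> :: "'a::euclidean_space \<Rightarrow> real"
  assumes "t > 0" "Linf_le l \<phi>" "0 \<le> D" "holder_L1 D \<phi>"
  shows "L1_le (D * (6 * kC TYPE('a) * kC TYPE('a) * norm a * t powr (- (1 / 8)))) (grad_heat a t \<phi>)"
  using conv_holder(1)[OF gradG_L1[OF assms(1)] gradG_moment_34[OF assms(1), of a] assms(2,3,4)] gradG_integral_0[OF assms(1), of a]
  by (simp add: grad_heat_conv)

lemma grad_heat_holder_Linf:
  fixes \<phi> :: "'a::euclidean_space \<Rightarrow> real"
  assumes "t > 0" "Linf_le l \<phi>" "0 \<le> D" "holder_Linf D \<phi>"
  shows "Linf_le (D * (6 * kC TYPE('a) * kC TYPE('a) * norm a * t powr (- (1 / 8)))) (grad_heat a t \<phi>)"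
  using conv_holder(2)[OF gradG_L1[OF assms(1)] gradG_moment_34[OF assms(1), of a] assms(2,3,4)] gradG_integral_0[OF assms(1), of a]
  by (simp add: grad_heat_conv)

lemma conv_shift_diff:
  fixes k :: "'a::euclidean_space \<Rightarrow> real"
  assumes k: "L1_le m k" and \<phi>: "Linf_le l \<phi>"
  shows "conv k \<phi> (x - y) - conv k \<phi> x = conv (\<lambda>z. k (z - y) - k z) \<phi> x"
proof -
  have e: "x - y - z = x - z - y" for z by simp
  show ?thesis unfolding conv_def left_diff_distrib
    by (subst Bochner_Integration.integral_diff)
       (use conv_bounded_integrable[OF k \<phi>] conv_bounded_integrable[OF L1_le_shift[OF k, of y] \<phi>] in \<open>auto simp: e\<close>)
qed

subsection \<open>Duhamel terms with bounded sources\<close>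

text \<open>The flow acting on a Duhamel term only lengthens the kernel times, from t - s to t + h -
  s. Fubini is licensed by the bounded kernel of S(h) and the integrable time weight.\<close>

lemma heat_duhamel:
  fixes F :: "real \<Rightarrow> 'a::euclidean_space \<Rightarrow> real"
  assumes F: "case_prod F \<in> borel_measurable (borel \<Otimes>\<^sub>M borel)"
    and b: "\<And>s. 0 < s \<Longrightarrow> L1_le A (F s)" and t: "0 < t" and h: "0 < h"
  shows "heat h (duhamel a F 0 t t) x = duhamel a F 0 t (t + h) x"
proof -
  let ?g = "\<lambda>s y. indicator {0..t} s * grad_heat a (t - s) (F s) y :: real"
  let ?c = "h powr (- real DIM('a) / 2) * (kC TYPE('a) * norm a * A)"
  have ae: "AE s in lborel. s \<noteq> 0 \<and> s \<noteq> t" using AE_lborel_neq[of "0::real"] AE_lborel_neq[of t] by eventually_elim simp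
  have gm[measurable]: "(\<lambda>w. ?g (fst w) (snd w)) \<in> borel_measurable (lborel \<Otimes>\<^sub>M lborel)"
    using duhamel_integrand_measurable[OF F, of 0 t a t] by (simp add: case_prod_beta')
  have i: "integrable (lborel \<Otimes>\<^sub>M lborel) (\<lambda>(s, y). heatG h (x - y) * ?g s y)"
  proof (rule Minkowski_L1_integrable)
    show "integrable lborel (\<lambda>s. ?c * (indicator {0..t} s *\<^sub>R (t - s) powr (- (1 / 2))))"
      using set_integrable_powr_reflect(1)[of "- (1 / 2)" t] t by (simp add: set_integrable_def)
    show "AE s in lborel. L1_le (?c * (indicator {0..t} s *\<^sub>R (t - s) powr (- (1 / 2)))) (\<lambda>y. heatG h (x - y) * ?g s y)"
      using ae
    proof eventually_elim
      case (elim s)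
      show ?case
      proof (cases "s \<in> {0..t}")
        case True
        then have s: "0 < s" "s < t" using elim by auto
        have g: "L1_le (kC TYPE('a) * norm a * (t - s) powr (- 1 / 2) * A) (grad_heat a (t - s) (F s))"
          using s by (intro grad_heat_L1 b) auto
        note [measurable] = L1_le_measurable[OF g]
        have "L1_le (\<bar>h powr (- real DIM('a) / 2)\<bar> * (kC TYPE('a) * norm a * (t - s) powr (- 1 / 2) * A))
            (\<lambda>y. h powr (- real DIM('a) / 2) * grad_heat a (t - s) (F s) y)"
          by (intro L1_le_cmult g)
        then have "L1_le (\<bar>h powr (- real DIM('a) / 2)\<bar> * (kC TYPE('a) * norm a * (t - s) powr (- 1 / 2) * A))
            (\<lambda>y. heatG h (x - y) * grad_heat a (t - s) (F s) y)"
        proof (rule L1_le_dominated)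
          have "\<bar>heatG h (x - y) * grad_heat a (t - s) (F s) y\<bar> \<le> \<bar>h powr (- real DIM('a) / 2) * grad_heat a (t - s) (F s) y\<bar>" for y
            unfolding abs_mult using heatG_Linf[OF h, of "x - y"] by (intro mult_right_mono) auto
          then show "AE y in lborel. \<bar>heatG h (x - y) * grad_heat a (t - s) (F s) y\<bar> \<le> \<bar>h powr (- real DIM('a) / 2) * grad_heat a (t - s) (F s) y\<bar>" by simp
        qed measurable
        then show ?thesis using True by (simp add: mult_ac)
      qed (simp add: L1_le_def)
    qed
  qed (auto intro: sigma_finite_lborel)
  have "heat h (duhamel a F 0 t t) x = (\<integral>y. (\<integral>s. heatG h (x - y) * ?g s y \<partial>lborel) \<partial>lborel)"
    unfolding heat_def duhamel_eq by simp
  also have "\<dots> = (\<integral>s. (\<integral>y. heatG h (x - y) * ?g s y \<partial>lborel) \<partial>lborel)"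
    by (rule lborel_pair.Fubini_integral[OF i])
  also have "\<dots> = (\<integral>s. indicator {0..t} s * grad_heat a (t + h - s) (F s) x \<partial>lborel)"
  proof (rule integral_cong_AE)
    show "(\<lambda>s. \<integral>y. heatG h (x - y) * ?g s y \<partial>lborel) \<in> borel_measurable lborel"
      by (rule lborel.borel_measurable_lebesgue_integral) (use i in auto)
    show "(\<lambda>s. indicator {0..t} s * grad_heat a (t + h - s) (F s) x) \<in> borel_measurable lborel"
      using duhamel_slice_measurable[OF F, of a "t + h" x] by simp
    show "AE s in lborel. (\<integral>y. heatG h (x - y) * ?g s y \<partial>lborel) = indicator {0..t} s * grad_heat a (t + h - s) (F s) x"
      using ae
    proof eventually_elim
      case (elim s)
      show ?case
      proof (cases "s \<in> {0..t}")
        case True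
        then have s: "0 < s" "s < t" using elim by auto
        have "(\<integral>y. heatG h (x - y) * ?g s y \<partial>lborel) = heat h (grad_heat a (t - s) (F s)) x"
          using True by (simp add: heat_def)
        also have "\<dots> = grad_heat a (h + (t - s)) (F s) x"
          using heat_grad_heat[OF h _ b, of "t - s" s a] s by simp
        finally show ?thesis using True by (simp add: algebra_simps)
      qed simp
    qed
  qed
  finally show ?thesis unfolding duhamel_eq .
qed

lemma duhamel_split:
  fixes F :: "real \<Rightarrow> 'a::euclidean_space \<Rightarrow> real"
  assumes F: "case_prod F \<in> borel_measurable (borel \<Otimes>\<^sub>M borel)"
    and b: "\<And>s. 0 < s \<Longrightarrow> Linf_le A (F s)" and A: "0 \<le> A" and t: "0 < t" and h: "0 < h"
  shows "duhamel a F 0 (t + h) (t + h) x = duhamel a F 0 t (t + h) x + duhamel a (\<lambda>s. F (t + s)) 0 h h x"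
proof -
  let ?g = "\<lambda>s. grad_heat a (t + h - s) (F s) x"
  have i1: "integrable lborel (\<lambda>s. indicator {0..t} s * ?g s)"
    using duhamel_bounded(2)[OF F, of "t + h" 0 t A a x] b A t h by (simp add: set_integrable_def)
  have i2: "integrable lborel (\<lambda>s. indicator {t..t + h} s * ?g s)"
    using duhamel_bounded(2)[OF F, of "t + h" t "t + h" A a x] b A t h by (simp add: set_integrable_def)
  have m[measurable]: "?g \<in> borel_measurable lborel"
    using duhamel_slice_measurable[OF F, of a "t + h" x] by simp
  have "(\<integral>s. indicator {0..t + h} s * ?g s \<partial>lborel) = (\<integral>s. indicator {0..t} s * ?g s + indicator {t..t + h} s * ?g s \<partial>lborel)"
  proof (rule integral_cong_AE)
    show "AE s in lborel. indicator {0..t + h} s * ?g s = indicator {0..t} s * ?g s + indicator {t..t + h} s * ?g s"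
      using AE_lborel_neq[of t] by eventually_elim (use t h in \<open>auto simp: indicator_def\<close>)
  qed measurable
  also have "\<dots> = (\<integral>s. indicator {0..t} s * ?g s \<partial>lborel) + (\<integral>s. indicator {t..t + h} s * ?g s \<partial>lborel)"
    by (rule Bochner_Integration.integral_add[OF i1 i2])
  also have "(\<integral>s. indicator {t..t + h} s * ?g s \<partial>lborel) = duhamel a (\<lambda>s. F (t + s)) 0 h h x"
  proof -
    have F': "case_prod (\<lambda>s. F (t + s)) \<in> borel_measurable (borel \<Otimes>\<^sub>M borel)"
      unfolding case_prod_beta' by (rule joint_measurable_comp[OF F]) auto
    have "(\<lambda>s. indicator {0..h} s * grad_heat a (h - s) (F (t + s)) x) \<in> borel_measurable borel"
      using duhamel_slice_measurable[OF F', of a h x] by simp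
    from integral_shift[OF this, of t]
    have "duhamel a (\<lambda>s. F (t + s)) 0 h h x = (\<integral>s. indicator {0..h} (s - t) * grad_heat a (h - (s - t)) (F (t + (s - t))) x \<partial>lborel)"
      unfolding duhamel_eq by simp
    also have "\<dots> = (\<integral>s. indicator {t..t + h} s * ?g s \<partial>lborel)"
    proof -
      have 1: "indicator {0..h} (s - t) = (indicator {t..t + h} s :: real)" for s by (auto simp: indicator_def)
      have 2: "h - (s - t) = t + h - s" "t + (s - t) = s" for s by auto
      show ?thesis unfolding 1 2 ..
    qed
    finally show ?thesis ..
  qed
  finally show ?thesis unfolding duhamel_eq .
qed

lemma scaled_min_le:
  fixes v \<tau> :: real
  assumes "\<tau> > 0" "0 \<le> v"
  shows "min 1 (v / sqrt \<tau>) \<le> v powr (3 / 4) * \<tau> powr (- (3 / 8))"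
proof -
  have "min 1 (v / sqrt \<tau>) \<le> (v / sqrt \<tau>) powr (3 / 4)" using assms by (intro min_powr_34) auto
  also have "\<dots> = v powr (3 / 4) / sqrt \<tau> powr (3 / 4)" using assms by (simp add: powr_divide)
  also have "sqrt \<tau> powr (3 / 4) = \<tau> powr (3 / 8)" using assms by (simp add: powr_powr flip: powr_half_sqrt)
  finally show ?thesis by (simp add: powr_minus field_simps)
qed

text \<open>The translation is put on the kernel, whose increment \<open>scaled_min_le\<close>
  interpolates to |y|^(3/4) (h - s)^(-7/8). The exponent 7/8 = 1/2 + 3/8 is still integrable, and 8
  is the integral of the weight over a unit interval.\<close>

lemma duhamel_holder:
  fixes F :: "real \<Rightarrow> 'a::euclidean_space \<Rightarrow> real"
  assumes F: "case_prod F \<in> borel_measurable (borel \<Otimes>\<^sub>M borel)"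
    and b1: "\<And>s. 0 < s \<Longrightarrow> L1_le A (F s)" and b2: "\<And>s. 0 < s \<Longrightarrow> Linf_le A (F s)"
    and h: "0 < h" "h \<le> 1"
  shows "holder_L1 (8 * kD TYPE('a) * norm a * A) (duhamel a F 0 h h)"
    and "holder_Linf (8 * kD TYPE('a) * norm a * A) (duhamel a F 0 h h)"
proof -
  have A: "0 \<le> A" using L1_le_nonneg[OF b1[of 1]] by simp
  let ?g = "\<lambda>y s x. indicator {0..h} s * (grad_heat a (h - s) (F s) (x - y) - grad_heat a (h - s) (F s) x)"
  let ?m = "\<lambda>y s. (kD TYPE('a) * norm a * A * norm y powr (3 / 4)) * (indicator {0..h} s *\<^sub>R (h - s) powr (- (7 / 8)))"
  have ae: "AE s in lborel. s \<noteq> 0 \<and> s \<noteq> h" using AE_lborel_neq[of "0::real"] AE_lborel_neq[of h] by eventually_elim simp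
  have int: "integrable lborel (?m y)" for y
    using set_integrable_powr_reflect(1)[of "- (7 / 8)" h] h by (simp add: set_integrable_def)
  have le: "(\<integral>s. ?m y s \<partial>lborel) \<le> 8 * kD TYPE('a) * norm a * A * norm y powr (3 / 4)" for y
  proof -
    have "(\<integral>s. ?m y s \<partial>lborel) = (kD TYPE('a) * norm a * A * norm y powr (3 / 4)) * (LINT s:{0..h}|lborel. (h - s) powr (- (7 / 8)))"
      unfolding set_lebesgue_integral_def by simp
    also have "(LINT s:{0..h}|lborel. (h - s) powr (- (7 / 8))) = 8 * h powr (1 / 8)"
      using set_integrable_powr_reflect(2)[of "- (7 / 8)" h] h by simp
    also have "(kD TYPE('a) * norm a * A * norm y powr (3 / 4)) * (8 * h powr (1 / 8)) \<le> (kD TYPE('a) * norm a * A * norm y powr (3 / 4)) * (8 * 1)"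
      using h A powr_mono2[of "1 / 8" h 1] by (intro mult_left_mono) auto
    finally show ?thesis by (simp add: mult_ac)
  qed
  have meas: "(\<lambda>(s, x). ?g y s x) \<in> borel_measurable (lborel \<Otimes>\<^sub>M lborel)" for y
  proof -
    note [measurable] = grad_heat_joint_measurable[OF F, of a h]
    have [measurable]: "(\<lambda>w. grad_heat a (h - fst w) (F (fst w)) (snd w - y)) \<in> borel_measurable (borel \<Otimes>\<^sub>M borel)"
      using measurable_compose[of "\<lambda>w. (fst w, snd w - y)" "borel \<Otimes>\<^sub>M borel" "borel \<Otimes>\<^sub>M borel",
          OF _ grad_heat_joint_measurable[OF F, of a h]] by simp
    have "(\<lambda>w. ?g y (fst w) (snd w)) \<in> borel_measurable (borel \<Otimes>\<^sub>M borel)" by measurable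
    then show ?thesis by (simp add: case_prod_beta')
  qed
  have eq: "duhamel a F 0 h h (x - y) - duhamel a F 0 h h x = (\<integral>s. ?g y s x \<partial>lborel)" for x y
  proof -
    have "integrable lborel (\<lambda>s. indicator {0..h} s * grad_heat a (h - s) (F s) z)" for z
      using duhamel_bounded(2)[OF F, of h 0 h A a z] h A b2 by (simp add: set_integrable_def)
    then show ?thesis unfolding duhamel_eq right_diff_distrib by simp
  qed
  have k: "L1_le (kD TYPE('a) * norm a * norm y powr (3 / 4) * (h - s) powr (- (7 / 8))) (\<lambda>z. gradG a (h - s) (z - y) - gradG a (h - s) z)"
    if s: "0 < s" "s < h" for s y
  proof -
    have "kD TYPE('a) * norm a * (h - s) powr (- 1 / 2) * min 1 (norm y / sqrt (h - s) + 0 / (h - s))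
       \<le> kD TYPE('a) * norm a * (h - s) powr (- 1 / 2) * (norm y powr (3 / 4) * (h - s) powr (- (3 / 8)))"
      using scaled_min_le[of "h - s" "norm y"] s by (intro mult_left_mono) auto
    also have "\<dots> = kD TYPE('a) * norm a * norm y powr (3 / 4) * ((h - s) powr (- 1 / 2) * (h - s) powr (- (3 / 8)))" by (simp only: mult_ac)
    also have "(h - s) powr (- 1 / 2) * (h - s) powr (- (3 / 8)) = (h - s) powr (- (7 / 8))"
      unfolding powr_add[symmetric] by simp
    finally show ?thesis
      by (rule L1_le_mono[OF gradG_diff_est(1)[of "h - s" 0 a y, unfolded diff_zero], rotated -1]) (use s in auto)
  qed
  have g: "?g y s = conv (\<lambda>z. gradG a (h - s) (z - y) - gradG a (h - s) z) (F s)" if s: "0 < s" "s < h" for s y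
    unfolding grad_heat_conv using s conv_shift_diff[OF gradG_L1 b2, of "h - s" s a _ y] by (auto simp: fun_eq_iff)
  show "holder_L1 (8 * kD TYPE('a) * norm a * A) (duhamel a F 0 h h)"
    unfolding holder_L1_def
  proof
    fix y
    have "AE s in lborel. L1_le (?m y s) (?g y s)"
      using ae
    proof eventually_elim
      case (elim s)
      show ?case
      proof (cases "s \<in> {0..h}")
        case True
        then have s: "0 < s" "s < h" using elim by auto
        show ?thesis unfolding g[OF s] using conv_L1[OF k[OF s, of y] b1[OF s(1)]] True by (simp add: mult_ac)
      qed (simp add: L1_le_def)
    qed
    from L1_le_mono[OF Minkowski_L1_le[OF sigma_finite_lborel meas this int] le]
    show "L1_le (8 * kD TYPE('a) * norm a * A * norm y powr (3 / 4)) (\<lambda>x. duhamel a F 0 h h (x - y) - duhamel a F 0 h h x)"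
      unfolding eq .
  qed
  show "holder_Linf (8 * kD TYPE('a) * norm a * A) (duhamel a F 0 h h)"
    unfolding holder_Linf_def
  proof
    fix y
    have "AE s in lborel. Linf_le (?m y s) (?g y s)"
      using ae
    proof eventually_elim
      case (elim s)
      show ?case
      proof (cases "s \<in> {0..h}")
        case True
        then have s: "0 < s" "s < h" using elim by auto
        show ?thesis unfolding g[OF s] using conv_Linf[OF k[OF s, of y] b2[OF s(1)]] True by (simp add: mult_ac)
      qed (simp add: Linf_le_def)
    qed
    from Linf_le_mono[OF Minkowski_Linf_le[OF sigma_finite_lborel meas this int] le]
    show "Linf_le (8 * kD TYPE('a) * norm a * A * norm y powr (3 / 4)) (\<lambda>x. duhamel a F 0 h h (x - y) - duhamel a F 0 h h x)"
      unfolding eq .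
  qed
qed

lemma heat_holder:
  fixes \<phi> :: "'a::euclidean_space \<Rightarrow> real"
  assumes t: "0 < t" and b: "L1_le m \<phi>" "Linf_le m \<phi>"
  shows "holder_L1 (4 * kC TYPE('a) * m * t powr (- (3 / 8))) (heat t \<phi>)"
    and "holder_Linf (4 * kC TYPE('a) * m * t powr (- (3 / 8))) (heat t \<phi>)"
proof -
  have m: "0 \<le> m" by (rule L1_le_nonneg[OF b(1)])
  have le: "4 * kC TYPE('a) * min 1 (norm y / sqrt t) * m \<le> 4 * kC TYPE('a) * m * t powr (- (3 / 8)) * norm y powr (3 / 4)" for y :: 'a
  proof -
    have "(4 * kC TYPE('a) * m) * min 1 (norm y / sqrt t) \<le> (4 * kC TYPE('a) * m) * (norm y powr (3 / 4) * t powr (- (3 / 8)))"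
      using scaled_min_le[OF t, of "norm y"] m by (intro mult_left_mono) auto
    then show ?thesis by (simp only: mult_ac)
  qed
  show "holder_L1 (4 * kC TYPE('a) * m * t powr (- (3 / 8))) (heat t \<phi>)"
    unfolding holder_L1_def heat_conv conv_shift_diff[OF heatG_L1[OF t] b(2)]
    using L1_le_mono[OF conv_L1[OF heatG_diff_L1[OF t] b(1)] le] by blast
  show "holder_Linf (4 * kC TYPE('a) * m * t powr (- (3 / 8))) (heat t \<phi>)"
    unfolding holder_Linf_def heat_conv conv_shift_diff[OF heatG_L1[OF t] b(2)]
    using Linf_le_mono[OF conv_Linf[OF heatG_diff_L1[OF t] b(2)] le] by blast
qed

text \<open>Hoelder bounds compare values at \<open>x\<close> and \<open>x - y\<close>, so the
  almost everywhere identity is needed at both points; null sets are translation invariant.\<close>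

lemma holder_add_cong:
  fixes \<phi> \<psi> \<omega> :: "'a::euclidean_space \<Rightarrow> real"
  assumes [measurable]: "\<omega> \<in> borel_measurable borel" "\<phi> \<in> borel_measurable borel" "\<psi> \<in> borel_measurable borel"
    and ae: "AE x in lborel. \<omega> x = \<phi> x + \<psi> x"
  shows "holder_L1 D \<phi> \<Longrightarrow> holder_L1 E \<psi> \<Longrightarrow> holder_L1 (D + E) \<omega>"
    and "holder_Linf D \<phi> \<Longrightarrow> holder_Linf E \<psi> \<Longrightarrow> holder_Linf (D + E) \<omega>"
proof -
  have "AE x in lborel. \<omega> x - (\<phi> x + \<psi> x) = 0" using ae by eventually_elim simp
  then have ae1: "AE x in lborel. \<omega> (x - y) - (\<phi> (x - y) + \<psi> (x - y)) = 0" for y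
    using AE_shift[of "\<lambda>x. \<omega> x - (\<phi> x + \<psi> x)" "\<lambda>z. z = 0" y] by simp
  have ae2: "AE x in lborel. \<omega> (x - y) - \<omega> x = (\<phi> (x - y) - \<phi> x) + (\<psi> (x - y) - \<psi> x)" for y
    using ae1[of y] ae by eventually_elim linarith
  show "holder_L1 (D + E) \<omega>" if "holder_L1 D \<phi>" "holder_L1 E \<psi>"
    unfolding holder_L1_def distrib_right
  proof
    fix y
    have "L1_le (D * norm y powr (3 / 4) + E * norm y powr (3 / 4)) (\<lambda>x. (\<phi> (x - y) - \<phi> x) + (\<psi> (x - y) - \<psi> x))"
      by (rule L1_le_add) (use that in \<open>auto simp: holder_L1_def\<close>)
    then show "L1_le (D * norm y powr (3 / 4) + E * norm y powr (3 / 4)) (\<lambda>x. \<omega> (x - y) - \<omega> x)"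
      by (rule L1_le_cong_AE[OF _ _ ae2]) measurable
  qed
  show "holder_Linf (D + E) \<omega>" if "holder_Linf D \<phi>" "holder_Linf E \<psi>"
    unfolding holder_Linf_def distrib_right
  proof
    fix y
    have "Linf_le (D * norm y powr (3 / 4) + E * norm y powr (3 / 4)) (\<lambda>x. (\<phi> (x - y) - \<phi> x) + (\<psi> (x - y) - \<psi> x))"
      by (rule Linf_le_add) (use that in \<open>auto simp: holder_Linf_def\<close>)
    then show "Linf_le (D * norm y powr (3 / 4) + E * norm y powr (3 / 4)) (\<lambda>x. \<omega> (x - y) - \<omega> x)"
      by (rule Linf_le_cong_AE[OF _ _ ae2]) measurable
  qed
qed

subsection \<open>Bounded mild solutions\<close>

text \<open>A single \<open>M\<close> bounds the initial L1 norm and both norms at all positive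
  times. It also fixes the range [-M, M] on which \<open>f\<close> is Lipschitz with the constant
  called \<open>lip\<close>.\<close>

locale mild_solution =
  fixes a :: "'a::euclidean_space" and f :: "real \<Rightarrow> real" and p C M :: real
    and u0 :: "'a \<Rightarrow> real" and u :: "real \<Rightarrow> 'a \<Rightarrow> real"
  assumes p1: "1 < p" and C_nonneg: "0 \<le> C" and M_pos: "0 < M"
    and f_cont: "continuous_on UNIV f" and f_0: "f 0 = 0"
    and f_diff: "\<And>\<xi> \<eta>. \<bar>f \<xi> - f \<eta>\<bar> \<le> C * (\<bar>\<xi>\<bar> powr (p - 1) + \<bar>\<eta>\<bar> powr (p - 1)) * \<bar>\<xi> - \<eta>\<bar>"
    and u_meas: "case_prod u \<in> borel_measurable (borel \<Otimes>\<^sub>M borel)"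
    and u_L1: "\<And>t. 0 < t \<Longrightarrow> L1_le M (u t)"
    and u_Linf: "\<And>t. 0 < t \<Longrightarrow> Linf_le M (u t)"
    and u0_L1: "L1_le M u0"
    and mild: "\<And>t. 0 < t \<Longrightarrow> AE x in lborel. u t x = heat t u0 x + duhamel a (\<lambda>s y. f (u s y)) 0 t t x"
begin

lemma f_measurable[measurable]: "f \<in> borel_measurable borel"
  using f_cont by (rule borel_measurable_continuous_onI)

lemma f_lip:
  assumes "\<bar>\<xi>\<bar> \<le> l" "\<bar>\<eta>\<bar> \<le> l"
  shows "\<bar>f \<xi> - f \<eta>\<bar> \<le> 2 * C * l powr (p - 1) * \<bar>\<xi> - \<eta>\<bar>"
proof -
  have "\<bar>\<xi>\<bar> powr (p - 1) + \<bar>\<eta>\<bar> powr (p - 1) \<le> l powr (p - 1) + l powr (p - 1)"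
    using assms p1 by (intro add_mono powr_mono2) auto
  then have "C * (\<bar>\<xi>\<bar> powr (p - 1) + \<bar>\<eta>\<bar> powr (p - 1)) * \<bar>\<xi> - \<eta>\<bar> \<le> C * (2 * l powr (p - 1)) * \<bar>\<xi> - \<eta>\<bar>"
    using C_nonneg by (intro mult_right_mono mult_left_mono) auto
  then show ?thesis using f_diff[of \<xi> \<eta>] by (simp add: mult_ac)
qed

lemma f_diff_norm:
  fixes \<phi> \<psi> :: "'a \<Rightarrow> real"
  assumes [measurable]: "\<phi> \<in> borel_measurable borel" "\<psi> \<in> borel_measurable borel"
    and l: "Linf_le l \<phi>" "Linf_le l \<psi>"
  shows "L1_le m (\<lambda>x. \<phi> x - \<psi> x) \<Longrightarrow> L1_le (2 * C * l powr (p - 1) * m) (\<lambda>x. f (\<phi> x) - f (\<psi> x))"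
    and "Linf_le m (\<lambda>x. \<phi> x - \<psi> x) \<Longrightarrow> Linf_le (2 * C * l powr (p - 1) * m) (\<lambda>x. f (\<phi> x) - f (\<psi> x))"
proof -
  let ?c = "2 * C * l powr (p - 1)"
  have c: "0 \<le> ?c" using C_nonneg by simp
  have ae: "AE x in lborel. \<bar>f (\<phi> x) - f (\<psi> x)\<bar> \<le> \<bar>?c * (\<phi> x - \<psi> x)\<bar>"
    using Linf_leD(2)[OF l(1)] Linf_leD(2)[OF l(2)]
    by eventually_elim (use f_lip c C_nonneg in \<open>simp add: abs_mult\<close>)
  show "L1_le (?c * m) (\<lambda>x. f (\<phi> x) - f (\<psi> x))" if "L1_le m (\<lambda>x. \<phi> x - \<psi> x)"
    using L1_le_dominated[OF L1_le_cmult[OF that, of ?c] _ ae] c by simp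
  show "Linf_le (?c * m) (\<lambda>x. f (\<phi> x) - f (\<psi> x))" if "Linf_le m (\<lambda>x. \<phi> x - \<psi> x)"
    using Linf_le_dominated[OF Linf_le_cmult[OF that, of ?c] _ ae] c by simp
qed

lemma f_norm:
  fixes \<phi> :: "'a \<Rightarrow> real"
  assumes l: "Linf_le l \<phi>"
  shows "L1_le m \<phi> \<Longrightarrow> L1_le (2 * C * l powr (p - 1) * m) (\<lambda>x. f (\<phi> x))"
    and "Linf_le (2 * C * l powr (p - 1) * l) (\<lambda>x. f (\<phi> x))"
proof -
  note [measurable] = Linf_leD(1)[OF l]
  have z: "Linf_le l (\<lambda>x::'a. 0)" using Linf_le_nonneg[OF l] by (simp add: Linf_le_def)
  show "L1_le m \<phi> \<Longrightarrow> L1_le (2 * C * l powr (p - 1) * m) (\<lambda>x. f (\<phi> x))"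
    using f_diff_norm(1)[OF _ _ l z, of m] f_0 by simp
  show "Linf_le (2 * C * l powr (p - 1) * l) (\<lambda>x. f (\<phi> x))"
    using f_diff_norm(2)[OF _ _ l z, of l] f_0 l by simp
qed

definition "lip = 2 * C * M powr (p - 1)"

lemma lip_nonneg: "0 \<le> lip" using C_nonneg by (simp add: lip_def)

lemma fu_meas: "case_prod (\<lambda>s y. f (u s y)) \<in> borel_measurable (borel \<Otimes>\<^sub>M borel)"
  using measurable_compose[OF u_meas f_measurable] by (simp add: case_prod_beta')

lemma fu_L1: "0 < t \<Longrightarrow> L1_le (lip * M) (\<lambda>y. f (u t y))"
  unfolding lip_def by (intro f_norm u_Linf u_L1)

lemma fu_Linf: "0 < t \<Longrightarrow> Linf_le (lip * M) (\<lambda>y. f (u t y))"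
  unfolding lip_def by (intro f_norm u_Linf)

lemma fu_shift_meas: "case_prod (\<lambda>s y. f (u (t + s) y)) \<in> borel_measurable (borel \<Otimes>\<^sub>M borel)"
  unfolding case_prod_beta' by (rule joint_measurable_comp[OF fu_meas]) auto

lemma u_section: "u t \<in> borel_measurable borel"
  by (rule joint_measurable_section[OF u_meas])

text \<open>Apply S(h) to the mild formula at time t: the heat part becomes S(t + h) u0, the Duhamel
  part becomes the piece over {0..t} of the formula at t + h, and the remaining piece of that
  formula is the restarted Duhamel term.\<close>

lemma restart:
  assumes t: "0 < t" and h: "0 < h"
  shows "AE x in lborel. u (t + h) x = heat h (u t) x + duhamel a (\<lambda>s y. f (u (t + s) y)) 0 h h x"
proof -
  let ?F = "\<lambda>s y. f (u s y)"
  note [measurable] = u_section L1_le_measurable[OF u0_L1] duhamel_measurable[OF fu_meas]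
    heat_measurable[OF L1_le_measurable[OF u0_L1]]
  have LM: "0 \<le> lip * M" using lip_nonneg M_pos by simp
  \<comment> \<open>The L1 bound of the Duhamel term is read off from
    \<open>u t - heat t u0\<close>, which it equals almost everywhere; the time integral itself is
    not estimated.\<close>
  have d1: "L1_le (M + M) (duhamel a ?F 0 t t)"
  proof (rule L1_le_cong_AE[OF L1_le_diff[OF u_L1[OF t] heat_L1[OF t u0_L1]]])
    show "AE x in lborel. duhamel a ?F 0 t t x = u t x - heat t u0 x"
      using mild[OF t] by eventually_elim simp
  qed measurable
  have H: "heat h (u t) x = heat (t + h) u0 x + duhamel a ?F 0 t (t + h) x" for x
  proof -
    have "heat h (u t) x = heat h (\<lambda>x. heat t u0 x + duhamel a ?F 0 t t x) x"
      unfolding heat_conv[of h] by (rule conv_cong_AE) (use mild[OF t] in auto)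
    also have "\<dots> = heat h (heat t u0) x + heat h (duhamel a ?F 0 t t) x"
      unfolding heat_conv[of h] conv_def distrib_left
      by (rule Bochner_Integration.integral_add)
         (auto intro!: conv_bounded_kernel_integrable[OF _ heatG_Linf[OF h]] heat_L1[OF t u0_L1] d1)
    also have "heat h (heat t u0) = heat (h + t) u0" by (rule heat_heat[OF h t u0_L1])
    also have "heat h (duhamel a ?F 0 t t) x = duhamel a ?F 0 t (t + h) x"
      by (rule heat_duhamel[OF fu_meas fu_L1 t h])
    finally show ?thesis by (simp add: add.commute)
  qed
  have "AE x in lborel. u (t + h) x = heat (t + h) u0 x + duhamel a ?F 0 (t + h) (t + h) x"
    using mild[of "t + h"] t h by simp
  then show ?thesis
    by eventually_elim (simp add: H duhamel_split[OF fu_meas fu_Linf LM t h])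
qed

definition "hold = 16 * kC TYPE('a) * M + 8 * kD TYPE('a) * norm a * (lip * M)"

lemma hold_nonneg: "0 \<le> hold"
  unfolding hold_def using lip_nonneg M_pos by simp

text \<open>Restarting half a unit of time earlier makes the constant uniform in t \<ge> 1: the heat
  part is smoothed for a fixed time, and the Duhamel part over a short interval is Hoelder by
  itself.\<close>

lemma u_holder:
  assumes t: "1 \<le> t"
  shows "holder_L1 hold (u t)" "holder_Linf hold (u t)"
proof -
  have t2: "0 < t - 1 / 2" using t by simp
  have ae: "AE x in lborel. u t x = heat (1 / 2) (u (t - 1 / 2)) x + duhamel a (\<lambda>s y. f (u (t - 1 / 2 + s) y)) 0 (1 / 2) (1 / 2) x"
    using restart[OF t2, of "1 / 2"] by simp
  have c: "4 * kC TYPE('a) * M * (1 / 2) powr (- (3 / 8)) \<le> 16 * kC TYPE('a) * M"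
  proof -
    have "(1 / 2 :: real) powr (- (3 / 8)) \<le> (1 / 2) powr (- 1)" by (rule powr_mono') auto
    then have "(1 / 2 :: real) powr (- (3 / 8)) \<le> 4" by (simp add: powr_minus_divide)
    then have "(4 * kC TYPE('a) * M) * (1 / 2) powr (- (3 / 8)) \<le> (4 * kC TYPE('a) * M) * 4"
      using M_pos by (intro mult_left_mono) auto
    then show ?thesis by (simp add: mult_ac)
  qed
  note hh = heat_holder[of "1 / 2", OF _ u_L1[OF t2] u_Linf[OF t2]]
  have h1: "holder_L1 (16 * kC TYPE('a) * M) (heat (1 / 2) (u (t - 1 / 2)))"
    unfolding holder_L1_def
  proof
    fix y
    show "L1_le (16 * kC TYPE('a) * M * norm y powr (3 / 4)) (\<lambda>x. heat (1 / 2) (u (t - 1 / 2)) (x - y) - heat (1 / 2) (u (t - 1 / 2)) x)"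
      by (rule L1_le_mono[OF hh(1)[unfolded holder_L1_def, rule_format] mult_right_mono[OF c]]) simp_all
  qed
  have h2: "holder_Linf (16 * kC TYPE('a) * M) (heat (1 / 2) (u (t - 1 / 2)))"
    unfolding holder_Linf_def
  proof
    fix y
    show "Linf_le (16 * kC TYPE('a) * M * norm y powr (3 / 4)) (\<lambda>x. heat (1 / 2) (u (t - 1 / 2)) (x - y) - heat (1 / 2) (u (t - 1 / 2)) x)"
      by (rule Linf_le_mono[OF hh(2)[unfolded holder_Linf_def, rule_format] mult_right_mono[OF c]]) simp_all
  qed
  have b: "L1_le (lip * M) (\<lambda>y. f (u (t - 1 / 2 + s) y))" "Linf_le (lip * M) (\<lambda>y. f (u (t - 1 / 2 + s) y))" if "0 < s" for s
    using t2 that by (auto intro!: fu_L1 fu_Linf)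
  note d = duhamel_holder[OF fu_shift_meas b, where h="1 / 2" and a=a]
  note ms = u_section heat_measurable[OF u_section] duhamel_measurable[OF fu_shift_meas] ae
  show "holder_L1 hold (u t)" unfolding hold_def by (rule holder_add_cong(1)[OF ms h1 d(1)]) simp_all
  show "holder_Linf hold (u t)" unfolding hold_def by (rule holder_add_cong(2)[OF ms h2 d(2)]) simp_all
qed

end

subsection \<open>Energy dissipation\<close>

lemma L1_Linf_mult:
  fixes \<phi> \<psi> :: "'a::euclidean_space \<Rightarrow> real"
  assumes \<phi>: "L1_le m \<phi>" and \<psi>: "Linf_le l \<psi>"
  shows L1_Linf_integrable: "integrable lborel (\<lambda>x. \<phi> x * \<psi> x)"
    and L1_Linf_integral_le: "\<bar>\<integral>x. \<phi> x * \<psi> x \<partial>lborel\<bar> \<le> m * l"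
proof -
  have l: "0 \<le> l" by (rule Linf_le_nonneg[OF \<psi>])
  note [measurable] = L1_le_measurable[OF \<phi>] Linf_leD(1)[OF \<psi>]
  have b: "L1_le (\<bar>l\<bar> * m) (\<lambda>x. \<phi> x * \<psi> x)"
  proof (rule L1_le_dominated[OF L1_le_cmult[OF \<phi>, of l]])
    show "AE x in lborel. \<bar>\<phi> x * \<psi> x\<bar> \<le> \<bar>l * \<phi> x\<bar>"
      using Linf_leD(2)[OF \<psi>]
    proof eventually_elim
      case (elim x)
      then have "\<bar>\<psi> x\<bar> * \<bar>\<phi> x\<bar> \<le> l * \<bar>\<phi> x\<bar>" by (intro mult_right_mono) auto
      then show ?case using l by (simp add: abs_mult mult.commute)
    qed
  qed measurable
  show "integrable lborel (\<lambda>x. \<phi> x * \<psi> x)" by (rule L1_leD(1)[OF b])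
  have "\<bar>\<integral>x. \<phi> x * \<psi> x \<partial>lborel\<bar> \<le> (\<integral>x. \<bar>\<phi> x * \<psi> x\<bar> \<partial>lborel)" by (rule integral_abs_bound)
  also have "\<dots> \<le> \<bar>l\<bar> * m" by (rule L1_leD(2)[OF b])
  finally show "\<bar>\<integral>x. \<phi> x * \<psi> x \<partial>lborel\<bar> \<le> m * l" using l by (simp add: mult.commute)
qed

lemma heat_selfadjoint:
  fixes \<phi> \<psi> :: "'a::euclidean_space \<Rightarrow> real"
  assumes "0 < h" "L1_le m \<phi>" "Linf_le l \<psi>"
  shows "(\<integral>x. heat h \<phi> x * \<psi> x \<partial>lborel) = (\<integral>x. \<phi> x * heat h \<psi> x \<partial>lborel)"
  using conv_adjoint[OF heatG_L1[OF assms(1)] assms(2,3)] by (simp add: heat_conv)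

lemma grad_heat_antiadjoint:
  fixes \<phi> \<psi> :: "'a::euclidean_space \<Rightarrow> real"
  assumes "0 < h" "L1_le m \<phi>" "Linf_le l \<psi>"
  shows "(\<integral>x. grad_heat a h \<phi> x * \<psi> x \<partial>lborel) = - (\<integral>x. \<phi> x * grad_heat a h \<psi> x \<partial>lborel)"
proof -
  have "conv (\<lambda>z. gradG a h (- z)) \<psi> x = - conv (gradG a h) \<psi> x" for x
    by (simp add: conv_def)
  then show ?thesis
    using conv_adjoint[OF gradG_L1[OF assms(1), of a] assms(2,3)] by (simp add: grad_heat_conv)
qed

text \<open>\<open>j \<mapsto> \<integral>(S\<^sup>jv)\<^sup>2\<close> is convex because its second difference is
  \<open>\<integral>(S\<^sup>jv - S\<^sup>j\<^sup>+\<^sup>2v)\<^sup>2\<close> for the self-adjoint \<open>S = heat h\<close>.\<close>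

lemma heat_energy_convex:
  fixes v :: "'a::euclidean_space \<Rightarrow> real"
  assumes h: "0 < h" and v: "L1_le m v" "Linf_le m v"
  shows "(\<integral>x. (v x)\<^sup>2 \<partial>lborel) - (\<integral>x. (((heat h ^^ k) v) x)\<^sup>2 \<partial>lborel)
    \<le> real k * ((\<integral>x. (v x)\<^sup>2 \<partial>lborel) - (\<integral>x. (heat h v x)\<^sup>2 \<partial>lborel))"
proof -
  define V where "V j = (heat h ^^ j) v" for j
  define A where "A j = (\<integral>x. V j x * V j x \<partial>lborel)" for j
  have V: "L1_le m (V j)" "Linf_le m (V j)" for j
    by (induction j) (auto simp: V_def v intro!: heat_L1 heat_Linf h)
  have i: "integrable lborel (\<lambda>x. V j x * V k x)" for j k by (rule L1_Linf_integrable[OF V])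
  have V_Suc: "V (Suc j) = heat h (V j)" for j by (simp add: V_def)
  have "0 \<le> A j - 2 * A (Suc j) + A (Suc (Suc j))" for j
  proof -
    have "(\<integral>x. V j x * V (Suc (Suc j)) x \<partial>lborel) = A (Suc j)"
      unfolding A_def V_Suc[of "Suc j"] heat_selfadjoint[OF h V, symmetric] unfolding V_Suc[symmetric] ..
    moreover have "(\<integral>x. (V j x - V (Suc (Suc j)) x)\<^sup>2 \<partial>lborel)
       = (\<integral>x. (V j x * V j x - 2 * (V j x * V (Suc (Suc j)) x)) + V (Suc (Suc j)) x * V (Suc (Suc j)) x \<partial>lborel)"
      by (rule Bochner_Integration.integral_cong) (auto simp: power2_eq_square algebra_simps)
    moreover have "\<dots> = A j - 2 * (\<integral>x. V j x * V (Suc (Suc j)) x \<partial>lborel) + A (Suc (Suc j))"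
      using i by (simp add: A_def)
    moreover have "0 \<le> (\<integral>x. (V j x - V (Suc (Suc j)) x)\<^sup>2 \<partial>lborel)" by simp
    ultimately show ?thesis by linarith
  qed
  then have step: "A (Suc j) - A (Suc (Suc j)) \<le> A j - A (Suc j)" for j
    by (simp add: algebra_simps)
  have dec: "A j - A (Suc j) \<le> A 0 - A 1" for j
  proof (induction j)
    case (Suc j)
    then show ?case using step[of j] by linarith
  qed simp
  have "A 0 - A k \<le> real k * (A 0 - A 1)" for k
  proof (induction k)
    case (Suc k)
    then show ?case using dec[of k] by (simp add: algebra_simps)
  qed simp
  then show ?thesis unfolding A_def V_def by (simp add: power2_eq_square)
qed

lemma heat_funpow:
  fixes v :: "'a::euclidean_space \<Rightarrow> real"
  assumes h: "0 < h" and v: "L1_le m v"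
  shows "(heat h ^^ Suc k) v = heat (real (Suc k) * h) v"
proof (induction k)
  case (Suc k)
  have "(heat h ^^ Suc (Suc k)) v = heat h (heat (real (Suc k) * h) v)" using Suc by simp
  also have "\<dots> = heat (h + real (Suc k) * h) v" using h by (intro heat_heat[OF _ _ v]) auto
  finally show ?case by (simp add: algebra_simps)
qed simp

context mild_solution
begin

text \<open>A primitive with quadratic Taylor error: on the segment from b to c the derivative f z -
  f b of z \<mapsto> \<Phi> z - f b z is at most lip |c - b|, and the mean value inequality supplies
  the second factor.\<close>

lemma f_primitive:
  obtains \<Psi> :: "real \<Rightarrow> real" where "\<Psi> \<in> borel_measurable borel" "\<Psi> 0 = 0"
    "\<And>b c. \<bar>b\<bar> \<le> M \<Longrightarrow> \<bar>c\<bar> \<le> M \<Longrightarrow> \<bar>\<Psi> c - \<Psi> b - f b * (c - b)\<bar> \<le> lip * (c - b)\<^sup>2"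
proof -
  define \<Phi> where "\<Phi> x = integral {-M..x} f" for x
  have D: "(\<Phi> has_real_derivative f z) (at z within {-M..M})" if "z \<in> {-M..M}" for z
    unfolding \<Phi>_def by (rule integral_has_real_derivative[OF continuous_on_subset[OF f_cont] that]) auto
  \<comment> \<open>Clamping the argument extends the primitive from [-M, M] to a continuous, hence
    Borel, function on the line; the solution takes values in that range almost everywhere.\<close>
  define cl where "cl x = max (- M) (min M x)" for x :: real
  define \<Psi> where "\<Psi> x = \<Phi> (cl x) - \<Phi> 0" for x
  have cl: "cl x = x" if "\<bar>x\<bar> \<le> M" for x using that by (auto simp: cl_def)
  have cont: "continuous_on {-M..M} \<Phi>"
    by (rule DERIV_continuous_on) (use D in auto)
  have "continuous_on UNIV \<Psi>"
    unfolding \<Psi>_def cl_def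
    by (intro continuous_on_diff continuous_on_compose2[OF cont] continuous_intros) (use M_pos in auto)
  then have m: "\<Psi> \<in> borel_measurable borel" by (rule borel_measurable_continuous_onI)
  have T: "\<bar>\<Psi> c - \<Psi> b - f b * (c - b)\<bar> \<le> lip * (c - b)\<^sup>2" if bc: "\<bar>b\<bar> \<le> M" "\<bar>c\<bar> \<le> M" for b c
  proof -
    let ?S = "closed_segment b c"
    have S: "?S \<subseteq> {-M..M}" using bc by (auto simp: closed_segment_eq_real_ivl split: if_splits)
    have "norm ((\<Phi> c - f b * c) - (\<Phi> b - f b * b)) \<le> (lip * \<bar>c - b\<bar>) * norm (c - b)"
    proof (rule field_differentiable_bound[of ?S "\<lambda>z. \<Phi> z - f b * z" "\<lambda>z. f z - f b"])
      show "convex ?S" by simp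
      show "((\<lambda>z. \<Phi> z - f b * z) has_field_derivative f z - f b) (at z within ?S)" if "z \<in> ?S" for z
        by (rule derivative_eq_intros DERIV_subset[OF D S] refl)+ (use S that in auto)
      show "norm (f z - f b) \<le> lip * \<bar>c - b\<bar>" if "z \<in> ?S" for z
      proof -
        have "z \<in> {-M..M}" using S that by blast
        then have "\<bar>z\<bar> \<le> M" by (auto simp: abs_le_iff)
        then have "\<bar>f z - f b\<bar> \<le> lip * \<bar>z - b\<bar>" unfolding lip_def using bc by (intro f_lip) auto
        also have "\<dots> \<le> lip * \<bar>c - b\<bar>"
          using that by (intro mult_left_mono lip_nonneg) (auto simp: closed_segment_eq_real_ivl split: if_splits)
        finally show ?thesis by simp
      qed
    qed auto
    moreover have "(lip * \<bar>c - b\<bar>) * norm (c - b) = lip * (c - b)\<^sup>2"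
      by (simp add: power2_eq_square mult.assoc)
    moreover have "(\<Phi> c - f b * c) - (\<Phi> b - f b * b) = \<Psi> c - \<Psi> b - f b * (c - b)"
      unfolding \<Psi>_def cl[OF bc(1)] cl[OF bc(2)] by (simp add: algebra_simps)
    ultimately show ?thesis by (simp only: real_norm_def)
  qed
  show thesis by (rule that[OF m _ T]) (use M_pos in \<open>auto simp: \<Psi>_def cl\<close>)
qed

text \<open>Since \<open>f (w) (a \<cdot> \<nabla>w)\<close> is the derivative of a primitive of \<open>f\<close> along \<open>a\<close>, its integral
  vanishes by translation invariance.\<close>

lemma integral_f_grad_zero:
  assumes h: "0 < h" and U: "L1_le M U" "Linf_le M U"
  shows "(\<integral>x. grad_heat a h U x * f (heat h U x) \<partial>lborel) = 0"
proof -
  define w g where "w = heat h U" and "g = grad_heat a h U"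
  note UM[measurable] = L1_le_measurable[OF U(1)]
  have [measurable]: "w \<in> borel_measurable borel" "g \<in> borel_measurable borel"
    unfolding w_def g_def by (intro heat_measurable grad_heat_measurable UM)+
  have w_le: "\<bar>w x\<bar> \<le> M" for x
    unfolding w_def heat_conv using conv_bounded_le[OF heatG_L1[OF h] U(2), of x] by simp
  have wL: "L1_le M w" "Linf_le M w" unfolding w_def by (intro heat_L1 heat_Linf h U)+
  have gL: "L1_le (kC TYPE('a) * norm a * h powr (- 1 / 2) * M) g" unfolding g_def by (intro grad_heat_L1 h U)
  have fw: "Linf_le (lip * M) (\<lambda>x. f (w x))" unfolding lip_def by (rule f_norm(2)[OF wL(2)])
  obtain \<Psi> where [measurable]: "\<Psi> \<in> borel_measurable borel" and P0: "\<Psi> 0 = 0"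
    and P: "\<And>b c. \<bar>b\<bar> \<le> M \<Longrightarrow> \<bar>c\<bar> \<le> M \<Longrightarrow> \<bar>\<Psi> c - \<Psi> b - f b * (c - b)\<bar> \<le> lip * (c - b)\<^sup>2"
    using f_primitive by blast
  define \<kappa> where "\<kappa> = norm a / sqrt h"
  have \<kappa>: "0 \<le> \<kappa>" using h by (simp add: \<kappa>_def)
  define B where "B = lip * ((4 * kC TYPE('a) * \<kappa> * M) * (4 * kC TYPE('a) * \<kappa> * M)) + (3 * kC TYPE('a) * \<kappa> * \<kappa> * M) * (lip * M)"
  have PI: "integrable lborel (\<lambda>x. \<Psi> (w x))"
  proof (rule L1_leD(1)[OF L1_le_dominated[OF L1_le_cmult[OF wL(1), of "lip * M"]]])
    have "\<bar>\<Psi> (w x)\<bar> \<le> \<bar>lip * M * w x\<bar>" for x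
    proof -
      have "\<bar>\<Psi> (w x)\<bar> \<le> lip * (\<bar>w x\<bar> * \<bar>w x\<bar>)"
        using P[of 0 "w x"] w_le[of x] M_pos P0 f_0 by (simp add: power2_eq_square)
      also have "\<dots> \<le> lip * (M * \<bar>w x\<bar>)"
        by (intro mult_left_mono mult_right_mono w_le lip_nonneg) auto
      also have "\<dots> = \<bar>lip * M * w x\<bar>" using lip_nonneg M_pos by (simp add: abs_mult)
      finally show ?thesis .
    qed
    then show "AE x in lborel. \<bar>\<Psi> (w x)\<bar> \<le> \<bar>lip * M * w x\<bar>" by simp
  qed measurable
  \<comment> \<open>Displace by \<open>r *\<^sub>R a\<close>. The increment \<Delta> of w is -r g up
    to the second-order error e of the heat kernel, and the integral of \<Delta> f(w) is quadratic
    in r because the primitive composed with w has the same integral before and after the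
    translation. So r times the integral is O(r^2); divide by r and let r tend to 0.\<close>
  have main: "r * \<bar>\<integral>x. g x * f (w x) \<partial>lborel\<bar> \<le> r * (r * B)" if r: "0 < r" for r
  proof -
    define y where "y = r *\<^sub>R a"
    define \<Delta> e where "\<Delta> x = w (x - y) - w x" and "e x = \<Delta> x + r * g x" for x
    have ry: "norm y / sqrt h = r * \<kappa>" using r by (simp add: y_def \<kappa>_def)
    have [measurable]: "\<Delta> \<in> borel_measurable borel" "e \<in> borel_measurable borel"
      unfolding \<Delta>_def[abs_def] e_def[abs_def] by measurable
    have D_eq: "\<Delta> = conv (\<lambda>z. heatG h (z - y) - heatG h z) U"
      unfolding \<Delta>_def w_def heat_conv by (rule ext) (rule conv_shift_diff[OF heatG_L1[OF h] U(2)])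
    have k: "L1_le (4 * kC TYPE('a) * (r * \<kappa>)) (\<lambda>z::'a. heatG h (z - y) - heatG h z)"
      by (rule L1_le_mono[OF heatG_diff_L1[OF h]]) (auto simp: ry intro!: mult_left_mono)
    have D1: "L1_le (4 * kC TYPE('a) * (r * \<kappa>) * M) \<Delta>" "Linf_le (4 * kC TYPE('a) * (r * \<kappa>) * M) \<Delta>"
      unfolding D_eq by (intro conv_L1 conv_Linf k U)+
    have e_eq: "e = conv (\<lambda>z. heatG h (z - y) - heatG h z + gradG y h z) U"
    proof
      fix x
      have "r * g x = conv (gradG y h) U x"
        unfolding g_def grad_heat_conv conv_def y_def gradG_def
        by (simp add: mult_ac flip: integral_mult_right_zero)
      then show "e x = conv (\<lambda>z. heatG h (z - y) - heatG h z + gradG y h z) U x"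
        unfolding e_def D_eq conv_def distrib_right
        by (subst Bochner_Integration.integral_add)
           (use conv_bounded_integrable[OF k U(2)] conv_bounded_integrable[OF gradG_L1[OF h, of y] U(2)] in auto)
    qed
    have "L1_le (3 * kC TYPE('a) * (r * \<kappa>) * (r * \<kappa>)) (\<lambda>z::'a. heatG h (z - y) - heatG h z + gradG y h z)"
      by (rule L1_le_mono[OF heatG_taylor_est(1)[OF h]]) (use r \<kappa> in \<open>auto simp: ry intro!: mult_left_mono\<close>)
    then have e1: "L1_le (3 * kC TYPE('a) * (r * \<kappa>) * (r * \<kappa>) * M) e"
      unfolding e_eq by (rule conv_L1[OF _ U(1)])
    define E where "E x = \<Psi> (w (x - y)) - \<Psi> (w x) - f (w x) * \<Delta> x" for x
    have [measurable]: "E \<in> borel_measurable borel" unfolding E_def[abs_def] by measurable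
    have iD: "integrable lborel (\<lambda>x. \<Delta> x * f (w x))" by (rule L1_Linf_integrable[OF D1(1) fw])
    have sh: "integrable lborel (\<lambda>x. \<Psi> (w (x - y)))" "(\<integral>x. \<Psi> (w (x - y)) \<partial>lborel) = (\<integral>x. \<Psi> (w x) \<partial>lborel)"
      using integrable_shift_iff[of "\<lambda>x. \<Psi> (w x)" y] integral_shift[of "\<lambda>x. \<Psi> (w x)" y] PI by auto
    have iE: "(\<integral>x. E x \<partial>lborel) = - (\<integral>x. \<Delta> x * f (w x) \<partial>lborel)"
      unfolding E_def using PI sh iD by (simp add: mult.commute)
    have E_le: "\<bar>E x\<bar> \<le> lip * (\<Delta> x * \<Delta> x)" for x
      unfolding E_def \<Delta>_def using P[OF w_le[of x] w_le[of "x - y"]] by (simp add: power2_eq_square)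
    have "\<bar>\<integral>x. E x \<partial>lborel\<bar> \<le> (\<integral>x. \<bar>E x\<bar> \<partial>lborel)" by simp
    also have "\<dots> \<le> (\<integral>x. lip * (\<Delta> x * \<Delta> x) \<partial>lborel)"
    proof (rule integral_mono)
      show i: "integrable lborel (\<lambda>x. lip * (\<Delta> x * \<Delta> x))" using L1_Linf_integrable[OF D1] by simp
      show "integrable lborel (\<lambda>x. \<bar>E x\<bar>)"
        by (rule Bochner_Integration.integrable_bound[OF i]) (use E_le order_trans[OF E_le abs_ge_self] in auto)
    qed (rule E_le)
    also have "\<dots> \<le> lip * ((4 * kC TYPE('a) * (r * \<kappa>) * M) * (4 * kC TYPE('a) * (r * \<kappa>) * M))"
      using L1_Linf_integral_le[OF D1] lip_nonneg by (simp add: mult_left_mono)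
    finally have b1: "\<bar>\<integral>x. \<Delta> x * f (w x) \<partial>lborel\<bar> \<le> lip * ((4 * kC TYPE('a) * (r * \<kappa>) * M) * (4 * kC TYPE('a) * (r * \<kappa>) * M))"
      unfolding iE by simp
    have b2: "\<bar>\<integral>x. e x * f (w x) \<partial>lborel\<bar> \<le> (3 * kC TYPE('a) * (r * \<kappa>) * (r * \<kappa>) * M) * (lip * M)"
      by (rule L1_Linf_integral_le[OF e1 fw])
    have "(\<integral>x. e x * f (w x) \<partial>lborel) = (\<integral>x. \<Delta> x * f (w x) \<partial>lborel) + r * (\<integral>x. g x * f (w x) \<partial>lborel)"
      unfolding e_def distrib_right mult.assoc using iD L1_Linf_integrable[OF gL fw] by simp
    then have "r * \<bar>\<integral>x. g x * f (w x) \<partial>lborel\<bar> \<le> \<bar>\<integral>x. \<Delta> x * f (w x) \<partial>lborel\<bar> + \<bar>\<integral>x. e x * f (w x) \<partial>lborel\<bar>"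
    proof -
      have "r * X = Z - Y \<Longrightarrow> r * \<bar>X\<bar> \<le> \<bar>Y\<bar> + \<bar>Z\<bar>" for X Y Z
        using r abs_triangle_ineq4[of Z Y] by (simp flip: abs_mult_pos')
      moreover assume "(\<integral>x. e x * f (w x) \<partial>lborel) = (\<integral>x. \<Delta> x * f (w x) \<partial>lborel) + r * (\<integral>x. g x * f (w x) \<partial>lborel)"
      ultimately show ?thesis by (simp add: algebra_simps)
    qed
    also have "\<dots> \<le> lip * ((4 * kC TYPE('a) * (r * \<kappa>) * M) * (4 * kC TYPE('a) * (r * \<kappa>) * M)) + (3 * kC TYPE('a) * (r * \<kappa>) * (r * \<kappa>) * M) * (lip * M)"
      using b1 b2 by linarith
    also have "\<dots> = r * (r * B)" unfolding B_def by (simp only: distrib_left mult_ac)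
    finally show ?thesis .
  qed
  have "\<bar>\<integral>x. g x * f (w x) \<partial>lborel\<bar> \<le> r * B" if "0 < r" for r
    using main[OF that] that by simp
  moreover have "((\<lambda>r. r * B) \<longlongrightarrow> 0 * B) (at_right 0)" by (intro tendsto_intros)
  ultimately have "\<bar>\<integral>x. g x * f (w x) \<partial>lborel\<bar> \<le> 0 * B"
    by (intro tendsto_lowerbound[of "\<lambda>r. r * B" "0 * B" "at_right 0"])
       (auto simp: eventually_at_right_field intro!: exI[of _ 1])
  then show ?thesis unfolding g_def w_def by simp
qed

abbreviation (input) "K34 \<equiv> 6 * kC TYPE('a) * kC TYPE('a) * norm a"

lemma f_holder:
  fixes \<phi> :: "'a \<Rightarrow> real"
  assumes "Linf_le M \<phi>" "holder_L1 D \<phi>"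
  shows "holder_L1 (lip * D) (\<lambda>x. f (\<phi> x))"
  unfolding holder_L1_def
proof
  fix y
  note [measurable] = Linf_leD(1)[OF assms(1)]
  have "L1_le (lip * (D * norm y powr (3 / 4))) (\<lambda>x. f (\<phi> (x - y)) - f (\<phi> x))"
    unfolding lip_def
    by (rule f_diff_norm(1)[of "\<lambda>x. \<phi> (x - y)"]) (use assms Linf_le_shift[OF assms(1), of y] in \<open>auto simp: holder_L1_def\<close>)
  then show "L1_le (lip * D * norm y powr (3 / 4)) (\<lambda>x. f (\<phi> (x - y)) - f (\<phi> x))" by (simp add: mult.assoc)
qed

lemma fu_holder: "1 \<le> t \<Longrightarrow> holder_L1 (lip * hold) (\<lambda>y. f (u t y))"
  by (intro f_holder u_Linf u_holder) auto

text \<open>The mean-zero kernel sees only Hoelder increments of the source, at cost (h - s)^(-1/8),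
  so the Duhamel term is O(h^(7/8)) in L1 instead of the O(h^(1/2)) that a bounded source alone
  would give.\<close>

lemma increment_L1:
  assumes t: "1 \<le> t" and h: "0 < h"
  shows "L1_le (lip * hold * K34 * (2 * h powr (7 / 8))) (duhamel a (\<lambda>s y. f (u (t + s) y)) 0 h h)"
proof -
  let ?c = "lip * hold * K34"
  have c: "0 \<le> ?c" using lip_nonneg hold_nonneg by simp
  have ae: "AE s in lborel. s \<noteq> 0 \<and> s \<noteq> h" using AE_lborel_neq[of "0::real"] AE_lborel_neq[of h] by eventually_elim simp
  have i: "set_integrable lborel {0..h} (\<lambda>s. ?c * (h - s) powr (- (1 / 8)))"
    using set_integrable_powr_reflect(1)[of "- (1 / 8)" h] h by (intro set_integrable_mult_right) auto
  have "L1_le (LINT s:{0..h}|lborel. ?c * (h - s) powr (- (1 / 8))) (duhamel a (\<lambda>s y. f (u (t + s) y)) 0 h h)"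
  proof (rule duhamel_L1[OF fu_shift_meas order_refl i])
    show "AE s in lborel. s \<in> {0..h} \<longrightarrow> L1_le (?c * (h - s) powr (- (1 / 8))) (grad_heat a (h - s) (\<lambda>y. f (u (t + s) y)))"
      using ae
    proof (eventually_elim, intro impI)
      fix s assume "s \<noteq> 0 \<and> s \<noteq> h" "s \<in> {0..h}"
      then have s: "0 < s" "s < h" by auto
      have "L1_le (lip * hold * (K34 * (h - s) powr (- (1 / 8)))) (grad_heat a (h - s) (\<lambda>y. f (u (t + s) y)))"
        by (rule grad_heat_holder_L1[OF _ fu_Linf _ fu_holder]) (use s t lip_nonneg hold_nonneg in auto)
      then show "L1_le (?c * (h - s) powr (- (1 / 8))) (grad_heat a (h - s) (\<lambda>y. f (u (t + s) y)))" by (simp only: mult.assoc)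
    qed
  qed (use c in auto)
  moreover have "(LINT s:{0..h}|lborel. ?c * (h - s) powr (- (1 / 8))) \<le> ?c * (2 * h powr (7 / 8))"
  proof -
    have "(LINT s:{0..h}|lborel. ?c * (h - s) powr (- (1 / 8))) = ?c * (LINT s:{0..h}|lborel. (h - s) powr (- (1 / 8)))" by simp
    also have "(LINT s:{0..h}|lborel. (h - s) powr (- (1 / 8))) = h powr (7 / 8) / (7 / 8)"
      using set_integrable_powr_reflect(2)[of "- (1 / 8)" h] h by simp
    also have "?c * (h powr (7 / 8) / (7 / 8)) \<le> ?c * (2 * h powr (7 / 8))"
      by (intro mult_left_mono c) auto
    finally show ?thesis .
  qed
  ultimately show ?thesis by (rule L1_le_mono)
qed

definition "cE1 = lip * hold * (3 * kC TYPE('a)) + lip * (lip * hold * K34 * 2 + hold * (3 * kC TYPE('a)) + hold * (3 * kC TYPE('a)))"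

text \<open>Two replacements: S(h - s) is removed by Hoelder continuity of f(u(t + s)), and then u(t
  + s) is replaced by S(h) u(t), passing through u(t). Each costs at most a multiple of
  h^(3/8).\<close>

lemma source_deviation_L1:
  assumes t: "1 \<le> t" and h: "0 < h" "h \<le> 1" and s: "0 < s" "s < h"
  shows "L1_le (cE1 * h powr (3 / 8)) (\<lambda>x. heat (h - s) (\<lambda>y. f (u (t + s) y)) x - f (heat h (u t) x))"
proof -
  have tp: "0 < t" "0 < t + s" "1 \<le> t + s" using t s by auto
  note [measurable] = u_section heat_measurable[OF u_section] duhamel_measurable[OF fu_shift_meas]
  have le: "s powr (7 / 8) \<le> h powr (3 / 8)" "s powr (3 / 8) \<le> h powr (3 / 8)" "(h - s) powr (3 / 8) \<le> h powr (3 / 8)"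
  proof -
    have "s powr (7 / 8) \<le> h powr (7 / 8)" using s by (intro powr_mono2) auto
    also have "\<dots> \<le> h powr (3 / 8)" using h by (intro powr_mono') auto
    finally show "s powr (7 / 8) \<le> h powr (3 / 8)" .
    show "s powr (3 / 8) \<le> h powr (3 / 8)" "(h - s) powr (3 / 8) \<le> h powr (3 / 8)"
      using s by (auto intro!: powr_mono2)
  qed
  let ?k = "3 * kC TYPE('a)"
  have 1: "L1_le (lip * hold * (?k * (h - s) powr (3 / 8))) (\<lambda>x. heat (h - s) (\<lambda>y. f (u (t + s) y)) x - f (u (t + s) x))"
    by (rule heat_holder_L1[OF _ fu_Linf _ fu_holder]) (use s tp lip_nonneg hold_nonneg in auto)
  have ut: "L1_le (hold * (?k * \<tau> powr (3 / 8))) (\<lambda>x. heat \<tau> (u t) x - u t x)" if "0 < \<tau>" for \<tau>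
    by (rule heat_holder_L1[OF _ u_Linf _ u_holder(1)]) (use that t hold_nonneg tp in auto)
  have "L1_le (lip * hold * K34 * (2 * s powr (7 / 8)) + hold * (?k * s powr (3 / 8)) + hold * (?k * h powr (3 / 8)))
     (\<lambda>x. u (t + s) x - heat h (u t) x)"
  proof (rule L1_le_cong_AE[OF L1_le_diff[OF L1_le_add[OF increment_L1[OF t s(1)] ut[OF s(1)]] ut[OF h(1)]]])
    show "AE x in lborel. u (t + s) x - heat h (u t) x
      = duhamel a (\<lambda>sa y. f (u (t + sa) y)) 0 s s x + (heat s (u t) x - u t x) - (heat h (u t) x - u t x)"
      using restart[OF tp(1) s(1)] by eventually_elim simp
  qed measurable
  then have 2: "L1_le (lip * (lip * hold * K34 * (2 * s powr (7 / 8)) + hold * (?k * s powr (3 / 8)) + hold * (?k * h powr (3 / 8))))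
     (\<lambda>x. f (u (t + s) x) - f (heat h (u t) x))"
    unfolding lip_def
    by (intro f_diff_norm(1) u_Linf heat_Linf h tp) (auto simp: lip_def)
  have "L1_le (lip * hold * (?k * (h - s) powr (3 / 8)) + lip * (lip * hold * K34 * (2 * s powr (7 / 8)) + hold * (?k * s powr (3 / 8)) + hold * (?k * h powr (3 / 8))))
     (\<lambda>x. (heat (h - s) (\<lambda>y. f (u (t + s) y)) x - f (u (t + s) x)) + (f (u (t + s) x) - f (heat h (u t) x)))"
    by (rule L1_le_add[OF 1 2])
  moreover have "lip * hold * (?k * (h - s) powr (3 / 8)) + lip * (lip * hold * K34 * (2 * s powr (7 / 8)) + hold * (?k * s powr (3 / 8)) + hold * (?k * h powr (3 / 8)))
     \<le> lip * hold * (?k * h powr (3 / 8)) + lip * (lip * hold * K34 * (2 * h powr (3 / 8)) + hold * (?k * h powr (3 / 8)) + hold * (?k * h powr (3 / 8)))"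
    using lip_nonneg hold_nonneg le by (intro add_mono mult_left_mono) auto
  moreover have "\<dots> = cE1 * h powr (3 / 8)" unfolding cE1_def by (simp only: distrib_left distrib_right mult_ac)
  ultimately show ?thesis using L1_le_mono by fastforce
qed

definition "cE = 2 * (cE1 * (hold * K34)) + lip * hold * K34 * 2 * (kC TYPE('a) * norm a * (lip * M) * 2)"

text \<open>Write u(t + h) = w + R with w = S(h) u(t). In the cross term the gradient moves from the
  source onto w, and the leading part, the integral of f(w) (a \<cdot> \<nabla>w), vanishes. What
  remains is the L1 deviation h^(3/8) of the source times the sup bound h^(-1/8) of the gradient,
  integrated over a time h. The square of R is O(h^(7/8 + 1/2)). What counts is that 5/4 exceeds
  1.\<close>

lemma energy_step:
  assumes t: "1 \<le> t" and h: "0 < h" "h \<le> 1"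
  shows "(\<integral>x. (u (t + h) x)\<^sup>2 \<partial>lborel) \<le> (\<integral>x. (heat h (u t) x)\<^sup>2 \<partial>lborel) + cE * h powr (5 / 4)"
proof -
  define w g R where "w = heat h (u t)" and "g = grad_heat a h (u t)"
    and "R = duhamel a (\<lambda>s y. f (u (t + s) y)) 0 h h"
  have tp: "0 < t" using t by simp
  have LM: "0 \<le> lip * M" using lip_nonneg M_pos by simp
  note [measurable] = u_section
  have mm[measurable]: "w \<in> borel_measurable borel" "g \<in> borel_measurable borel" "R \<in> borel_measurable borel"
    unfolding w_def g_def R_def by (intro heat_measurable grad_heat_measurable duhamel_measurable u_section fu_shift_meas)+
  have wL: "L1_le M w" "Linf_le M w" unfolding w_def by (intro heat_L1 heat_Linf u_L1 u_Linf tp h(1))+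
  have R1: "L1_le (lip * hold * K34 * (2 * h powr (7 / 8))) R" unfolding R_def by (rule increment_L1[OF t h(1)])
  have Ri: "Linf_le (kC TYPE('a) * norm a * (lip * M) * (2 * h powr (1 / 2))) R"
    unfolding R_def using tp LM h(1) by (intro duhamel_bounded(1)[OF fu_shift_meas] fu_Linf) auto
  have gi: "Linf_le (hold * (K34 * h powr (- (1 / 8)))) g"
    unfolding g_def by (rule grad_heat_holder_Linf[OF h(1) u_Linf[OF tp] hold_nonneg u_holder(2)[OF t]])
  have ae: "AE s in lborel. s \<noteq> 0 \<and> s \<noteq> h" using AE_lborel_neq[of "0::real"] AE_lborel_neq[of h] by eventually_elim simp
  let ?F = "\<lambda>s y. f (u (t + s) y)"
  have FL: "L1_le (lip * M) (?F s)" "Linf_le (lip * M) (?F s)" if "0 < s" for s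
    using that tp by (auto intro!: fu_L1 fu_Linf)
  have slice: "\<bar>\<integral>x. w x * grad_heat a (h - s) (?F s) x \<partial>lborel\<bar> \<le> cE1 * (hold * K34) * h powr (1 / 4)" if s: "0 < s" "s < h" for s
  proof -
    have hs: "0 < h - s" using s by simp
    have g1: "L1_le (kC TYPE('a) * norm a * h powr (- 1 / 2) * M) g" unfolding g_def by (intro grad_heat_L1 h(1) u_L1 tp)
    \<comment> \<open>The semigroup law puts the gradient at time \<open>h\<close> for every s: a
      \<cdot> \<nabla>S(h - s) w = S(h - s) g. The factor S(h - s) then returns to the source by
      self-adjointness, leaving a g that is free of s.\<close>
    have "grad_heat a (h - s) w = grad_heat a (h - s + h) (u t)"
      unfolding w_def by (rule grad_heat_heat[OF hs h(1) u_L1[OF tp]])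
    also have "\<dots> = heat (h - s) g" unfolding g_def by (rule heat_grad_heat[OF hs h(1) u_L1[OF tp], symmetric])
    finally have gw: "grad_heat a (h - s) w = heat (h - s) g" .
    have "(\<integral>x. w x * grad_heat a (h - s) (?F s) x \<partial>lborel) = (\<integral>x. grad_heat a (h - s) (?F s) x * w x \<partial>lborel)"
      by (simp add: mult.commute)
    also have "\<dots> = - (\<integral>x. ?F s x * grad_heat a (h - s) w x \<partial>lborel)"
      by (rule grad_heat_antiadjoint[OF hs FL(1)[OF s(1)] wL(2)])
    also have "\<dots> = - (\<integral>x. heat (h - s) (?F s) x * g x \<partial>lborel)"
      unfolding gw heat_selfadjoint[OF hs FL(1)[OF s(1)] gi] ..
    also have "\<dots> = - (\<integral>x. (heat (h - s) (?F s) x - f (w x)) * g x \<partial>lborel)"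
    proof -
      have z: "(\<integral>x. f (w x) * g x \<partial>lborel) = 0"
        using integral_f_grad_zero[OF h(1) u_L1[OF tp] u_Linf[OF tp]] unfolding w_def g_def by (simp add: mult.commute)
      have fw: "L1_le (lip * M) (\<lambda>x. f (w x))" unfolding lip_def by (rule f_norm(1)[OF wL(2,1)])
      show ?thesis unfolding left_diff_distrib
        by (subst Bochner_Integration.integral_diff)
           (use L1_Linf_integrable[OF heat_L1[OF hs FL(1)[OF s(1)]] gi] L1_Linf_integrable[OF fw gi] z in auto)
    qed
    finally have "\<bar>\<integral>x. w x * grad_heat a (h - s) (?F s) x \<partial>lborel\<bar> \<le> (cE1 * h powr (3 / 8)) * (hold * (K34 * h powr (- (1 / 8))))"
      using L1_Linf_integral_le[OF source_deviation_L1[OF t h s] gi] by (simp add: w_def)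
    also have "\<dots> = cE1 * (hold * K34) * (h powr (3 / 8) * h powr (- (1 / 8)))" by (simp only: mult_ac)
    also have "h powr (3 / 8) * h powr (- (1 / 8)) = h powr (1 / 4)" unfolding powr_add[symmetric] by simp
    finally show ?thesis .
  qed
  have i: "integrable (lborel \<Otimes>\<^sub>M lborel) (\<lambda>(s, x). w x * (indicator {0..h} s * grad_heat a (h - s) (?F s) x))"
  proof (rule Minkowski_L1_integrable)
    let ?c = "kC TYPE('a) * norm a * (lip * M) * M"
    have [measurable]: "(\<lambda>z. indicator {0..h} (fst z) * grad_heat a (h - fst z) (?F (fst z)) (snd z)) \<in> borel_measurable (lborel \<Otimes>\<^sub>M lborel)"
      using duhamel_integrand_measurable[OF fu_shift_meas, of 0 h a h] by (simp add: case_prod_beta')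
    show "(\<lambda>(s, x). w x * (indicator {0..h} s * grad_heat a (h - s) (?F s) x)) \<in> borel_measurable (lborel \<Otimes>\<^sub>M lborel)"
      unfolding case_prod_beta' by measurable
    show "integrable lborel (\<lambda>s. ?c * (indicator {0..h} s *\<^sub>R (h - s) powr (- (1 / 2))))"
      using set_integrable_powr_reflect(1)[of "- (1 / 2)" h] h by (simp add: set_integrable_def)
    show "AE s in lborel. L1_le (?c * (indicator {0..h} s *\<^sub>R (h - s) powr (- (1 / 2)))) (\<lambda>x. w x * (indicator {0..h} s * grad_heat a (h - s) (?F s) x))"
      using ae
    proof eventually_elim
      case (elim s)
      show ?case
      proof (cases "s \<in> {0..h}")
        case True
        then have s: "0 < s" "0 < h - s" using elim by auto
        have gL: "L1_le (kC TYPE('a) * norm a * (h - s) powr (- 1 / 2) * (lip * M)) (grad_heat a (h - s) (?F s))"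
          by (rule grad_heat_L1[OF s(2) FL(1)[OF s(1)]])
        note [measurable] = L1_le_measurable[OF gL]
        have "L1_le (\<bar>M\<bar> * (kC TYPE('a) * norm a * (h - s) powr (- 1 / 2) * (lip * M))) (\<lambda>x. w x * grad_heat a (h - s) (?F s) x)"
        proof (rule L1_le_dominated[OF L1_le_cmult[OF gL, of M]])
          show "AE x in lborel. \<bar>w x * grad_heat a (h - s) (?F s) x\<bar> \<le> \<bar>M * grad_heat a (h - s) (?F s) x\<bar>"
            using Linf_leD(2)[OF wL(2)] by eventually_elim (use M_pos in \<open>auto simp: abs_mult intro!: mult_right_mono\<close>)
        qed measurable
        then show ?thesis using True M_pos by (simp add: mult_ac)
      qed (simp add: L1_le_def)
    qed
  qed (rule sigma_finite_lborel)
  have "(\<integral>x. w x * R x \<partial>lborel) = (\<integral>x. (\<integral>s. w x * (indicator {0..h} s * grad_heat a (h - s) (?F s) x) \<partial>lborel) \<partial>lborel)"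
    unfolding R_def duhamel_eq by simp
  also have "\<dots> = (\<integral>s. (\<integral>x. w x * (indicator {0..h} s * grad_heat a (h - s) (?F s) x) \<partial>lborel) \<partial>lborel)"
    by (rule lborel_pair.Fubini_integral[OF i])
  finally have eq: "(\<integral>x. w x * R x \<partial>lborel) = (\<integral>s. (\<integral>x. w x * (indicator {0..h} s * grad_heat a (h - s) (?F s) x) \<partial>lborel) \<partial>lborel)" .
  have "\<bar>\<integral>x. w x * R x \<partial>lborel\<bar> \<le> (\<integral>s. \<bar>\<integral>x. w x * (indicator {0..h} s * grad_heat a (h - s) (?F s) x) \<partial>lborel\<bar> \<partial>lborel)"
    unfolding eq by simp
  also have "\<dots> \<le> (\<integral>s. indicator {0..h} s * (cE1 * (hold * K34) * h powr (1 / 4)) \<partial>lborel)"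
  proof (rule integral_mono_AE)
    show "integrable lborel (\<lambda>s. \<bar>\<integral>x. w x * (indicator {0..h} s * grad_heat a (h - s) (?F s) x) \<partial>lborel\<bar>)"
      using lborel_pair.integrable_fst[OF i] by simp
    show "integrable lborel (\<lambda>s. indicator {0..h} s * (cE1 * (hold * K34) * h powr (1 / 4)))"
      using h by (intro integrable_mult_left) (simp add: integrable_indicator_iff emeasure_lborel_Icc_eq)
    show "AE s in lborel. \<bar>\<integral>x. w x * (indicator {0..h} s * grad_heat a (h - s) (?F s) x) \<partial>lborel\<bar>
       \<le> indicator {0..h} s * (cE1 * (hold * K34) * h powr (1 / 4))"
      using ae
    proof eventually_elim
      case (elim s)
      show ?case
      proof (cases "s \<in> {0..h}")
        case True
        then show ?thesis using slice[of s] elim by simp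
      qed simp
    qed
  qed
  also have "\<dots> = cE1 * (hold * K34) * (h * h powr (1 / 4))" using h by (simp add: mult_ac)
  also have "h * h powr (1 / 4) = h powr (5 / 4)" using h powr_add[of h 1 "1 / 4"] by simp
  finally have wR: "\<bar>\<integral>x. w x * R x \<partial>lborel\<bar> \<le> cE1 * (hold * K34) * h powr (5 / 4)" .
  have "\<bar>\<integral>x. R x * R x \<partial>lborel\<bar> \<le> (lip * hold * K34 * (2 * h powr (7 / 8))) * (kC TYPE('a) * norm a * (lip * M) * (2 * h powr (1 / 2)))"
    by (rule L1_Linf_integral_le[OF R1 Ri])
  also have "\<dots> = (lip * hold * K34 * 2 * (kC TYPE('a) * norm a * (lip * M) * 2)) * (h powr (7 / 8) * h powr (1 / 2))" by (simp only: mult_ac)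
  also have "h powr (7 / 8) * h powr (1 / 2) = h powr (11 / 8)" unfolding powr_add[symmetric] by simp
  also have "(lip * hold * K34 * 2 * (kC TYPE('a) * norm a * (lip * M) * 2)) * h powr (11 / 8) \<le> (lip * hold * K34 * 2 * (kC TYPE('a) * norm a * (lip * M) * 2)) * h powr (5 / 4)"
    using h lip_nonneg hold_nonneg M_pos by (intro mult_left_mono powr_mono') auto
  finally have RR: "\<bar>\<integral>x. R x * R x \<partial>lborel\<bar> \<le> (lip * hold * K34 * 2 * (kC TYPE('a) * norm a * (lip * M) * 2)) * h powr (5 / 4)" .
  have "(\<integral>x. (u (t + h) x)\<^sup>2 \<partial>lborel) = (\<integral>x. w x * w x + 2 * (w x * R x) + R x * R x \<partial>lborel)"
  proof (rule integral_cong_AE)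
    show "AE x in lborel. (u (t + h) x)\<^sup>2 = w x * w x + 2 * (w x * R x) + R x * R x"
      using restart[OF tp h(1), folded w_def R_def]
    proof eventually_elim
      case (elim x)
      show ?case unfolding elim by (simp add: power2_eq_square algebra_simps)
    qed
  qed measurable
  also have "\<dots> = (\<integral>x. w x * w x \<partial>lborel) + 2 * (\<integral>x. w x * R x \<partial>lborel) + (\<integral>x. R x * R x \<partial>lborel)"
    using L1_Linf_integrable[OF wL] L1_Linf_integrable[OF wL(1) Ri] L1_Linf_integrable[OF R1 Ri] by simp
  also have "\<dots> \<le> (\<integral>x. (w x)\<^sup>2 \<partial>lborel) + (2 * (cE1 * (hold * K34) * h powr (5 / 4)) + (lip * hold * K34 * 2 * (kC TYPE('a) * norm a * (lip * M) * 2)) * h powr (5 / 4))"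
    using wR RR unfolding power2_eq_square by linarith
  also have "2 * (cE1 * (hold * K34) * h powr (5 / 4)) + (lip * hold * K34 * 2 * (kC TYPE('a) * norm a * (lip * M) * 2)) * h powr (5 / 4) = cE * h powr (5 / 4)"
    unfolding cE_def by (simp only: distrib_right mult.assoc)
  finally show ?thesis unfolding w_def .
qed

end

section \<open>Smallness of the energy and of the sup norm at some time\<close>

context mild_solution
begin

lemma cancel_pos: "0 < q \<Longrightarrow> q * (e / (d * q)) = e / (d::real)"
  by simp

lemma cE_nonneg: "0 \<le> cE"
  unfolding cE_def cE1_def using lip_nonneg hold_nonneg M_pos by (intro add_nonneg_nonneg mult_nonneg_nonneg) auto

text \<open>If the energy stayed above \<epsilon>, a heat time \<tau> would still push the linear
  energy below \<epsilon>/4; by convexity the first of m steps of length \<tau>/m carries at least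
  its share 3 \<epsilon> / (4m) of that loss. For m large the nonlinear error per step is at most
  \<epsilon> / (4m), so every step lowers the energy by \<epsilon> / (2m) and it would become
  negative.\<close>

lemma energy_small:
  assumes \<epsilon>: "0 < \<epsilon>"
  shows "\<exists>t\<ge>1. (\<integral>x. (u t x)\<^sup>2 \<partial>lborel) < \<epsilon>"
proof (rule ccontr)
  assume neg: "\<not> ?thesis"
  define E where "E t = (\<integral>x. (u t x)\<^sup>2 \<partial>lborel)" for t
  have E: "\<epsilon> \<le> E t" if "1 \<le> t" for t
    using neg that unfolding E_def by (meson not_less)
  let ?n = "real DIM('a)"
  \<comment> \<open>Solves M \<tau>^(-n/2) M = \<epsilon>/4, the product of the L1 and sup bounds of
    S(\<tau>) applied to the solution.\<close>
  define \<tau> where "\<tau> = (\<epsilon> / (4 * M * M)) powr (- 2 / ?n)"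
  have x0: "0 < \<epsilon> / (4 * M * M)" using \<epsilon> M_pos by simp
  have \<tau>: "0 < \<tau>" unfolding \<tau>_def using \<epsilon> M_pos by simp
  have "\<tau> powr (- ?n / 2) = \<epsilon> / (4 * M * M)"
    unfolding \<tau>_def powr_powr using \<epsilon> M_pos by simp
  then have tail: "M * (\<tau> powr (- ?n / 2) * M) = \<epsilon> / 4" using M_pos by simp
  define \<eta> where "\<eta> = \<epsilon> / (4 * (\<tau> * cE + 1))"
  have q: "0 < \<tau> * cE + 1" using cE_nonneg \<tau> by (simp add: add_nonneg_pos)
  have \<eta>: "0 < \<eta>" unfolding \<eta>_def using \<epsilon> q by simp
  \<comment> \<open>m steps with m h = \<tau> cost m cE h^(5/4) = \<tau> cE h^(1/4), so h^(1/4)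
    \<le> \<eta> keeps the total below \<epsilon>/4. The restriction to h \<le> 1 comes from
    \<open>energy_step\<close>.\<close>
  define h0 where "h0 = min 1 (\<eta> powr 4)"
  have h0: "0 < h0" using \<eta> by (simp add: h0_def)
  obtain m :: nat where m: "\<tau> / h0 < real m" using reals_Archimedean2 by blast
  have m0: "0 < real m" using m \<tau> h0 by (smt (verit) divide_pos_pos)
  define h where "h = \<tau> / real m"
  have h: "0 < h" "h \<le> h0" using m m0 \<tau> h0 by (auto simp: h_def field_simps)
  then have h1: "h \<le> 1" by (simp add: h0_def)
  have mh: "real m * h = \<tau>" using m0 by (simp add: h_def)
  have err: "real m * (cE * h powr (5 / 4)) \<le> \<epsilon> / 4"
  proof -
    have "h powr (1 / 4) \<le> (\<eta> powr 4) powr (1 / 4)" using h by (intro powr_mono2) (auto simp: h0_def)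
    also have "\<dots> = \<eta>" unfolding powr_powr using \<eta> by simp
    finally have r: "h powr (1 / 4) \<le> \<eta>" .
    have "h powr (5 / 4) = h * h powr (1 / 4)" using h powr_add[of h 1 "1 / 4"] by simp
    then have "real m * (cE * h powr (5 / 4)) = (\<tau> * cE) * h powr (1 / 4)" using mh by (simp add: mult_ac flip: mh)
    also have "\<dots> \<le> (\<tau> * cE) * \<eta>" using r \<tau> cE_nonneg by (intro mult_left_mono) auto
    also have "\<dots> \<le> (\<tau> * cE + 1) * \<eta>" using \<eta> by (intro mult_right_mono) auto
    also have "\<dots> = \<epsilon> / 4" unfolding \<eta>_def by (rule cancel_pos[OF q])
    finally show ?thesis .
  qed
  obtain k where k: "m = Suc k" using m0 by (cases m) auto
  have step: "E (t + h) \<le> E t - \<epsilon> / (2 * real m)" if t: "1 \<le> t" for t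
  proof -
    have tp: "0 < t" using t by simp
    have "(heat h ^^ m) (u t) = heat \<tau> (u t)"
      unfolding k using heat_funpow[OF h(1) u_L1[OF tp], of k] mh k by simp
    then have cv: "E t - (\<integral>x. (heat \<tau> (u t) x)\<^sup>2 \<partial>lborel) \<le> real m * (E t - (\<integral>x. (heat h (u t) x)\<^sup>2 \<partial>lborel))"
      using heat_energy_convex[OF h(1) u_L1[OF tp] u_Linf[OF tp], of m] unfolding E_def by simp
    have "(\<integral>x. (heat \<tau> (u t) x)\<^sup>2 \<partial>lborel) \<le> M * (\<tau> powr (- ?n / 2) * M)"
      using L1_Linf_integral_le[OF heat_L1[OF \<tau> u_L1[OF tp]] heat_L1_Linf[OF \<tau> u_L1[OF tp]]] by (simp add: power2_eq_square)
    then have c1: "\<epsilon> - \<epsilon> / 4 \<le> real m * (E t - (\<integral>x. (heat h (u t) x)\<^sup>2 \<partial>lborel))" using cv E[OF t] tail by linarith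
    have "E t - (\<integral>x. (heat h (u t) x)\<^sup>2 \<partial>lborel) \<le> E t - E (t + h) + cE * h powr (5 / 4)"
      using energy_step[OF t h(1) h1] unfolding E_def by linarith
    then have "real m * (E t - (\<integral>x. (heat h (u t) x)\<^sup>2 \<partial>lborel)) \<le> real m * (E t - E (t + h) + cE * h powr (5 / 4))"
      by (intro mult_left_mono) auto
    then have "\<epsilon> / 2 \<le> real m * (E t - E (t + h))" using c1 err unfolding distrib_left by linarith
    then have "\<epsilon> / 2 / real m \<le> E t - E (t + h)" using m0 by (simp add: field_simps)
    then show ?thesis by (simp add: field_simps)
  qed
  have iter: "E (1 + real j * h) \<le> E 1 - real j * (\<epsilon> / (2 * real m))" for j
  proof (induction j)
    case (Suc j)
    have "E (1 + real (Suc j) * h) = E ((1 + real j * h) + h)" by (simp add: algebra_simps)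
    also have "\<dots> \<le> E (1 + real j * h) - \<epsilon> / (2 * real m)" by (rule step) (use h in simp)
    also have "\<dots> \<le> E 1 - real j * (\<epsilon> / (2 * real m)) - \<epsilon> / (2 * real m)" using Suc by simp
    also have "\<dots> = E 1 - real (Suc j) * (\<epsilon> / (2 * real m))" unfolding of_nat_Suc distrib_right by linarith
    finally show ?case .
  qed simp
  obtain j :: nat where j: "E 1 / (\<epsilon> / (2 * real m)) < real j" using reals_Archimedean2 by blast
  have "0 < \<epsilon> / (2 * real m)" using \<epsilon> m0 by simp
  then have "E 1 < real j * (\<epsilon> / (2 * real m))" using j by (simp only: pos_divide_less_eq)
  then have "E (1 + real j * h) < 0" using iter[of j] by linarith
  moreover have "0 < E (1 + real j * h)" using E[of "1 + real j * h"] \<epsilon> h by simp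
  ultimately show False by simp
qed

text \<open>Young's inequality with weight \<rho> under the convolution integral stands in for
  Cauchy-Schwarz; the integral of the squared kernel is at most its mass times its height.\<close>

lemma heat_le_energy:
  fixes v :: "'a \<Rightarrow> real"
  assumes d: "0 < \<delta>" and v: "L1_le m v" "Linf_le m v" and l: "0 < \<rho>"
  shows "\<bar>heat \<delta> v x\<bar> \<le> (\<rho> * \<delta> powr (- real DIM('a) / 2) + (\<integral>y. (v y)\<^sup>2 \<partial>lborel) / \<rho>) / 2"
proof -
  note [measurable] = L1_le_measurable[OF v(1)]
  have G1: "L1_le 1 (\<lambda>y. heatG \<delta> (x - y))" 
    using heatG_L1[OF d, where 'a='a] integrable_reflect_iff[of "heatG \<delta> :: 'a \<Rightarrow> real" x] integral_reflect[of "\<lambda>y. \<bar>heatG \<delta> (y::'a)\<bar>" x]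
    by (auto simp: L1_le_def)
  have G2: "Linf_le (\<delta> powr (- real DIM('a) / 2)) (\<lambda>y. heatG \<delta> (x - y))"
    unfolding Linf_le_def using heatG_Linf[OF d] by auto
  have iG: "integrable lborel (\<lambda>y. heatG \<delta> (x - y) * heatG \<delta> (x - y))" "(\<integral>y. heatG \<delta> (x - y) * heatG \<delta> (x - y) \<partial>lborel) \<le> \<delta> powr (- real DIM('a) / 2)"
    using L1_Linf_integrable[OF G1 G2] L1_Linf_integral_le[OF G1 G2] by auto
  have iv: "integrable lborel (\<lambda>y. v y * v y)" by (rule L1_Linf_integrable[OF v])
  let ?b = "\<lambda>y. (\<rho> * (heatG \<delta> (x - y) * heatG \<delta> (x - y)) + (v y * v y) / \<rho>) / 2"
  have ib: "integrable lborel ?b" using iG(1) iv by simp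
  have pt: "\<bar>heatG \<delta> (x - y) * v y\<bar> \<le> ?b y" for y
  proof -
    have "2 * (sqrt \<rho> * heatG \<delta> (x - y)) * (\<bar>v y\<bar> / sqrt \<rho>) \<le> (sqrt \<rho> * heatG \<delta> (x - y))\<^sup>2 + (\<bar>v y\<bar> / sqrt \<rho>)\<^sup>2"
      by (rule sum_squares_bound)
    moreover have "2 * (sqrt \<rho> * heatG \<delta> (x - y)) * (\<bar>v y\<bar> / sqrt \<rho>) = 2 * \<bar>heatG \<delta> (x - y) * v y\<bar>"
      using l by (simp add: abs_mult)
    moreover have "(sqrt \<rho> * heatG \<delta> (x - y))\<^sup>2 + (\<bar>v y\<bar> / sqrt \<rho>)\<^sup>2 = \<rho> * (heatG \<delta> (x - y) * heatG \<delta> (x - y)) + (v y * v y) / \<rho>"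
      using l by (simp add: power_mult_distrib power_divide) (simp add: power2_eq_square)
    ultimately have "2 * \<bar>heatG \<delta> (x - y) * v y\<bar> \<le> \<rho> * (heatG \<delta> (x - y) * heatG \<delta> (x - y)) + (v y * v y) / \<rho>"
      by (simp only:)
    moreover have "2 * c \<le> d \<Longrightarrow> c \<le> d / 2" for c d :: real by simp
    ultimately show ?thesis by blast
  qed
  have "\<bar>heat \<delta> v x\<bar> \<le> (\<integral>y. \<bar>heatG \<delta> (x - y) * v y\<bar> \<partial>lborel)" unfolding heat_def by (rule integral_abs_bound)
  also have "\<dots> \<le> (\<integral>y. ?b y \<partial>lborel)"
    using conv_bounded_integrable[OF heatG_L1[OF d] v(2), of x] by (intro integral_mono ib pt) auto
  also have "\<dots> = (\<rho> * (\<integral>y. heatG \<delta> (x - y) * heatG \<delta> (x - y) \<partial>lborel) + (\<integral>y. (v y)\<^sup>2 \<partial>lborel) / \<rho>) / 2"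
    using iG(1) iv by (simp add: power2_eq_square)
  also have "\<dots> \<le> (\<rho> * \<delta> powr (- real DIM('a) / 2) + (\<integral>y. (v y)\<^sup>2 \<partial>lborel) / \<rho>) / 2"
    using iG(2) l by (intro divide_right_mono add_mono mult_left_mono) auto
  finally show ?thesis .
qed

text \<open>Small energy at time t becomes small sup norm at t + \<delta>: the heat part through
  \<open>heat_le_energy\<close>, the Duhamel part because the interval is short.\<close>

lemma sup_small:
  assumes \<epsilon>: "0 < \<epsilon>"
  shows "\<exists>T\<ge>1. Linf_le \<epsilon> (u T)"
proof -
  define c where "c = kC TYPE('a) * norm a * (lip * M) * 2"
  have c0: "0 \<le> c" using lip_nonneg M_pos by (simp add: c_def)
  \<comment> \<open>\<delta> makes the Duhamel term at most \<epsilon>/2. Then \<rho> sets the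
    kernel part of \<open>heat_le_energy\<close> equal to \<epsilon>/2, and this fixes how small the
    energy has to be.\<close>
  define \<delta> where "\<delta> = (\<epsilon> / (2 * (c + 1)))\<^sup>2"
  have d0: "0 < \<epsilon> / (2 * (c + 1))" using \<epsilon> c0 by simp
  have \<delta>: "0 < \<delta>" unfolding \<delta>_def using zero_less_power[OF d0] .
  have "\<delta> powr (1 / 2) = \<epsilon> / (2 * (c + 1))" unfolding \<delta>_def using d0 powr_half_sqrt[OF less_imp_le[OF zero_less_power[OF d0, of 2]]] by (simp only: real_sqrt_abs abs_of_pos)
  then have "c * \<delta> powr (1 / 2) = c * (\<epsilon> / (2 * (c + 1)))" by simp
  also have "\<dots> \<le> (c + 1) * (\<epsilon> / (2 * (c + 1)))" using d0 by (intro mult_right_mono) auto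
  also have "\<dots> = \<epsilon> / 2" using c0 by (intro cancel_pos) simp
  finally have cd: "c * \<delta> powr (1 / 2) \<le> \<epsilon> / 2" .
  define \<rho> where "\<rho> = \<epsilon> / 2 / (\<delta> powr (- real DIM('a) / 2))"
  have l: "0 < \<rho>" "\<rho> * \<delta> powr (- real DIM('a) / 2) = \<epsilon> / 2" unfolding \<rho>_def using \<epsilon> \<delta> by auto
  obtain t where t: "1 \<le> t" "(\<integral>x. (u t x)\<^sup>2 \<partial>lborel) < \<rho> * (\<epsilon> / 2)"
    using energy_small[of "\<rho> * (\<epsilon> / 2)"] l \<epsilon> by auto
  have tp: "0 < t" using t by simp
  have "(\<integral>x. (u t x)\<^sup>2 \<partial>lborel) / \<rho> \<le> \<epsilon> / 2" using t(2) l by (simp add: field_simps)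
  moreover have "q \<le> e \<Longrightarrow> z \<le> (e + q) / 2 \<Longrightarrow> z \<le> e" for q e z :: real by simp
  ultimately have "\<bar>heat \<delta> (u t) x\<bar> \<le> \<epsilon> / 2" for x
    using heat_le_energy[OF \<delta> u_L1[OF tp] u_Linf[OF tp] l(1), of x] unfolding l(2) by blast
  then have h: "Linf_le (\<epsilon> / 2) (heat \<delta> (u t))"
    unfolding Linf_le_def using heat_measurable[OF u_section] by auto
  have LM: "0 \<le> lip * M" using lip_nonneg M_pos by simp
  have "Linf_le (kC TYPE('a) * norm a * (lip * M) * (2 * \<delta> powr (1 / 2))) (duhamel a (\<lambda>s y. f (u (t + s) y)) 0 \<delta> \<delta>)"
    using tp LM \<delta> by (intro duhamel_bounded(1)[OF fu_shift_meas] fu_Linf) auto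
  then have d: "Linf_le (\<epsilon> / 2) (duhamel a (\<lambda>s y. f (u (t + s) y)) 0 \<delta> \<delta>)"
    by (rule Linf_le_mono) (use cd in \<open>simp add: c_def mult_ac\<close>)
  have "Linf_le (\<epsilon> / 2 + \<epsilon> / 2) (u (t + \<delta>))"
    by (rule Linf_le_cong_AE[OF Linf_le_add[OF h d] u_section restart[OF tp \<delta>]])
  then show ?thesis using t(1) \<delta> by (intro exI[of _ "t + \<delta>"]) auto
qed

end

subsection \<open>Decay of supercritical solutions\<close>

text \<open>\<open>u_cont\<close> is continuity in the sup norm in the form used by the barrier: a
  bound at one time persists, with a small loss, at nearby times.\<close>

locale decaying_solution = mild_solution a f p C M u0 u
  for a :: "'a::euclidean_space" and f p C M u0 u +
  assumes supercritical: "1 / 2 < real DIM('a) / 2 * (p - 1)"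
    and u_cont: "\<And>t e. 0 < t \<Longrightarrow> 0 < e \<Longrightarrow> \<exists>d>0. \<forall>s>0. \<bar>s - t\<bar> < d \<longrightarrow> Linf_le e (\<lambda>x. u s x - u t x)"
begin

definition "\<sigma> = real DIM('a) / 2 * (p - 1) - 1 / 2"

lemma sigma_pos: "0 < \<sigma>" using supercritical by (simp add: \<sigma>_def)

text \<open>\<sigma> is chosen so that n (p - 1) / 2 = 1/2 + \<sigma>: the factor |u|^(p - 1) of a
  function of Gaussian height decays faster by \<sigma> than the critical rate
  \<open>r powr (- (1 / 2))\<close>.\<close>

lemma powr_p_minus_1:
  assumes "0 < r" "0 \<le> D"
  shows "(D * r powr (- (real DIM('a) / 2))) powr (p - 1) = D powr (p - 1) * r powr (- (1 / 2) - \<sigma>)"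
proof -
  have e: "- (real DIM('a) / 2) * (p - 1) = - (1 / 2) - \<sigma>" by (simp add: \<sigma>_def)
  have "(D * r powr (- (real DIM('a) / 2))) powr (p - 1) = D powr (p - 1) * (r powr (- (real DIM('a) / 2))) powr (p - 1)"
    using assms by (intro powr_mult)
  then show ?thesis unfolding powr_powr e .
qed

text \<open>The profile is a Gaussian height of virtual age \<tau>. The new constant has a linear
  part independent of D and \<tau>, while its nonlinear part carries \<tau>^(-\<sigma>): the surplus
  decay (\<tau> + r)^(-\<sigma>) of the source is frozen at r = 0, and the remaining (\<tau> +
  r)^(-1/2) is what the time integral absorbs.\<close>

lemma barrier_improvement:
  fixes T \<tau> s D Q :: real
  assumes T: "0 < T" and \<tau>: "0 < \<tau>" and s: "0 < s" and D: "0 < D"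
    and init: "Linf_le (\<tau> powr (- (real DIM('a) / 2))) (u T)"
    and b: "\<And>r. 0 \<le> r \<Longrightarrow> r < s \<Longrightarrow> Linf_le (D * (\<tau> + r) powr (- (real DIM('a) / 2))) (u (T + r))"
  defines "Q \<equiv> 2 * C * D powr (p - 1) * (M + D) * \<tau> powr (- \<sigma>)"
  shows "Linf_le ((2 ^ DIM('a) * (M + 1) + 2 ^ DIM('a) * (kE a 0 + 2 * kC TYPE('a) * norm a) * Q) * (\<tau> + s) powr (- (real DIM('a) / 2))) (u (T + s))"
proof -
  let ?n = "real DIM('a) / 2"
  let ?F = "\<lambda>r y. f (u (T + r) y)"
  have Q0: "0 \<le> Q" unfolding Q_def using C_nonneg D M_pos by simp
  have half: "x powr (- ?n) \<le> 2 ^ DIM('a) * (\<tau> + s) powr (- ?n)" if "(\<tau> + s) / 2 \<le> x" for x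
  proof -
    have "x powr (- ?n) \<le> ((\<tau> + s) / 2) powr (- ?n)" using that \<tau> s by (intro powr_mono2') auto
    also have "\<dots> \<le> 2 ^ DIM('a) * (\<tau> + s) powr (- ?n)" using \<tau> s by (intro powr_half_rescale) auto
    finally show ?thesis .
  qed
  have src: "L1_le (Q * (\<tau> + r) powr (- (1 / 2))) (?F r)"
    "Linf_le (Q * ((\<tau> + r) powr (- (1 / 2)) * (\<tau> + r) powr (- ?n))) (?F r)" if r: "0 < r" "r < s" for r
  proof -
    have bl: "Linf_le (D * (\<tau> + r) powr (- ?n)) (u (T + r))" using b r by simp
    have pw: "(D * (\<tau> + r) powr (- ?n)) powr (p - 1) \<le> D powr (p - 1) * (\<tau> powr (- \<sigma>) * (\<tau> + r) powr (- (1 / 2)))"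
    proof -
      have "(\<tau> + r) powr (- (1 / 2) - \<sigma>) = (\<tau> + r) powr (- \<sigma>) * (\<tau> + r) powr (- (1 / 2))"
        unfolding powr_add[symmetric] by (rule arg_cong[where f="(powr) (\<tau> + r)"]) simp
      also have "\<dots> \<le> \<tau> powr (- \<sigma>) * (\<tau> + r) powr (- (1 / 2))"
        using \<tau> r sigma_pos by (intro mult_right_mono powr_mono2') auto
      finally show ?thesis using powr_p_minus_1[of "\<tau> + r" D] \<tau> r D by (simp add: mult_left_mono)
    qed
    have k: "2 * C * (D * (\<tau> + r) powr (- ?n)) powr (p - 1) * m \<le> (2 * C * D powr (p - 1) * \<tau> powr (- \<sigma>)) * ((\<tau> + r) powr (- (1 / 2)) * m)" if "0 \<le> m" for m
    proof -
      have "2 * C * (D * (\<tau> + r) powr (- ?n)) powr (p - 1) * m \<le> 2 * C * (D powr (p - 1) * (\<tau> powr (- \<sigma>) * (\<tau> + r) powr (- (1 / 2)))) * m"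
        using C_nonneg that pw by (intro mult_right_mono mult_left_mono) auto
      then show ?thesis by (simp only: mult_ac)
    qed
    have Qm: "(2 * C * D powr (p - 1) * \<tau> powr (- \<sigma>)) * (x * (d * m)) \<le> Q * (x * m)" if "d \<le> M + D" "0 \<le> m" "0 \<le> x" for x m d
    proof -
      have "(2 * C * D powr (p - 1) * \<tau> powr (- \<sigma>)) * (x * (d * m)) = (2 * C * D powr (p - 1) * \<tau> powr (- \<sigma>)) * d * (x * m)"
        by (simp only: mult_ac)
      also have "\<dots> \<le> (2 * C * D powr (p - 1) * \<tau> powr (- \<sigma>)) * (M + D) * (x * m)"
        using that C_nonneg by (intro mult_right_mono mult_left_mono mult_nonneg_nonneg) auto
      finally show ?thesis unfolding Q_def by (simp only: mult_ac)
    qed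
    have "L1_le (2 * C * (D * (\<tau> + r) powr (- ?n)) powr (p - 1) * M) (?F r)"
      using T r by (intro f_norm(1)[OF bl] u_L1) auto
    moreover have "(2 * C * D powr (p - 1) * \<tau> powr (- \<sigma>)) * ((\<tau> + r) powr (- (1 / 2)) * (M * 1)) \<le> Q * ((\<tau> + r) powr (- (1 / 2)) * 1)"
      using M_pos D by (intro Qm) auto
    ultimately show "L1_le (Q * (\<tau> + r) powr (- (1 / 2))) (?F r)"
      using k[of M] M_pos by (auto elim!: L1_le_mono)
    have "Linf_le (2 * C * (D * (\<tau> + r) powr (- ?n)) powr (p - 1) * (D * (\<tau> + r) powr (- ?n))) (?F r)"
      by (rule f_norm(2)[OF bl])
    moreover have "(2 * C * D powr (p - 1) * \<tau> powr (- \<sigma>)) * ((\<tau> + r) powr (- (1 / 2)) * (D * (\<tau> + r) powr (- ?n))) \<le> Q * ((\<tau> + r) powr (- (1 / 2)) * (\<tau> + r) powr (- ?n))"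
      using M_pos D by (intro Qm) auto
    ultimately show "Linf_le (Q * ((\<tau> + r) powr (- (1 / 2)) * (\<tau> + r) powr (- ?n))) (?F r)"
      using k[of "D * (\<tau> + r) powr (- ?n)"] D by (auto elim!: Linf_le_mono)
  qed
  \<comment> \<open>For s \<ge> \<tau> the ages s and \<tau> + s are comparable and the decay
    estimate with \<kappa> = 0 applies; for s < \<tau> the profile is comparable with its initial
    height, and the sup bound over a time shorter than \<tau> is enough.\<close>
  have duh: "Linf_le (2 ^ DIM('a) * (kE a 0 + 2 * kC TYPE('a) * norm a) * Q * (\<tau> + s) powr (- ?n)) (duhamel a ?F 0 s s)"
  proof (cases "\<tau> \<le> s")
    case True
    have "Linf_le (kE a 0 * Q * (s powr (- 0) * s powr (- ?n))) (duhamel a ?F 0 s s)"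
    proof (rule duhamel_decay(2)[OF fu_shift_meas])
      fix r assume r: "0 < r" "r < s"
      have 1: "(\<tau> + r) powr (- (1 / 2)) \<le> r powr (- (1 / 2) - 0)" using \<tau> r by (auto intro!: powr_mono2')
      have 2: "(\<tau> + r) powr (- ?n) \<le> r powr (- ?n)" using \<tau> r by (auto intro!: powr_mono2')
      show "L1_le (Q * r powr (- (1 / 2) - 0)) (?F r)"
        by (rule L1_le_mono[OF src(1)[OF r]]) (intro mult_left_mono 1 Q0)
      show "Linf_le (Q * (r powr (- (1 / 2) - 0) * r powr (- ?n))) (?F r)"
        by (rule Linf_le_mono[OF src(2)[OF r]]) (intro mult_left_mono mult_mono 1 2 Q0; simp)
    qed (use s Q0 in auto)
    moreover have "kE a 0 * Q * (s powr (- 0) * s powr (- ?n)) \<le> kE a 0 * Q * (2 ^ DIM('a) * (\<tau> + s) powr (- ?n))"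
      using half[of s] True s kE_nonneg[of 0 a] Q0 by (intro mult_left_mono) auto
    moreover have "\<dots> \<le> (kE a 0 + 2 * kC TYPE('a) * norm a) * Q * (2 ^ DIM('a) * (\<tau> + s) powr (- ?n))"
      using Q0 by (intro mult_right_mono) auto
    ultimately show ?thesis by (elim Linf_le_mono) (simp only: mult_ac)
  next
    case False
    let ?A = "Q * (\<tau> powr (- (1 / 2)) * \<tau> powr (- ?n))"
    have "Linf_le (kC TYPE('a) * norm a * ?A * (2 * s powr (1 / 2))) (duhamel a ?F 0 s s)"
    proof (rule duhamel_bounded(1)[OF fu_shift_meas])
      fix r assume r: "0 < r" "r < s"
      show "Linf_le ?A (?F r)"
        by (rule Linf_le_mono[OF src(2)[OF r]]) (intro mult_left_mono mult_mono Q0 powr_mono2'; use \<tau> r in simp)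
    qed (use s Q0 in auto)
    note L = this
    have "kC TYPE('a) * norm a * ?A * (2 * s powr (1 / 2)) \<le> kC TYPE('a) * norm a * ?A * (2 * \<tau> powr (1 / 2))"
      using False s Q0 by (intro mult_left_mono powr_mono2) auto
    also have "\<dots> = 2 * kC TYPE('a) * norm a * Q * \<tau> powr (- ?n) * (\<tau> powr (- (1 / 2)) * \<tau> powr (1 / 2))"
      by (simp only: mult_ac)
    also have "\<tau> powr (- (1 / 2)) * \<tau> powr (1 / 2) = 1" unfolding powr_add[symmetric] using \<tau> by simp
    also have "2 * kC TYPE('a) * norm a * Q * \<tau> powr (- ?n) * 1 \<le> 2 * kC TYPE('a) * norm a * Q * (2 ^ DIM('a) * (\<tau> + s) powr (- ?n))"
      using half[of \<tau>] False Q0 by (simp add: mult_left_mono)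
    also have "\<dots> \<le> (kE a 0 + 2 * kC TYPE('a) * norm a) * Q * (2 ^ DIM('a) * (\<tau> + s) powr (- ?n))"
      using Q0 kE_nonneg[of 0 a] by (intro mult_right_mono) auto
    also have "(kE a 0 + 2 * kC TYPE('a) * norm a) * Q * (2 ^ DIM('a) * (\<tau> + s) powr (- ?n)) = 2 ^ DIM('a) * (kE a 0 + 2 * kC TYPE('a) * norm a) * Q * (\<tau> + s) powr (- ?n)"
      by (simp only: mult_ac)
    finally show ?thesis by (rule Linf_le_mono[OF L])
  qed
  have heat: "Linf_le (2 ^ DIM('a) * (M + 1) * (\<tau> + s) powr (- ?n)) (heat s (u T))"
  proof (cases "\<tau> \<le> s")
    case True
    have "s powr (- real DIM('a) / 2) * M \<le> (2 ^ DIM('a) * (\<tau> + s) powr (- ?n)) * (M + 1)"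
      using half[of s] True M_pos by (intro mult_mono) auto
    then show ?thesis by (intro Linf_le_mono[OF heat_L1_Linf[OF s u_L1[OF T]]]) (simp only: mult_ac)
  next
    case False
    have "\<tau> powr (- ?n) * 1 \<le> (2 ^ DIM('a) * (\<tau> + s) powr (- ?n)) * (M + 1)"
      using half[of \<tau>] False M_pos by (intro mult_mono) auto
    then show ?thesis by (intro Linf_le_mono[OF heat_Linf[OF s init]]) (simp only: mult_ac mult_1_right)
  qed
  show ?thesis
    unfolding distrib_right[of _ _ "(\<tau> + s) powr (- ?n)"]
    by (rule Linf_le_cong_AE[OF Linf_le_add[OF heat duh] u_section restart[OF T s]])
qed

text \<open>The order of the choices matters: D is twice the linear constant, then \<tau> is so
  large that the nonlinear part is at most D/4, and only then is \<open>T\<close> taken at a time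
  when the sup norm lies below the height of age \<tau>. The improved constant (3/4) D leaves room
  for continuity in time.\<close>

lemma exists_barrier: "\<exists>T>0. \<exists>\<tau>>0. \<exists>D>0. \<forall>s\<ge>0. Linf_le (D * (\<tau> + s) powr (- (real DIM('a) / 2))) (u (T + s))"
proof -
  let ?n = "real DIM('a) / 2"
  define D where "D = 2 * (2 ^ DIM('a) * (M + 1))"
  have "1 * 1 \<le> 2 ^ DIM('a) * (M + 1)" using M_pos by (intro mult_mono one_le_power) auto
  then have D2: "2 \<le> D" by (simp add: D_def)
  then have D: "0 < D" by linarith
  define k where "k = 2 ^ DIM('a) * (kE a 0 + 2 * kC TYPE('a) * norm a) * (2 * C * D powr (p - 1) * (M + D))"
  have k0: "0 \<le> k" unfolding k_def using kE_nonneg[of 0 a] C_nonneg M_pos D by (intro mult_nonneg_nonneg add_nonneg_nonneg) auto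
  define \<tau> where "\<tau> = (1 / (4 * (k + 1))) powr (- (1 / \<sigma>))"
  have x: "0 < 1 / (4 * (k + 1))" using k0 by simp
  have \<tau>: "0 < \<tau>" unfolding \<tau>_def using k0 by simp
  have "\<tau> powr (- \<sigma>) = 1 / (4 * (k + 1))" unfolding \<tau>_def powr_powr using sigma_pos x by simp
  then have "k * \<tau> powr (- \<sigma>) = k * (1 / (4 * (k + 1)))" by simp
  also have "\<dots> \<le> (k + 1) * (1 / (4 * (k + 1)))" using k0 by (intro mult_right_mono) auto
  also have "\<dots> = 1 / 4" using k0 by (intro cancel_pos) simp
  also have "\<dots> \<le> D / 4" using D2 by simp
  finally have small: "k * \<tau> powr (- \<sigma>) \<le> D / 4" .
  obtain T where T: "1 \<le> T" "Linf_le (\<tau> powr (- ?n)) (u T)"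
    using sup_small[of "\<tau> powr (- ?n)"] \<tau> by auto
  have T0: "0 < T" using T by simp
  define B where "B s = D * (\<tau> + s) powr (- ?n)" for s
  have B0: "0 < B s" if "0 \<le> s" for s using D \<tau> that by (simp add: B_def)
  have A: "Linf_le (3 / 4 * B s) (u (T + s))" if s: "0 \<le> s" and b: "\<And>r. 0 \<le> r \<Longrightarrow> r < s \<Longrightarrow> Linf_le (B r) (u (T + r))" for s
  proof (cases "s = 0")
    case True
    have "1 * \<tau> powr (- ?n) \<le> (3 / 4 * D) * \<tau> powr (- ?n)" using D2 by (intro mult_right_mono) auto
    then show ?thesis using Linf_le_mono[OF T(2)] True by (simp add: B_def)
  next
    case False
    then have s0: "0 < s" using s by simp
    have "2 ^ DIM('a) * (M + 1) + 2 ^ DIM('a) * (kE a 0 + 2 * kC TYPE('a) * norm a) * (2 * C * D powr (p - 1) * (M + D) * \<tau> powr (- \<sigma>)) \<le> 3 / 4 * D"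
    proof -
      have "2 ^ DIM('a) * (kE a 0 + 2 * kC TYPE('a) * norm a) * (2 * C * D powr (p - 1) * (M + D) * \<tau> powr (- \<sigma>)) = k * \<tau> powr (- \<sigma>)"
        unfolding k_def by (simp only: mult.assoc)
      then show ?thesis using small unfolding D_def by linarith
    qed
    then have le: "(2 ^ DIM('a) * (M + 1) + 2 ^ DIM('a) * (kE a 0 + 2 * kC TYPE('a) * norm a) * (2 * C * D powr (p - 1) * (M + D) * \<tau> powr (- \<sigma>))) * (\<tau> + s) powr (- ?n)
       \<le> (3 / 4 * D) * (\<tau> + s) powr (- ?n)" by (intro mult_right_mono) auto
    show ?thesis unfolding B_def
      using Linf_le_mono[OF barrier_improvement[OF T0 \<tau> s0 D T(2) b[unfolded B_def]] le] by (simp add: mult.assoc)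
  qed
  have Bc: "\<exists>d>0. \<forall>r. s \<le> r \<and> r < s + d \<longrightarrow> 7 / 8 * B s \<le> B r" if s: "0 \<le> s" for s
  proof -
    have "isCont B s" unfolding B_def using \<tau> s by (intro continuous_intros) auto
    then obtain d where d: "d > 0" "\<And>r. dist r s < d \<Longrightarrow> dist (B r) (B s) < B s / 8"
      unfolding continuous_at_eps_delta using B0[OF s] by (metis divide_pos_pos zero_less_numeral)
    have "7 / 8 * B s \<le> B r" if "s \<le> r" "r < s + d" for r
    proof -
      have "dist r s < d" using that by (simp add: dist_real_def)
      from d(2)[OF this] show ?thesis unfolding dist_real_def by linarith
    qed
    then show ?thesis using d(1) by blast
  qed
  have P: "Linf_le (B s) (u (T + s))" if "0 \<le> s" for s
  proof (rule ccontr)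
    assume neg: "\<not> Linf_le (B s) (u (T + s))"
    \<comment> \<open>At the infimum of the failing times the bound holds with the factor 3/4, by
      improvement from all earlier times. Continuity adds 1/8, and shortly afterwards the profile
      still exceeds 7/8 of its value, so failing times cannot accumulate there.\<close>
    define S where "S = {r. 0 \<le> r \<and> \<not> Linf_le (B r) (u (T + r))}"
    have S: "S \<noteq> {}" "bdd_below S" using neg that by (auto simp: S_def intro: bdd_belowI[of _ 0])
    define s1 where "s1 = Inf S"
    have s1: "0 \<le> s1" unfolding s1_def by (rule cInf_greatest[OF S(1)]) (auto simp: S_def)
    have before: "Linf_le (B r) (u (T + r))" if "0 \<le> r" "r < s1" for r
      using cInf_lower[OF _ S(2), of r] that unfolding s1_def S_def by force
    have a3: "Linf_le (3 / 4 * B s1) (u (T + s1))" by (rule A[OF s1 before])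
    obtain d1 where d1: "d1 > 0" "\<And>r. s1 \<le> r \<Longrightarrow> r < s1 + d1 \<Longrightarrow> 7 / 8 * B s1 \<le> B r" using Bc[OF s1] by blast
    obtain d2 where d2: "d2 > 0" "\<And>r. 0 < r \<Longrightarrow> \<bar>r - (T + s1)\<bar> < d2 \<Longrightarrow> Linf_le (B s1 / 8) (\<lambda>x. u r x - u (T + s1) x)"
      using u_cont[of "T + s1" "B s1 / 8"] T0 s1 B0[OF s1] by auto
    obtain r where r: "r \<in> S" "r < s1 + min d1 d2"
      using cInf_lessD[OF S(1), of "s1 + min d1 d2"] d1(1) d2(1) by (auto simp: s1_def)
    have rs: "s1 \<le> r" unfolding s1_def by (rule cInf_lower[OF r(1) S(2)])
    have "Linf_le (B s1 / 8) (\<lambda>x. u (T + r) x - u (T + s1) x)"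
      by (rule d2(2)) (use rs r T0 s1 in auto)
    from Linf_le_add[OF this a3] have "Linf_le (B s1 / 8 + 3 / 4 * B s1) (u (T + r))" by simp
    moreover have "B s1 / 8 + 3 / 4 * B s1 \<le> B r" using d1(2)[OF rs] r by simp
    ultimately have "Linf_le (B r) (u (T + r))" by (rule Linf_le_mono)
    then show False using r(1) by (simp add: S_def)
  qed
  show ?thesis using T0 \<tau> D P unfolding B_def by blast
qed

text \<open>The constant removes the shifts: for t \<ge> 2T one has \<tau> + t - T \<ge> t/2, and
  for t < 2T the uniform bound \<open>M\<close> is compensated by (2T)^(n/2), since the weight
  t^(-n/2) is at least (2T)^(-n/2) there.\<close>

lemma u_decay: "\<exists>K\<ge>M. \<forall>t>0. Linf_le (K * t powr (- (real DIM('a) / 2))) (u t)"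
proof -
  let ?n = "real DIM('a) / 2"
  obtain T \<tau> D where T: "0 < T" and \<tau>: "0 < \<tau>" and D: "0 < D"
    and b: "\<And>s. 0 \<le> s \<Longrightarrow> Linf_le (D * (\<tau> + s) powr (- ?n)) (u (T + s))"
    using exists_barrier by blast
  define K where "K = D * 2 ^ DIM('a) + M * (2 * T) powr ?n + M"
  have K: "M \<le> K" "D * 2 ^ DIM('a) \<le> K" "M * (2 * T) powr ?n \<le> K" using D M_pos by (auto simp: K_def)
  have "Linf_le (K * t powr (- ?n)) (u t)" if t: "0 < t" for t
  proof (cases "2 * T \<le> t")
    case True
    have "(\<tau> + (t - T)) powr (- ?n) \<le> (t / 2) powr (- ?n)" using True \<tau> t by (intro powr_mono2') auto
    also have "\<dots> \<le> 2 ^ DIM('a) * t powr (- ?n)" using t by (intro powr_half_rescale) auto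
    finally have "D * (\<tau> + (t - T)) powr (- ?n) \<le> D * (2 ^ DIM('a) * t powr (- ?n))" using D by (intro mult_left_mono) auto
    also have "\<dots> = (D * 2 ^ DIM('a)) * t powr (- ?n)" by simp
    also have "\<dots> \<le> K * t powr (- ?n)" by (intro mult_right_mono K) auto
    finally show ?thesis using b[of "t - T"] True T by (auto elim!: Linf_le_mono)
  next
    case False
    have "1 = t powr ?n * t powr (- ?n)" unfolding powr_add[symmetric] using t by simp
    also have "\<dots> \<le> (2 * T) powr ?n * t powr (- ?n)" using False t by (intro mult_right_mono powr_mono2) auto
    finally have "M * 1 \<le> M * ((2 * T) powr ?n * t powr (- ?n))" using M_pos by (intro mult_left_mono) auto
    also have "\<dots> = (M * (2 * T) powr ?n) * t powr (- ?n)" by simp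
    also have "\<dots> \<le> K * t powr (- ?n)" by (intro mult_right_mono K) auto
    finally show ?thesis using u_Linf[OF t] by (auto elim!: Linf_le_mono)
  qed
  then show ?thesis using K(1) by blast
qed

end

subsection \<open>Parabolically weighted bounds\<close>

text \<open>The two norms scale as for \<open>c * heatG t\<close>; the remaining \<open>L\<^sup>q\<close> norms follow by interpolation.\<close>

definition wb :: "real \<Rightarrow> real \<Rightarrow> ('a::euclidean_space \<Rightarrow> real) \<Rightarrow> bool" where
  "wb c t \<phi> \<longleftrightarrow> L1_le c \<phi> \<and> Linf_le (c * t powr (- (real DIM('a) / 2))) \<phi>"

lemma wbD: "wb c t \<phi> \<Longrightarrow> L1_le c \<phi>"
    "wb c t (\<phi>::'a::euclidean_space \<Rightarrow> real) \<Longrightarrow> Linf_le (c * t powr (- (real DIM('a) / 2))) \<phi>"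
    "wb c t \<phi> \<Longrightarrow> \<phi> \<in> borel_measurable borel"
  by (auto simp: wb_def Linf_le_def)

lemma wb_nonneg: "wb c t \<phi> \<Longrightarrow> 0 \<le> c"
  using wbD(1) L1_le_nonneg by blast

lemma wb_mono: "wb c t \<phi> \<Longrightarrow> c \<le> d \<Longrightarrow> wb d t \<phi>"
  unfolding wb_def by (auto elim!: L1_le_mono Linf_le_mono intro!: mult_right_mono)

lemma wb_add: "wb c t \<phi> \<Longrightarrow> wb d t \<psi> \<Longrightarrow> wb (c + d) t (\<lambda>x. \<phi> x + \<psi> x)"
  unfolding wb_def distrib_right by (auto intro: L1_le_add Linf_le_add)

lemma wb_diff: "wb c t \<phi> \<Longrightarrow> wb d t \<psi> \<Longrightarrow> wb (c + d) t (\<lambda>x. \<phi> x - \<psi> x)"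
  unfolding wb_def distrib_right by (auto intro: L1_le_diff Linf_le_diff)

lemma wb_cmult: "wb c t \<phi> \<Longrightarrow> wb (\<bar>r\<bar> * c) t (\<lambda>x. r * \<phi> x)"
  unfolding wb_def using L1_le_cmult[of c \<phi> r] Linf_le_cmult[of _ \<phi> r] by (auto simp: mult.assoc)

lemma wb_cong_AE:
  assumes "wb c t \<psi>" "\<phi> \<in> borel_measurable borel" "AE x in lborel. \<phi> x = \<psi> x"
  shows "wb c t \<phi>"
  using assms L1_le_cong_AE Linf_le_cong_AE unfolding wb_def by blast

lemma wb_kernel:
  fixes k :: "'a::euclidean_space \<Rightarrow> real"
  assumes "L1_le c k" "\<And>z. \<bar>k z\<bar> \<le> c * t powr (- real DIM('a) / 2)"
  shows "wb c t k"
  using assms L1_le_measurable[OF assms(1)] by (auto simp: wb_def Linf_le_def)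

lemma wb_heatG: "0 < t \<Longrightarrow> wb 1 t (heatG t)"
  by (rule wb_kernel) (auto simp: heatG_L1 heatG_le[simplified])

lemma wb_gradG: "0 < t \<Longrightarrow> wb (kC TYPE('a) * norm a * t powr (- 1 / 2)) t (gradG (a::'a::euclidean_space) t)"
  by (rule wb_kernel[OF gradG_L1 gradG_le])

lemma wb_Minkowski:
  fixes H :: "'w \<Rightarrow> 'a::euclidean_space \<Rightarrow> real"
  assumes "sigma_finite_measure N"
    and "(\<lambda>(w, x). H w x) \<in> borel_measurable (N \<Otimes>\<^sub>M lborel)"
    and H: "AE w in N. wb (m w) t (H w)" and m: "integrable N m"
  shows "wb (\<integral>w. m w \<partial>N) t (\<lambda>x. \<integral>w. H w x \<partial>N)"
proof -
  let ?c = "t powr (- (real DIM('a) / 2))"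
  have 1: "AE w in N. L1_le (m w) (H w)" using H by eventually_elim (auto simp: wb_def)
  have 2: "AE w in N. Linf_le (m w * ?c) (H w)" using H by eventually_elim (auto simp: wb_def)
  have "L1_le (\<integral>w. m w \<partial>N) (\<lambda>x. \<integral>w. H w x \<partial>N)" by (rule Minkowski_L1_le[OF assms(1,2) 1 m])
  moreover have "Linf_le (\<integral>w. m w * ?c \<partial>N) (\<lambda>x. \<integral>w. H w x \<partial>N)"
    by (rule Minkowski_Linf_le[OF assms(1,2) 2]) (use m in simp)
  ultimately show ?thesis unfolding wb_def by simp
qed

lemma wb_duhamel_decay:
  fixes F :: "real \<Rightarrow> 'a::euclidean_space \<Rightarrow> real"
  assumes F: "case_prod F \<in> borel_measurable (borel \<Otimes>\<^sub>M borel)"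
    and t: "0 < t" "0 \<le> t0" "t1 \<le> t" and k: "0 \<le> \<kappa>" "\<kappa> < 1 / 2" and A: "0 \<le> A"
    and b: "\<And>s. 0 < s \<Longrightarrow> s < t \<Longrightarrow> t0 \<le> s \<Longrightarrow> s \<le> t1 \<Longrightarrow> wb (A * s powr (- (1 / 2) - \<kappa>)) s (F s)"
  shows "wb (kE a \<kappa> * A * t powr (- \<kappa>)) t (duhamel a F t0 t1 t)"
    and "AE x in lborel. set_integrable lborel {t0..t1} (\<lambda>s. grad_heat a (t - s) (F s) x)"
proof -
  have b1: "L1_le (A * s powr (- (1 / 2) - \<kappa>)) (F s)"
    and b2: "Linf_le (A * (s powr (- (1 / 2) - \<kappa>) * s powr (- (real DIM('a) / 2)))) (F s)"
    if "0 < s" "s < t" "t0 \<le> s" "s \<le> t1" for s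
    using b[OF that] by (auto simp: wb_def mult.assoc)
  note D = duhamel_decay[OF F t k A b1 b2, where a=a]
  show "wb (kE a \<kappa> * A * t powr (- \<kappa>)) t (duhamel a F t0 t1 t)"
    using D(1,2) by (simp add: wb_def mult.assoc)
  show "AE x in lborel. set_integrable lborel {t0..t1} (\<lambda>s. grad_heat a (t - s) (F s) x)"
    by (rule D(3))
qed

text \<open>Interpolation by |\<phi>|^r \<le> l^(r - 1) |\<phi>| with l the sup bound. The exponent
  uses \<open>1 / q\<close> in the extended reals, so q = \<infinity> gives 1 / q = 0 and the full
  power n/2.\<close>

lemma wb_Lq:
  fixes \<phi> :: "'a::euclidean_space \<Rightarrow> real"
  assumes \<phi>: "wb c t \<phi>" and c: "0 < c" and t: "0 < t" and q: "1 \<le> q"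
  shows "memLq q \<phi>"
    and "0 \<le> Lq_norm q \<phi>"
    and "Lq_norm q \<phi> \<le> c * t powr (- (real DIM('a) / 2) * (1 - real_of_ereal (1 / q)))"
proof -
  let ?n = "real DIM('a) / 2"
  define l where "l = c * t powr (- ?n)"
  have l0: "0 < l" using c t by (simp add: l_def)
  note [measurable] = wbD(3)[OF \<phi>]
  have ae: "AE x in lborel. \<bar>\<phi> x\<bar> \<le> l" using Linf_leD(2)[OF wbD(2)[OF \<phi>]] by (simp add: l_def)
  have L1: "integrable lborel \<phi>" "(\<integral>x. \<bar>\<phi> x\<bar> \<partial>lborel) \<le> c" using L1_leD[OF wbD(1)[OF \<phi>]] by auto
  have "memLq q \<phi> \<and> 0 \<le> Lq_norm q \<phi> \<and> Lq_norm q \<phi> \<le> c * t powr (- ?n * (1 - real_of_ereal (1 / q)))"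
  proof (cases "q = \<infinity>")
    case True
    have e1: "esssup lborel (\<lambda>x. ereal \<bar>\<phi> x\<bar>) \<le> ereal l"
      by (rule esssup_I) (use ae in auto)
    have e0: "0 \<le> esssup lborel (\<lambda>x. ereal \<bar>\<phi> x\<bar>)"
    proof -
      have "esssup (lborel :: 'a measure) (\<lambda>x. 0 :: ereal) \<le> esssup lborel (\<lambda>x. ereal \<bar>\<phi> x\<bar>)" by (rule esssup_mono) auto
      then show ?thesis by (subst (asm) esssup_const) auto
    qed
    have "real_of_ereal (esssup lborel (\<lambda>x. ereal \<bar>\<phi> x\<bar>)) \<le> l"
      using e0 e1 by (metis real_of_ereal_le_0 ereal_less_eq(3) real_of_ereal_positive_mono real_of_ereal.simps(1) ereal_infty_less(1) less_ereal.simps(4) PInfty_neq_ereal(1))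
    moreover have "esssup lborel (\<lambda>x. ereal \<bar>\<phi> x\<bar>) < \<infinity>" using e1 by (rule le_less_trans) simp
    ultimately show ?thesis
      using True e0 by (simp add: memLq_def Lq_norm_def l_def real_of_ereal_pos)
  next
    case False
    then obtain r where r: "q = ereal r" "1 \<le> r" using q by (cases q) auto
    have pw: "AE x in lborel. \<bar>\<phi> x\<bar> powr r \<le> l powr (r - 1) * \<bar>\<phi> x\<bar>"
      using ae
    proof eventually_elim
      case (elim x)
      show ?case
      proof (cases "\<phi> x = 0")
        case False
        have "\<bar>\<phi> x\<bar> powr r = \<bar>\<phi> x\<bar> powr (r - 1) * \<bar>\<phi> x\<bar>"
          using False powr_add[of "\<bar>\<phi> x\<bar>" "r - 1" 1] by simp
        also have "\<dots> \<le> l powr (r - 1) * \<bar>\<phi> x\<bar>"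
          using elim r by (intro mult_right_mono powr_mono2) auto
        finally show ?thesis .
      qed simp
    qed
    have i: "integrable lborel (\<lambda>x. l powr (r - 1) * \<bar>\<phi> x\<bar>)" using L1(1) by simp
    have j: "integrable lborel (\<lambda>x. \<bar>\<phi> x\<bar> powr r)"
      by (rule Bochner_Integration.integrable_bound[OF i]) (use pw in \<open>auto elim!: eventually_mono\<close>)
    have "(\<integral>x. \<bar>\<phi> x\<bar> powr r \<partial>lborel) \<le> (\<integral>x. l powr (r - 1) * \<bar>\<phi> x\<bar> \<partial>lborel)"
      by (rule integral_mono_AE[OF j i pw])
    also have "\<dots> \<le> l powr (r - 1) * c" using L1(2) by (simp add: mult_left_mono)
    finally have "(\<integral>x. \<bar>\<phi> x\<bar> powr r \<partial>lborel) powr (1 / r) \<le> (l powr (r - 1) * c) powr (1 / r)"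
      using r by (intro powr_mono2) auto
    also have "\<dots> = c * t powr (- ?n * (1 - 1 / r))"
    proof -
      have "l powr (r - 1) * c = c powr r * t powr (- ?n * (r - 1))"
      proof -
        have "c powr (r - 1) * c = c powr r" using c powr_add[of c "r - 1" 1] by simp
        moreover have "l powr (r - 1) = c powr (r - 1) * t powr (- ?n * (r - 1))"
          unfolding l_def powr_powr[symmetric] using c by (intro powr_mult)
        ultimately show ?thesis by (metis mult.commute mult.left_commute)
      qed
      then have "(l powr (r - 1) * c) powr (1 / r) = (c powr r) powr (1 / r) * (t powr (- ?n * (r - 1))) powr (1 / r)"
        by (simp only: powr_mult)
      also have "(c powr r) powr (1 / r) = c" unfolding powr_powr using r c by simp
      also have "(t powr (- ?n * (r - 1))) powr (1 / r) = t powr (- ?n * (1 - 1 / r))"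
        unfolding powr_powr using r by (intro arg_cong[where f="(powr) t"]) (simp add: field_simps)
      finally show ?thesis .
    qed
    finally show ?thesis using r j by (simp add: memLq_def Lq_norm_def divide_ereal_def one_ereal_def inverse_eq_divide)
  qed
  then show "memLq q \<phi>" "0 \<le> Lq_norm q \<phi>" "Lq_norm q \<phi> \<le> c * t powr (- (real DIM('a) / 2) * (1 - real_of_ereal (1 / q)))"
    by auto
qed

subsection \<open>Algebra of Duhamel terms\<close>

lemma grad_heat_measurable_comp:
  fixes F :: "real \<Rightarrow> 'a::euclidean_space \<Rightarrow> real"
  assumes F: "case_prod F \<in> borel_measurable (borel \<Otimes>\<^sub>M borel)"
    and [measurable]: "g \<in> borel_measurable N" "h \<in> borel_measurable N" "z \<in> borel_measurable N"
  shows "(\<lambda>w. grad_heat a (g w) (F (h w)) (z w)) \<in> borel_measurable N"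
proof -
  have [measurable]: "(\<lambda>v. F (h (fst v)) (snd v)) \<in> borel_measurable (N \<Otimes>\<^sub>M lborel)"
    by (rule joint_measurable_comp[OF F]) auto
  have "(\<lambda>w. \<integral>y. gradG a (g w) (z w - y) * F (h w) y \<partial>lborel) \<in> borel_measurable N"
    by (rule lborel.borel_measurable_lebesgue_integral) (simp add: case_prod_beta', measurable)
  then show ?thesis unfolding grad_heat_conv conv_def .
qed

lemma duhamel_joint_measurable:
  fixes F :: "real \<Rightarrow> 'a::euclidean_space \<Rightarrow> real"
  assumes F: "case_prod F \<in> borel_measurable (borel \<Otimes>\<^sub>M borel)"
    and [measurable]: "t1 \<in> borel_measurable borel"
  shows "case_prod (\<lambda>t. duhamel a F t0 (t1 t) t) \<in> borel_measurable (borel \<Otimes>\<^sub>M borel)"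
proof -
  have [measurable]: "(\<lambda>v. grad_heat a (fst (fst v) - snd v) (F (snd v)) (snd (fst v))) \<in> borel_measurable ((borel \<Otimes>\<^sub>M borel) \<Otimes>\<^sub>M lborel)"
    by (rule grad_heat_measurable_comp[OF F]) auto
  have "(\<lambda>v::(real \<times> 'a) \<times> real. indicator {t0..t1 (fst (fst v))} (snd v) :: real)
      = (\<lambda>v. if t0 \<le> snd v \<and> snd v \<le> t1 (fst (fst v)) then 1 else 0)"
    by (auto simp: fun_eq_iff indicator_def)
  then have [measurable]: "(\<lambda>v::(real \<times> 'a) \<times> real. indicator {t0..t1 (fst (fst v))} (snd v) :: real) \<in> borel_measurable ((borel \<Otimes>\<^sub>M borel) \<Otimes>\<^sub>M lborel)"
    by simp
  have "(\<lambda>w. \<integral>s. indicator {t0..t1 (fst w)} s * grad_heat a (fst w - s) (F s) (snd w) \<partial>lborel) \<in> borel_measurable (borel \<Otimes>\<^sub>M borel)"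
    by (rule lborel.borel_measurable_lebesgue_integral) (simp add: case_prod_beta', measurable)
  then show ?thesis unfolding case_prod_beta' duhamel_eq .
qed

lemma grad_heat_diff:
  fixes \<phi> \<psi> :: "'a::euclidean_space \<Rightarrow> real"
  assumes t: "0 < t" and "L1_le m \<phi>" "L1_le m' \<psi>"
  shows "grad_heat a t (\<lambda>y. \<phi> y - \<psi> y) x = grad_heat a t \<phi> x - grad_heat a t \<psi> x"
  unfolding grad_heat_conv conv_def right_diff_distrib
  by (rule Bochner_Integration.integral_diff)
     (rule conv_bounded_kernel_integrable[OF _ gradG_le[OF t]], simp, rule assms)+

text \<open>Linearity is available at points where both time integrals converge, hence almost
  everywhere; the default value 0 of a divergent Bochner integral would break it.\<close>

lemma duhamel_diff:
  fixes F G :: "real \<Rightarrow> 'a::euclidean_space \<Rightarrow> real"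
  assumes F: "case_prod F \<in> borel_measurable (borel \<Otimes>\<^sub>M borel)" and G: "case_prod G \<in> borel_measurable (borel \<Otimes>\<^sub>M borel)"
    and t: "0 < t" "0 \<le> t0" "t1 \<le> t" and k: "0 \<le> \<kappa>" "\<kappa> < 1 / 2" and A: "0 \<le> A"
    and b: "\<And>s. 0 < s \<Longrightarrow> s < t \<Longrightarrow> t0 \<le> s \<Longrightarrow> s \<le> t1 \<Longrightarrow> wb (A * s powr (- (1 / 2) - \<kappa>)) s (F s)"
    and c: "\<And>s. 0 < s \<Longrightarrow> s < t \<Longrightarrow> t0 \<le> s \<Longrightarrow> s \<le> t1 \<Longrightarrow> wb (A * s powr (- (1 / 2) - \<kappa>)) s (G s)"
  shows "AE x in lborel. duhamel a (\<lambda>s y. F s y - G s y) t0 t1 t x = duhamel a F t0 t1 t x - duhamel a G t0 t1 t x"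
proof -
  have "AE x in lborel. set_integrable lborel {t0..t1} (\<lambda>s. grad_heat a (t - s) (F s) x)"
    by (rule wb_duhamel_decay(2)[OF F t k A]) (rule b)
  moreover have "AE x in lborel. set_integrable lborel {t0..t1} (\<lambda>s. grad_heat a (t - s) (G s) x)"
    by (rule wb_duhamel_decay(2)[OF G t k A]) (rule c)
  ultimately show ?thesis
  proof eventually_elim
    case (elim x)
    have FG: "case_prod (\<lambda>s y. F s y - G s y) \<in> borel_measurable (borel \<Otimes>\<^sub>M borel)"
      using borel_measurable_diff[OF F G] by (simp add: case_prod_beta')
    have ae: "AE s in lborel. s \<noteq> 0 \<and> s \<noteq> t" using AE_lborel_neq[of "0::real"] AE_lborel_neq[of t] by eventually_elim simp
    note [measurable] = duhamel_slice_measurable[OF F, of a t x] duhamel_slice_measurable[OF G, of a t x] duhamel_slice_measurable[OF FG, of a t x]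
    have "duhamel a (\<lambda>s y. F s y - G s y) t0 t1 t x
       = (\<integral>s. indicator {t0..t1} s * grad_heat a (t - s) (F s) x - indicator {t0..t1} s * grad_heat a (t - s) (G s) x \<partial>lborel)"
      unfolding duhamel_eq
    proof (rule integral_cong_AE)
      show "AE s in lborel. indicator {t0..t1} s * grad_heat a (t - s) (\<lambda>y. F s y - G s y) x
        = indicator {t0..t1} s * grad_heat a (t - s) (F s) x - indicator {t0..t1} s * grad_heat a (t - s) (G s) x"
        using ae
      proof eventually_elim
        case (elim s)
        show ?case
        proof (cases "s \<in> {t0..t1}")
          case True
          then have s: "0 < s" "s < t" "t0 \<le> s" "s \<le> t1" using elim t by auto
          show ?thesis using grad_heat_diff[OF _ wbD(1)[OF b[OF s]] wbD(1)[OF c[OF s]], of "t - s" a x] s by (simp add: right_diff_distrib)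
        qed simp
      qed
    qed measurable
    also have "\<dots> = duhamel a F t0 t1 t x - duhamel a G t0 t1 t x"
      unfolding duhamel_eq by (rule Bochner_Integration.integral_diff) (use elim in \<open>auto simp: set_integrable_def\<close>)
    finally show ?case .
  qed
qed

lemma duhamel_split_at:
  fixes F :: "real \<Rightarrow> 'a::euclidean_space \<Rightarrow> real"
  assumes i: "set_integrable lborel {t0..t1} (\<lambda>s. grad_heat a (t - s) (F s) x)" and r: "t0 \<le> r" "r \<le> t1"
  shows "duhamel a F t0 t1 t x = duhamel a F t0 r t x + duhamel a F r t1 t x"
proof -
  let ?g = "\<lambda>s. grad_heat a (t - s) (F s) x"
  have i1: "set_integrable lborel {t0..r} ?g" "set_integrable lborel {r..t1} ?g"
    using r by (auto intro: set_integrable_subset[OF i])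
  have "duhamel a F t0 t1 t x = (\<integral>s. indicator {t0..r} s *\<^sub>R ?g s + indicator {r..t1} s *\<^sub>R ?g s \<partial>lborel)"
    unfolding duhamel_def set_lebesgue_integral_def
  proof (rule integral_cong_AE)
    show "AE s in lborel. indicator {t0..t1} s *\<^sub>R ?g s = indicator {t0..r} s *\<^sub>R ?g s + indicator {r..t1} s *\<^sub>R ?g s"
      using AE_lborel_neq[of r] by eventually_elim (use r in \<open>auto simp: indicator_def\<close>)
    show "(\<lambda>s. indicator {t0..t1} s *\<^sub>R ?g s) \<in> borel_measurable lborel"
      using i by (auto simp: set_integrable_def)
    show "(\<lambda>s. indicator {t0..r} s *\<^sub>R ?g s + indicator {r..t1} s *\<^sub>R ?g s) \<in> borel_measurable lborel"
      using i1 by (intro borel_measurable_add) (auto simp: set_integrable_def)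
  qed
  then show ?thesis unfolding duhamel_def set_lebesgue_integral_def
    using i1 by (simp add: set_integrable_def)
qed

text \<open>Agreement is asked on a half-open interval, the left endpoint being a null set. This
  matches sources that switch from one formula to another at time 1.\<close>

lemma duhamel_cong:
  assumes "\<And>s. t0 < s \<Longrightarrow> s \<le> t1 \<Longrightarrow> F s = G s"
    and "case_prod F \<in> borel_measurable (borel \<Otimes>\<^sub>M borel)" "case_prod G \<in> borel_measurable (borel \<Otimes>\<^sub>M borel)"
  shows "duhamel a F t0 t1 t x = duhamel a G t0 t1 t x"
  unfolding duhamel_eq
proof (rule integral_cong_AE)
  show "AE s in lborel. indicator {t0..t1} s * grad_heat a (t - s) (F s) x = indicator {t0..t1} s * grad_heat a (t - s) (G s) x"
    using AE_lborel_neq[of t0] by eventually_elim (use assms(1) in \<open>auto simp: indicator_def\<close>)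
qed (use duhamel_slice_measurable[OF assms(2), of a t x] duhamel_slice_measurable[OF assms(3), of a t x] in auto)

subsection \<open>First-order expansion of the heat flow\<close>

text \<open>The self-similar profile of the expansion is, up to sign, a derivative of the Gaussian
  at time t: it is \<open>gradG b 1\<close> scaled from time 1.\<close>

lemma dil_xG1:
  fixes b x :: "'a::euclidean_space"
  assumes t: "0 < t"
  shows "1 / 2 * t powr (- 1 / 2) * dil t (xG1 b) x = - gradG b t x"
proof -
  define c where "c = sqrt t"
  have c: "0 < c" "c\<^sup>2 = t" using t by (auto simp: c_def)
  define z where "z = (1 / c) *\<^sub>R x"
  have x: "x = c *\<^sub>R z" using c by (simp add: z_def)
  have tc: "t powr (- 1 / 2) = 1 / c" "t powr (- real DIM('a) / 2) = c powr (- real DIM('a))"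
  proof -
    show "t powr (- 1 / 2) = 1 / c" using t by (simp add: c_def powr_minus_divide powr_half_sqrt)
    have "c powr (- real DIM('a)) = (t powr (1 / 2)) powr (- real DIM('a))" using t by (simp add: c_def powr_half_sqrt)
    then show "t powr (- real DIM('a) / 2) = c powr (- real DIM('a))" unfolding powr_powr by simp
  qed
  have "gradG b t x = c powr (- real DIM('a) - 1) * gradG b 1 z"
    using gradG_scale[of c 1 b z] c x by simp
  also have "\<dots> = - (1 / 2 * (1 / c) * (c powr (- real DIM('a)) * ((z \<bullet> b) * heatG 1 z)))"
    using c(1) by (simp add: gradG_def powr_diff inner_commute field_simps)
  finally show ?thesis unfolding dil_def xG1_def tc z_def[symmetric] by simp
qed

text \<open>The Taylor bound of \<open>heatG_taylor_est\<close> averaged against |u0|. It is at most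
  a multiple of \<open>t powr (- 1 / 2)\<close> times the first absolute moment, and of smaller
  order as t grows.\<close>

definition heat_remainder :: "('a::euclidean_space \<Rightarrow> real) \<Rightarrow> real \<Rightarrow> real" where
  "heat_remainder u0 t = (\<integral>y. \<bar>u0 y\<bar> * (3 * kC TYPE('a) * (norm y / sqrt t) * min 1 (norm y / sqrt t)) \<partial>lborel)"

lemma L11_norm_integrable:
  fixes u0 :: "'a::euclidean_space \<Rightarrow> real"
  assumes "L11 u0"
  shows "integrable lborel (\<lambda>y. norm y * \<bar>u0 y\<bar>)"
proof (rule Bochner_Integration.integrable_bound)
  have m[measurable]: "u0 \<in> borel_measurable borel" using assms by (auto simp: L11_def)
  show "integrable lborel (\<lambda>y. \<Sum>b\<in>Basis. \<bar>(y \<bullet> b) * u0 y\<bar>)"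
    using assms by (auto simp: L11_def intro!: Bochner_Integration.integrable_sum)
  show "(\<lambda>y. norm y * \<bar>u0 y\<bar>) \<in> borel_measurable lborel" by measurable
  show "AE y in lborel. norm (norm y * \<bar>u0 y\<bar>) \<le> norm (\<Sum>b\<in>Basis. \<bar>(y \<bullet> b) * u0 y\<bar>)"
  proof (rule AE_I2)
    fix y :: 'a
    have "norm y * \<bar>u0 y\<bar> \<le> (\<Sum>b\<in>Basis. \<bar>y \<bullet> b\<bar>) * \<bar>u0 y\<bar>" by (intro mult_right_mono norm_le_l1) auto
    also have "\<dots> = (\<Sum>b\<in>Basis. \<bar>(y \<bullet> b) * u0 y\<bar>)" by (simp add: sum_distrib_right abs_mult)
    finally show "norm (norm y * \<bar>u0 y\<bar>) \<le> norm (\<Sum>b\<in>Basis. \<bar>(y \<bullet> b) * u0 y\<bar>)" by (simp add: sum_nonneg)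
  qed
qed

lemma heat_remainder_eq:
  fixes u0 :: "'a::euclidean_space \<Rightarrow> real"
  assumes t: "0 < t"
  shows "heat_remainder u0 t = t powr (- 1 / 2) * (\<integral>y. (3 * kC TYPE('a) * (norm y * \<bar>u0 y\<bar>)) * min 1 (norm y / sqrt t) \<partial>lborel)"
proof -
  have "t powr (- 1 / 2) = 1 / sqrt t" using t by (simp add: powr_minus_divide powr_half_sqrt)
  then have "\<bar>u0 y\<bar> * (3 * kC TYPE('a) * (norm y / sqrt t) * min 1 (norm y / sqrt t))
     = t powr (- 1 / 2) * ((3 * kC TYPE('a) * (norm y * \<bar>u0 y\<bar>)) * min 1 (norm y / sqrt t))" for y
    by simp
  then show ?thesis unfolding heat_remainder_def by simp
qed

lemma min_weight_bound: "0 \<le> g \<Longrightarrow> 0 \<le> r \<Longrightarrow> \<bar>g * min 1 r\<bar> \<le> g" for g r :: real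
  by (simp add: abs_mult min_def mult_left_le)

text \<open>Dominated convergence with majorant proportional to |y| |u0(y)|: the truncated factor
  tends to 0 for each y. A first moment thus gives the little o, but no rate.\<close>

lemma heat_remainder_tendsto:
  fixes u0 :: "'a::euclidean_space \<Rightarrow> real"
  assumes u0: "L11 u0"
  shows "((\<lambda>t. t powr (1 / 2) * heat_remainder u0 t) \<longlongrightarrow> 0) at_top"
proof -
  let ?g = "\<lambda>y. 3 * kC TYPE('a) * (norm y * \<bar>u0 y\<bar>)"
  have m[measurable]: "u0 \<in> borel_measurable borel" using u0 by (auto simp: L11_def)
  have "((\<lambda>t. \<integral>y. ?g y * min 1 (norm y / sqrt t) \<partial>lborel) \<longlongrightarrow> (\<integral>y. 0 \<partial>(lborel :: 'a measure))) at_top"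
  proof (rule integral_dominated_convergence_at_top[where w="?g"])
    show "integrable lborel ?g" using L11_norm_integrable[OF u0] by simp
    show "AE y in lborel. ((\<lambda>t. ?g y * min 1 (norm y / sqrt t)) \<longlongrightarrow> 0) at_top"
    proof (rule AE_I2)
      fix y :: 'a
      have "((\<lambda>t. norm y / sqrt t) \<longlongrightarrow> 0) at_top"
        by (rule tendsto_divide_0[OF tendsto_const filterlim_mono[OF sqrt_at_top at_top_le_at_infinity order_refl]])
      then have "((\<lambda>t. min 1 (norm y / sqrt t)) \<longlongrightarrow> min 1 0) at_top" by (intro tendsto_intros)
      then show "((\<lambda>t. ?g y * min 1 (norm y / sqrt t)) \<longlongrightarrow> 0) at_top"
        using tendsto_mult_right_zero by (simp only: min_def) auto
    qed
    show "\<forall>\<^sub>F t in at_top. AE y in lborel. norm (?g y * min 1 (norm y / sqrt t)) \<le> ?g y"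
      using eventually_gt_at_top[of 0]
    proof eventually_elim
      case (elim t)
      have "norm (?g y * min 1 (norm y / sqrt t)) \<le> ?g y" for y
        unfolding real_norm_def using elim by (intro min_weight_bound) auto
      then show ?case by (intro AE_I2)
    qed
  qed measurable
  then have lim: "((\<lambda>t. \<integral>y. ?g y * min 1 (norm y / sqrt t) \<partial>lborel) \<longlongrightarrow> 0) at_top" by simp
  show ?thesis
  proof (rule Lim_transform_eventually[OF lim])
    show "\<forall>\<^sub>F t in at_top. (\<integral>y. ?g y * min 1 (norm y / sqrt t) \<partial>lborel) = t powr (1 / 2) * heat_remainder u0 t"
      using eventually_gt_at_top[of 0]
    proof eventually_elim
      case (elim t)
      have "t powr (1 / 2) * t powr (- 1 / 2) = 1" unfolding powr_add[symmetric] using elim by simp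
      then show ?case unfolding heat_remainder_eq[OF elim] by (simp add: mult.assoc[symmetric])
    qed
  qed
qed

lemma heat_remainder_le:
  fixes u0 :: "'a::euclidean_space \<Rightarrow> real"
  assumes u0: "L11 u0" and t: "0 < t"
  shows "heat_remainder u0 t \<le> t powr (- 1 / 2) * (\<integral>y. 3 * kC TYPE('a) * (norm y * \<bar>u0 y\<bar>) \<partial>lborel)"
  unfolding heat_remainder_eq[OF t]
proof (intro mult_left_mono integral_mono)
  let ?g = "\<lambda>y. 3 * kC TYPE('a) * (norm y * \<bar>u0 y\<bar>)"
  have m[measurable]: "u0 \<in> borel_measurable borel" using u0 by (auto simp: L11_def)
  show i: "integrable lborel ?g" using L11_norm_integrable[OF u0] by simp
  have b: "\<bar>?g y * min 1 (norm y / sqrt t)\<bar> \<le> ?g y" for y using t by (intro min_weight_bound) auto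
  show "integrable lborel (\<lambda>y. ?g y * min 1 (norm y / sqrt t))"
    by (rule Bochner_Integration.integrable_bound[OF i]) (use b in \<open>auto simp del: abs_mult intro: order_trans[OF b]\<close>)
  show "?g y * min 1 (norm y / sqrt t) \<le> ?g y" for y using b[of y] by linarith
qed simp

text \<open>Superpose the Taylor remainders of y \<mapsto> heatG t (x - y) with weights u0(y). The
  zeroth-order term collects the mass, and expanding \<open>gradG y\<close> along the basis collects
  the first moments.\<close>

lemma heat_expansion:
  fixes u0 :: "'a::euclidean_space \<Rightarrow> real"
  assumes u0: "L11 u0" and t: "0 < t"
  shows "wb (heat_remainder u0 t) t (\<lambda>x. heat t u0 x - A0 u0 t x + (\<Sum>b\<in>Basis. Me b u0 * gradG b t x))"
proof -
  have m[measurable]: "u0 \<in> borel_measurable borel" and i0: "integrable lborel u0"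
    and i1: "\<And>b. b \<in> Basis \<Longrightarrow> integrable lborel (\<lambda>y. (y \<bullet> b) * u0 y)" using u0 by (auto simp: L11_def)
  let ?H = "\<lambda>y x. u0 y * (heatG t (x - y) - heatG t x + gradG y t x)"
  let ?m = "\<lambda>y. \<bar>u0 y\<bar> * (3 * kC TYPE('a) * (norm y / sqrt t) * min 1 (norm y / sqrt t))"
  have "wb (\<integral>y. ?m y \<partial>lborel) t (\<lambda>x. \<integral>y. ?H y x \<partial>lborel)"
  proof (rule wb_Minkowski[OF sigma_finite_lborel])
    have "wb (?m y) t (?H y)" for y
      by (intro wb_cmult wb_kernel heatG_taylor_est t)
    then show "AE y in lborel. wb (?m y) t (?H y)" by simp
    let ?g = "\<lambda>y. 3 * kC TYPE('a) * (norm y * \<bar>u0 y\<bar>)"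
    have i: "integrable lborel (\<lambda>y. ?g y / sqrt t)" using L11_norm_integrable[OF u0] by simp
    show "integrable lborel ?m"
    proof (rule Bochner_Integration.integrable_bound[OF i])
      have "\<bar>?m y\<bar> \<le> ?g y / sqrt t" for y
      proof -
        have "?m y = (?g y / sqrt t) * min 1 (norm y / sqrt t)" by simp
        moreover have "\<bar>(?g y / sqrt t) * min 1 (norm y / sqrt t)\<bar> \<le> ?g y / sqrt t"
          using t by (intro min_weight_bound) auto
        ultimately show ?thesis by (simp only:)
      qed
      then show "AE y in lborel. norm (?m y) \<le> norm (?g y / sqrt t)" by (intro AE_I2) (metis abs_ge_self order_trans real_norm_def)
    qed measurable
  qed measurable
  moreover have "(\<integral>y. ?H y x \<partial>lborel) = heat t u0 x - A0 u0 t x + (\<Sum>b\<in>Basis. Me b u0 * gradG b t x)" for x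
  proof -
    have g: "u0 y * gradG y t x = (\<Sum>b\<in>Basis. gradG b t x * ((y \<bullet> b) * u0 y))" for y
    proof -
      have "y \<bullet> x = (\<Sum>b\<in>Basis. (y \<bullet> b) * (x \<bullet> b))" by (rule euclidean_inner)
      then show ?thesis unfolding gradG_def
        by (simp add: sum_distrib_left sum_distrib_right sum_divide_distrib sum_negf inner_commute mult_ac)
    qed
    have j1: "integrable lborel (\<lambda>y. heatG t (x - y) * u0 y)"
      by (rule conv_bounded_kernel_integrable[OF _ heatG_Linf[OF t], where m="\<integral>y. \<bar>u0 y\<bar> \<partial>lborel"]) (auto simp: L1_le_def i0)
    have j2: "integrable lborel (\<lambda>y. u0 y * gradG y t x)"
      unfolding g using i1 by (intro Bochner_Integration.integrable_sum integrable_mult_right) auto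
    have "(\<integral>y. ?H y x \<partial>lborel) = (\<integral>y. (heatG t (x - y) * u0 y - heatG t x * u0 y) + u0 y * gradG y t x \<partial>lborel)"
      by (rule Bochner_Integration.integral_cong) (auto simp: algebra_simps)
    also have "\<dots> = (\<integral>y. heatG t (x - y) * u0 y \<partial>lborel) - heatG t x * (\<integral>y. u0 y \<partial>lborel) + (\<integral>y. u0 y * gradG y t x \<partial>lborel)"
      using j1 j2 i0 by simp
    also have "(\<integral>y. u0 y * gradG y t x \<partial>lborel) = (\<Sum>b\<in>Basis. Me b u0 * gradG b t x)"
      unfolding g using i1 by (subst Bochner_Integration.integral_sum) (auto simp: Me_def mult.commute)
    finally show ?thesis by (simp add: heat_def A0_def M0_def mult.commute)
  qed
  ultimately show ?thesis unfolding heat_remainder_def by simp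
qed

subsection \<open>Asymptotic expansion\<close>

lemma wb_0: "wb 0 t (\<lambda>_::'a::euclidean_space. 0)"
  by (simp add: wb_def L1_le_def Linf_le_def)

lemma wb_sum:
  assumes "finite S" "\<And>b. b \<in> S \<Longrightarrow> wb (c b) t (\<phi> b)"
  shows "wb (\<Sum>b\<in>S. c b) t (\<lambda>x::'a::euclidean_space. \<Sum>b\<in>S. \<phi> b x)"
  using assms by (induction S rule: finite_induct) (auto simp: wb_0 intro!: wb_add)

lemma gradG_sum_Basis: "gradG a t x = (\<Sum>b\<in>Basis. (a \<bullet> b) * gradG b t (x::'a::euclidean_space))"
proof -
  have "a \<bullet> x = (\<Sum>b\<in>Basis. (a \<bullet> b) * (x \<bullet> b))" by (rule euclidean_inner)
  then show ?thesis unfolding gradG_def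
    by (simp add: sum_distrib_left sum_distrib_right sum_divide_distrib sum_negf inner_commute mult_ac)
qed

lemma powr_antimono_ge_1: "1 \<le> t \<Longrightarrow> e \<le> d \<Longrightarrow> t powr (- d) \<le> t powr (- e)" for t :: real
  by (rule powr_mono) auto

locale expansion = decaying_solution a f p C M u0 u
  for a :: "'a::euclidean_space" and f p C M u0 u +
  fixes K :: real and k :: nat
  assumes K_ge: "M \<le> K"
    and u_decays: "\<And>t. 0 < t \<Longrightarrow> Linf_le (K * t powr (- (real DIM('a) / 2))) (u t)"
    and u0_L11: "L11 u0" and k_pos: "0 < k"
    and k_low: "real k * \<sigma> < 1 / 2" and k_up: "1 / 2 < (real k + 1) * \<sigma>"
begin

lemma K_pos: "0 < K" using K_ge M_pos by linarith

lemma sigma_half: "\<sigma> < 1 / 2"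
proof -
  have "1 * \<sigma> \<le> real k * \<sigma>" using k_pos sigma_pos by (intro mult_right_mono) auto
  then show ?thesis using k_low by simp
qed

lemma u_wb: "0 < t \<Longrightarrow> wb K t (u t)"
  unfolding wb_def using L1_le_mono[OF u_L1 K_ge] u_decays by blast

lemma A0_wb: assumes "0 < t" shows "wb K t (A0 u0 t)"
proof -
  have "\<bar>M0 u0\<bar> \<le> (\<integral>x. \<bar>u0 x\<bar> \<partial>lborel)" unfolding M0_def by (rule integral_abs_bound)
  then have "\<bar>M0 u0\<bar> * 1 \<le> K" using L1_leD(2)[OF u0_L1] K_ge by simp
  then show ?thesis using wb_mono[OF wb_cmult[OF wb_heatG[OF assms], of "M0 u0"]] by (simp add: A0_def[abs_def])
qed

definition "cf B = 2 * C * B powr (p - 1)"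

lemma cf_nonneg: "0 \<le> cf B" using C_nonneg by (simp add: cf_def)

lemma f_wb_diff:
  fixes \<phi> \<psi> :: "'a \<Rightarrow> real"
  assumes "0 < t" "0 \<le> B" "wb B t \<phi>" "wb B t \<psi>" "wb c t (\<lambda>x. \<phi> x - \<psi> x)"
  shows "wb (cf B * t powr (- (1 / 2) - \<sigma>) * c) t (\<lambda>x. f (\<phi> x) - f (\<psi> x))"
proof -
  note m = wbD(3)[OF assms(3)] wbD(3)[OF assms(4)]
  note D = f_diff_norm[OF m wbD(2)[OF assms(3)] wbD(2)[OF assms(4)]]
  show ?thesis
    unfolding wb_def cf_def
    using D(1)[OF wbD(1)[OF assms(5)]] D(2)[OF wbD(2)[OF assms(5)]] powr_p_minus_1[OF assms(1,2)]
    by (simp add: mult.assoc)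
qed

lemma f_wb:
  fixes \<phi> :: "'a \<Rightarrow> real"
  assumes "0 < t" "0 \<le> B" "wb B t \<phi>"
  shows "wb (cf B * B * t powr (- (1 / 2) - \<sigma>)) t (\<lambda>x. f (\<phi> x))"
proof -
  have z: "wb B t (\<lambda>_::'a. 0)" by (rule wb_mono[OF wb_0 assms(2)])
  have "wb (cf B * t powr (- (1 / 2) - \<sigma>) * B) t (\<lambda>x. f (\<phi> x) - f 0)"
    by (rule f_wb_diff[OF assms z]) (use assms in simp)
  then show ?thesis using f_0 by (simp add: mult_ac)
qed

lemma A0_meas: "case_prod (A0 u0) \<in> borel_measurable (borel \<Otimes>\<^sub>M borel)"
  unfolding A0_def[abs_def] case_prod_beta' by measurable

lemma f_comp_meas:
  fixes F :: "real \<Rightarrow> 'a \<Rightarrow> real"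
  assumes "case_prod F \<in> borel_measurable (borel \<Otimes>\<^sub>M borel)"
  shows "case_prod (\<lambda>s y. f (F s y)) \<in> borel_measurable (borel \<Otimes>\<^sub>M borel)"
  using measurable_compose[OF assms f_measurable] by (simp add: case_prod_beta')

abbreviation "A \<equiv> A0k a f u0"

lemma A_Suc: "A (Suc j) = (\<lambda>t x. A0 u0 t x + duhamel a (\<lambda>s y. f (A0 u0 s y)) 0 1 t x + duhamel a (\<lambda>s y. f (A j s y)) 1 t t x)"
  by (simp add: fun_eq_iff)

lemma A_meas: "case_prod (A j) \<in> borel_measurable (borel \<Otimes>\<^sub>M borel)"
proof (induction j)
  case 0
  have "A 0 = A0 u0" by (simp add: fun_eq_iff)
  then show ?case using A0_meas by simp
next
  case (Suc j)
  have 1: "case_prod (\<lambda>t. duhamel a (\<lambda>s y. f (A0 u0 s y)) 0 1 t) \<in> borel_measurable (borel \<Otimes>\<^sub>M borel)"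
    by (rule duhamel_joint_measurable[OF f_comp_meas[OF A0_meas]]) simp
  have 2: "case_prod (\<lambda>t. duhamel a (\<lambda>s y. f (A j s y)) 1 t t) \<in> borel_measurable (borel \<Otimes>\<^sub>M borel)"
    by (rule duhamel_joint_measurable[OF f_comp_meas[OF Suc]]) simp
  show ?case unfolding A_Suc
    using borel_measurable_add[OF borel_measurable_add[OF A0_meas 1] 2] by (simp add: case_prod_beta')
qed

lemma A_section: "A j t \<in> borel_measurable borel"
  by (rule joint_measurable_section[OF A_meas])

text \<open>The first-order terms are themselves of size \<open>t powr (- 1 / 2)\<close>, so they
  can be moved into the error. This rate is the ceiling of the iteration.\<close>

lemma heat_leading: "\<exists>c\<ge>0. \<forall>t>0. wb (c * t powr (- (1 / 2))) t (\<lambda>x. heat t u0 x - A0 u0 t x)"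
proof -
  define c1 where "c1 = (\<integral>y. 3 * kC TYPE('a) * (norm y * \<bar>u0 y\<bar>) \<partial>lborel)"
  define c2 where "c2 = (\<Sum>b\<in>(Basis::'a set). \<bar>Me b u0\<bar> * (kC TYPE('a) * norm b))"
  have c0: "0 \<le> c1" "0 \<le> c2" unfolding c1_def c2_def by (auto intro!: sum_nonneg Bochner_Integration.integral_nonneg)
  have "wb ((c1 + c2) * t powr (- (1 / 2))) t (\<lambda>x. heat t u0 x - A0 u0 t x)" if t: "0 < t" for t
  proof -
    have 1: "wb (t powr (- 1 / 2) * c1) t (\<lambda>x. heat t u0 x - A0 u0 t x + (\<Sum>b\<in>Basis. Me b u0 * gradG b t x))"
      unfolding c1_def by (rule wb_mono[OF heat_expansion[OF u0_L11 t] heat_remainder_le[OF u0_L11 t]])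
    have 2: "wb (\<Sum>b\<in>Basis. \<bar>Me b u0\<bar> * (kC TYPE('a) * norm b * t powr (- 1 / 2))) t (\<lambda>x. \<Sum>b\<in>(Basis::'a set). Me b u0 * gradG b t x)"
      by (rule wb_sum[OF finite_Basis]) (rule wb_cmult, rule wb_gradG[OF t])
    have "(\<Sum>b\<in>(Basis::'a set). \<bar>Me b u0\<bar> * (kC TYPE('a) * norm b * t powr (- 1 / 2))) = c2 * t powr (- 1 / 2)"
      unfolding c2_def sum_distrib_right by (simp only: mult.assoc)
    with wb_diff[OF 1 2] show ?thesis by (simp add: algebra_simps)
  qed
  then show ?thesis using c0 by (intro exI[of _ "c1 + c2"]) auto
qed

section \<open>Sources of the differences between the solution and its iterates\<close>

text \<open>The Duhamel source of \<open>u - A j\<close>. It switches at time 1 as the iterates do: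
  near 0 the comparison with \<open>A0\<close> is bounded by a multiple of s^(-1/2 - \<sigma>),
  integrable since \<sigma> < 1/2, and from time 1 on the bounds on \<open>A (j - 1)\<close> can be
  used.\<close>

definition G :: "nat \<Rightarrow> real \<Rightarrow> 'a \<Rightarrow> real" where
  "G j s y = (if s \<le> 1 then f (u s y) - f (A0 u0 s y) else f (u s y) - f (A (j - 1) s y))"

lemma fdiff_meas:
  fixes F H :: "real \<Rightarrow> 'a \<Rightarrow> real"
  assumes "case_prod F \<in> borel_measurable (borel \<Otimes>\<^sub>M borel)" "case_prod H \<in> borel_measurable (borel \<Otimes>\<^sub>M borel)"
  shows "case_prod (\<lambda>s y. f (F s y) - f (H s y)) \<in> borel_measurable (borel \<Otimes>\<^sub>M borel)"
  using borel_measurable_diff[OF f_comp_meas[OF assms(1)] f_comp_meas[OF assms(2)]] by (simp add: case_prod_beta')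

lemma G_meas: "case_prod (G j) \<in> borel_measurable (borel \<Otimes>\<^sub>M borel)"
proof -
  note [measurable] = fdiff_meas[OF u_meas A0_meas, unfolded case_prod_beta'] fdiff_meas[OF u_meas A_meas, unfolded case_prod_beta']
  show ?thesis unfolding G_def[abs_def] case_prod_beta' by measurable
qed

lemma G_wb_early:
  assumes "K \<le> B" "0 < s" "s \<le> 1"
  shows "wb (2 * (cf B * B) * s powr (- (1 / 2) - \<sigma>)) s (G j s)"
proof -
  have B: "0 \<le> B" using assms K_pos by simp
  have "wb (cf B * B * s powr (- (1 / 2) - \<sigma>) + cf B * B * s powr (- (1 / 2) - \<sigma>)) s (\<lambda>y. f (u s y) - f (A0 u0 s y))"
    using assms by (intro wb_diff f_wb B wb_mono[OF u_wb] wb_mono[OF A0_wb])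
  then show ?thesis using assms by (simp add: G_def[abs_def] mult_ac)
qed

lemma G_wb_late:
  assumes B: "K \<le> B" "wb B s (A (j - 1) s)" and d: "wb c s (\<lambda>x. u s x - A (j - 1) s x)" and s: "1 < s"
  shows "wb (cf B * s powr (- (1 / 2) - \<sigma>) * c) s (G j s)"
proof -
  have "wb (cf B * s powr (- (1 / 2) - \<sigma>) * c) s (\<lambda>y. f (u s y) - f (A (j - 1) s y))"
    by (rule f_wb_diff) (use assms K_pos wb_mono[OF u_wb] in auto)
  then show ?thesis using s by (simp add: G_def[abs_def])
qed

lemma G_wb_crude:
  assumes B: "K \<le> B" "\<And>s. 1 \<le> s \<Longrightarrow> wb B s (A (j - 1) s)" and s: "0 < s"
  shows "wb (2 * (cf B * B) * s powr (- (1 / 2) - \<sigma>)) s (G j s)"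
proof (cases "s \<le> 1")
  case True
  then show ?thesis using G_wb_early B s by blast
next
  case False
  have B0: "0 \<le> B" using B K_pos by simp
  have "wb (cf B * B * s powr (- (1 / 2) - \<sigma>) + cf B * B * s powr (- (1 / 2) - \<sigma>)) s (\<lambda>y. f (u s y) - f (A (j - 1) s y))"
    using False by (intro wb_diff f_wb B0 s wb_mono[OF u_wb] B) auto
  then show ?thesis using False by (simp add: G_def[abs_def] mult_ac)
qed

text \<open>Subtract the recursion from the mild formula and cut the Duhamel integral of
  \<open>u\<close> at time 1. A crude bound on the iterate suffices, since only convergence of the
  integrals is at stake.\<close>

lemma representation:
  assumes j: "0 < j" and t: "1 \<le> t" and B: "K \<le> B" "\<And>s. 1 \<le> s \<Longrightarrow> wb B s (A (j - 1) s)"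
  shows "AE x in lborel. u t x - A j t x = (heat t u0 x - A0 u0 t x) + duhamel a (G j) 0 t t x"
    and "AE x in lborel. set_integrable lborel {0..t} (\<lambda>s. grad_heat a (t - s) (G j s) x)"
proof -
  have tp: "0 < t" using t by simp
  have B0: "0 \<le> B" using B K_pos by simp
  let ?A = "cf B * B"
  have A0: "0 \<le> ?A" "0 \<le> 2 * ?A" using cf_nonneg B0 by auto
  have Fu: "wb (?A * s powr (- (1 / 2) - \<sigma>)) s (\<lambda>y. f (u s y))" if "0 < s" for s
    by (intro f_wb B0 that wb_mono[OF u_wb] B)
  have FA: "wb (?A * s powr (- (1 / 2) - \<sigma>)) s (\<lambda>y. f (A0 u0 s y))" if "0 < s" for s
    by (intro f_wb B0 that wb_mono[OF A0_wb] B)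
  have FB: "wb (?A * s powr (- (1 / 2) - \<sigma>)) s (\<lambda>y. f (A (j - 1) s y))" if "1 \<le> s" for s
    using that by (intro f_wb B0 B) auto
  note sg = less_imp_le[OF sigma_pos] sigma_half
  show G: "AE x in lborel. set_integrable lborel {0..t} (\<lambda>s. grad_heat a (t - s) (G j s) x)"
    by (rule wb_duhamel_decay(2)[OF G_meas tp _ _ sg A0(2)]) (use G_wb_crude[OF B] in auto)
  have U: "AE x in lborel. set_integrable lborel {0..t} (\<lambda>s. grad_heat a (t - s) (\<lambda>y. f (u s y)) x)"
    by (rule wb_duhamel_decay(2)[OF fu_meas tp _ _ sg A0(1)]) (use Fu in auto)
  have D1: "AE x in lborel. duhamel a (\<lambda>s y. f (u s y) - f (A0 u0 s y)) 0 1 t x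
      = duhamel a (\<lambda>s y. f (u s y)) 0 1 t x - duhamel a (\<lambda>s y. f (A0 u0 s y)) 0 1 t x"
    by (rule duhamel_diff[OF fu_meas f_comp_meas[OF A0_meas] tp _ t sg A0(1)]) (use Fu FA in auto)
  have D2: "AE x in lborel. duhamel a (\<lambda>s y. f (u s y) - f (A (j - 1) s y)) 1 t t x
      = duhamel a (\<lambda>s y. f (u s y)) 1 t t x - duhamel a (\<lambda>s y. f (A (j - 1) s y)) 1 t t x"
    by (rule duhamel_diff[OF fu_meas f_comp_meas[OF A_meas] tp _ _ sg A0(1)]) (use Fu FB in auto)
  have C1: "duhamel a (G j) 0 1 t x = duhamel a (\<lambda>s y. f (u s y) - f (A0 u0 s y)) 0 1 t x" for x
    by (rule duhamel_cong[OF _ G_meas fdiff_meas[OF u_meas A0_meas]]) (auto simp: G_def)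
  have C2: "duhamel a (G j) 1 t t x = duhamel a (\<lambda>s y. f (u s y) - f (A (j - 1) s y)) 1 t t x" for x
    by (rule duhamel_cong[OF _ G_meas fdiff_meas[OF u_meas A_meas]]) (auto simp: G_def)
  obtain i where i: "j = Suc i" using j by (cases j) auto
  show "AE x in lborel. u t x - A j t x = (heat t u0 x - A0 u0 t x) + duhamel a (G j) 0 t t x"
    using mild[OF tp] G U D1 D2
  proof eventually_elim
    case (elim x)
    have "duhamel a (G j) 0 t t x = duhamel a (G j) 0 1 t x + duhamel a (G j) 1 t t x"
      by (rule duhamel_split_at[OF elim(2)]) (use t in auto)
    moreover have "duhamel a (\<lambda>s y. f (u s y)) 0 t t x = duhamel a (\<lambda>s y. f (u s y)) 0 1 t x + duhamel a (\<lambda>s y. f (u s y)) 1 t t x"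
      by (rule duhamel_split_at[OF elim(3)]) (use t in auto)
    moreover have "A j t x = A0 u0 t x + duhamel a (\<lambda>s y. f (A0 u0 s y)) 0 1 t x + duhamel a (\<lambda>s y. f (A (j - 1) s y)) 1 t t x"
      using i by simp
    ultimately show ?case using elim(1,4,5) C1[of x] C2[of x] by linarith
  qed
qed

lemma A_bound:
  assumes "0 \<le> c" "0 \<le> e" "\<And>t. 1 \<le> t \<Longrightarrow> wb (c * t powr (- e)) t (\<lambda>x. u t x - A i t x)" "1 \<le> t"
  shows "wb (K + c) t (A i t)"
proof -
  have "t powr (- e) \<le> t powr (- 0)" using assms by (intro powr_antimono_ge_1) auto
  then have "c * t powr (- e) \<le> c * 1" using assms by (intro mult_left_mono) auto
  then have "wb c t (\<lambda>x. u t x - A i t x)" using wb_mono[OF assms(3)[OF assms(4)]] by simp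
  from wb_diff[OF u_wb this] show ?thesis using assms(4) by simp
qed

text \<open>Two decays multiply: the factors of degree p - 1 contribute the exponent 1/2 + \<sigma>,
  the difference \<open>u - A (j - 1)\<close> contributes j \<sigma>.\<close>

lemma G_rate:
  assumes c: "0 \<le> c" and d: "\<And>t. 1 \<le> t \<Longrightarrow> wb (c * t powr (- (real j * \<sigma>))) t (\<lambda>x. u t x - A (j - 1) t x)"
    and s: "1 < s"
  shows "wb ((cf (K + c) * c) * s powr (- (1 / 2) - (real j + 1) * \<sigma>)) s (G j s)"
proof -
  have e: "0 \<le> real j * \<sigma>" using sigma_pos by simp
  have "wb (cf (K + c) * s powr (- (1 / 2) - \<sigma>) * (c * s powr (- (real j * \<sigma>)))) s (G j s)"
    by (rule G_wb_late[OF _ A_bound[OF c e d] d s]) (use c s in auto)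
  moreover have "s powr (- (1 / 2) - \<sigma>) * s powr (- (real j * \<sigma>)) = s powr (- (1 / 2) - (real j + 1) * \<sigma>)"
    unfolding powr_add[symmetric] by (rule arg_cong[where f="(powr) s"]) (simp add: algebra_simps)
  then have "cf (K + c) * s powr (- (1 / 2) - \<sigma>) * (c * s powr (- (real j * \<sigma>))) = (cf (K + c) * c) * s powr (- (1 / 2) - (real j + 1) * \<sigma>)"
    by (metis mult.assoc mult.left_commute)
  ultimately show ?thesis by simp
qed

text \<open>The Duhamel integral turns a source exponent 1/2 + \<kappa> into the rate \<kappa>,
  which is \<sigma> more than the previous rate. This works while \<kappa> < 1/2, both for
  integrability at s = 0 and because the linear part is only O(t^(-1/2)); j < k guarantees
  it.\<close>

lemma approximation:
  "j < k \<Longrightarrow> \<exists>c\<ge>0. \<forall>t\<ge>1. wb (c * t powr (- ((real j + 1) * \<sigma>))) t (\<lambda>x. u t x - A j t x)"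
proof (induction j)
  case 0
  obtain cL where cL: "0 \<le> cL" "\<And>t. 0 < t \<Longrightarrow> wb (cL * t powr (- (1 / 2))) t (\<lambda>x. heat t u0 x - A0 u0 t x)"
    using heat_leading by blast
  let ?A = "cf K * K"
  have A0: "0 \<le> ?A" using cf_nonneg K_pos by simp
  have "wb ((cL + kE a \<sigma> * ?A) * t powr (- \<sigma>)) t (\<lambda>x. u t x - A 0 t x)" if t: "1 \<le> t" for t
  proof -
    have tp: "0 < t" using t by simp
    have "wb (kE a \<sigma> * ?A * t powr (- \<sigma>)) t (duhamel a (\<lambda>s y. f (u s y)) 0 t t)"
      by (rule wb_duhamel_decay(1)[OF fu_meas tp _ _ less_imp_le[OF sigma_pos] sigma_half A0])
         (use f_wb u_wb K_pos in auto)
    from wb_add[OF cL(2)[OF tp] this]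
    have "wb (cL * t powr (- (1 / 2)) + kE a \<sigma> * ?A * t powr (- \<sigma>)) t (\<lambda>x. u t x - A 0 t x)"
    proof (rule wb_cong_AE)
      show "(\<lambda>x. u t x - A 0 t x) \<in> borel_measurable borel" by (intro borel_measurable_diff u_section A_section)
      show "AE x in lborel. u t x - A 0 t x = heat t u0 x - A0 u0 t x + duhamel a (\<lambda>s y. f (u s y)) 0 t t x"
        using mild[OF tp] by eventually_elim simp
    qed
    moreover have "cL * t powr (- (1 / 2)) + kE a \<sigma> * ?A * t powr (- \<sigma>) \<le> cL * t powr (- \<sigma>) + kE a \<sigma> * ?A * t powr (- \<sigma>)"
      using t sigma_half cL(1) by (intro add_mono order_refl mult_left_mono powr_antimono_ge_1) auto
    ultimately show ?thesis unfolding distrib_right by (rule wb_mono)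
  qed
  moreover have "0 \<le> cL + kE a \<sigma> * ?A"
    by (intro add_nonneg_nonneg mult_nonneg_nonneg[OF kE_nonneg[OF sigma_half] A0] cL(1))
  ultimately show ?case by (intro exI[of _ "cL + kE a \<sigma> * ?A"]) auto
next
  case (Suc j)
  then obtain c where c: "0 \<le> c" "\<And>t. 1 \<le> t \<Longrightarrow> wb (c * t powr (- ((real j + 1) * \<sigma>))) t (\<lambda>x. u t x - A j t x)"
    by auto
  obtain cL where cL: "0 \<le> cL" "\<And>t. 0 < t \<Longrightarrow> wb (cL * t powr (- (1 / 2))) t (\<lambda>x. heat t u0 x - A0 u0 t x)"
    using heat_leading by blast
  define \<kappa> where "\<kappa> = (real (Suc j) + 1) * \<sigma>"
  have "\<kappa> \<le> real k * \<sigma>" unfolding \<kappa>_def using Suc.prems sigma_pos by (intro mult_right_mono) auto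
  then have "\<kappa> < 1 / 2" using k_low by linarith
  moreover have "0 \<le> \<kappa>" unfolding \<kappa>_def using sigma_pos by simp
  ultimately have \<kappa>: "0 \<le> \<kappa>" "\<kappa> < 1 / 2" by auto
  have \<sigma>\<kappa>: "\<sigma> \<le> \<kappa>" unfolding \<kappa>_def using sigma_pos mult_right_mono[of 1 "real (Suc j) + 1" \<sigma>] by simp
  define B where "B = K + c"
  have B: "K \<le> B" "0 \<le> B" using c K_pos by (auto simp: B_def)
  have Ab: "wb B t (A (Suc j - 1) t)" if "1 \<le> t" for t
    unfolding B_def using A_bound[OF c(1) _ c(2) that] sigma_pos by simp
  define A1 where "A1 = 2 * (cf B * B) + cf B * c"
  have A1: "0 \<le> A1" "2 * (cf B * B) \<le> A1" "cf B * c \<le> A1" unfolding A1_def using cf_nonneg[of B] B c(1) by auto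
  have Gb: "wb (A1 * s powr (- (1 / 2) - \<kappa>)) s (G (Suc j) s)" if s: "0 < s" for s
  proof (cases "s \<le> 1")
    case True
    \<comment> \<open>For s \<le> 1 raising the exponent weakens the bound, so the early source fits
      the weight dictated by the late one.\<close>
    have "s powr (- (1 / 2) - \<sigma>) \<le> s powr (- (1 / 2) - \<kappa>)" using True s \<sigma>\<kappa> by (intro powr_mono') auto
    then have "2 * (cf B * B) * s powr (- (1 / 2) - \<sigma>) \<le> A1 * s powr (- (1 / 2) - \<kappa>)"
      using A1 by (intro mult_mono) auto
    then show ?thesis using wb_mono[OF G_wb_early[OF B(1) s True]] by blast
  next
    case False
    have "wb ((cf (K + c) * c) * s powr (- (1 / 2) - (real (Suc j) + 1) * \<sigma>)) s (G (Suc j) s)"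
      by (rule G_rate[OF c(1)]) (use c(2) False in \<open>auto simp: add.commute\<close>)
    then show ?thesis unfolding \<kappa>_def
      by (rule wb_mono) (use A1(3) in \<open>auto simp: B_def intro!: mult_right_mono\<close>)
  qed
  have "wb ((cL + kE a \<kappa> * A1) * t powr (- \<kappa>)) t (\<lambda>x. u t x - A (Suc j) t x)" if t: "1 \<le> t" for t
  proof -
    have tp: "0 < t" using t by simp
    have "wb (kE a \<kappa> * A1 * t powr (- \<kappa>)) t (duhamel a (G (Suc j)) 0 t t)"
      by (rule wb_duhamel_decay(1)[OF G_meas tp _ _ \<kappa> A1(1)]) (use Gb in auto)
    from wb_add[OF cL(2)[OF tp] this]
    have "wb (cL * t powr (- (1 / 2)) + kE a \<kappa> * A1 * t powr (- \<kappa>)) t (\<lambda>x. u t x - A (Suc j) t x)"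
      by (rule wb_cong_AE[OF _ borel_measurable_diff[OF u_section A_section] representation(1)[OF _ t B(1) Ab]]) auto
    moreover have "cL * t powr (- (1 / 2)) + kE a \<kappa> * A1 * t powr (- \<kappa>) \<le> cL * t powr (- \<kappa>) + kE a \<kappa> * A1 * t powr (- \<kappa>)"
      using t \<kappa> cL(1) by (intro add_mono order_refl mult_left_mono powr_antimono_ge_1) auto
    ultimately show ?thesis unfolding distrib_right by (rule wb_mono)
  qed
  moreover have "0 \<le> cL + kE a \<kappa> * A1"
    by (intro add_nonneg_nonneg mult_nonneg_nonneg[OF kE_nonneg[OF \<kappa>(2)] A1(1)] cL(1))
  ultimately show ?case unfolding \<kappa>_def[symmetric] by (intro exI[of _ "cL + kE a \<kappa> * A1"]) auto
qed

section \<open>The final source as an integrable function on space-time\<close>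

text \<open>The source of \<open>u - A k\<close> as one function of (s, y), set to 0 for negative
  times, so that mass, Fubini and dominated convergence all refer to a single integral.\<close>

definition "\<Gamma> w = indicator {0..} (fst w) * G k (fst w) (snd w)"

lemma \<Gamma>_meas[measurable]: "\<Gamma> \<in> borel_measurable (borel \<Otimes>\<^sub>M borel)"
proof -
  note [measurable] = G_meas[of k, unfolded case_prod_beta']
  show ?thesis unfolding \<Gamma>_def[abs_def] by measurable
qed

lemma final_source:
  obtains A1 B where "0 \<le> A1" "K \<le> B" "\<And>t. 1 \<le> t \<Longrightarrow> wb B t (A (k - 1) t)"
    "\<And>s. 0 < s \<Longrightarrow> s \<le> 1 \<Longrightarrow> wb (A1 * s powr (- (1 / 2) - \<sigma>)) s (G k s)"
    "\<And>s. 1 < s \<Longrightarrow> wb (A1 * s powr (- (1 / 2) - (real k + 1) * \<sigma>)) s (G k s)"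
proof -
  have kk: "k - 1 < k" "real (k - 1) + 1 = real k" using k_pos by auto
  obtain c where c: "0 \<le> c" "\<And>t. 1 \<le> t \<Longrightarrow> wb (c * t powr (- (real k * \<sigma>))) t (\<lambda>x. u t x - A (k - 1) t x)"
    using approximation[OF kk(1)] unfolding kk(2) by auto
  define B where "B = K + c"
  have B: "K \<le> B" "0 \<le> B" using c K_pos by (auto simp: B_def)
  have Ab: "wb B t (A (k - 1) t)" if "1 \<le> t" for t
    unfolding B_def using A_bound[OF c(1) _ c(2) that] sigma_pos by simp
  define A1 where "A1 = 2 * (cf B * B) + cf B * c"
  have A1: "0 \<le> A1" "2 * (cf B * B) \<le> A1" "cf B * c \<le> A1" unfolding A1_def using cf_nonneg[of B] B c(1) by auto
  have 1: "wb (A1 * s powr (- (1 / 2) - \<sigma>)) s (G k s)" if "0 < s" "s \<le> 1" for s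
    by (rule wb_mono[OF G_wb_early[OF B(1) that]]) (intro mult_right_mono A1; simp)
  have 2: "wb (A1 * s powr (- (1 / 2) - (real k + 1) * \<sigma>)) s (G k s)" if "1 < s" for s
    by (rule wb_mono[OF G_rate[OF c that]]) (use A1(3) in \<open>auto simp: B_def intro!: mult_right_mono\<close>)
  show thesis by (rule that[OF A1(1) B(1) Ab 1 2])
qed

text \<open>Both ends of the range of p act here: k \<sigma> < 1/2 forces \<sigma> < 1/2 and
  integrability at s = 0, while (k + 1) \<sigma> > 1/2 gives integrability at infinity.\<close>

lemma \<Gamma>_integrable:
  shows "integrable (lborel \<Otimes>\<^sub>M lborel) \<Gamma>"
    and "AE x in lborel. integrable lborel (\<lambda>s. \<Gamma> (s, x))"
    and "integrable lborel (\<lambda>x. \<integral>s. \<Gamma> (s, x) \<partial>lborel)"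
proof -
  obtain A1 where A1: "0 \<le> A1"
    and G1: "\<And>s. 0 < s \<Longrightarrow> s \<le> 1 \<Longrightarrow> wb (A1 * s powr (- (1 / 2) - \<sigma>)) s (G k s)"
    and G2: "\<And>s. 1 < s \<Longrightarrow> wb (A1 * s powr (- (1 / 2) - (real k + 1) * \<sigma>)) s (G k s)"
    using final_source by metis
  let ?m = "\<lambda>s. A1 * (indicator {0..1} s *\<^sub>R s powr (- (1 / 2) - \<sigma>) + indicator {1..} s *\<^sub>R s powr (- (1 / 2) - (real k + 1) * \<sigma>))"
  have im: "integrable lborel ?m"
    using set_integrable_powr_0(1)[of "- (1 / 2) - \<sigma>" 1] set_integrable_powr_inf[of "- (1 / 2) - (real k + 1) * \<sigma>" 1] sigma_half k_up
    by (auto simp: set_integrable_def)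
  have "AE s in lborel. L1_le (?m s) (\<lambda>x. \<Gamma> (s, x))"
    using AE_lborel_neq[of "0::real"]
  proof eventually_elim
    case (elim s)
    have m0: "0 \<le> ?m s" using A1 by simp
    consider "s < 0" | "0 < s" "s \<le> 1" | "1 < s" using elim by linarith
    then show ?case
    proof cases
      case 1
      then show ?thesis using m0 by (simp add: \<Gamma>_def L1_le_def)
    next
      case 2
      have "A1 * s powr (- (1 / 2) - \<sigma>) \<le> ?m s" using 2 A1 by (intro mult_left_mono) auto
      then show ?thesis using L1_le_mono[OF wbD(1)[OF G1[OF 2]]] 2 by (simp add: \<Gamma>_def)
    next
      case 3
      have "A1 * s powr (- (1 / 2) - (real k + 1) * \<sigma>) \<le> ?m s" using 3 A1 by (intro mult_left_mono) auto
      then show ?thesis using L1_le_mono[OF wbD(1)[OF G2[OF 3]]] 3 by (simp add: \<Gamma>_def)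
    qed
  qed
  note M = Minkowski_L1[OF sigma_finite_lborel _ this im]
  have mm: "(\<lambda>(s, x). \<Gamma> (s, x)) \<in> borel_measurable (lborel \<Otimes>\<^sub>M lborel)" using \<Gamma>_meas by simp
  show "integrable (lborel \<Otimes>\<^sub>M lborel) \<Gamma>" using M(2)[OF mm] by simp
  show "AE x in lborel. integrable lborel (\<lambda>s. \<Gamma> (s, x))" using M(3)[OF mm] .
  show "integrable lborel (\<lambda>x. \<integral>s. \<Gamma> (s, x) \<partial>lborel)" using L1_leD(1)[OF M(1)[OF mm]] .
qed

abbreviation "\<psi> \<equiv> psi0k a f u0 u k"

text \<open>The two time integrals in \<open>psi0k\<close> join into one; the overlap and the switch
  of formulas concern only s = 1. Convergence of the section is needed to add them, hence the
  restriction to almost every x.\<close>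

lemma psi_AE: "AE x in lborel. \<psi> x = (\<integral>s. \<Gamma> (s, x) \<partial>lborel)"
  using \<Gamma>_integrable(2)
proof eventually_elim
  case (elim x)
  have s1: "set_integrable lborel {0..} (\<lambda>s. G k s x)" using elim by (simp add: set_integrable_def \<Gamma>_def)
  have i1: "set_integrable lborel {0..1} (\<lambda>s. G k s x)" "set_integrable lborel {1..} (\<lambda>s. G k s x)"
    by (auto intro: set_integrable_subset[OF s1])
  have Gm: "(\<lambda>s. G k s x) \<in> borel_measurable borel"
    using joint_measurable_comp[OF G_meas, of "\<lambda>s. s" borel "\<lambda>_. x" k] by simp
  have am: "(\<lambda>s. f (u s x) - f (A (k - 1) s x)) \<in> borel_measurable borel"
    using joint_measurable_comp[OF fdiff_meas[OF u_meas A_meas], of "\<lambda>s. s" borel "\<lambda>_. x" "k - 1"] by simp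
  have 1: "(LINT s:{0..1}|lborel. f (u s x) - f (A0 u0 s x)) = (LINT s:{0..1}|lborel. G k s x)"
    by (rule set_lebesgue_integral_cong) (auto simp: G_def)
  have 2: "(LINT s:{1..}|lborel. f (u s x) - f (A (k - 1) s x)) = (LINT s:{1..}|lborel. G k s x)"
    unfolding set_lebesgue_integral_def
  proof (rule integral_cong_AE)
    show "AE s in lborel. indicator {1..} s *\<^sub>R (f (u s x) - f (A (k - 1) s x)) = indicator {1..} s *\<^sub>R G k s x"
      using AE_lborel_neq[of "1::real"] by eventually_elim (auto simp: G_def indicator_def)
  qed (use am Gm in auto)
  have 3: "(\<integral>s. \<Gamma> (s, x) \<partial>lborel) = (\<integral>s. indicator {0..1} s *\<^sub>R G k s x + indicator {1..} s *\<^sub>R G k s x \<partial>lborel)"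
  proof (rule integral_cong_AE)
    show "AE s in lborel. \<Gamma> (s, x) = indicator {0..1} s *\<^sub>R G k s x + indicator {1..} s *\<^sub>R G k s x"
      using AE_lborel_neq[of "1::real"] by eventually_elim (auto simp: \<Gamma>_def indicator_def)
  qed (use elim Gm in auto)
  show ?case unfolding psi0k_def 1 2 3 using i1 by (simp add: set_integrable_def set_lebesgue_integral_def)
qed

lemma psi_meas: "\<psi> \<in> borel_measurable borel"
proof -
  have "(\<lambda>w. indicator S (snd w) *\<^sub>R (f (u (snd w) (fst w)) - f (H (snd w) (fst w)))) \<in> borel_measurable (lborel \<Otimes>\<^sub>M lborel)"
    if H: "case_prod H \<in> borel_measurable (borel \<Otimes>\<^sub>M borel)" and [measurable]: "S \<in> sets borel" for H and S :: "real set"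
  proof -
    have [measurable]: "(\<lambda>w. f (u (snd w) (fst w)) - f (H (snd w) (fst w))) \<in> borel_measurable (lborel \<Otimes>\<^sub>M lborel)"
      by (rule joint_measurable_comp[OF fdiff_meas[OF u_meas H]]) auto
    show ?thesis by measurable
  qed
  note m = this
  have L: "(\<lambda>x. LINT s:S|lborel. f (u s x) - f (H s x)) \<in> borel_measurable lborel"
    if "case_prod H \<in> borel_measurable (borel \<Otimes>\<^sub>M borel)" "S \<in> sets borel" for H S
    unfolding set_lebesgue_integral_def
    by (rule lborel.borel_measurable_lebesgue_integral) (use m[OF that] in \<open>simp add: case_prod_beta'\<close>)
  have "\<psi> \<in> borel_measurable lborel"
    unfolding psi0k_def[abs_def]
    by (rule borel_measurable_add[OF L[OF A0_meas] L[OF A_meas]]) auto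
  then show ?thesis by simp
qed

lemma psi_integrable: "integrable lborel \<psi>"
  by (rule integrable_cong_AE_imp[OF \<Gamma>_integrable(3)]) (use psi_meas psi_AE in \<open>auto elim!: eventually_mono\<close>)

lemma M0_psi: "M0 \<psi> = (\<integral>w. \<Gamma> w \<partial>(lborel \<Otimes>\<^sub>M lborel))"
proof -
  have "M0 \<psi> = (\<integral>x. (\<integral>s. \<Gamma> (s, x) \<partial>lborel) \<partial>lborel)"
    unfolding M0_def by (rule integral_cong_AE) (use psi_meas psi_AE \<Gamma>_integrable(3) in auto)
  also have "\<dots> = (\<integral>w. \<Gamma> w \<partial>(lborel \<Otimes>\<^sub>M lborel))"
    using lborel_pair.integral_snd[of "\<lambda>s x. \<Gamma> (s, x)"] \<Gamma>_integrable(1) by simp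
  finally show ?thesis .
qed

text \<open>Normalised deviation of the kernel emitted at (s, y) from the one emitted at the origin.
  For s \<le> t/2 it is the factor in \<open>gradG_diff_est\<close>; for later s the emitted kernel
  is left out and 1 accounts for the one at the origin.\<close>

definition "\<eta> t w = (if fst w \<le> t / 2 then min 1 (norm (snd w :: 'a) / sqrt t + fst w / t) else 1 :: real)"

definition "early t = kD TYPE('a) * norm a * t powr (- 1 / 2) * (\<integral>w. \<bar>\<Gamma> w\<bar> * \<eta> t w \<partial>(lborel \<Otimes>\<^sub>M lborel))"

lemma \<eta>_meas[measurable]: "\<eta> t \<in> borel_measurable (borel \<Otimes>\<^sub>M borel)"
  unfolding \<eta>_def[abs_def] by measurable

lemma \<eta>_range: "0 < t \<Longrightarrow> 0 \<le> fst w \<Longrightarrow> 0 \<le> \<eta> t w \<and> \<eta> t w \<le> 1"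
  unfolding \<eta>_def by (auto simp: min_def)

lemma \<Gamma>\<eta>_bound: "0 < t \<Longrightarrow> \<bar>\<bar>\<Gamma> w\<bar> * \<eta> t w\<bar> \<le> \<bar>\<Gamma> w\<bar>"
proof (cases "0 \<le> fst w")
  case True
  assume "0 < t"
  from \<eta>_range[OF this True] show ?thesis by (simp add: abs_mult mult_left_le)
next
  case False
  then show ?thesis by (simp add: \<Gamma>_def)
qed

lemma \<Gamma>\<eta>_integrable: "0 < t \<Longrightarrow> integrable (lborel \<Otimes>\<^sub>M lborel) (\<lambda>w. \<bar>\<Gamma> w\<bar> * \<eta> t w)"
proof -
  assume t: "0 < t"
  have m: "(\<lambda>w. \<bar>\<Gamma> w\<bar> * \<eta> t w) \<in> borel_measurable (lborel \<Otimes>\<^sub>M lborel)" by measurable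
  show ?thesis
    by (rule Bochner_Integration.integrable_bound[OF \<Gamma>_integrable(1) m]) (use \<Gamma>\<eta>_bound[OF t] in simp)
qed

text \<open>For each fixed point of space-time the weight \<eta> tends to 0, and |\<Gamma>| is an
  integrable majorant. No moment of the source enters, hence no rate comes out.\<close>

lemma early_tendsto: "((\<lambda>t. t powr (1 / 2) * early t) \<longlongrightarrow> 0) at_top"
proof -
  have "((\<lambda>t. \<integral>w. \<bar>\<Gamma> w\<bar> * \<eta> t w \<partial>(lborel \<Otimes>\<^sub>M lborel)) \<longlongrightarrow> (\<integral>w. 0 \<partial>(lborel \<Otimes>\<^sub>M lborel :: (real \<times> 'a) measure))) at_top"
  proof (rule integral_dominated_convergence_at_top[where w="\<lambda>w. \<bar>\<Gamma> w\<bar>"])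
    show "integrable (lborel \<Otimes>\<^sub>M lborel) (\<lambda>w. \<bar>\<Gamma> w\<bar>)" using \<Gamma>_integrable(1) by simp
    show "AE w in lborel \<Otimes>\<^sub>M lborel. ((\<lambda>t. \<bar>\<Gamma> w\<bar> * \<eta> t w) \<longlongrightarrow> 0) at_top"
    proof (rule AE_I2)
      fix w :: "real \<times> 'a"
      have i: "((\<lambda>t. norm (snd w) / sqrt t) \<longlongrightarrow> 0) at_top"
        by (rule tendsto_divide_0[OF tendsto_const filterlim_mono[OF sqrt_at_top at_top_le_at_infinity order_refl]])
      have ii: "((\<lambda>t. fst w / t) \<longlongrightarrow> 0) at_top"
        by (rule tendsto_divide_0[OF tendsto_const filterlim_mono[OF filterlim_ident at_top_le_at_infinity order_refl]])
      have "((\<lambda>t. min 1 (norm (snd w) / sqrt t + fst w / t)) \<longlongrightarrow> min 1 (0 + 0)) at_top"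
        by (intro tendsto_intros i ii)
      then have iii: "((\<lambda>t. min 1 (norm (snd w) / sqrt t + fst w / t)) \<longlongrightarrow> 0) at_top" by simp
      have "min 1 (norm (snd w) / sqrt t + fst w / t) = \<eta> t w" if "2 * fst w \<le> t" for t
        using that by (simp add: \<eta>_def)
      then have "\<forall>\<^sub>F t in at_top. min 1 (norm (snd w) / sqrt t + fst w / t) = \<eta> t w"
        by (rule eventually_mono[OF eventually_ge_at_top[of "2 * fst w"]])
      from Lim_transform_eventually[OF iii this]
      have "((\<lambda>t. \<eta> t w) \<longlongrightarrow> 0) at_top" .
      then show "((\<lambda>t. \<bar>\<Gamma> w\<bar> * \<eta> t w) \<longlongrightarrow> 0) at_top" by (rule tendsto_mult_right_zero)
    qed
    show "\<forall>\<^sub>F t in at_top. AE w in lborel \<Otimes>\<^sub>M lborel. norm (\<bar>\<Gamma> w\<bar> * \<eta> t w) \<le> \<bar>\<Gamma> w\<bar>"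
      using eventually_gt_at_top[of 0]
    proof eventually_elim
      case (elim t)
      show ?case by (rule AE_I2) (use \<Gamma>\<eta>_bound[OF elim] in simp)
    qed
    show "(\<lambda>w. \<bar>\<Gamma> w\<bar> * \<eta> t w) \<in> borel_measurable (lborel \<Otimes>\<^sub>M lborel)" for t by measurable
  qed simp
  then have "((\<lambda>t. \<integral>w. \<bar>\<Gamma> w\<bar> * \<eta> t w \<partial>(lborel \<Otimes>\<^sub>M lborel)) \<longlongrightarrow> 0) at_top" by simp
  then have lim: "((\<lambda>t. (kD TYPE('a) * norm a) * (\<integral>w. \<bar>\<Gamma> w\<bar> * \<eta> t w \<partial>(lborel \<Otimes>\<^sub>M lborel))) \<longlongrightarrow> 0) at_top"
    by (rule tendsto_mult_right_zero)
  show ?thesis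
  proof (rule Lim_transform_eventually[OF lim])
    show "\<forall>\<^sub>F t in at_top. (kD TYPE('a) * norm a) * (\<integral>w. \<bar>\<Gamma> w\<bar> * \<eta> t w \<partial>(lborel \<Otimes>\<^sub>M lborel)) = t powr (1 / 2) * early t"
      using eventually_gt_at_top[of 0]
    proof eventually_elim
      case (elim t)
      have "t powr (1 / 2) * t powr (- 1 / 2) = 1" unfolding powr_add[symmetric] using elim by simp
      then have "t powr (1 / 2) * (x * t powr (- 1 / 2) * y) = x * y" for x y by (metis mult.left_commute mult.commute mult_1)
      then show ?case unfolding early_def by (rule sym)
    qed
  qed
qed

text \<open>\<open>M0 \<psi>\<close> counts the mass emitted at all times, the Duhamel term only
  that emitted up to t/2. The indicator in the integrand reconciles them: for s > t/2 only the
  subtracted kernel is left.\<close>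

lemma early_wb:
  assumes t: "0 < t"
  shows "wb (early t) t (\<lambda>x. duhamel a (G k) 0 (t / 2) t x - M0 \<psi> * gradG a t x)"
proof -
  let ?N = "lborel \<Otimes>\<^sub>M lborel :: (real \<times> 'a) measure"
  let ?H = "\<lambda>w x. (indicator {..t / 2} (fst w) * gradG a (t - fst w) (x - snd w) - gradG a t x) * \<Gamma> w"
  let ?c = "kD TYPE('a) * norm a * t powr (- 1 / 2)"
  have sN: "sigma_finite_measure ?N" unfolding lborel_prod by (rule sigma_finite_lborel)
  have kCD: "kC TYPE('a) \<le> kD TYPE('a)"
  proof -
    have "1 * kC TYPE('a) \<le> 2 ^ (DIM('a) + 2) * kC TYPE('a)" by (intro mult_right_mono one_le_power) auto
    then show ?thesis by (simp add: kD_def)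
  qed
  have wbH: "wb (?c * (\<bar>\<Gamma> w\<bar> * \<eta> t w)) t (?H w)" for w
  proof (cases "fst w < 0")
    case True
    then show ?thesis using wb_0 by (simp add: \<Gamma>_def)
  next
    case False
    have "wb (?c * \<eta> t w) t (\<lambda>x. indicator {..t / 2} (fst w) * gradG a (t - fst w) (x - snd w) - gradG a t x)"
    proof (cases "fst w \<le> t / 2")
      case True
      have "wb (?c * min 1 (norm (snd w) / sqrt t + fst w / t)) t (\<lambda>x. gradG a (t - fst w) (x - snd w) - gradG a t x)"
        by (rule wb_kernel[OF gradG_diff_est]) (use t True False in auto)
      then show ?thesis using True by (simp add: \<eta>_def)
    next
      case F2: False
      have "wb (\<bar>-1\<bar> * (kC TYPE('a) * norm a * t powr (- 1 / 2))) t (\<lambda>x. -1 * gradG a t x)"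
        by (intro wb_cmult wb_gradG t)
      then have "wb ?c t (\<lambda>x. -1 * gradG a t x)"
        by (rule wb_mono) (use kCD in \<open>auto intro!: mult_right_mono\<close>)
      then show ?thesis using F2 by (simp add: \<eta>_def)
    qed
    from wb_cmult[OF this, of "\<Gamma> w"] show ?thesis by (simp add: mult_ac)
  qed
  have meas: "(\<lambda>(w, x). ?H w x) \<in> borel_measurable (?N \<Otimes>\<^sub>M lborel)"
    unfolding case_prod_beta' by measurable
  have "wb (\<integral>w. ?c * (\<bar>\<Gamma> w\<bar> * \<eta> t w) \<partial>?N) t (\<lambda>x. \<integral>w. ?H w x \<partial>?N)"
    by (rule wb_Minkowski[OF sN meas]) (use wbH \<Gamma>\<eta>_integrable[OF t] in auto)
  moreover have "(\<integral>w. ?c * (\<bar>\<Gamma> w\<bar> * \<eta> t w) \<partial>?N) = early t" unfolding early_def by simp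
  moreover have "(\<integral>w. ?H w x \<partial>?N) = duhamel a (G k) 0 (t / 2) t x - M0 \<psi> * gradG a t x" for x
  proof -
    let ?h = "\<lambda>w. indicator {..t / 2} (fst w) * gradG a (t - fst w) (x - snd w) * \<Gamma> w"
    let ?l = "kC TYPE('a) * norm a * (t / 2) powr (- 1 / 2) * (t / 2) powr (- real DIM('a) / 2)"
    \<comment> \<open>Up to s = t/2 the kernel is no larger than its bound at time t/2, so its
      product with \<Gamma> is integrable and Fubini turns the space-time integral into the Duhamel
      term.\<close>
    have ih: "integrable ?N ?h"
    proof (rule Bochner_Integration.integrable_bound)
      show "integrable ?N (\<lambda>w. ?l * \<bar>\<Gamma> w\<bar>)" using \<Gamma>_integrable(1) by simp
      show "?h \<in> borel_measurable ?N" by measurable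
      have hb: "\<bar>?h w\<bar> \<le> ?l * \<bar>\<Gamma> w\<bar>" for w
      proof (cases "fst w \<le> t / 2")
        case True
        then have ts: "t / 2 \<le> t - fst w" "0 < t - fst w" using t by auto
        have "\<bar>gradG a (t - fst w) (x - snd w)\<bar> \<le> kC TYPE('a) * norm a * (t - fst w) powr (- 1 / 2) * (t - fst w) powr (- real DIM('a) / 2)"
          by (rule gradG_le[OF ts(2)])
        also have "\<dots> \<le> ?l"
          using ts t by (intro mult_mono mult_left_mono powr_mono2') auto
        finally show ?thesis using True by (simp add: abs_mult mult_right_mono)
      qed simp
      show "AE w in ?N. norm (?h w) \<le> norm (?l * \<bar>\<Gamma> w\<bar>)"
        unfolding real_norm_def by (rule AE_I2) (rule order_trans[OF hb abs_ge_self])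
    qed
    have "(\<integral>w. ?H w x \<partial>?N) = (\<integral>w. ?h w \<partial>?N) - gradG a t x * (\<integral>w. \<Gamma> w \<partial>?N)"
      unfolding left_diff_distrib using ih \<Gamma>_integrable(1) by simp
    also have "(\<integral>w. ?h w \<partial>?N) = (\<integral>s. (\<integral>y. ?h (s, y) \<partial>lborel) \<partial>lborel)"
      using lborel_pair.integral_fst'[OF ih] by simp
    also have "\<dots> = duhamel a (G k) 0 (t / 2) t x"
      unfolding duhamel_eq
    proof (rule Bochner_Integration.integral_cong[OF refl])
      fix s
      show "(\<integral>y. ?h (s, y) \<partial>lborel) = indicator {0..t / 2} s * grad_heat a (t - s) (G k s) x"
      proof (cases "s \<in> {0..t / 2}")
        case True
        then show ?thesis by (simp add: \<Gamma>_def grad_heat_conv conv_def)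
      next
        case False
        then have z: "?h (s, y) = 0" for y by (auto simp: \<Gamma>_def indicator_def)
        show ?thesis unfolding z using False by simp
      qed
    qed
    finally show ?thesis by (simp add: M0_psi mult.commute)
  qed
  ultimately show ?thesis by simp
qed

text \<open>\<open>dil t (xG1 b)\<close> is a negative multiple of \<open>gradG b t\<close>, so in
  terms of gradient kernels the first moments of \<open>u0\<close> enter with a minus sign and the
  mass of \<psi> with a plus sign.\<close>

lemma A1k_eq:
  assumes t: "0 < t"
  shows "A1k a f u0 u k t x = A k t x - (\<Sum>b\<in>Basis. Me b u0 * gradG b t x) + M0 \<psi> * gradG a t x"
proof -
  have d: "1 / 2 * t powr (- 1 / 2) * dil t (xG1 b) x = - gradG b t x" for b by (rule dil_xG1[OF t])
  have "(1/2) * t powr (-1/2) * (\<Sum>b\<in>Basis. Me b u0 * dil t (xG1 b) x)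
      = (\<Sum>b\<in>Basis. Me b u0 * (1 / 2 * t powr (- 1 / 2) * dil t (xG1 b) x))"
    unfolding sum_distrib_left by (intro sum.cong refl) (simp only: mult_ac)
  also have "\<dots> = - (\<Sum>b\<in>Basis. Me b u0 * gradG b t x)" unfolding d by (simp add: sum_negf)
  finally have 1: "(1/2) * t powr (-1/2) * (\<Sum>b\<in>Basis. Me b u0 * dil t (xG1 b) x) = - (\<Sum>b\<in>Basis. Me b u0 * gradG b t x)" .
  have "Lambda b t \<psi> x = M0 \<psi> * gradG b t x" for b
  proof -
    have "Lambda b t \<psi> x = - M0 \<psi> * (1 / 2 * t powr (- 1 / 2) * dil t (xG1 b) x)" unfolding Lambda_def by simp
    then show ?thesis unfolding d by simp
  qed
  then have 2: "(\<Sum>b\<in>Basis. (a \<bullet> b) * Lambda b t \<psi> x) = M0 \<psi> * gradG a t x"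
    unfolding gradG_sum_Basis[of a] sum_distrib_left by (simp add: mult_ac)
  show ?thesis unfolding A1k_def 1 2 by simp
qed

lemma main_estimate:
  "\<exists>m. (\<forall>t>2. 0 < m t \<and> wb (m t) t (\<lambda>x. u t x - A1k a f u0 u k t x)) \<and> ((\<lambda>t. t powr (1 / 2) * m t) \<longlongrightarrow> 0) at_top"
proof -
  obtain A1 B where A1: "0 \<le> A1" and B: "K \<le> B" "\<And>t. 1 \<le> t \<Longrightarrow> wb B t (A (k - 1) t)"
    and G2: "\<And>s. 1 < s \<Longrightarrow> wb (A1 * s powr (- (1 / 2) - (real k + 1) * \<sigma>)) s (G k s)"
    using final_source by metis
  define \<kappa> where "\<kappa> = (real k + 1) * \<sigma>"
  have \<kappa>: "1 / 2 < \<kappa>" using k_up by (simp add: \<kappa>_def)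
  \<comment> \<open>Bound for the sources with s \<ge> t/2; it is o(t^(-1/2)) because \<kappa> >
    1/2.\<close>
  define late where "late t = kE a 0 * (A1 * (t / 2) powr (- \<kappa>))" for t
  \<comment> \<open>The summand \<open>t powr (- 1)\<close> makes the bound strictly positive, as
    \<open>wb_Lq\<close> asks, and is negligible against \<open>t powr (- 1 / 2)\<close>.\<close>
  define m where "m t = heat_remainder u0 t + (early t + late t) + t powr (- 1)" for t
  have late0: "0 \<le> late t" for t unfolding late_def using kE_nonneg[of 0 a] A1 by simp
  have "wb (m t) t (\<lambda>x. u t x - A1k a f u0 u k t x)" "0 < m t" if t: "2 < t" for t
  proof -
    have tp: "0 < t" "1 \<le> t" "0 \<le> t / 2" "t / 2 \<le> t" using t by auto
    have lw: "wb (late t) t (duhamel a (G k) (t / 2) t t)"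
    proof -
      have "wb (kE a 0 * (A1 * (t / 2) powr (- \<kappa>)) * t powr (- 0)) t (duhamel a (G k) (t / 2) t t)"
      proof (rule wb_duhamel_decay(1)[OF G_meas tp(1,3) order_refl])
        fix s assume s: "0 < s" "s < t" "t / 2 \<le> s"
        \<comment> \<open>The full exponent 1/2 + \<kappa> exceeds 1, beyond the reach of the decay
          estimate. So s^(-\<kappa>) is bounded by its value at t/2 and only s^(-1/2) is left to the
          time integral.\<close>
        have "s powr (- (1 / 2) - \<kappa>) = s powr (- \<kappa>) * s powr (- (1 / 2) - 0)"
          unfolding powr_add[symmetric] by (rule arg_cong[where f="(powr) s"]) simp
        also have "\<dots> \<le> (t / 2) powr (- \<kappa>) * s powr (- (1 / 2) - 0)"
          using s tp \<kappa> t by (intro mult_right_mono powr_mono2') auto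
        finally have "A1 * s powr (- (1 / 2) - \<kappa>) \<le> A1 * ((t / 2) powr (- \<kappa>) * s powr (- (1 / 2) - 0))"
          using A1 by (rule mult_left_mono)
        then show "wb (A1 * (t / 2) powr (- \<kappa>) * s powr (- (1 / 2) - 0)) s (G k s)"
          using wb_mono[OF G2[of s, folded \<kappa>_def]] s t by (simp add: mult.assoc)
      qed (use A1 in auto)
      then show ?thesis unfolding late_def using tp by simp
    qed
    have w: "wb (heat_remainder u0 t + (early t + late t)) t (\<lambda>x. (heat t u0 x - A0 u0 t x + (\<Sum>b\<in>Basis. Me b u0 * gradG b t x))
        + ((duhamel a (G k) 0 (t / 2) t x - M0 \<psi> * gradG a t x) + duhamel a (G k) (t / 2) t t x))"
      by (intro wb_add heat_expansion[OF u0_L11 tp(1)] early_wb[OF tp(1)] lw)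
    have rp1: "AE x in lborel. u t x - A k t x = (heat t u0 x - A0 u0 t x) + duhamel a (G k) 0 t t x"
      by (rule representation(1)[OF k_pos tp(2) B(1)]) (rule B(2))
    have rp2: "AE x in lborel. set_integrable lborel {0..t} (\<lambda>s. grad_heat a (t - s) (G k s) x)"
      by (rule representation(2)[OF k_pos tp(2) B(1)]) (rule B(2))
    have "wb (heat_remainder u0 t + (early t + late t)) t (\<lambda>x. u t x - A1k a f u0 u k t x)"
    proof (rule wb_cong_AE[OF w])
      show "(\<lambda>x. u t x - A1k a f u0 u k t x) \<in> borel_measurable borel"
        unfolding A1k_eq[OF tp(1)] using u_section[of t] A_section[of k t] by measurable
      show "AE x in lborel. u t x - A1k a f u0 u k t x = (heat t u0 x - A0 u0 t x + (\<Sum>b\<in>Basis. Me b u0 * gradG b t x))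
        + ((duhamel a (G k) 0 (t / 2) t x - M0 \<psi> * gradG a t x) + duhamel a (G k) (t / 2) t t x)"
        using rp1 rp2
      proof eventually_elim
        case (elim x)
        have "duhamel a (G k) 0 t t x = duhamel a (G k) 0 (t / 2) t x + duhamel a (G k) (t / 2) t t x"
          by (rule duhamel_split_at[OF elim(2)]) (use tp in auto)
        then show ?case unfolding A1k_eq[OF tp(1)] using elim(1) by linarith
      qed
    qed
    then show "wb (m t) t (\<lambda>x. u t x - A1k a f u0 u k t x)" by (rule wb_mono) (simp add: m_def)
    have "0 \<le> heat_remainder u0 t" by (rule wb_nonneg[OF heat_expansion[OF u0_L11 tp(1)]])
    moreover have "0 \<le> early t" by (rule wb_nonneg[OF early_wb[OF tp(1)]])
    moreover have "0 < t powr (- 1)" using tp by simp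
    ultimately show "0 < m t" unfolding m_def using late0[of t] by linarith
  qed
  moreover have "((\<lambda>t. t powr (1 / 2) * m t) \<longlongrightarrow> 0) at_top"
  proof -
    have p0: "((\<lambda>t::real. c * t powr (- e)) \<longlongrightarrow> 0) at_top" if "0 < e" for c e :: real
      using tendsto_mult_right_zero[OF tendsto_neg_powr[OF _ filterlim_ident, of "- e"]] that by simp
    have l1: "((\<lambda>t. t powr (1 / 2) * late t) \<longlongrightarrow> 0) at_top"
    proof (rule Lim_transform_eventually[OF p0[of "\<kappa> - 1 / 2" "kE a 0 * A1 * 2 powr \<kappa>"]])
      show "\<forall>\<^sub>F t in at_top. kE a 0 * A1 * 2 powr \<kappa> * t powr (- (\<kappa> - 1 / 2)) = t powr (1 / 2) * late t"
        using eventually_gt_at_top[of 0]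
      proof eventually_elim
        case (elim t)
        have "(t / 2) powr (- \<kappa>) = 2 powr \<kappa> * t powr (- \<kappa>)"
          using elim by (simp add: powr_divide powr_minus field_simps)
        moreover have "t powr (- (\<kappa> - 1 / 2)) = t powr (1 / 2) * t powr (- \<kappa>)"
          unfolding powr_add[symmetric] by (rule arg_cong[where f="(powr) t"]) simp
        ultimately show ?case unfolding late_def by (simp only: mult_ac)
      qed
    qed (use \<kappa> in simp)
    have l2: "((\<lambda>t::real. t powr (1 / 2) * t powr (- 1)) \<longlongrightarrow> 0) at_top"
    proof (rule Lim_transform_eventually[OF p0[of "1 / 2" 1]])
      have "1 * t powr (- (1 / 2)) = t powr (1 / 2) * t powr (- 1)" for t :: real
        unfolding powr_add[symmetric] by simp
      then show "\<forall>\<^sub>F t::real in at_top. 1 * t powr (- (1 / 2)) = t powr (1 / 2) * t powr (- 1)" by simp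
    qed simp
    have "((\<lambda>t. t powr (1 / 2) * heat_remainder u0 t + (t powr (1 / 2) * early t + t powr (1 / 2) * late t) + t powr (1 / 2) * t powr (- 1)) \<longlongrightarrow> 0 + (0 + 0) + 0) at_top"
      by (intro tendsto_add heat_remainder_tendsto u0_L11 early_tendsto l1 l2)
    then show ?thesis unfolding m_def distrib_left by simp
  qed
  ultimately show ?thesis by (intro exI[of _ m]) auto
qed

lemma conclusion:
  "integrable lborel (psi0k a f u0 u k) \<and>
    (\<forall>q::ereal. 1 \<le> q \<longrightarrow>
      (\<forall>\<^sub>F t in at_top. memLq q (\<lambda>x. u t x - A1k a f u0 u k t x)) \<and>
      ((\<lambda>t. t powr (real DIM('a) / 2 * (1 - real_of_ereal (1 / q)) + 1/2)
              * Lq_norm q (\<lambda>x. u t x - A1k a f u0 u k t x)) \<longlongrightarrow> 0) at_top)"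
proof (intro conjI allI impI psi_integrable)
  fix q :: ereal assume q: "1 \<le> q"
  obtain m where m: "\<And>t. 2 < t \<Longrightarrow> 0 < m t" "\<And>t. 2 < t \<Longrightarrow> wb (m t) t (\<lambda>x. u t x - A1k a f u0 u k t x)"
    and lim: "((\<lambda>t. t powr (1 / 2) * m t) \<longlongrightarrow> 0) at_top"
    using main_estimate by blast
  let ?\<phi> = "\<lambda>t x. u t x - A1k a f u0 u k t x"
  let ?e = "real DIM('a) / 2 * (1 - real_of_ereal (1 / q))"
  have W: "memLq q (?\<phi> t)" "0 \<le> Lq_norm q (?\<phi> t)" "Lq_norm q (?\<phi> t) \<le> m t * t powr (- ?e)" if "2 < t" for t
    using wb_Lq[OF m(2)[OF that] m(1)[OF that] _ q] that by auto
  show "\<forall>\<^sub>F t in at_top. memLq q (?\<phi> t)"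
    using eventually_gt_at_top[of 2] by eventually_elim (rule W(1))
  show "((\<lambda>t. t powr (?e + 1/2) * Lq_norm q (?\<phi> t)) \<longlongrightarrow> 0) at_top"
  proof (rule tendsto_sandwich[OF _ _ tendsto_const lim])
    show "\<forall>\<^sub>F t in at_top. 0 \<le> t powr (?e + 1/2) * Lq_norm q (?\<phi> t)"
      using eventually_gt_at_top[of 2] by eventually_elim (intro mult_nonneg_nonneg W(2); simp)
    show "\<forall>\<^sub>F t in at_top. t powr (?e + 1/2) * Lq_norm q (?\<phi> t) \<le> t powr (1 / 2) * m t"
      using eventually_gt_at_top[of 2]
    proof eventually_elim
      case (elim t)
      have "t powr (?e + 1/2) * Lq_norm q (?\<phi> t) \<le> t powr (?e + 1/2) * (m t * t powr (- ?e))"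
        by (intro mult_left_mono W(3)[OF elim]) simp
      also have "\<dots> = (t powr (?e + 1/2) * t powr (- ?e)) * m t" by (simp only: mult_ac)
      also have "t powr (?e + 1/2) * t powr (- ?e) = t powr (1 / 2)" unfolding powr_add[symmetric] by simp
      finally show ?case .
    qed
  qed
qed

end

section \<open>From the stated norms and solution concept to the locales\<close>

lemma Lq_norm_1: "Lq_norm 1 \<phi> = (\<integral>x. \<bar>\<phi> x\<bar> \<partial>lborel)"
  by (simp add: Lq_norm_def)

text \<open>\<open>real_of_ereal\<close> sends \<infinity> to 0, so a bound on
  \<open>Lq_norm \<infinity>\<close> acquires meaning only together with membership, which excludes
  that value.\<close>

lemma memLq_infinity_AE:
  fixes \<phi> :: "'a::euclidean_space \<Rightarrow> real"
  assumes "memLq \<infinity> \<phi>" "Lq_norm \<infinity> \<phi> \<le> e"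
  shows "Linf_le e \<phi>"
proof -
  let ?s = "esssup lborel (\<lambda>x. ereal \<bar>\<phi> x\<bar>)"
  have [measurable]: "\<phi> \<in> borel_measurable borel" and fin: "?s < \<infinity>" using assms(1) by (auto simp: memLq_def)
  have "real_of_ereal ?s \<le> e" using assms(2) by (simp add: Lq_norm_def)
  then have "?s \<le> ereal e" using fin by (cases ?s) auto
  moreover have "AE x in lborel. ereal \<bar>\<phi> x\<bar> \<le> ?s" by (rule esssup_AE)
  ultimately have "AE x in lborel. ereal \<bar>\<phi> x\<bar> \<le> ereal e" by (meson eventually_mono order_trans)
  then show ?thesis unfolding Linf_le_def by simp
qed

theorem theorem2p3:
  fixes a :: "'a::euclidean_space" and f :: "real \<Rightarrow> real" and p :: real and k :: nat
    and u0 :: "'a \<Rightarrow> real" and u :: "real \<Rightarrow> 'a \<Rightarrow> real"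
  assumes a_nz: "a \<noteq> 0"
    and f_C1: "\<exists>f'. (\<forall>\<xi>. (f has_real_derivative f' \<xi>) (at \<xi>)) \<and> continuous_on UNIV f'"
    and f_nz: "\<exists>\<xi>. f \<xi> \<noteq> 0"
    and f0: "f 0 = 0"
    and f_growth: "\<exists>C. \<forall>\<xi> \<eta>. \<bar>f \<xi> - f \<eta>\<bar> \<le> C * (\<bar>\<xi>\<bar> powr (p - 1) + \<bar>\<eta>\<bar> powr (p - 1)) * \<bar>\<xi> - \<eta>\<bar>"
    and k_pos: "k > 0"
    and p_low: "1 + (real k + 2) / ((real k + 1) * real DIM('a)) < p"
    and p_up: "p < 1 + (real k + 1) / (real k * real DIM('a))"
    and u0_L11: "L11 u0"
    and u0_Linf: "memLq \<infinity> u0"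
    and sol: "global_solution a f u0 u"
  shows "integrable lborel (psi0k a f u0 u k) \<and>
    (\<forall>q::ereal. 1 \<le> q \<longrightarrow>
      (\<forall>\<^sub>F t in at_top. memLq q (\<lambda>x. u t x - A1k a f u0 u k t x)) \<and>
      ((\<lambda>t. t powr (real DIM('a) / 2 * (1 - real_of_ereal (1 / q)) + 1/2)
              * Lq_norm q (\<lambda>x. u t x - A1k a f u0 u k t x)) \<longlongrightarrow> 0) at_top)"
proof -
  obtain C0 where C0: "\<And>\<xi> \<eta>. \<bar>f \<xi> - f \<eta>\<bar> \<le> C0 * (\<bar>\<xi>\<bar> powr (p - 1) + \<bar>\<eta>\<bar> powr (p - 1)) * \<bar>\<xi> - \<eta>\<bar>"
    using f_growth by blast
  define C where "C = \<bar>C0\<bar>"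
  have C: "\<bar>f \<xi> - f \<eta>\<bar> \<le> C * (\<bar>\<xi>\<bar> powr (p - 1) + \<bar>\<eta>\<bar> powr (p - 1)) * \<bar>\<xi> - \<eta>\<bar>" for \<xi> \<eta>
    by (rule order_trans[OF C0]) (intro mult_right_mono; simp add: C_def)
  have cont: "continuous_on UNIV f"
    using f_C1 by (auto intro!: continuous_at_imp_continuous_on dest: DERIV_isCont)
  note S = sol[unfolded global_solution_def]
  \<comment> \<open>Measurability is given on the product of \<open>lborel\<close>, while the
    locales use the product of \<open>borel\<close>; the two sigma-algebras coincide.\<close>
  have "sets (lborel \<Otimes>\<^sub>M lborel) = sets (borel \<Otimes>\<^sub>M borel :: (real \<times> 'a) measure)"
    by (rule sets_pair_measure_cong) auto
  then have um: "case_prod u \<in> borel_measurable (borel \<Otimes>\<^sub>M borel)"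
    using S measurable_cong_sets[of "lborel \<Otimes>\<^sub>M lborel" "borel \<Otimes>\<^sub>M borel" borel borel] by blast
  obtain M1 where M1: "\<And>t. 0 \<le> t \<Longrightarrow> Lq_norm 1 (u t) \<le> M1" using S by blast
  obtain M2 where M2: "\<And>t. 0 < t \<Longrightarrow> Lq_norm \<infinity> (u t) \<le> M2" using S by blast
  define M where "M = \<bar>M1\<bar> + \<bar>M2\<bar> + (\<integral>x. \<bar>u0 x\<bar> \<partial>lborel) + 1"
  have I0: "0 \<le> (\<integral>x. \<bar>u0 x\<bar> \<partial>lborel)" by simp
  have M: "0 < M" "M1 \<le> M" "M2 \<le> M" "(\<integral>x. \<bar>u0 x\<bar> \<partial>lborel) \<le> M" unfolding M_def using I0 by linarith+
  have uL1: "L1_le M (u t)" if "0 < t" for t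
    unfolding L1_le_def using S M1[of t] M(2) that unfolding Lq_norm_1 by auto
  have uLi: "Linf_le M (u t)" if "0 < t" for t
    by (rule memLq_infinity_AE) (use S M2[OF that] M(3) that in auto)
  have u0L1: "L1_le M u0" unfolding L1_le_def using u0_L11 M(4) by (auto simp: L11_def)
  have mild: "AE x in lborel. u t x = heat t u0 x + duhamel a (\<lambda>s y. f (u s y)) 0 t t x" if "0 < t" for t
    using S that by blast
  define n where "n = real DIM('a)"
  have n: "0 < n" unfolding n_def using DIM_positive[where 'a='a] by simp
  have kp: "0 < real k" using k_pos by simp
  \<comment> \<open>In terms of n (p - 1) the range of p reads (k + 2)/(k + 1) < n (p - 1) < (k +
    1)/k; subtracting 1 and halving gives 1/(2(k + 1)) < \<sigma> < 1/(2k).\<close>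
  have low: "(real k + 2) / (real k + 1) < n * (p - 1)"
  proof -
    have "(real k + 2) / ((real k + 1) * n) < p - 1" using p_low unfolding n_def by linarith
    then have "n * ((real k + 2) / ((real k + 1) * n)) < n * (p - 1)" using n by (rule mult_strict_left_mono)
    then show ?thesis using n by simp
  qed
  have up: "n * (p - 1) < (real k + 1) / real k"
  proof -
    have "p - 1 < (real k + 1) / (real k * n)" using p_up unfolding n_def by linarith
    then have "n * (p - 1) < n * ((real k + 1) / (real k * n))" using n by (rule mult_strict_left_mono)
    then show ?thesis using n by simp
  qed
  have "1 < (real k + 2) / (real k + 1)" using kp by simp
  then have np: "1 < n * (p - 1)" using low by linarith
  then have p1: "1 < p" using n by (metis diff_gt_0_iff_gt less_trans zero_less_mult_pos zero_less_one)
  interpret mild_solution a f p C M u0 u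
  proof unfold_locales
    show "0 \<le> C" by (simp add: C_def)
    show "\<And>\<xi> \<eta>. \<bar>f \<xi> - f \<eta>\<bar> \<le> C * (\<bar>\<xi>\<bar> powr (p - 1) + \<bar>\<eta>\<bar> powr (p - 1)) * \<bar>\<xi> - \<eta>\<bar>" by (rule C)
    show "\<And>t. 0 < t \<Longrightarrow> L1_le M (u t)" by (rule uL1)
    show "\<And>t. 0 < t \<Longrightarrow> Linf_le M (u t)" by (rule uLi)
    show "\<And>t. 0 < t \<Longrightarrow> AE x in lborel. u t x = heat t u0 x + duhamel a (\<lambda>s y. f (u s y)) 0 t t x"
      by (rule mild)
  qed (rule p1 M(1) cont f0 um u0L1)+
  interpret decaying_solution a f p C M u0 u
  proof unfold_locales
    show "1 / 2 < real DIM('a) / 2 * (p - 1)" using np by (simp add: n_def)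
    fix t e :: real assume t: "0 < t" and e: "0 < e"
    have "((\<lambda>s. Lq_norm \<infinity> (\<lambda>x. u s x - u t x)) \<longlongrightarrow> 0) (at t within {0<..})" using S t by blast
    from tendstoD[OF this e] obtain d where d: "d > 0" "\<And>s. s \<in> {0<..} \<Longrightarrow> s \<noteq> t \<Longrightarrow> dist s t < d \<Longrightarrow> dist (Lq_norm \<infinity> (\<lambda>x. u s x - u t x)) 0 < e"
      unfolding eventually_at by blast
    have "Linf_le e (\<lambda>x. u s x - u t x)" if s: "0 < s" "\<bar>s - t\<bar> < d" for s
    proof (cases "s = t")
      case True
      then show ?thesis using e by (simp add: Linf_le_def)
    next
      case False
      \<comment> \<open>The hypothesis makes a real number small; before it can be read as a sup
        bound the difference must be known to be essentially bounded, which the uniform bound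
        \<open>M\<close> supplies.\<close>
      have L: "Linf_le (M + M) (\<lambda>x. u s x - u t x)" by (intro Linf_le_diff u_Linf t s)
      have "esssup lborel (\<lambda>x. ereal \<bar>u s x - u t x\<bar>) \<le> ereal (M + M)"
        by (rule esssup_I) (use Linf_leD[OF L] in auto)
      then have mem: "memLq \<infinity> (\<lambda>x. u s x - u t x)"
        using Linf_leD(1)[OF L] le_less_trans[of _ "ereal (M + M)" \<infinity>] by (auto simp: memLq_def)
      have "\<bar>Lq_norm \<infinity> (\<lambda>x. u s x - u t x)\<bar> < e" using d(2)[of s] s False by (simp add: dist_real_def)
      then show ?thesis by (intro memLq_infinity_AE[OF mem]) auto
    qed
    then show "\<exists>d>0. \<forall>s>0. \<bar>s - t\<bar> < d \<longrightarrow> Linf_le e (\<lambda>x. u s x - u t x)" using d(1) by blast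
  qed
  obtain K where K: "M \<le> K" "\<And>t. 0 < t \<Longrightarrow> Linf_le (K * t powr (- (real DIM('a) / 2))) (u t)"
    using u_decay by blast
  have sg: "\<sigma> = (n * (p - 1) - 1) / 2" by (simp add: \<sigma>_def n_def field_simps)
  interpret expansion a f p C M u0 u K k
  proof unfold_locales
    have "real k * (n * (p - 1)) < real k * ((real k + 1) / real k)" using up kp by (rule mult_strict_left_mono)
    also have "\<dots> = real k + 1" using kp by simp
    finally show "real k * \<sigma> < 1 / 2" unfolding sg by (simp add: algebra_simps)
    have "real k + 2 = (real k + 1) * ((real k + 2) / (real k + 1))" using kp by simp
    also have "\<dots> < (real k + 1) * (n * (p - 1))"
      using low by (rule mult_strict_left_mono) simp
    finally show "1 / 2 < (real k + 1) * \<sigma>" unfolding sg by (simp add: algebra_simps)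
  qed (use K u0_L11 k_pos in auto)
  show ?thesis by (rule conclusion)
qed

end
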